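(* Let $\mathcal{G}$ be a (marked) labelled ecimahedron satisfying the conditions of Andreev's theorem, that is: $\mathcal{G}$ is not the graph of a tetrahedron; every non-prismatic 3-circuit of $\mathcal{G}$ is spherical; every prismatic 3-circuit of $\mathcal{G}$ is hyperbolic; every prismatic 4-circuit of $\mathcal{G}$ is hyperbolic; and $\mathcal{G}$ is not an exceptional prism. Then the moduli space $X_{\mathcal{G}}$ of marked projective mirror polyhedra realizing $\mathcal{G}$ is diffeomorphic to $\mathbb{R}^{d(\mathcal{G})}$, where $d(\mathcal{G})=e_+-3$ and $e_+$ is the number of edges of $\mathcal{G}$ whose label is different from $\frac{\pi}{2}$.
   Context: Mirror polyhedra. $\mathbb{P}^+(\mathbb{R}^4)=(\mathbb{R}^4\setminus\{0\})/\mathbb{R}_{>0}$, $p$ the projection; its group of projective transformations is $\mathrm{SL}_4^{\pm}(\mathbb{R})=\{g:\det g=\pm1\}$. A projective polyhedron is a closed properly convex set (convex and bounded in some affine chart) $P$ with non-empty interior of the form $p(\{x\neq0:\alpha_i(x)\leq0\ \forall i\})$ for finitely many linear forms. Faces of codimension 1, 2, 3 are called faces, edges, vertices; two faces are adjacent if they share an edge. A projective mirror polyhedron is a projective polyhedron $P$ with, for each face $s\in S$, a reflection $\sigma_s=\mathrm{Id}-\alpha_s\otimes v_s$ fixing $s$, $\alpha_s(v_s)=2$, $P=p(\{x\neq0:\alpha_s(x)\leq0\ \forall s\in S\})$, such that for adjacent $s,t$: $-\alpha_s(v_t)\geq0$; $\alpha_s(v_t)=0\Leftrightarrow\alpha_t(v_s)=0$;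 $\alpha_s(v_t)\alpha_t(v_s)=4\cos^2\theta_{st}$ with $\theta_{st}\in(0,\frac\pi2]$, the dihedral angle. Labelled graphs. A labelled graph is a planar 3-connected trivalent graph with a label $\theta_e\in(0,\frac\pi2]$ on each edge; marked means the faces are numbered. $Y_{\mathcal{G}}$ is the set of marked mirror polyhedra whose planar graph is identified with $\mathcal{G}$ compatibly with markings and whose dihedral angles are the labels (a subset of $(\mathbb{P}^+((\mathbb{R}^4)^* )\times\mathbb{P}^+(\mathbb{R}^4))^S$ via $([\alpha_s],[v_s])_s$); $X_{\mathcal{G}}=Y_{\mathcal{G}}/\mathrm{SL}_4^\pm(\mathbb{R})$. A combinatorial ecimahedron is a graph obtained from the complete graph on 4 vertices (combinatorial tetrahedron) by finitely many truncations (replacing a vertex by a triangle whose vertices lie on the three edges issuing from it); a labelled ecimahedron is a labelled graph with such an underlying graph. An exceptional prism is a triangular prism whose six edges in the two triangular faces all have label $\frac\pi2$ (the other three labels being arbitrary in $(0,\frac\pi2]$). Circuits. A $k$-circuit is a sequence of $k$ distinct faces $f_1,\dots,f_k$ with $f_i\cap f_{i+1}$ an edge for all $i$ ($f_{k+1}=f_1$), up to cyclic permutation and reversal. It is prismatic if all endpoints of its $k$ edges are distinct. With $\Sigma$ the sum of the labels of its $k$ edges, it is spherical if $\Sigma>(k-2)\pi$ and hyperbolic if $\Sigma<(k-2)\pi$. *)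

theory Defs
  imports "HOL-Analysis.Analysis" "Graph_Theory.Graph_Theory"
begin

section \<open>Smooth structures\<close>

text \<open>
  A smooth structure is given by its sheaf of smooth real functions (a functionally structured
  space): \<open>smooth_funs M U\<close> is the set of functions that are smooth on the open set \<open>U\<close>;
  membership only depends on the values on \<open>U\<close>.  Smooth manifolds are the structures locally
  isomorphic to open subsets of Euclidean spaces, and diffeomorphisms are the isomorphisms.  The
  induced structure on an embedded submanifold, and the quotient structure for a smooth, free and
  proper group action, are the usual manifold structures.
\<close>

record 'a smooth_space =
  smooth_top :: "'a topology"
  smooth_funs :: "'a set \<Rightarrow> ('a \<Rightarrow> real) set"

coinductive C_infinity_on :: "'a::real_normed_vector set \<Rightarrow> ('a \<Rightarrow> real) \<Rightarrow> bool" for U where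
  "(\<And>x. x \<in> U \<Longrightarrow> f differentiable (at x)) \<Longrightarrow>
   (\<And>h. C_infinity_on U (\<lambda>x. frechet_derivative f (at x) h)) \<Longrightarrow> C_infinity_on U f"

definition euclidean_smooth :: "'a::euclidean_space smooth_space" where
  "euclidean_smooth = \<lparr>smooth_top = euclidean, smooth_funs = (\<lambda>U. {f. C_infinity_on U f})\<rparr>"

definition sub_smooth :: "'a smooth_space \<Rightarrow> 'a set \<Rightarrow> 'a smooth_space" where
  "sub_smooth M A = \<lparr>smooth_top = subtopology (smooth_top M) A,
     smooth_funs = (\<lambda>U. {f. \<forall>x\<in>U. \<exists>V g. openin (smooth_top M) V \<and> x \<in> V \<and>
        g \<in> smooth_funs M V \<and> (\<forall>y\<in>U \<inter> V. f y = g y)})\<rparr>"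

definition quotient_topology :: "'a topology \<Rightarrow> ('a \<Rightarrow> 'b) \<Rightarrow> 'b topology" where
  "quotient_topology X q =
     topology (\<lambda>U. U \<subseteq> q ` topspace X \<and> openin X {x \<in> topspace X. q x \<in> U})"

lemma openin_quotient_topology:
  "openin (quotient_topology X q) U \<longleftrightarrow>
     U \<subseteq> q ` topspace X \<and> openin X {x \<in> topspace X. q x \<in> U}"
proof -
  have "istopology (\<lambda>U. U \<subseteq> q ` topspace X \<and> openin X {x \<in> topspace X. q x \<in> U})"
    unfolding istopology_def
  proof (intro conjI allI impI)
    fix S T
    assume S: "S \<subseteq> q ` topspace X \<and> openin X {x \<in> topspace X. q x \<in> S}"
      and T: "T \<subseteq> q ` topspace X \<and> openin X {x \<in> topspace X. q x \<in> T}"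
    show "S \<inter> T \<subseteq> q ` topspace X" using S by blast
    have "{x \<in> topspace X. q x \<in> S \<inter> T}
        = {x \<in> topspace X. q x \<in> S} \<inter> {x \<in> topspace X. q x \<in> T}" by blast
    then show "openin X {x \<in> topspace X. q x \<in> S \<inter> T}" using S T by (simp add: openin_Int)
  next
    fix K
    assume K: "\<forall>S\<in>K. S \<subseteq> q ` topspace X \<and> openin X {x \<in> topspace X. q x \<in> S}"
    show "\<Union>K \<subseteq> q ` topspace X" using K by blast
    have "{x \<in> topspace X. q x \<in> \<Union>K} = (\<Union>S\<in>K. {x \<in> topspace X. q x \<in> S})" by blast
    then show "openin X {x \<in> topspace X. q x \<in> \<Union>K}" using K by auto
  qed
  then show ?thesis unfolding quotient_topology_def by (simp add: topology_inverse')
qed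

definition quotient_smooth :: "'a smooth_space \<Rightarrow> ('a \<Rightarrow> 'b) \<Rightarrow> 'b smooth_space" where
  "quotient_smooth M q = \<lparr>smooth_top = quotient_topology (smooth_top M) q,
     smooth_funs = (\<lambda>U. {f. f \<circ> q \<in> smooth_funs M {x \<in> topspace (smooth_top M). q x \<in> U}})\<rparr>"

definition diffeomorphism :: "'a smooth_space \<Rightarrow> 'b smooth_space \<Rightarrow> ('a \<Rightarrow> 'b) \<Rightarrow> bool" where
  "diffeomorphism M N \<phi> \<longleftrightarrow>
     homeomorphic_map (smooth_top M) (smooth_top N) \<phi> \<and>
     (\<forall>U f. openin (smooth_top N) U \<longrightarrow>
        (f \<in> smooth_funs N U \<longleftrightarrow>
         f \<circ> \<phi> \<in> smooth_funs M {x \<in> topspace (smooth_top M). \<phi> x \<in> U}))"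

definition diffeomorphic :: "'a smooth_space \<Rightarrow> 'b smooth_space \<Rightarrow> bool" where
  "diffeomorphic M N \<longleftrightarrow> (\<exists>\<phi>. diffeomorphism M N \<phi>)"


section \<open>Projective polyhedra\<close>

text \<open>
  Points of \<open>\<P>\<^sup>+(\<real>\<^sup>4)\<close> are open rays \<open>p(x)\<close>, \<open>x \<noteq> 0\<close>.  A linear form is represented by its
  coefficient vector \<open>\<alpha>\<close>, acting by \<open>x \<mapsto> \<alpha> \<bullet> x\<close>; thus \<open>\<P>\<^sup>+((\<real>\<^sup>4)\<^sup>*)\<close> also consists of rays of
  \<open>\<real>\<^sup>4\<close>, on which matrices act contragrediently.
\<close>

type_synonym ppoint = "(real^4) set"

definition ray :: "real^4 \<Rightarrow> ppoint" where
  "ray x = {t *\<^sub>R x | t. 0 < t}"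

definition proj_top :: "ppoint topology" where
  "proj_top = quotient_topology (top_of_set (- {0})) ray"

definition cone_over :: "ppoint set \<Rightarrow> (real^4) set" where
  "cone_over P = insert 0 {x. x \<noteq> 0 \<and> ray x \<in> P}"

text \<open>The affine chart of \<open>\<beta>\<close> is \<open>{p(x). \<beta> \<bullet> x > 0}\<close>, identified with \<open>{x. \<beta> \<bullet> x = 1}\<close>.\<close>

definition properly_convex :: "ppoint set \<Rightarrow> bool" where
  "properly_convex P \<longleftrightarrow>
     (\<exists>\<beta>. \<beta> \<noteq> 0 \<and> P \<subseteq> ray ` {x. 0 < \<beta> \<bullet> x} \<and>
          convex {x. \<beta> \<bullet> x = 1 \<and> ray x \<in> P} \<and> bounded {x. \<beta> \<bullet> x = 1 \<and> ray x \<in> P})"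

definition projective_polyhedron :: "ppoint set \<Rightarrow> bool" where
  "projective_polyhedron P \<longleftrightarrow>
     closedin proj_top P \<and> properly_convex P \<and> proj_top interior_of P \<noteq> {} \<and>
     (\<exists>A. finite A \<and> P = ray ` {x. x \<noteq> 0 \<and> (\<forall>\<alpha>\<in>A. \<alpha> \<bullet> x \<le> 0)})"

text \<open>The cone over a face of codimension \<open>k\<close> in a 3-dimensional polyhedron has dimension
  \<open>4 - k\<close>.\<close>

definition codim_face :: "nat \<Rightarrow> ppoint set \<Rightarrow> ppoint set \<Rightarrow> bool" where
  "codim_face k P F \<longleftrightarrow>
     F \<subseteq> P \<and> cone_over F face_of cone_over P \<and> aff_dim (cone_over F) = 4 - int k"

definition adjacent_in :: "ppoint set \<Rightarrow> ppoint set \<Rightarrow> ppoint set \<Rightarrow> bool" where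
  "adjacent_in P F F' \<longleftrightarrow> F \<noteq> F' \<and> (\<exists>e. codim_face 2 P e \<and> e \<subseteq> F \<and> e \<subseteq> F')"

definition reflection :: "real^4 \<Rightarrow> real^4 \<Rightarrow> real^4 \<Rightarrow> real^4" where
  "reflection \<alpha> v x = x - (\<alpha> \<bullet> x) *\<^sub>R v"

definition has_dihedral_angle ::
  "('s \<Rightarrow> real^4) \<Rightarrow> ('s \<Rightarrow> real^4) \<Rightarrow> 's \<Rightarrow> 's \<Rightarrow> real \<Rightarrow> bool" where
  "has_dihedral_angle \<alpha> v s t \<theta> \<longleftrightarrow>
     0 < \<theta> \<and> \<theta> \<le> pi / 2 \<and> (\<alpha> s \<bullet> v t) * (\<alpha> t \<bullet> v s) = 4 * (cos \<theta>)\<^sup>2"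

text \<open>\<open>face\<close> is the marking: it numbers the faces of \<open>P\<close> by the index set \<open>'s\<close>.\<close>

definition mirror_polyhedron ::
  "ppoint set \<Rightarrow> ('s \<Rightarrow> ppoint set) \<Rightarrow> ('s \<Rightarrow> real^4) \<Rightarrow> ('s \<Rightarrow> real^4) \<Rightarrow> bool" where
  "mirror_polyhedron P face \<alpha> v \<longleftrightarrow>
     projective_polyhedron P \<and>
     bij_betw face UNIV {F. codim_face 1 P F} \<and>
     (\<forall>s. \<alpha> s \<bullet> v s = 2) \<and>
     (\<forall>s x. x \<noteq> 0 \<and> ray x \<in> face s \<longrightarrow> reflection (\<alpha> s) (v s) x = x) \<and>
     P = ray ` {x. x \<noteq> 0 \<and> (\<forall>s. \<alpha> s \<bullet> x \<le> 0)} \<and>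
     (\<forall>s t. adjacent_in P (face s) (face t) \<longrightarrow>
        - (\<alpha> s \<bullet> v t) \<ge> 0 \<and>
        (\<alpha> s \<bullet> v t = 0 \<longleftrightarrow> \<alpha> t \<bullet> v s = 0) \<and>
        (\<exists>\<theta>. has_dihedral_angle \<alpha> v s t \<theta>))"


section \<open>Labelled graphs\<close>

text \<open>
  A simple graph is a symmetric loop-free digraph without parallel arcs.  A plane embedding is
  given by a rotation system: a permutation of the arcs that cyclically permutes the arcs leaving
  each vertex.  Faces are the orbits on arcs of \<open>(u,v) \<mapsto> \<rho> (v,u)\<close>, and planarity is Euler's
  relation.  For a 3-connected planar graph \<open>\<rho>\<close> is unique up to inversion (Whitney), so that the
  faces, as subgraphs, do not depend on it.
\<close>

definition edges :: "'v pair_pre_digraph \<Rightarrow> 'v set set" where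
  "edges G = {{u, w} | u w. (u, w) \<in> parcs G}"

definition trivalent :: "'v pair_pre_digraph \<Rightarrow> bool" where
  "trivalent G \<longleftrightarrow> (\<forall>v\<in>pverts G. out_degree (with_proj G) v = 3)"

definition three_connected :: "'v pair_pre_digraph \<Rightarrow> bool" where
  "three_connected G \<longleftrightarrow> card (pverts G) \<ge> 4 \<and>
     (\<forall>X\<subseteq>pverts G. card X \<le> 2 \<longrightarrow>
        Digraph_Component.connected (induce_subgraph (with_proj G) (pverts G - X)))"

definition faces :: "'v pair_pre_digraph \<Rightarrow> ('v \<times> 'v \<Rightarrow> 'v \<times> 'v) \<Rightarrow> ('v \<times> 'v) set set" where
  "faces G \<rho> = orbit (\<rho> \<circ> prod.swap) ` parcs G"

definition planar_embedding :: "'v pair_pre_digraph \<Rightarrow> ('v \<times> 'v \<Rightarrow> 'v \<times> 'v) \<Rightarrow> bool" where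
  "planar_embedding G \<rho> \<longleftrightarrow>
     \<rho> permutes parcs G \<and>
     (\<forall>v\<in>pverts G. cyclic_on \<rho> (out_arcs (with_proj G) v)) \<and>
     Digraph_Component.connected (with_proj G) \<and>
     card (pverts G) + card (faces G \<rho>) = card (edges G) + 2"

definition face_verts :: "('v \<times> 'v) set \<Rightarrow> 'v set" where
  "face_verts f = fst ` f"

definition face_edges :: "('v \<times> 'v) set \<Rightarrow> 'v set set" where
  "face_edges f = {{u, w} | u w. (u, w) \<in> f}"

definition marked_labelled_graph ::
  "'v pair_pre_digraph \<Rightarrow> ('v \<times> 'v \<Rightarrow> 'v \<times> 'v) \<Rightarrow> ('v set \<Rightarrow> real) \<Rightarrow> ('s \<Rightarrow> ('v \<times> 'v) set) \<Rightarrow> bool"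
where
  "marked_labelled_graph G \<rho> \<theta> mark \<longleftrightarrow>
     pair_graph G \<and> trivalent G \<and> three_connected G \<and> planar_embedding G \<rho> \<and>
     (\<forall>e\<in>edges G. 0 < \<theta> e \<and> \<theta> e \<le> pi / 2) \<and>
     bij_betw mark UNIV (faces G \<rho>)"

definition truncation :: "'v pair_pre_digraph \<Rightarrow> 'v pair_pre_digraph \<Rightarrow> bool" where
  "truncation G G' \<longleftrightarrow>
     (\<exists>v\<in>pverts G. \<exists>x y z a b c.
        distinct [x, y, z] \<and> {w. (v, w) \<in> parcs G} = {x, y, z} \<and>
        distinct [a, b, c] \<and> {a, b, c} \<inter> (pverts G - {v}) = {} \<and>
        pverts G' = (pverts G - {v}) \<union> {a, b, c} \<and>
        edges G' = {e \<in> edges G. v \<notin> e} \<union> {{a, x}, {b, y}, {c, z}, {a, b}, {b, c}, {c, a}} \<and>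
        pair_graph G')"

abbreviation tetrahedron_graph :: "'v pair_pre_digraph \<Rightarrow> bool" where
  "tetrahedron_graph G \<equiv> complete_digraph 4 (with_proj G)"

inductive combinatorial_ecimahedron :: "'v pair_pre_digraph \<Rightarrow> bool" where
  "tetrahedron_graph G \<Longrightarrow> combinatorial_ecimahedron G"
| "combinatorial_ecimahedron G \<Longrightarrow> truncation G G' \<Longrightarrow> combinatorial_ecimahedron G'"

definition exceptional_prism :: "'v pair_pre_digraph \<Rightarrow> ('v set \<Rightarrow> real) \<Rightarrow> bool" where
  "exceptional_prism G \<theta> \<longleftrightarrow>
     (\<exists>a b c a' b' c'. distinct [a, b, c, a', b', c'] \<and>
        pverts G = {a, b, c, a', b', c'} \<and>
        edges G = {{a, b}, {b, c}, {c, a}, {a', b'}, {b', c'}, {c', a'},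
                   {a, a'}, {b, b'}, {c, c'}} \<and>
        (\<forall>e\<in>{{a, b}, {b, c}, {c, a}, {a', b'}, {b', c'}, {c', a'}}. \<theta> e = pi / 2))"

text \<open>\<open>es ! i\<close> is the edge in which the faces \<open>fs ! i\<close> and \<open>fs ! (i + 1)\<close> (cyclically) meet.
  Circuits are only quantified over, so they need not be identified up to cyclic permutation and
  reversal.\<close>

definition circuit ::
  "'v pair_pre_digraph \<Rightarrow> ('v \<times> 'v \<Rightarrow> 'v \<times> 'v) \<Rightarrow> nat \<Rightarrow> ('v \<times> 'v) set list \<Rightarrow> 'v set list \<Rightarrow> bool"
where
  "circuit G \<rho> k fs es \<longleftrightarrow>
     length fs = k \<and> length es = k \<and> distinct fs \<and> set fs \<subseteq> faces G \<rho> \<and>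
     (\<forall>i<k. face_edges (fs ! i) \<inter> face_edges (fs ! (Suc i mod k)) = {es ! i} \<and>
            face_verts (fs ! i) \<inter> face_verts (fs ! (Suc i mod k)) = es ! i)"

definition prismatic :: "'v set list \<Rightarrow> bool" where
  "prismatic es \<longleftrightarrow> (\<forall>i<length es. \<forall>j<length es. i \<noteq> j \<longrightarrow> es ! i \<inter> es ! j = {})"

definition spherical :: "('v set \<Rightarrow> real) \<Rightarrow> 'v set list \<Rightarrow> bool" where
  "spherical \<theta> es \<longleftrightarrow> sum_list (map \<theta> es) > (real (length es) - 2) * pi"

definition hyperbolic :: "('v set \<Rightarrow> real) \<Rightarrow> 'v set list \<Rightarrow> bool" where
  "hyperbolic \<theta> es \<longleftrightarrow> sum_list (map \<theta> es) < (real (length es) - 2) * pi"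

definition andreev_conditions ::
  "'v pair_pre_digraph \<Rightarrow> ('v \<times> 'v \<Rightarrow> 'v \<times> 'v) \<Rightarrow> ('v set \<Rightarrow> real) \<Rightarrow> bool" where
  "andreev_conditions G \<rho> \<theta> \<longleftrightarrow>
     \<not> tetrahedron_graph G \<and>
     (\<forall>fs es. circuit G \<rho> 3 fs es \<and> \<not> prismatic es \<longrightarrow> spherical \<theta> es) \<and>
     (\<forall>fs es. circuit G \<rho> 3 fs es \<and> prismatic es \<longrightarrow> hyperbolic \<theta> es) \<and>
     (\<forall>fs es. circuit G \<rho> 4 fs es \<and> prismatic es \<longrightarrow> hyperbolic \<theta> es) \<and>
     \<not> exceptional_prism G \<theta>"

definition e_plus :: "'v pair_pre_digraph \<Rightarrow> ('v set \<Rightarrow> real) \<Rightarrow> nat" where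
  "e_plus G \<theta> = card {e \<in> edges G. \<theta> e \<noteq> pi / 2}"


section \<open>The moduli space\<close>

text \<open>\<open>\<psi>\<close> identifies the graph of \<open>P\<close> with \<open>G\<close>, compatibly with the marked faces.\<close>

definition realizes_graph ::
  "'v pair_pre_digraph \<Rightarrow> ('s \<Rightarrow> ('v \<times> 'v) set) \<Rightarrow> ppoint set \<Rightarrow> ('s \<Rightarrow> ppoint set) \<Rightarrow> bool" where
  "realizes_graph G mark P face \<longleftrightarrow>
     (\<exists>\<psi>. bij_betw \<psi> (pverts G) {q. codim_face 3 P q} \<and>
        (\<forall>u\<in>pverts G. \<forall>w\<in>pverts G. u \<noteq> w \<longrightarrow>
           ((u, w) \<in> parcs G \<longleftrightarrow> (\<exists>e. codim_face 2 P e \<and> \<psi> u \<subseteq> e \<and> \<psi> w \<subseteq> e))) \<and>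
        (\<forall>s. \<forall>u\<in>pverts G. \<psi> u \<subseteq> face s \<longleftrightarrow> u \<in> face_verts (mark s)))"

type_synonym 's config = "'s \<Rightarrow> ppoint \<times> ppoint"

definition Y_space ::
  "'v pair_pre_digraph \<Rightarrow> ('v set \<Rightarrow> real) \<Rightarrow> ('s \<Rightarrow> ('v \<times> 'v) set) \<Rightarrow> 's config set" where
  "Y_space G \<theta> mark =
     {\<lambda>s. (ray (\<alpha> s), ray (v s)) | \<alpha> v. \<exists>P face.
        mirror_polyhedron P face \<alpha> v \<and> realizes_graph G mark P face \<and>
        (\<forall>s t e. s \<noteq> t \<and> e \<in> face_edges (mark s) \<inter> face_edges (mark t) \<longrightarrow>
           has_dihedral_angle \<alpha> v s t (\<theta> e))}"

text \<open>\<open>(\<P>\<^sup>+((\<real>\<^sup>4)\<^sup>*) \<times> \<P>\<^sup>+(\<real>\<^sup>4))\<^sup>S\<close>, as the quotient of the open set of tuples of nonzero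
  vectors by positive rescaling of each entry.\<close>

definition config_smooth :: "('s::finite) config smooth_space" where
  "config_smooth =
     quotient_smooth
       (sub_smooth (euclidean_smooth :: (((real^4) \<times> (real^4))^'s) smooth_space)
          {c. \<forall>s. fst (c $ s) \<noteq> 0 \<and> snd (c $ s) \<noteq> 0})
       (\<lambda>c s. (ray (fst (c $ s)), ray (snd (c $ s))))"

text \<open>The action \<open>g \<cdot> ([\<alpha>\<^sub>s], [v\<^sub>s]) = ([\<alpha>\<^sub>s \<circ> g\<^sup>-\<^sup>1], [g v\<^sub>s])\<close>.\<close>

definition act :: "real^4^4 \<Rightarrow> 's config \<Rightarrow> 's config" where
  "act g c = (\<lambda>s. ((\<lambda>\<beta>. transpose (matrix_inv g) *v \<beta>) ` fst (c s), (\<lambda>x. g *v x) ` snd (c s)))"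

definition SL_orbit :: "'s config \<Rightarrow> 's config set" where
  "SL_orbit c = {act g c | g. det g = 1 \<or> det g = -1}"

text \<open>\<open>\<real>\<^sup>d\<close> is taken to be any \<open>d\<close>-dimensional linear subspace \<open>W\<close> of a Euclidean space, with
  structure \<open>sub_smooth euclidean_smooth W\<close>; unlike \<open>real ^ 'n\<close> this includes \<open>d = 0\<close>, which does
  occur as a value of \<open>d(G)\<close>.\<close>

definition X_space ::
  "'v pair_pre_digraph \<Rightarrow> ('v set \<Rightarrow> real) \<Rightarrow> ('s::finite \<Rightarrow> ('v \<times> 'v) set)
    \<Rightarrow> 's config set smooth_space" where
  "X_space G \<theta> mark = quotient_smooth (sub_smooth config_smooth (Y_space G \<theta> mark)) SL_orbit"

end

(*
 Dually, an ecimahedron is a stack of tetrahedra: its faces are the vertices of the stack, and a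
 truncation glues a tetrahedron onto a boundary triangle {a,b,c} with apex d, which adds one face k.
 Normalise by alpha_s(v_s) = 2.  A mirror polyhedron is then determined by the numbers
 alpha_s(v_t) for adjacent s, t and, for each truncation, by the number e > 0 in
 alpha_k = c_a alpha_a + c_b alpha_b + c_c alpha_c - e alpha_d.  Conversely these numbers can be
 prescribed: the circuit abc is prismatic, hence hyperbolic, so that its 3x3 Cartan matrix has
 negative determinant, and (alpha_k, v_k) is the unique solution of linear equations.

 That the result is a polyhedron with the right faces is an induction over the truncations, which
 carries along the vertices p of the cells and, for every later truncation, the form pi vanishing on
 v_a, v_b, v_c.  Hyperbolicity makes every new vector and form a positive combination of old ones;
 the only obstruction is that both k and d are orthogonal to a, b and c, which would make the graph
 an exceptional prism.

 The logarithms of the numbers -alpha_s(v_t), one for each edge that is not right-angled, and of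
 the numbers e are coordinates on the normalised configurations.  Rescaling the pairs
 (alpha_s, v_s) translates them by differences of one parameter per face.  The nonright edges and
 the pairs (k,d) connect all f faces, so this group has dimension f - 1, and
 e_+ + (f - 4) - (f - 1) = e_+ - 3 parameters remain.
*)
theory Submission
 imports Defs
begin

section \<open>Hyperbolic triples in dimension four\<close>

text \<open>The face \<open>k\<close> over a triangle \<open>tr\<close> must leave every other
  vertex strictly inside. Written in the three forms of \<open>tr\<close> and the polar form
  \<open>\<pi> tr\<close>, \<open>\<alpha> k\<close> has nonnegative coefficients, because the
  inverse of a hyperbolic Cartan matrix has only negative entries; what remains is the sign of
  \<open>\<pi> tr\<close> at the other vertices. That sign is only weak when \<open>d\<close> is
  orthogonal to \<open>tr\<close>, and this degenerate case shapes the invariant.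

  On the combinatorial side truncation acts on abstract graphs, whereas faces come from a rotation
  system. Euler's relation links the two: the edges separating a set of faces form a cycle modulo 2,
  so a labelling that looks locally like faces has at most \<open>E - V + 2\<close> labels, with
  equality only if every edge has two different sides. This makes the rotations at the corners of a
  truncation triangle coherent, so that the labelling can be contracted.

  The dimension count becomes a diffeomorphism through a global smooth section: exponentials of the
  coordinates prescribe Cartan entries, and each later pair solves linear equations with
  nonvanishing determinant.\<close>

lemma det_4: "det (A::real^4^4) =
  A$1$1 * (A$2$2 * (A$3$3 * A$4$4 - A$3$4 * A$4$3) - A$2$3 * (A$3$2 * A$4$4 - A$3$4 * A$4$2) + A$2$4 * (A$3$2 * A$4$3 - A$3$3 * A$4$2))
 - A$1$2 * (A$2$1 * (A$3$3 * A$4$4 - A$3$4 * A$4$3) - A$2$3 * (A$3$1 * A$4$4 - A$3$4 * A$4$1) + A$2$4 * (A$3$1 * A$4$3 - A$3$3 * A$4$1))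
 + A$1$3 * (A$2$1 * (A$3$2 * A$4$4 - A$3$4 * A$4$2) - A$2$2 * (A$3$1 * A$4$4 - A$3$4 * A$4$1) + A$2$4 * (A$3$1 * A$4$2 - A$3$2 * A$4$1))
 - A$1$4 * (A$2$1 * (A$3$2 * A$4$3 - A$3$3 * A$4$2) - A$2$2 * (A$3$1 * A$4$3 - A$3$3 * A$4$1) + A$2$3 * (A$3$1 * A$4$2 - A$3$2 * A$4$1))"
proof -
 have f1: "finite {4::4}" and "1 \<notin> {4::4}" by auto
 have f2: "finite {3::4,4}" "2 \<notin> {3::4,4}" by auto
 have f234: "finite {2::4, 3, 4}" "1 \<notin> {2::4, 3, 4}" by auto
 have f34: "finite {3::4, 4}" "2 \<notin> {3::4, 4}" by auto
 have f4: "finite {4::4}" "3 \<notin> {4::4}" by auto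
 show ?thesis
  unfolding det_def UNIV_4
  unfolding sum_over_permutations_insert[OF f234]
  unfolding sum_over_permutations_insert[OF f34]
  unfolding sum_over_permutations_insert[OF f4]
  unfolding permutes_sing
  by (simp add: sign_swap_id sign_compose permutation_swap_id permutation_compose sign_id transpose_def algebra_simps)
qed

definition D4 :: "real^4 => real^4 => real^4 => real^4 => real" where
 "D4 a b c d = det ((\<chi> i. if i = 1 then a else if i = 2 then b else if i = 3 then c else d) :: real^4^4)"

text \<open>The generalised cross product: the vector that represents the linear form
  \<open>D4 a b c\<close>. It spans the common kernel of \<open>a\<close>, \<open>b\<close>,
  \<open>c\<close> when these are independent.\<close>

definition cross4 :: "real^4 => real^4 => real^4 => real^4" where
 "cross4 a b c = (\<chi> i. D4 a b c (axis i 1))"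

lemma inner_4: "(x::real^4) \<bullet> y = x$1*y$1 + x$2*y$2 + x$3*y$3 + x$4*y$4"
 by (simp add: inner_vec_def sum_4)

lemma vec_eq_4: "(x::real^4) = y \<longleftrightarrow> x$1 = y$1 & x$2 = y$2 & x$3 = y$3 & x$4 = y$4"
 by (simp add: vec_eq_iff forall_4)

lemmas D4_explicit = D4_def[unfolded det_4, simplified]

lemma cross4_inner: "cross4 a b c \<bullet> x = D4 a b c x"
 unfolding inner_4 cross4_def by (simp add: D4_explicit axis_def algebra_simps)

lemma D4_alt: "D4 a b c a = 0" "D4 a b c b = 0" "D4 a b c c = 0"
 by (simp_all add: D4_explicit algebra_simps)

lemma D4_add: "D4 a b c (x + y) = D4 a b c x + D4 a b c y"
 and D4_scale: "D4 a b c (r *\<^sub>R x) = r * D4 a b c x"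
 and D4_diff: "D4 a b c (x - y) = D4 a b c x - D4 a b c y"
 by (simp_all add: cross4_inner[symmetric] inner_add_right inner_diff_right)

text \<open>The four cofactor vectors are the dual basis of \<open>a\<close>, \<open>b\<close>,
  \<open>c\<close>, \<open>d\<close> up to the determinant. Keeping the determinant on the left
  turns this into a polynomial identity.\<close>

lemma D4_adjugate:
 "D4 a b c d *\<^sub>R x = (d \<bullet> x) *\<^sub>R cross4 a b c - (c \<bullet> x) *\<^sub>R cross4 a b d
   + (b \<bullet> x) *\<^sub>R cross4 a c d - (a \<bullet> x) *\<^sub>R cross4 b c d"
 unfolding vec_eq_4 inner_4 cross4_def by (simp add: D4_explicit axis_def algebra_simps)

lemma D4_inj: "D4 a b c d ~= 0 ==> a \<bullet> x = 0 ==> b \<bullet> x = 0 ==> c \<bullet> x = 0 ==> d \<bullet> x = 0 ==> x = 0"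
 using D4_adjugate[of a b c d x] by simp

lemma D4_surj:
 assumes "D4 a b c d ~= 0"
 shows "\<exists>x. a \<bullet> x = wa & b \<bullet> x = wb & c \<bullet> x = wc & d \<bullet> x = wd"
proof -
 let ?D = "D4 a b c d"
 let ?x = "(wd / ?D) *\<^sub>R cross4 a b c - (wc / ?D) *\<^sub>R cross4 a b d
   + (wb / ?D) *\<^sub>R cross4 a c d - (wa / ?D) *\<^sub>R cross4 b c d"
 have s: "D4 a b d c = - ?D" "D4 a c d b = ?D" "D4 b c d a = - ?D" 
  by (simp_all add: D4_explicit algebra_simps)
 have "u \<bullet> ?x = (wd / ?D) * D4 a b c u - (wc / ?D) * D4 a b d u + (wb / ?D) * D4 a c d u - (wa / ?D) * D4 b c d u" for u
  by (simp add: inner_add_right inner_diff_right cross4_inner[symmetric] inner_commute[of u])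
 thus ?thesis using assms s by (intro exI[of _ ?x]) (simp add: D4_alt)
qed

lemma D4_expand:
 assumes "D4 a b c d ~= 0"
 shows "\<exists>p q r s. y = p *\<^sub>R a + q *\<^sub>R b + r *\<^sub>R c + s *\<^sub>R d"
proof -
 define A where "A = ((\<chi> i. if i = 1 then a else if i = 2 then b else if i = 3 then c else d) :: real^4^4)"
 have "det (transpose A) ~= 0" using assms unfolding D4_def A_def by simp
 then obtain z where z: "transpose A *v z = y"
  by (metis invertible_det_nz matrix_vector_mul_assoc matrix_vector_mul_lid invertible_def)
 have "y = z$1 *\<^sub>R a + z$2 *\<^sub>R b + z$3 *\<^sub>R c + z$4 *\<^sub>R d"
  unfolding z[symmetric] by (simp add: vec_eq_4 matrix_vector_mult_def sum_4 transpose_def A_def algebra_simps)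
 thus ?thesis by blast
qed

text \<open>A dual system of vectors rules out a linear dependence: evaluating it at
  \<open>xa\<close>, \<open>xb\<close>, \<open>xc\<close>, \<open>xd\<close> kills its coefficients
  one by one.\<close>

lemma D4_nonzeroI:
 assumes "a \<bullet> xa ~= 0" "b \<bullet> xa = 0" "c \<bullet> xa = 0" "d \<bullet> xa = 0"
  and "a \<bullet> xb = 0" "b \<bullet> xb ~= 0" "c \<bullet> xb = 0" "d \<bullet> xb = 0"
  and "a \<bullet> xc = 0" "b \<bullet> xc = 0" "c \<bullet> xc ~= 0" "d \<bullet> xc = 0"
  and "a \<bullet> xd = 0" "b \<bullet> xd = 0" "c \<bullet> xd = 0" "d \<bullet> xd ~= 0"
 shows "D4 a b c d ~= 0"
proof
 assume "D4 a b c d = 0"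
 define A where "A = ((\<chi> i. if i = 1 then a else if i = 2 then b else if i = 3 then c else d) :: real^4^4)"
 have "\<not> invertible (transpose A)" using \<open>D4 a b c d = 0\<close> unfolding D4_def A_def[symmetric] by (simp add: invertible_det_nz)
 then obtain z where z: "transpose A *v z = 0" "z ~= 0"
  by (metis matrix_left_invertible_ker invertible_left_inverse)
 have e: "z$1 *\<^sub>R a + z$2 *\<^sub>R b + z$3 *\<^sub>R c + z$4 *\<^sub>R d = 0"
  unfolding z(1)[symmetric] by (simp add: vec_eq_4 matrix_vector_mult_def sum_4 transpose_def A_def algebra_simps)
 have "z$1 * (a \<bullet> x) + z$2 * (b \<bullet> x) + z$3 * (c \<bullet> x) + z$4 * (d \<bullet> x) = 0" for x
  using arg_cong[OF e, of "\<lambda>u. u \<bullet> x"] by (simp add: inner_add_left)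
 from this[of xa] this[of xb] this[of xc] this[of xd] have "z = 0"
  using assms by (simp add: vec_eq_4)
 with z show False by simp
qed

text \<open>The last inequality says that the determinant of the Cartan matrix of \<open>a, b, c\<close> is negative.\<close>

definition hyp :: "('s => 's => real) => 's => 's => 's => bool" where
 "hyp M a b c \<longleftrightarrow> M a a = 2 & M b b = 2 & M c c = 2 &
   M a b <= 0 & M b a <= 0 & M a c <= 0 & M c a <= 0 & M b c <= 0 & M c b <= 0 &
   (M a b = 0 \<longleftrightarrow> M b a = 0) & (M a c = 0 \<longleftrightarrow> M c a = 0) & (M b c = 0 \<longleftrightarrow> M c b = 0) &
   M a b * M b a < 4 & M a c * M c a < 4 & M b c * M c b < 4 &
   8 - 2 * (M a b * M b a + M a c * M c a + M b c * M c b) + M a b * M b c * M c a + M a c * M c b * M b a < 0"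

lemma hyp_perm: "hyp M a b c ==> hyp M b a c" "hyp M a b c ==> hyp M a c b"
 unfolding hyp_def by (auto simp: algebra_simps)

lemma hyp_transpose: "hyp M a b c ==> hyp (\<lambda>s t. M t s) a b c"
 unfolding hyp_def by (auto simp: algebra_simps)

text \<open>If two of the three pairs are orthogonal, both cyclic products vanish and the
  determinant is \<open>8 - 2 * m\<close> with \<open>m < 4\<close>, hence positive.\<close>

lemma hyp_connected:
 assumes "hyp M a b c"
 shows "(M a b ~= 0 & M b c ~= 0) \<or> (M a b ~= 0 & M a c ~= 0) \<or> (M a c ~= 0 & M b c ~= 0)"
proof (rule ccontr)
 assume "\<not> ?thesis"
 then consider "M a b = 0 & M a c = 0" | "M a b = 0 & M b c = 0" | "M a c = 0 & M b c = 0" by blast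
 thus False using assms unfolding hyp_def by cases auto
qed

text \<open>Cramer's rule for \<open>x\<close>: the cofactors \<open>A1\<close>, \<open>A2\<close>,
  \<open>A3\<close> are positive while the determinant \<open>D\<close> is negative, so the inverse
  matrix has negative entries. This is where hyperbolicity enters the geometry of cones.\<close>

lemma hyp_solve_first:
 assumes h: "hyp M a b c"
  and e: "2 * x + M b a * y + M c a * z = wa" "M a b * x + 2 * y + M c b * z = wb" "M a c * x + M b c * y + 2 * z = wc"
  and w: "wa <= 0" "wb <= 0" "wc <= 0"
 shows "0 <= x" and "wa ~= 0 \<or> wb ~= 0 \<or> wc ~= 0 ==> 0 < x"
proof -
 define D where "D = 8 - 2 * (M a b * M b a + M a c * M c a + M b c * M c b) + M a b * M b c * M c a + M a c * M c b * M b a"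
 have D: "D < 0" using h unfolding hyp_def D_def by simp
 define A1 A2 A3 where "A1 = 4 - M b c * M c b" and "A2 = M b c * M c a - 2 * M b a" and "A3 = M b a * M c b - 2 * M c a"
 have Dx: "D * x = A1 * wa + A2 * wb + A3 * wc"
  unfolding e[symmetric] A1_def A2_def A3_def D_def by (simp add: algebra_simps)
 have A1: "A1 > 0" using h unfolding hyp_def A1_def by simp
 have nonneg: "M b c * M c a \<ge> 0" "M b a * M c b \<ge> 0" using h unfolding hyp_def by (auto intro: mult_nonpos_nonpos)
 \<comment> \<open>Both summands of \<open>A2\<close> and of \<open>A3\<close> are nonnegative. If
   both vanished, two of the three pairs would be orthogonal, against
   \<open>hyp_connected\<close>.\<close>
 have A2: "A2 > 0" and A3: "A3 > 0"
 proof -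
  have p: "M b c ~= 0 & M c a ~= 0 ==> M b c * M c a > 0" "M b a ~= 0 & M c b ~= 0 ==> M b a * M c b > 0"
   using h unfolding hyp_def by (metis less_eq_real_def mult_neg_neg)+
  have n: "M b a <= 0" "M c a <= 0" using h unfolding hyp_def by auto
  have z: "(M a b = 0 \<longleftrightarrow> M b a = 0)" "(M a c = 0 \<longleftrightarrow> M c a = 0)" "(M b c = 0 \<longleftrightarrow> M c b = 0)"
   using h unfolding hyp_def by auto
  show "A2 > 0" using hyp_connected[OF h] nonneg p n z unfolding A2_def by linarith
  show "A3 > 0" using hyp_connected[OF h] nonneg p n z unfolding A3_def by linarith
 qed
 have t: "A1 * wa <= 0" "A2 * wb <= 0" "A3 * wc <= 0" using A1 A2 A3 w by (auto intro: mult_nonneg_nonpos)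
 have "D * x <= 0" using Dx t by linarith
 thus "0 <= x" using D by (simp add: mult_le_0_iff)
 assume "wa ~= 0 \<or> wb ~= 0 \<or> wc ~= 0"
 hence "A1 * wa < 0 \<or> A2 * wb < 0 \<or> A3 * wc < 0" using A1 A2 A3 w by (auto simp: mult_less_0_iff)
 hence "D * x < 0" using Dx t by linarith
 thus "0 < x" using D by (simp add: mult_less_0_iff)
qed

lemma hyp_solve:
 assumes h: "hyp M a b c"
  and e: "2 * x + M b a * y + M c a * z <= 0" "M a b * x + 2 * y + M c b * z <= 0" "M a c * x + M b c * y + 2 * z <= 0"
 shows "0 <= x & 0 <= y & 0 <= z"
  and "2 * x + M b a * y + M c a * z ~= 0 \<or> M a b * x + 2 * y + M c b * z ~= 0 \<or> M a c * x + M b c * y + 2 * z ~= 0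
   ==> 0 < x & 0 < y & 0 < z"
 using hyp_solve_first[OF h refl refl refl, of x y z] 
    hyp_solve_first[OF hyp_perm(1)[OF h] refl refl refl, of y x z]
    hyp_solve_first[OF hyp_perm(1)[OF hyp_perm(2)[OF h]] refl refl refl, of z x y] e
 by (smt (verit))+

lemma hyp_solvable:
 assumes h: "hyp M a b c"
 shows "\<exists>x y z. 2 * x + M b a * y + M c a * z = wa & M a b * x + 2 * y + M c b * z = wb & M a c * x + M b c * y + 2 * z = wc"
proof -
 define D where "D = 8 - 2 * (M a b * M b a + M a c * M c a + M b c * M c b) + M a b * M b c * M c a + M a c * M c b * M b a"
 have D: "D ~= 0" using h unfolding hyp_def D_def by simp
 define X where "X = (4 - M b c * M c b) * wa + (M b c * M c a - 2 * M b a) * wb + (M b a * M c b - 2 * M c a) * wc"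
 define Y where "Y = (4 - M a c * M c a) * wb + (M a c * M c b - 2 * M a b) * wa + (M a b * M c a - 2 * M c b) * wc"
 define Z where "Z = (4 - M b a * M a b) * wc + (M b a * M a c - 2 * M b c) * wb + (M b c * M a b - 2 * M a c) * wa"
 have "2 * X + M b a * Y + M c a * Z = D * wa" "M a b * X + 2 * Y + M c b * Z = D * wb" "M a c * X + M b c * Y + 2 * Z = D * wc"
  unfolding X_def Y_def Z_def D_def by (simp_all add: algebra_simps)
 hence "2 * (X / D) + M b a * (Y / D) + M c a * (Z / D) = wa & M a b * (X / D) + 2 * (Y / D) + M c b * (Z / D) = wb
   & M a c * (X / D) + M b c * (Y / D) + 2 * (Z / D) = wc" using D 
  by (simp add: field_simps)
 thus ?thesis by blast
qed

section \<open>Cones over hyperbolic triples and their polar forms\<close>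

abbreviation cartan :: "('s => real^4) => ('s => real^4) => 's => 's => real" where
 "cartan \<alpha> v s t \<equiv> \<alpha> s \<bullet> v t"

text \<open>The first three coefficients solve the linear system of the Cartan matrix; what remains
  of \<open>q\<close> is killed by the three forms and therefore lies on the line of
  \<open>p\<close>. The sign rules of \<open>hyp_solve\<close> put every \<open>q\<close> with
  nonpositive values into the cone of the three vectors, modulo that line.\<close>

lemma cone_vec:
 assumes h: "hyp (cartan \<alpha> v) a b c" and nd: "D4 (\<alpha> a) (\<alpha> b) (\<alpha> c) (\<alpha> d) ~= 0"
  and p: "\<alpha> a \<bullet> p = 0" "\<alpha> b \<bullet> p = 0" "\<alpha> c \<bullet> p = 0" "\<alpha> d \<bullet> p ~= 0"
 obtains x y z h where "q = x *\<^sub>R v a + y *\<^sub>R v b + z *\<^sub>R v c + h *\<^sub>R p"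
  "\<alpha> a \<bullet> q <= 0 ==> \<alpha> b \<bullet> q <= 0 ==> \<alpha> c \<bullet> q <= 0 ==> 0 <= x & 0 <= y & 0 <= z"
  "\<alpha> a \<bullet> q <= 0 ==> \<alpha> b \<bullet> q <= 0 ==> \<alpha> c \<bullet> q <= 0 ==>
    \<alpha> a \<bullet> q ~= 0 \<or> \<alpha> b \<bullet> q ~= 0 \<or> \<alpha> c \<bullet> q ~= 0 ==> 0 < x & 0 < y & 0 < z"
proof -
 note ht = hyp_transpose[OF h]
 have diag: "\<alpha> a \<bullet> v a = 2" "\<alpha> b \<bullet> v b = 2" "\<alpha> c \<bullet> v c = 2" using h unfolding hyp_def by auto
 obtain x y z where s: "2 * x + (\<alpha> a \<bullet> v b) * y + (\<alpha> a \<bullet> v c) * z = \<alpha> a \<bullet> q"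
   "(\<alpha> b \<bullet> v a) * x + 2 * y + (\<alpha> b \<bullet> v c) * z = \<alpha> b \<bullet> q" "(\<alpha> c \<bullet> v a) * x + (\<alpha> c \<bullet> v b) * y + 2 * z = \<alpha> c \<bullet> q"
  using hyp_solvable[OF ht, of "\<alpha> a \<bullet> q" "\<alpha> b \<bullet> q" "\<alpha> c \<bullet> q"] by blast
 define r where "r = q - (x *\<^sub>R v a + y *\<^sub>R v b + z *\<^sub>R v c)"
 have r: "\<alpha> a \<bullet> r = 0" "\<alpha> b \<bullet> r = 0" "\<alpha> c \<bullet> r = 0"
  unfolding r_def using s diag by (auto simp: inner_diff_right inner_add_right algebra_simps)
 define h where "h = (\<alpha> d \<bullet> r) / (\<alpha> d \<bullet> p)"
 have "r - h *\<^sub>R p = 0"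
  by (rule D4_inj[OF nd]) (use r p in \<open>auto simp: inner_diff_right h_def\<close>)
 hence "q = x *\<^sub>R v a + y *\<^sub>R v b + z *\<^sub>R v c + h *\<^sub>R p" unfolding r_def by (simp add: algebra_simps)
 thus ?thesis using that hyp_solve[OF ht, of x y z] unfolding s by blast
qed

text \<open>Dual of \<open>cone_vec\<close>: \<open>\<pi>\<close> vanishes on the three vectors and
  the three \<open>\<alpha>\<close> vanish on \<open>p\<close>, so the coefficient of
  \<open>\<pi>\<close> is read off at \<open>p\<close>. Equality of forms is tested on the spanning
  vectors that \<open>cone_vec\<close> supplies.\<close>

lemma cone_form:
 assumes h: "hyp (cartan \<alpha> v) a b c" and nd: "D4 (\<alpha> a) (\<alpha> b) (\<alpha> c) (\<alpha> d) ~= 0"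
  and p: "\<alpha> a \<bullet> p = 0" "\<alpha> b \<bullet> p = 0" "\<alpha> c \<bullet> p = 0" "\<alpha> d \<bullet> p ~= 0"
  and pi: "\<pi> \<bullet> v a = 0" "\<pi> \<bullet> v b = 0" "\<pi> \<bullet> v c = 0" "\<pi> \<bullet> p > 0"
 obtains x y z where "f = x *\<^sub>R \<alpha> a + y *\<^sub>R \<alpha> b + z *\<^sub>R \<alpha> c + ((f \<bullet> p) / (\<pi> \<bullet> p)) *\<^sub>R \<pi>"
  "f \<bullet> v a <= 0 ==> f \<bullet> v b <= 0 ==> f \<bullet> v c <= 0 ==> 0 <= x & 0 <= y & 0 <= z"
  "f \<bullet> v a <= 0 ==> f \<bullet> v b <= 0 ==> f \<bullet> v c <= 0 ==>
    f \<bullet> v a ~= 0 \<or> f \<bullet> v b ~= 0 \<or> f \<bullet> v c ~= 0 ==> 0 < x & 0 < y & 0 < z"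
proof -
 have diag: "\<alpha> a \<bullet> v a = 2" "\<alpha> b \<bullet> v b = 2" "\<alpha> c \<bullet> v c = 2" using h unfolding hyp_def by auto
 obtain x y z where s: "2 * x + (\<alpha> b \<bullet> v a) * y + (\<alpha> c \<bullet> v a) * z = f \<bullet> v a"
   "(\<alpha> a \<bullet> v b) * x + 2 * y + (\<alpha> c \<bullet> v b) * z = f \<bullet> v b" "(\<alpha> a \<bullet> v c) * x + (\<alpha> b \<bullet> v c) * y + 2 * z = f \<bullet> v c"
  using hyp_solvable[OF h, of "f \<bullet> v a" "f \<bullet> v b" "f \<bullet> v c"] by blast
 define g where "g = f - (x *\<^sub>R \<alpha> a + y *\<^sub>R \<alpha> b + z *\<^sub>R \<alpha> c + ((f \<bullet> p) / (\<pi> \<bullet> p)) *\<^sub>R \<pi>)"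
 have g: "g \<bullet> v a = 0" "g \<bullet> v b = 0" "g \<bullet> v c = 0" "g \<bullet> p = 0"
  unfolding g_def using s diag pi p by (auto simp: inner_diff_left inner_add_left algebra_simps)
 have "g \<bullet> q = 0" for q
 proof -
  obtain x y z h where "q = x *\<^sub>R v a + y *\<^sub>R v b + z *\<^sub>R v c + h *\<^sub>R p"
   by (rule cone_vec[OF h nd p, of q])
  thus ?thesis using g by (simp add: inner_add_right)
 qed
 hence "g = 0" by (metis inner_eq_zero_iff)
 hence "f = x *\<^sub>R \<alpha> a + y *\<^sub>R \<alpha> b + z *\<^sub>R \<alpha> c + ((f \<bullet> p) / (\<pi> \<bullet> p)) *\<^sub>R \<pi>" unfolding g_def by (simp add: algebra_simps)
 thus ?thesis using that hyp_solve[OF h, of x y z] unfolding s by blast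
qed

text \<open>The coefficients solve the Cartan system whose right-hand side consists of the values of
  \<open>\<alpha> d\<close>, so that the difference vanishes on the three vectors. On
  \<open>v d\<close> it is a sum of nonpositive terms minus \<open>2\<close>.\<close>

lemma polar_tetra:
 assumes h: "hyp (cartan \<alpha> v) a b c"
  and n: "\<alpha> d \<bullet> v a <= 0" "\<alpha> d \<bullet> v b <= 0" "\<alpha> d \<bullet> v c <= 0" "\<alpha> a \<bullet> v d <= 0" "\<alpha> b \<bullet> v d <= 0" "\<alpha> c \<bullet> v d <= 0" "\<alpha> d \<bullet> v d = 2"
 obtains x y z where "0 <= x" "0 <= y" "0 <= z"
  "\<alpha> d \<bullet> v a ~= 0 \<or> \<alpha> d \<bullet> v b ~= 0 \<or> \<alpha> d \<bullet> v c ~= 0 ==> 0 < x & 0 < y & 0 < z"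
  "(x *\<^sub>R \<alpha> a + y *\<^sub>R \<alpha> b + z *\<^sub>R \<alpha> c - \<alpha> d) \<bullet> v a = 0"
  "(x *\<^sub>R \<alpha> a + y *\<^sub>R \<alpha> b + z *\<^sub>R \<alpha> c - \<alpha> d) \<bullet> v b = 0"
  "(x *\<^sub>R \<alpha> a + y *\<^sub>R \<alpha> b + z *\<^sub>R \<alpha> c - \<alpha> d) \<bullet> v c = 0"
  "(x *\<^sub>R \<alpha> a + y *\<^sub>R \<alpha> b + z *\<^sub>R \<alpha> c - \<alpha> d) \<bullet> v d < 0"
proof -
 have diag: "\<alpha> a \<bullet> v a = 2" "\<alpha> b \<bullet> v b = 2" "\<alpha> c \<bullet> v c = 2" using h unfolding hyp_def by auto
 obtain x y z where s: "2 * x + (\<alpha> b \<bullet> v a) * y + (\<alpha> c \<bullet> v a) * z = \<alpha> d \<bullet> v a"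
   "(\<alpha> a \<bullet> v b) * x + 2 * y + (\<alpha> c \<bullet> v b) * z = \<alpha> d \<bullet> v b" "(\<alpha> a \<bullet> v c) * x + (\<alpha> b \<bullet> v c) * y + 2 * z = \<alpha> d \<bullet> v c"
  using hyp_solvable[OF h, of "\<alpha> d \<bullet> v a" "\<alpha> d \<bullet> v b" "\<alpha> d \<bullet> v c"] by blast
 note sv = hyp_solve[OF h, of x y z, unfolded s, OF n(1-3)]
 have "x * (\<alpha> a \<bullet> v d) <= 0" "y * (\<alpha> b \<bullet> v d) <= 0" "z * (\<alpha> c \<bullet> v d) <= 0" 
  using sv(1) n by (auto intro: mult_nonneg_nonpos)
 hence "(x *\<^sub>R \<alpha> a + y *\<^sub>R \<alpha> b + z *\<^sub>R \<alpha> c - \<alpha> d) \<bullet> v d < 0" 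
  by (simp add: inner_add_left inner_diff_left n)
 thus ?thesis using sv s diag
  by (intro that[of x y z]) (auto simp: inner_add_left inner_diff_left algebra_simps)
qed

lemma sum3_neg:
 fixes x y z :: real
 assumes "0 <= x" "0 <= y" "0 <= z" "a <= 0" "b <= 0" "c <= 0"
 shows "x * a + y * b + z * c <= 0"
  and "0 < x ==> 0 < y ==> 0 < z ==> a < 0 \<or> b < 0 \<or> c < 0 ==> x * a + y * b + z * c < 0"
proof -
 have n: "x * a <= 0" "y * b <= 0" "z * c <= 0" using assms by (auto intro: mult_nonneg_nonpos)
 thus "x * a + y * b + z * c <= 0" by linarith
 assume "0 < x" "0 < y" "0 < z" "a < 0 \<or> b < 0 \<or> c < 0"
 hence "x * a < 0 \<or> y * b < 0 \<or> z * c < 0" by (auto simp: mult_less_0_iff)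
 with n show "x * a + y * b + z * c < 0" by linarith
qed

text \<open>The last clause normalises \<open>\<pi>\<close> to \<open>- \<alpha> d\<close> on the
  kernel line of the triangle, which makes it positive at the vertex, where
  \<open>\<alpha> d\<close> is negative. The middle clause gives signs on the face \<open>d\<close>;
  a strict sign is claimed only if \<open>d\<close> is not orthogonal to the whole triangle.\<close>

definition polar_form :: "('s => real^4) => ('s => real^4) => 's set => 's => real^4 => bool" where
 "polar_form \<alpha> v tr d \<pi> \<longleftrightarrow> (\<forall>t\<in>tr. \<pi> \<bullet> v t = 0) & \<pi> \<bullet> v d < 0 &
   (\<forall>q. (\<forall>i\<in>tr. \<alpha> i \<bullet> q <= 0) & \<alpha> d \<bullet> q = 0 --> \<pi> \<bullet> q <= 0 &
    ((\<exists>i\<in>tr. \<alpha> d \<bullet> v i ~= 0) & (\<exists>i\<in>tr. \<alpha> i \<bullet> q < 0) --> \<pi> \<bullet> q < 0)) &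
   (\<forall>q. (\<forall>i\<in>tr. \<alpha> i \<bullet> q = 0) --> \<pi> \<bullet> q = - (\<alpha> d \<bullet> q))"

lemma polar_form_exists:
 assumes h: "hyp (cartan \<alpha> v) a b c"
  and n: "\<alpha> d \<bullet> v a <= 0" "\<alpha> d \<bullet> v b <= 0" "\<alpha> d \<bullet> v c <= 0" "\<alpha> a \<bullet> v d <= 0" "\<alpha> b \<bullet> v d <= 0" "\<alpha> c \<bullet> v d <= 0" "\<alpha> d \<bullet> v d = 2"
 obtains x y z where "polar_form \<alpha> v {a,b,c} d (x *\<^sub>R \<alpha> a + y *\<^sub>R \<alpha> b + z *\<^sub>R \<alpha> c - \<alpha> d)" 
  "0 <= x" "0 <= y" "0 <= z" "\<alpha> d \<bullet> v a ~= 0 \<or> \<alpha> d \<bullet> v b ~= 0 \<or> \<alpha> d \<bullet> v c ~= 0 ==> 0 < x & 0 < y & 0 < z"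
proof -
 obtain x y z where s: "0 <= x" "0 <= y" "0 <= z"
  "\<alpha> d \<bullet> v a ~= 0 \<or> \<alpha> d \<bullet> v b ~= 0 \<or> \<alpha> d \<bullet> v c ~= 0 ==> 0 < x & 0 < y & 0 < z"
  "(x *\<^sub>R \<alpha> a + y *\<^sub>R \<alpha> b + z *\<^sub>R \<alpha> c - \<alpha> d) \<bullet> v a = 0"
  "(x *\<^sub>R \<alpha> a + y *\<^sub>R \<alpha> b + z *\<^sub>R \<alpha> c - \<alpha> d) \<bullet> v b = 0"
  "(x *\<^sub>R \<alpha> a + y *\<^sub>R \<alpha> b + z *\<^sub>R \<alpha> c - \<alpha> d) \<bullet> v c = 0"
  "(x *\<^sub>R \<alpha> a + y *\<^sub>R \<alpha> b + z *\<^sub>R \<alpha> c - \<alpha> d) \<bullet> v d < 0"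
  by (rule polar_tetra[OF h n]) blast
 have "polar_form \<alpha> v {a,b,c} d (x *\<^sub>R \<alpha> a + y *\<^sub>R \<alpha> b + z *\<^sub>R \<alpha> c - \<alpha> d)"
  unfolding polar_form_def
 proof (intro conjI allI impI, goal_cases)
  case 1 thus ?case using s by simp
 next
  case 2 thus ?case using s by simp
 next
  case (3 q) thus ?case using sum3_neg(1)[OF s(1-3), of "\<alpha> a \<bullet> q" "\<alpha> b \<bullet> q" "\<alpha> c \<bullet> q"]
   by (simp add: inner_add_left inner_diff_left)
 next
  case (4 q) thus ?case using sum3_neg(2)[OF s(1-3), of "\<alpha> a \<bullet> q" "\<alpha> b \<bullet> q" "\<alpha> c \<bullet> q"] s(4)
   by (auto simp add: inner_add_left inner_diff_left)
 next
  case (5 q) thus ?case by (simp add: inner_add_left inner_diff_left)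
 qed
 thus ?thesis using that s by blast
qed

text \<open>After the truncation by \<open>k\<close> the triangle \<open>{a,b,k}\<close> has apex
  \<open>c\<close>. Its polar form is built from the forms of \<open>a\<close>, \<open>b\<close>,
  \<open>k\<close>, \<open>c\<close>, but in the old basis, consisting of the forms of
  \<open>a\<close>, \<open>b\<close>, \<open>c\<close> and \<open>\<pi>0\<close>, all four
  coefficients are positive. Hence it is negative wherever the old data are nonpositive and not all
  zero.\<close>

lemma polar_form_new:
 assumes h0: "hyp (cartan \<alpha> v) a b c" and nd: "D4 (\<alpha> a) (\<alpha> b) (\<alpha> c) (\<alpha> d) ~= 0"
  and p: "\<alpha> a \<bullet> p = 0" "\<alpha> b \<bullet> p = 0" "\<alpha> c \<bullet> p = 0" "\<alpha> d \<bullet> p < 0"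
  and pi0: "\<pi>0 \<bullet> v a = 0" "\<pi>0 \<bullet> v b = 0" "\<pi>0 \<bullet> v c = 0" "\<pi>0 \<bullet> p > 0"
  and k: "\<alpha> k \<bullet> v a <= 0" "\<alpha> k \<bullet> v b <= 0" "\<alpha> k \<bullet> v c <= 0" "\<alpha> a \<bullet> v k <= 0" "\<alpha> b \<bullet> v k <= 0" "\<alpha> c \<bullet> v k <= 0" "\<alpha> k \<bullet> v k = 2"
  and kp: "\<alpha> k \<bullet> p > 0"
  and h: "hyp (cartan \<alpha> v) a b k"
 obtains \<pi> where "polar_form \<alpha> v {a,b,k} c \<pi>"
  "\<forall>q. \<alpha> a \<bullet> q <= 0 & \<alpha> b \<bullet> q <= 0 & \<alpha> c \<bullet> q <= 0 & \<pi>0 \<bullet> q <= 0 &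
    (\<alpha> a \<bullet> q < 0 \<or> \<alpha> b \<bullet> q < 0 \<or> \<alpha> c \<bullet> q < 0 \<or> \<pi>0 \<bullet> q < 0) --> \<pi> \<bullet> q < 0"
proof -
 have n: "\<alpha> c \<bullet> v a <= 0" "\<alpha> c \<bullet> v b <= 0" "\<alpha> a \<bullet> v c <= 0" "\<alpha> b \<bullet> v c <= 0" "\<alpha> c \<bullet> v c = 2"
  using h0 unfolding hyp_def by auto
 have c: "\<alpha> c \<bullet> v a ~= 0 \<or> \<alpha> c \<bullet> v b ~= 0" using hyp_connected[OF h0] h0 unfolding hyp_def by auto
 obtain x y z where s: "polar_form \<alpha> v {a,b,k} c (x *\<^sub>R \<alpha> a + y *\<^sub>R \<alpha> b + z *\<^sub>R \<alpha> k - \<alpha> c)" 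
  "0 <= x" "0 <= y" "0 <= z" "\<alpha> c \<bullet> v a ~= 0 \<or> \<alpha> c \<bullet> v b ~= 0 \<or> \<alpha> c \<bullet> v k ~= 0 ==> 0 < x & 0 < y & 0 < z"
  by (rule polar_form_exists[OF h n(1,2) k(6) n(3,4) k(3) n(5)]) blast
 define \<pi> where "\<pi> = x *\<^sub>R \<alpha> a + y *\<^sub>R \<alpha> b + z *\<^sub>R \<alpha> k - \<alpha> c"
 have z: "z > 0" using s(5) c by auto
 have \<pi>v: "\<pi> \<bullet> v a = 0" "\<pi> \<bullet> v b = 0" "\<pi> \<bullet> v c < 0" using s(1) unfolding polar_form_def \<pi>_def[symmetric] by auto
 have \<pi>p: "\<pi> \<bullet> p > 0" unfolding \<pi>_def using p z kp by (simp add: inner_add_left inner_diff_left)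
 \<comment> \<open>The form vanishes on \<open>v a\<close> and \<open>v b\<close> and is negative on
   \<open>v c\<close>, which is the strict case of \<open>cone_form\<close>.\<close>
 obtain x' y' z' where e: "\<pi> = x' *\<^sub>R \<alpha> a + y' *\<^sub>R \<alpha> b + z' *\<^sub>R \<alpha> c + ((\<pi> \<bullet> p) / (\<pi>0 \<bullet> p)) *\<^sub>R \<pi>0"
  and pos: "0 < x' & 0 < y' & 0 < z'"
  using cone_form[OF h0 nd p(1-3) _ pi0, of \<pi>] \<pi>v p(4) by (smt (verit))
 have r: "(\<pi> \<bullet> p) / (\<pi>0 \<bullet> p) > 0" using \<pi>p pi0 by simp
 show ?thesis
 proof (rule that[of \<pi>])
  show "polar_form \<alpha> v {a,b,k} c \<pi>" using s(1) unfolding \<pi>_def .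
  have "\<pi> \<bullet> q < 0" if q: "\<alpha> a \<bullet> q <= 0" "\<alpha> b \<bullet> q <= 0" "\<alpha> c \<bullet> q <= 0" "\<pi>0 \<bullet> q <= 0"
    "\<alpha> a \<bullet> q < 0 \<or> \<alpha> b \<bullet> q < 0 \<or> \<alpha> c \<bullet> q < 0 \<or> \<pi>0 \<bullet> q < 0" for q
  proof -
  have "\<pi> \<bullet> q = x' * (\<alpha> a \<bullet> q) + y' * (\<alpha> b \<bullet> q) + z' * (\<alpha> c \<bullet> q) + ((\<pi> \<bullet> p) / (\<pi>0 \<bullet> p)) * (\<pi>0 \<bullet> q)"
   by (subst e) (simp add: inner_add_left)
  moreover have "((\<pi> \<bullet> p) / (\<pi>0 \<bullet> p)) * (\<pi>0 \<bullet> q) <= 0" using r q by (intro mult_nonneg_nonpos) auto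
  moreover have "\<pi>0 \<bullet> q < 0 ==> ((\<pi> \<bullet> p) / (\<pi>0 \<bullet> p)) * (\<pi>0 \<bullet> q) < 0" using r by (intro mult_pos_neg) auto
  ultimately show "\<pi> \<bullet> q < 0"
   using sum3_neg[of x' y' z' "\<alpha> a \<bullet> q" "\<alpha> b \<bullet> q" "\<alpha> c \<bullet> q"] pos q by (smt (verit))
  qed
  thus "\<forall>q. \<alpha> a \<bullet> q <= 0 & \<alpha> b \<bullet> q <= 0 & \<alpha> c \<bullet> q <= 0 & \<pi>0 \<bullet> q <= 0 &
    (\<alpha> a \<bullet> q < 0 \<or> \<alpha> b \<bullet> q < 0 \<or> \<alpha> c \<bullet> q < 0 \<or> \<pi>0 \<bullet> q < 0) --> \<pi> \<bullet> q < 0" by blast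
 qed
qed

section \<open>Stacks of tetrahedra\<close>

text \<open>An element \<open>(tr, d)\<close> of \<open>T\<close> is a boundary triangle \<open>tr\<close> of the stack, that is, a vertex of the
  ecimahedron given by the faces through it, together with the apex \<open>d\<close> of the tetrahedron
  containing it.  The list records the triangles \<open>tr\<close> that later faces \<open>k\<close> truncate.\<close>

definition step_cells :: "('s set \<times> 's) set => 's => 's set => 's => ('s set \<times> 's) set" where
 "step_cells T k tr d = (T - {(tr, d)}) \<union> (\<lambda>x. (insert k (tr - {x}), x)) ` tr"

inductive stk :: "'s set => ('s set \<times> 's) set => ('s \<times> 's set \<times> 's) list => bool" where
 base: "card S = 4 ==> stk S ((\<lambda>x. (S - {x}, x)) ` S) []"
| step: "stk S T L ==> (tr, d) \<in> T ==> k \<notin> S ==> stk (insert k S) (step_cells T k tr d) (L @ [(k, tr, d)])"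

definition adj :: "('s set \<times> 's) set => 's => 's => bool" where
 "adj T s t \<longleftrightarrow> s ~= t & (\<exists>\<tau>\<in>fst ` T. s \<in> \<tau> & t \<in> \<tau>)"

lemma adjI: "\<tau> \<in> fst ` T ==> s \<in> \<tau> ==> t \<in> \<tau> ==> s ~= t ==> adj T s t"
 unfolding adj_def by blast

lemma adjE: assumes "adj T s t" obtains \<tau> where "\<tau> \<in> fst ` T" "s \<in> \<tau>" "t \<in> \<tau>" "s ~= t"
 using assms unfolding adj_def by blast

lemma adj_sym: "adj T s t ==> adj T t s" unfolding adj_def by auto

lemma card3E:
 assumes "card tr = 3" "x \<in> tr" obtains y z where "tr = {x,y,z}" "distinct [x,y,z]"
proof -
 have "card (tr - {x}) = 2" using assms by (metis card_Diff_singleton diff_Suc_1 numeral_3_eq_3 numeral_2_eq_2)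
 then obtain y z where "tr - {x} = {y,z}" "y ~= z" by (meson card_2_iff)
 thus ?thesis using that[of y z] assms(2) by auto
qed

lemma card3_iff_distinct: "card tr = 3 \<longleftrightarrow> (\<exists>a b c. tr = {a,b,c} & distinct [a,b,c])"
 by (auto simp: card_3_iff)

lemma card3_third:
 assumes "card tr = 3" obtains x where "x \<in> tr" "x ~= s" "x ~= t"
proof -
 have "\<not> tr \<subseteq> {s,t}"
 proof
  assume "tr \<subseteq> {s,t}"
  hence "card tr <= card {s,t}" by (intro card_mono) auto
  also have "\<dots> <= 2" by (simp add: card_insert_if)
  finally show False using assms by simp
 qed
 thus ?thesis using that by blast
qed

lemma stk_finite: "stk S T L ==> finite S"
 by (induction rule: stk.induct) (auto intro: card_ge_0_finite)

lemma stk_cell: "stk S T L ==> (\<tau>, d) \<in> T ==> card \<tau> = 3 & \<tau> \<subseteq> S & d \<in> S & d \<notin> \<tau>"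
proof (induction arbitrary: \<tau> d rule: stk.induct)
 case (base S) thus ?case by (auto simp: card_Diff_singleton_if)
next
 case (step S T L tr d0 k)
 have tr: "card tr = 3" "tr \<subseteq> S" "d0 \<in> S" "d0 \<notin> tr" using step.IH[OF step.hyps(2)] by auto
 hence fin: "finite tr" by (metis card.infinite zero_neq_numeral)
 have "card (insert k (tr - {x})) = 3 & insert k (tr - {x}) \<subseteq> insert k S & x \<in> insert k S & x \<notin> insert k (tr - {x})" if "x \<in> tr" for x
  using that tr step.hyps fin by (subst card_insert_disjoint) (auto simp: card_Diff_singleton)
 thus ?case using step.prems step.IH unfolding step_cells_def by auto
qed

lemma stk_apex: "stk S T L ==> (\<tau>, d) \<in> T ==> (\<tau>, e) \<in> T ==> d = e"
proof (induction arbitrary: \<tau> d e rule: stk.induct)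
 case (base S) thus ?case by auto
next
 case (step S T L tr d0 k)
 have old: "k \<notin> \<tau>" if "(\<tau>, x) \<in> T" for \<tau> x using stk_cell[OF step.hyps(1) that] step.hyps by auto
 have k: "k \<notin> tr" using old step.hyps by auto
 have new: "x = y" if "insert k (tr - {x}) = insert k (tr - {y})" "x \<in> tr" "y \<in> tr" for x y
  using that k by (metis DiffE DiffI insertE insertI2 insert_iff singletonD)
 show ?case using step.prems unfolding step_cells_def
  using old new step.IH k by (smt (verit, best) DiffD1 Pair_inject Un_iff imageE insertI1)
qed

lemma step_cells_iff:
 assumes s: "stk S T L" and tr: "(tr, d) \<in> T"
 shows "\<tau> \<in> fst ` step_cells T k tr d \<longleftrightarrow> (\<tau> \<in> fst ` T & \<tau> ~= tr) \<or> (\<exists>x\<in>tr. \<tau> = insert k (tr - {x}))"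
proof -
 have "\<tau> \<in> fst ` (T - {(tr, d)}) \<longleftrightarrow> \<tau> \<in> fst ` T & \<tau> ~= tr"
 proof
  assume "\<tau> \<in> fst ` (T - {(tr, d)})"
  then obtain z where z: "z \<in> T - {(tr, d)}" "\<tau> = fst z" by (rule imageE)
  define e where "e = snd z"
  have "(\<tau>, e) \<in> T - {(tr, d)}" using z unfolding e_def by simp
  hence "(\<tau>, e) \<in> T" "\<tau> = tr --> e ~= d" by auto
  thus "\<tau> \<in> fst ` T & \<tau> ~= tr" using stk_apex[OF s _ tr] by force
 next
  assume "\<tau> \<in> fst ` T & \<tau> ~= tr"
  thus "\<tau> \<in> fst ` (T - {(tr, d)})" by force
 qed
 thus ?thesis unfolding step_cells_def image_Un image_image by (simp add: image_iff)
qed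

text \<open>No edge of the stack becomes interior: when a triangle through \<open>s\<close> and
  \<open>t\<close> is covered, the new triangle that omits its third vertex still contains
  both.\<close>

lemma adj_step:
 assumes s: "stk S T L" and tr: "(tr, d) \<in> T" and a: "adj T s t"
 shows "adj (step_cells T k tr d) s t"
proof -
 from a obtain \<tau> where \<tau>: "\<tau> \<in> fst ` T" "s \<in> \<tau>" "t \<in> \<tau>" "s ~= t" by (rule adjE)
 show ?thesis
 proof (cases "\<tau> = tr")
  case False
  hence "\<tau> \<in> fst ` step_cells T k tr d" using \<tau>(1) by (simp only: step_cells_iff[OF s tr] simp_thms not_False_eq_True)
  thus ?thesis using \<tau> by (intro adjI)
 next
  case True
  have "card tr = 3" using stk_cell[OF s tr] by auto
  then obtain x where "x \<in> tr" "x ~= s" "x ~= t" by (rule card3_third)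
  hence "insert k (tr - {x}) \<in> fst ` step_cells T k tr d" "s \<in> insert k (tr - {x})" "t \<in> insert k (tr - {x})"
   using \<tau> True unfolding step_cells_iff[OF s tr] by blast+
  thus ?thesis using \<tau>(4) by (rule adjI)
 qed
qed

lemma adj_new:
 assumes s: "stk S T L" and tr: "(tr, d) \<in> T" and k: "k \<notin> S" and a: "a \<in> tr"
 shows "adj (step_cells T k tr d) k a"
proof -
 have tr': "card tr = 3" "k \<notin> tr" using stk_cell[OF s tr] k by auto
 then obtain x where x: "x \<in> tr" "x ~= a" using card3_third[of tr a a] by blast
 have 1: "insert k (tr - {x}) \<in> fst ` step_cells T k tr d" using x unfolding step_cells_iff[OF s tr] by blast
 have "k ~= a" "k \<in> insert k (tr - {x})" "a \<in> insert k (tr - {x})" using a tr' x by auto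
 thus ?thesis using adjI[OF 1] by blast
qed

text \<open>Tetrahedra are glued along whole triangles only, so all six edges of a tetrahedron stay
  on the boundary. All Cartan entries of such a tetrahedron are therefore subject to the angle
  conditions.\<close>

lemma adj_tetra: "stk S T L ==> (\<tau>, d) \<in> T ==> s \<in> insert d \<tau> ==> t \<in> insert d \<tau> ==> s ~= t ==> adj T s t"
proof (induction arbitrary: \<tau> d s t rule: stk.induct)
 case (base S)
 have "card (S - {s,t}) = 2" using base by (subst card_Diff_subset) auto
 then obtain x where "x \<in> S" "x ~= s" "x ~= t" by (metis Diff_iff all_not_in_conv card.empty insert_iff zero_neq_numeral)
 thus ?case using base unfolding adj_def by (intro conjI bexI[of _ "S - {x}"]) (auto simp: image_iff)
next
 case (step S T L tr d0 k)
 show ?case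
 proof (cases "(\<tau>, d) \<in> T")
  case True thus ?thesis using step adj_step by metis
 next
  case False
  then obtain x where x: "x \<in> tr" "\<tau> = insert k (tr - {x})" "d = x" using step.prems(1) unfolding step_cells_def by auto
  hence "s \<in> insert k tr" "t \<in> insert k tr" using step.prems by auto
  thus ?thesis using step adj_new adj_step adj_sym by (metis insertE insert_iff)
 qed
qed

text \<open>The third vertices of the boundary triangles through the edge \<open>ab\<close>. Dually
  they stand for the endpoints of the edge in which the faces \<open>a\<close> and \<open>b\<close>
  meet.\<close>

definition ends :: "('s set \<times> 's) set => 's => 's => 's set" where
 "ends T a b = {x. x ~= a & x ~= b & {a,b,x} \<in> fst ` T}"

lemma triple_eq_iff: "x ~= a ==> x ~= b ==> y ~= a ==> y ~= b ==> {a,b,x} = {a,b,y} \<longleftrightarrow> x = y"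
 by blast

text \<open>The boundary of the stack is a closed surface. A truncation affects the triangles
  through \<open>ab\<close> only if \<open>k\<close> is one of the two, or if both lie in
  \<open>tr\<close>; in the latter case the third vertex of \<open>tr\<close> is replaced by
  \<open>k\<close>.\<close>

lemma stk_ends: "stk S T L ==> adj T a b ==> \<exists>u w. u ~= w & ends T a b = {u, w}"
proof (induction arbitrary: a b rule: stk.induct)
 case (base S)
 hence ab: "a \<in> S" "b \<in> S" "a ~= b" unfolding adj_def by auto
 have "card (S - {a,b}) = 2" using base ab by (subst card_Diff_subset) auto
 then obtain u w where uw: "S - {a,b} = {u,w}" "u ~= w" by (meson card_2_iff)
 hence S: "S = {a,b,u,w}" "distinct [a,b,u,w]" using ab by auto
 have "S - {a} = {b,u,w}" "S - {b} = {a,u,w}" "S - {u} = {a,b,w}" "S - {w} = {a,b,u}" using S by auto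
 hence it: "\<tau> \<in> fst ` (\<lambda>x. (S - {x}, x)) ` S \<longleftrightarrow> \<tau> = {b,u,w} \<or> \<tau> = {a,u,w} \<or> \<tau> = {a,b,w} \<or> \<tau> = {a,b,u}" for \<tau>
  unfolding image_image using S(1) by (simp add: image_iff)
 have "a \<notin> {b,u,w}" "b \<notin> {a,u,w}" using S(2) by auto
 hence "x \<in> ends ((\<lambda>x. (S - {x}, x)) ` S) a b \<longleftrightarrow> x = u \<or> x = w" for x
  unfolding ends_def mem_Collect_eq it using triple_eq_iff[of x a b u] triple_eq_iff[of x a b w] S(2)
  by (metis distinct_length_2_or_more insertCI)
 hence "ends ((\<lambda>x. (S - {x}, x)) ` S) a b = {u,w}" by blast
 thus ?case using uw by blast
next
 case (step S T L tr d k)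
 let ?T = "step_cells T k tr d"
 note it = step_cells_iff[OF step.hyps(1,2)]
 have tr: "card tr = 3" "tr \<subseteq> S" "k \<notin> tr" using stk_cell[OF step.hyps(1,2)] step.hyps by auto
 have old: "k \<notin> \<tau>" if "\<tau> \<in> fst ` T" for \<tau> using stk_cell[OF step.hyps(1)] step.hyps(3) that by force
 have ab: "a ~= b" using step.prems unfolding adj_def by auto
 consider (kk) "a = k \<or> b = k" | (inn) "a ~= k" "b ~= k" "a \<in> tr" "b \<in> tr" | (out) "a ~= k" "b ~= k" "\<not> (a \<in> tr & b \<in> tr)" by blast
 thus ?case
 proof cases
  case kk
  \<comment> \<open>Up to symmetry \<open>a = k\<close>. The triangles through \<open>k\<close> are
    the three new ones, and those that also contain \<open>b\<close> omit one of the other two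
    elements of \<open>tr\<close>.\<close>
  have *: "\<exists>u w. u ~= w & ends ?T k b = {u, w}" if b: "b \<in> tr" for b
  proof -
   obtain u w where uw: "tr = {b,u,w}" "distinct [b,u,w]" using card3E[OF tr(1) b] .
   have bk: "b ~= k" "u ~= k" "w ~= k" "u ~= b" "w ~= b" using uw tr(3) by auto
   have e: "insert k (tr - {b}) = {k,u,w}" "insert k (tr - {u}) = {k,b,w}" "insert k (tr - {w}) = {k,b,u}"
    using uw by auto
   have bex: "(\<exists>y\<in>tr. Q y) \<longleftrightarrow> Q b \<or> Q u \<or> Q w" for Q unfolding uw(1) by simp
   have "x \<in> ends ?T k b \<longleftrightarrow> x = u \<or> x = w" for x
   proof (cases "x = k \<or> x = b")
    case True thus ?thesis unfolding ends_def mem_Collect_eq using bk by auto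
   next
    case False
    have nT: "{k,b,x} \<notin> fst ` T" using old[of "{k,b,x}"] by auto
    have "b \<notin> {k,u,w}" using bk by auto
    hence n: "{k,b,x} ~= {k,u,w}" by (metis insertCI)
    have A: "{k,b,x} \<in> fst ` ?T \<longleftrightarrow> {k,b,x} = {k,b,w} \<or> {k,b,x} = {k,b,u}"
     by (simp only: it nT bex e n simp_thms)
    have "{k,b,x} = {k,b,u} \<longleftrightarrow> x = u" "{k,b,x} = {k,b,w} \<longleftrightarrow> x = w"
     using False bk by (intro triple_eq_iff; simp)+
    thus ?thesis unfolding ends_def mem_Collect_eq A using False by auto
   qed
   hence "ends ?T k b = {u,w}" by blast
   moreover have "u ~= w" using uw(2) by simp
   ultimately show ?thesis by blast
  qed
  have sym: "ends ?T a b = ends ?T b a" unfolding ends_def by (auto simp: insert_commute)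
  obtain \<tau> where \<tau>: "\<tau> \<in> fst ` ?T" "a \<in> \<tau>" "b \<in> \<tau>" using step.prems by (rule adjE)
  have "\<tau> \<notin> fst ` T" using kk old[of \<tau>] \<tau>(2,3) by auto
  then obtain y where "\<tau> = insert k (tr - {y})" using it[of \<tau>] \<tau>(1) by auto
  hence i: "a \<in> insert k tr" "b \<in> insert k tr" using \<tau>(2,3) by auto
  show ?thesis
  proof (cases "a = k")
   case True thus ?thesis using *[of b] i ab by auto
  next
   case False
   hence "b = k" "a \<in> tr" using kk i by auto
   thus ?thesis using *[of a] sym by simp
  qed
 next
  case inn
  obtain y z where yz: "tr = {a,y,z}" "distinct [a,y,z]" using card3E[OF tr(1) inn(3)] .
  obtain c where c: "tr = {a,b,c}" "distinct [a,b,c]"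
  proof (cases "b = y")
   case True thus ?thesis using that[of z] yz by auto
  next
   case False thus ?thesis using that[of y] yz inn(4) ab by auto
  qed
  have trT: "tr \<in> fst ` T" using step.hyps(2) by force
  hence "adj T a b" using inn ab by (intro adjI)
  then obtain u w where uw: "u ~= w" "ends T a b = {u,w}" using step.IH by blast
  have "c ~= a" "c ~= b" using c(2) by auto
  hence "c \<in> ends T a b" unfolding ends_def using c(1) trT by simp
  hence "\<exists>u. u ~= c & ends T a b = {c,u}"
   using uw by (metis insert_commute insertE singletonD)
  then obtain u where u: "u ~= c" "ends T a b = {c,u}" by blast
  have "{a,b,u} \<in> fst ` T" using u unfolding ends_def by blast
  hence uk: "u ~= k" using old[of "{a,b,u}"] by auto
  have "x \<in> ends ?T a b \<longleftrightarrow> x = k \<or> x = u" for x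
  proof (cases "x = k")
   case True
   have "insert k (tr - {c}) = {a,b,k}" using c by auto
   moreover have "c \<in> tr" using c by blast
   ultimately have "\<exists>y\<in>tr. {a,b,k} = insert k (tr - {y})" by (intro bexI[of _ c]) simp_all
   hence "{a,b,k} \<in> fst ` ?T" using it[of "{a,b,k}"] by simp
   thus ?thesis unfolding ends_def using True inn by simp
  next
   case False
   have "x \<in> ends ?T a b \<longleftrightarrow> x \<in> ends T a b & x ~= c"
   proof -
    have "k \<notin> {a,b,x}" using inn False by auto
    hence "\<not> (\<exists>y\<in>tr. {a,b,x} = insert k (tr - {y}))" by blast
    hence "{a,b,x} \<in> fst ` ?T \<longleftrightarrow> {a,b,x} \<in> fst ` T & {a,b,x} ~= {a,b,c}" using it[of "{a,b,x}"] c(1) by simp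
    moreover have "{a,b,x} = {a,b,c} \<longleftrightarrow> x = c" if "x ~= a" "x ~= b"
      using that c(2) by (intro triple_eq_iff; auto)
     ultimately show ?thesis unfolding ends_def mem_Collect_eq by (cases "x = a \<or> x = b") (use c(2) in \<open>elim disjE; simp\<close>, simp)
   qed
   thus ?thesis using u False by auto
  qed
  hence "ends ?T a b = {k,u}" by blast
  thus ?thesis using uk by blast
 next
  case out
  obtain \<tau> where \<tau>: "\<tau> \<in> fst ` ?T" "a \<in> \<tau>" "b \<in> \<tau>" using step.prems by (rule adjE)
  have "\<tau> ~= insert k (tr - {y})" for y using out \<tau>(2,3) by auto
  hence "\<tau> \<in> fst ` T" using it[of \<tau>] \<tau>(1) by auto
  hence "adj T a b" using \<tau> ab by (intro adjI)
  moreover have "{a,b,x} \<in> fst ` ?T \<longleftrightarrow> {a,b,x} \<in> fst ` T" for x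
  proof -
   have "{a,b,x} ~= tr" using out by blast
   moreover have "{a,b,x} ~= insert k (tr - {y})" for y using out by blast
   ultimately show ?thesis using it[of "{a,b,x}"] by simp
  qed
  hence "ends ?T a b = ends T a b" unfolding ends_def by simp
  ultimately show ?thesis using step.IH by metis
 qed
qed

text \<open>The second triangle through the edge opposite \<open>x\<close>. Geometrically it is the
  vertex of the polyhedron that is reached by leaving the face \<open>x\<close> along an
  edge.\<close>

lemma stk_neighbour:
 assumes s: "stk S T L" and tr: "tr \<in> fst ` T" and x: "x \<in> tr"
 obtains u where "u \<notin> tr" "insert u (tr - {x}) \<in> fst ` T"
proof -
 have "card tr = 3" using stk_cell[OF s] tr by force
 then obtain a b where ab: "tr = {x,a,b}" "distinct [x,a,b]" using x card3E by metis
 have "adj T a b" using ab tr unfolding adj_def by auto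
 then obtain u w where uw: "u ~= w" "ends T a b = {u,w}" using stk_ends[OF s] by blast
 then obtain y where y: "y \<in> ends T a b" "y ~= x" by blast
 have "tr - {x} = {a,b}" using ab by auto
 moreover have "{a,b,y} = insert y {a,b}" by blast
 ultimately have "insert y (tr - {x}) \<in> fst ` T" using y(1) unfolding ends_def by simp
 moreover have "y \<notin> tr" using y ab unfolding ends_def by blast
 ultimately show ?thesis using that by blast
qed

section \<open>The induction over truncations\<close>

text \<open>The forms indexed by \<open>Q\<close> span the dual space, phrased by common zeros so
  that the indices need no ordering.\<close>

definition nd :: "('s => real^4) => 's set => bool" where
 "nd \<alpha> Q \<longleftrightarrow> (\<forall>x. (\<forall>s\<in>Q. \<alpha> s \<bullet> x = 0) --> x = 0)"

lemma nd_D4: "nd \<alpha> {a,b,c,d} \<longleftrightarrow> D4 (\<alpha> a) (\<alpha> b) (\<alpha> c) (\<alpha> d) ~= 0"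
proof
 assume n: "nd \<alpha> {a,b,c,d}"
 show "D4 (\<alpha> a) (\<alpha> b) (\<alpha> c) (\<alpha> d) ~= 0"
 proof
  define A where "A = ((\<chi> i. if i = 1 then \<alpha> a else if i = 2 then \<alpha> b else if i = 3 then \<alpha> c else \<alpha> d) :: real^4^4)"
  assume "D4 (\<alpha> a) (\<alpha> b) (\<alpha> c) (\<alpha> d) = 0"
  hence "\<not> invertible A" unfolding D4_def A_def[symmetric] by (simp add: invertible_det_nz)
  then obtain z where z: "A *v z = 0" "z ~= 0"
   by (metis matrix_left_invertible_ker invertible_left_inverse)
  have "\<alpha> a \<bullet> z = (A *v z) $ 1" "\<alpha> b \<bullet> z = (A *v z) $ 2" "\<alpha> c \<bullet> z = (A *v z) $ 3" "\<alpha> d \<bullet> z = (A *v z) $ 4"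
   by (simp_all add: inner_4 matrix_vector_mult_def sum_4 A_def)
  hence "\<forall>s\<in>{a,b,c,d}. \<alpha> s \<bullet> z = 0" using z by simp
  with n z(2) show False unfolding nd_def by blast
 qed
qed (auto simp: nd_def intro: D4_inj)

lemma wsum_nonpos:
 fixes y t :: "'s => real"
 assumes "!!i. i \<in> tr ==> 0 <= y i" "!!i. i \<in> tr ==> t i <= 0"
 shows "(\<Sum>i\<in>tr. y i * t i) <= 0"
 using assms by (intro sum_nonpos mult_nonneg_nonpos)

lemma wsum_neg:
 fixes y t :: "'s => real"
 assumes "finite tr" "!!i. i \<in> tr ==> 0 < y i" "!!i. i \<in> tr ==> t i <= 0" "i \<in> tr" "t i < 0"
 shows "(\<Sum>i\<in>tr. y i * t i) < 0"
proof -
 have "(\<Sum>i\<in>tr - {i}. y i * t i) <= 0" using assms(2,3) by (intro wsum_nonpos) (auto intro: less_imp_le)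
 moreover have "y i * t i < 0" using assms by (intro mult_pos_neg) auto
 ultimately show ?thesis using assms by (simp add: sum.remove[of tr i])
qed

text \<open>\<open>cone_vec\<close> for an unordered triangle. The expansion is tested against an
  arbitrary form \<open>f\<close>, since it is later used with the values of \<open>\<alpha>\<close>
  and of polar forms alike.\<close>

lemma cone_vec_set:
 assumes h: "hyp (cartan \<alpha> v) a b c" and dist: "distinct [a,b,c]" and tr: "tr = {a,b,c}" and nd: "nd \<alpha> (insert d tr)"
  and p: "!!i. i \<in> tr ==> \<alpha> i \<bullet> p = 0" "\<alpha> d \<bullet> p ~= 0"
 obtains z h where "\<forall>f. f \<bullet> q = (\<Sum>i\<in>tr. z i * (f \<bullet> v i)) + h * (f \<bullet> p)"
  "(\<forall>i\<in>tr. \<alpha> i \<bullet> q <= 0) --> (\<forall>i\<in>tr. 0 <= z i)"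
  "(\<forall>i\<in>tr. \<alpha> i \<bullet> q <= 0) & (\<exists>i\<in>tr. \<alpha> i \<bullet> q ~= 0) --> (\<forall>i\<in>tr. 0 < z i)"
proof -
 have nd': "D4 (\<alpha> a) (\<alpha> b) (\<alpha> c) (\<alpha> d) ~= 0" using nd unfolding tr nd_D4[symmetric] by (simp add: insert_commute)
 have p': "\<alpha> a \<bullet> p = 0" "\<alpha> b \<bullet> p = 0" "\<alpha> c \<bullet> p = 0" "\<alpha> d \<bullet> p ~= 0" using p tr by auto
 obtain x y z h where q: "q = x *\<^sub>R v a + y *\<^sub>R v b + z *\<^sub>R v c + h *\<^sub>R p"
  and s: "\<alpha> a \<bullet> q <= 0 ==> \<alpha> b \<bullet> q <= 0 ==> \<alpha> c \<bullet> q <= 0 ==> 0 <= x & 0 <= y & 0 <= z"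
  "\<alpha> a \<bullet> q <= 0 ==> \<alpha> b \<bullet> q <= 0 ==> \<alpha> c \<bullet> q <= 0 ==>
    \<alpha> a \<bullet> q ~= 0 \<or> \<alpha> b \<bullet> q ~= 0 \<or> \<alpha> c \<bullet> q ~= 0 ==> 0 < x & 0 < y & 0 < z"
  by (rule cone_vec[OF h nd' p', of q]) blast
 define w where "w = (\<lambda>i. if i = a then x else if i = b then y else z)"
 have w: "w a = x" "w b = y" "w c = z" using dist unfolding w_def by auto
 show ?thesis
 proof (rule that[of w h], goal_cases)
  case 1 show ?case using dist unfolding q tr by (simp add: inner_add_right w)
 next
  case 2 thus ?case using s(1) unfolding tr by (auto simp: w)
 next
  case 3 thus ?case using s(2) unfolding tr by (auto simp: w)
 qed
qed

lemma cone_form_set: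
 assumes h: "hyp (cartan \<alpha> v) a b c" and dist: "distinct [a,b,c]" and tr: "tr = {a,b,c}" and nd: "nd \<alpha> (insert d tr)"
  and p: "!!i. i \<in> tr ==> \<alpha> i \<bullet> p = 0" "\<alpha> d \<bullet> p ~= 0"
  and pi: "!!i. i \<in> tr ==> \<pi> \<bullet> v i = 0" "\<pi> \<bullet> p > 0"
 obtains z where "\<forall>q. f \<bullet> q = (\<Sum>i\<in>tr. z i * (\<alpha> i \<bullet> q)) + ((f \<bullet> p) / (\<pi> \<bullet> p)) * (\<pi> \<bullet> q)"
  "(\<forall>i\<in>tr. f \<bullet> v i <= 0) --> (\<forall>i\<in>tr. 0 <= z i)"
  "(\<forall>i\<in>tr. f \<bullet> v i <= 0) & (\<exists>i\<in>tr. f \<bullet> v i ~= 0) --> (\<forall>i\<in>tr. 0 < z i)"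
proof -
 have nd': "D4 (\<alpha> a) (\<alpha> b) (\<alpha> c) (\<alpha> d) ~= 0" using nd unfolding tr nd_D4[symmetric] by (simp add: insert_commute)
 have p': "\<alpha> a \<bullet> p = 0" "\<alpha> b \<bullet> p = 0" "\<alpha> c \<bullet> p = 0" "\<alpha> d \<bullet> p ~= 0" using p tr by auto
 have pi': "\<pi> \<bullet> v a = 0" "\<pi> \<bullet> v b = 0" "\<pi> \<bullet> v c = 0" "\<pi> \<bullet> p > 0" using pi tr by auto
 obtain x y z where q: "f = x *\<^sub>R \<alpha> a + y *\<^sub>R \<alpha> b + z *\<^sub>R \<alpha> c + ((f \<bullet> p) / (\<pi> \<bullet> p)) *\<^sub>R \<pi>"
  and s: "f \<bullet> v a <= 0 ==> f \<bullet> v b <= 0 ==> f \<bullet> v c <= 0 ==> 0 <= x & 0 <= y & 0 <= z"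
  "f \<bullet> v a <= 0 ==> f \<bullet> v b <= 0 ==> f \<bullet> v c <= 0 ==>
    f \<bullet> v a ~= 0 \<or> f \<bullet> v b ~= 0 \<or> f \<bullet> v c ~= 0 ==> 0 < x & 0 < y & 0 < z"
  by (rule cone_form[OF h nd' p' pi', of f]) blast
 define w where "w = (\<lambda>i. if i = a then x else if i = b then y else z)"
 have w: "w a = x" "w b = y" "w c = z" using dist unfolding w_def by auto
 show ?thesis
 proof (rule that[of w], goal_cases)
  case 1
  have "f \<bullet> r = x * (\<alpha> a \<bullet> r) + y * (\<alpha> b \<bullet> r) + z * (\<alpha> c \<bullet> r) + ((f \<bullet> p) / (\<pi> \<bullet> p)) * (\<pi> \<bullet> r)" for r
   using arg_cong[OF q, of "\<lambda>u. u \<bullet> r"] by (simp add: inner_add_left)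
  moreover have "(\<Sum>i\<in>tr. w i * (\<alpha> i \<bullet> r)) = x * (\<alpha> a \<bullet> r) + y * (\<alpha> b \<bullet> r) + z * (\<alpha> c \<bullet> r)" for r
   using dist unfolding tr by (simp add: w)
  ultimately show ?case by metis
 next
  case 2 thus ?case using s(1) unfolding tr by (auto simp: w)
 next
  case 3 thus ?case using s(2) unfolding tr by (auto simp: w)
 qed
qed

text \<open>\<open>H\<close> marks the triangles that are going to be truncated.  The condition \<open>Z\<close>, which
  the exceptional prism would violate, is what makes a second truncated triangle harmless.\<close>

locale polar_inv =
 fixes S :: "'s set" and T H \<alpha> v and p :: "'s set => real^4" and \<pi> :: "'s set => real^4"
 assumes n: "s \<in> S ==> t \<in> S ==> s ~= t ==> \<alpha> s \<bullet> v t <= 0"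
  and ndT: "(tr, d) \<in> T ==> nd \<alpha> (insert d tr)"
  and p0: "(\<tau>, d) \<in> T ==> s \<in> \<tau> ==> \<alpha> s \<bullet> p \<tau> = 0"
  and pneg: "(\<tau>, d) \<in> T ==> s \<in> S ==> s \<notin> \<tau> ==> \<alpha> s \<bullet> p \<tau> < 0"
  and pi0: "(tr, d) \<in> T ==> H tr ==> t \<in> tr ==> \<pi> tr \<bullet> v t = 0"
  and pineg: "(tr, d) \<in> T ==> H tr ==> t \<in> S ==> t \<notin> tr ==> \<pi> tr \<bullet> v t < 0"
  and pipos: "(tr, d) \<in> T ==> H tr ==> \<pi> tr \<bullet> p tr > 0"
  and pip: "(tr, d) \<in> T ==> H tr ==> (\<tau>, e) \<in> T ==> \<tau> ~= tr ==> \<pi> tr \<bullet> p \<tau> <= 0"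
  and pips: "(tr, d) \<in> T ==> H tr ==> (\<tau>, e) \<in> T ==> \<tau> ~= tr ==> \<exists>i\<in>tr. \<alpha> d \<bullet> v i ~= 0 ==> \<pi> tr \<bullet> p \<tau> < 0"
  and Z: "(tr, d) \<in> T ==> (\<tau>, e) \<in> T ==> tr ~= \<tau> ==> H tr ==> H \<tau> ==> \<exists>i\<in>tr. \<alpha> d \<bullet> v i ~= 0"

text \<open>The face \<open>k\<close> cuts off the vertex \<open>P\<close>, and the new vertices
  \<open>q x\<close> are the points where \<open>k\<close> meets the three edges leaving
  \<open>P\<close>. Expanding \<open>\<alpha> k\<close> in the forms of \<open>tr\<close> and the
  polar form, and \<open>v k\<close> in the vectors of \<open>tr\<close> and \<open>P\<close>, turns
  the required inequalities into sums of terms of one sign.\<close>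

lemma polar_step:
 assumes s: "stk S T L" and trT: "(tr, d) \<in> T" and kS: "k \<notin> S"
  and inv: "polar_inv S T H \<alpha> v p \<pi>" and Htr: "H tr"
  and hyptr: "!!a b c. tr = {a,b,c} ==> distinct [a,b,c] ==> hyp (cartan \<alpha> v) a b c"
  and hypk: "!!a b c. tr = {a,b,c} ==> distinct [a,b,c] ==> H {a,b,k} ==> hyp (cartan \<alpha> v) a b k"
  and kk: "\<alpha> k \<bullet> v k = 2"
  and kn: "!!i. i \<in> tr ==> \<alpha> k \<bullet> v i <= 0" "!!i. i \<in> tr ==> \<alpha> i \<bullet> v k <= 0" "!!i. i \<in> tr ==> \<alpha> k \<bullet> v i = 0 \<longleftrightarrow> \<alpha> i \<bullet> v k = 0"
  and nonexc: "(\<exists>i\<in>tr. \<alpha> k \<bullet> v i ~= 0) \<or> (\<exists>i\<in>tr. \<alpha> d \<bullet> v i ~= 0)"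
  and ndk: "nd \<alpha> (insert k tr)" and kp: "\<alpha> k \<bullet> p tr > 0"
 shows "\<exists>p' \<pi>'. polar_inv (insert k S) (step_cells T k tr d) H \<alpha> v p' \<pi>'"
proof -
 interpret polar_inv S T H \<alpha> v p \<pi> by (rule inv)
 have tr: "card tr = 3" "tr \<subseteq> S" "d \<in> S" "d \<notin> tr" using stk_cell[OF s trT] by auto
 have fin: "finite tr" using tr(1) by (metis card.infinite zero_neq_numeral)
 have ktr: "k \<notin> tr" using tr kS by auto
 have cell: "card \<tau> = 3" "\<tau> \<subseteq> S" "e \<in> S" "k \<notin> \<tau>" "finite \<tau>" if "(\<tau>, e) \<in> T" for \<tau> e
  using stk_cell[OF s that] kS by (auto intro: card_ge_0_finite)
 have not_sub: "\<exists>i\<in>tr. i \<notin> \<tau>" if "(\<tau>, e) \<in> T" "\<tau> ~= tr" for \<tau> e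
  using cell[OF that(1)] that(2) tr(1) by (metis card_subset_eq subsetI)
 obtain a b c where abc: "tr = {a,b,c}" "distinct [a,b,c]" using tr(1) by (metis card3E card_gt_0_iff ex_in_conv less_numeral_extra(3) zero_less_numeral)
 note hs = hyptr[OF abc]
 define P PP where "P = p tr" and "PP = \<pi> tr"
 have P0: "\<alpha> i \<bullet> P = 0" if "i \<in> tr" for i unfolding P_def by (rule p0[OF trT that])
 have Pneg: "\<alpha> i \<bullet> P < 0" if "i \<in> S" "i \<notin> tr" for i unfolding P_def by (rule pneg[OF trT that])
 have Pd: "\<alpha> d \<bullet> P ~= 0" using Pneg[OF tr(3,4)] by simp
 have PP0: "PP \<bullet> v i = 0" if "i \<in> tr" for i unfolding PP_def by (rule pi0[OF trT Htr that])
 have PPP: "PP \<bullet> P > 0" unfolding PP_def P_def by (rule pipos[OF trT Htr])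
 have kP: "\<alpha> k \<bullet> P > 0" using kp unfolding P_def .
 note nds = ndT[OF trT]
 define \<eta> where "\<eta> = (\<alpha> k \<bullet> P) / (PP \<bullet> P)"
 have \<eta>: "\<eta> > 0" unfolding \<eta>_def using kP PPP by simp
 obtain y where y: "\<forall>q. \<alpha> k \<bullet> q = (\<Sum>i\<in>tr. y i * (\<alpha> i \<bullet> q)) + \<eta> * (PP \<bullet> q)"
  "(\<forall>i\<in>tr. \<alpha> k \<bullet> v i <= 0) --> (\<forall>i\<in>tr. 0 <= y i)"
  "(\<forall>i\<in>tr. \<alpha> k \<bullet> v i <= 0) & (\<exists>i\<in>tr. \<alpha> k \<bullet> v i ~= 0) --> (\<forall>i\<in>tr. 0 < y i)"
  by (rule cone_form_set[OF hs abc(2,1) nds P0 Pd PP0 PPP, of "\<alpha> k", folded \<eta>_def])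
 note ay = y(1)[rule_format]
 have y0: "0 <= y i" if "i \<in> tr" for i using y(2) kn(1) that by blast
 have y1: "0 < y i" if "\<exists>i\<in>tr. \<alpha> k \<bullet> v i ~= 0" "i \<in> tr" for i using y(3) kn(1) that by blast
 obtain z g where z: "\<forall>f. f \<bullet> v k = (\<Sum>i\<in>tr. z i * (f \<bullet> v i)) + g * (f \<bullet> P)"
  "(\<forall>i\<in>tr. \<alpha> i \<bullet> v k <= 0) --> (\<forall>i\<in>tr. 0 <= z i)"
  by (rule cone_vec_set[OF hs abc(2,1) nds P0 Pd, of "v k"])
 note vz = z(1)[rule_format]
 have z0: "0 <= z i" if "i \<in> tr" for i using z(2) kn(2) that by blast
 \<comment> \<open>Evaluate \<open>\<alpha> k\<close> on the expansion of \<open>v k\<close>: the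
   value is \<open>2\<close>, the contribution of \<open>tr\<close> is nonpositive, and
   \<open>\<alpha> k\<close> is positive at \<open>P\<close>.\<close>
 have g: "g > 0"
 proof -
  have "(\<Sum>i\<in>tr. z i * (\<alpha> k \<bullet> v i)) <= 0" by (intro wsum_nonpos z0 kn)
  hence "g * (\<alpha> k \<bullet> P) > 0" using vz[of "\<alpha> k"] kk by linarith
  thus ?thesis using kP by (simp add: zero_less_mult_iff)
 qed
 \<comment> \<open>One strict term is needed, either from the coefficients \<open>y\<close> or from
   the value of \<open>PP\<close>. \<open>nonexc\<close> guarantees that one of the two is
   available.\<close>
 have knew: "\<alpha> k \<bullet> p \<tau> < 0" if \<tau>: "(\<tau>, e) \<in> T" "\<tau> ~= tr" for \<tau> e
 proof -
  have t: "\<alpha> i \<bullet> p \<tau> <= 0" if "i \<in> tr" for i using pneg[OF \<tau>(1), of i] p0[OF \<tau>(1), of i] that tr(2) by (cases "i \<in> \<tau>") auto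
  obtain i where i: "i \<in> tr" "i \<notin> \<tau>" using not_sub[OF \<tau>] by blast
  have ti: "\<alpha> i \<bullet> p \<tau> < 0" using pneg[OF \<tau>(1), of i] i tr(2) by auto
  have P': "PP \<bullet> p \<tau> <= 0" unfolding PP_def by (rule pip[OF trT Htr \<tau>])
  hence e0: "\<eta> * (PP \<bullet> p \<tau>) <= 0" using \<eta> by (simp add: mult_le_0_iff)
  have s0: "(\<Sum>i\<in>tr. y i * (\<alpha> i \<bullet> p \<tau>)) <= 0" by (intro wsum_nonpos y0 t)
  from nonexc show ?thesis
  proof
   assume "\<exists>i\<in>tr. \<alpha> k \<bullet> v i ~= 0"
   hence "(\<Sum>i\<in>tr. y i * (\<alpha> i \<bullet> p \<tau>)) < 0" 
    by (intro wsum_neg[where i = i]) (use fin y1 t i ti in auto)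
   thus ?thesis using ay[of "p \<tau>"] e0 by linarith
  next
   assume "\<exists>i\<in>tr. \<alpha> d \<bullet> v i ~= 0"
   hence "PP \<bullet> p \<tau> < 0" unfolding PP_def by (rule pips[OF trT Htr \<tau>])
   hence "\<eta> * (PP \<bullet> p \<tau>) < 0" using \<eta> by (simp add: mult_less_0_iff)
   thus ?thesis using ay[of "p \<tau>"] s0 by linarith
  qed
 qed
 \<comment> \<open>\<open>r\<close> is the vertex at the other end of the edge that leaves
   \<open>P\<close> along the faces of \<open>tr\<close> other than \<open>x\<close>.\<close>
 have "\<exists>r. (\<forall>i\<in>tr. i ~= x --> \<alpha> i \<bullet> r = 0) & \<alpha> x \<bullet> r < 0 & (\<forall>i\<in>S. \<alpha> i \<bullet> r <= 0) & \<alpha> k \<bullet> r < 0" if x: "x \<in> tr" for x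
 proof -
  have "tr \<in> fst ` T" using trT by force
  then obtain u where u: "u \<notin> tr" "insert u (tr - {x}) \<in> fst ` T" using stk_neighbour[OF s _ x] by metis
  define \<tau> where "\<tau> = insert u (tr - {x})"
  obtain e where \<tau>: "(\<tau>, e) \<in> T" using u(2) unfolding \<tau>_def by auto
  have ne: "\<tau> ~= tr" "x \<notin> \<tau>" using u x unfolding \<tau>_def by auto
  have "\<alpha> i \<bullet> p \<tau> <= 0" if "i \<in> S" for i
   using p0[OF \<tau>, of i] pneg[OF \<tau> that] by (cases "i \<in> \<tau>") auto
  moreover have "\<alpha> i \<bullet> p \<tau> = 0" if "i \<in> tr" "i ~= x" for i using that by (intro p0[OF \<tau>]) (auto simp: \<tau>_def)
  moreover have "\<alpha> x \<bullet> p \<tau> < 0" using pneg[OF \<tau>, of x] x ne(2) tr(2) by blast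
  ultimately show ?thesis using knew[OF \<tau> ne(1)] by blast
 qed
 hence "\<exists>r. \<forall>x\<in>tr. (\<forall>i\<in>tr. i ~= x --> \<alpha> i \<bullet> r x = 0) & \<alpha> x \<bullet> r x < 0 & (\<forall>i\<in>S. \<alpha> i \<bullet> r x <= 0) & \<alpha> k \<bullet> r x < 0"
  by (intro bchoice ballI)
 then obtain r where r: "\<forall>x\<in>tr. (\<forall>i\<in>tr. i ~= x --> \<alpha> i \<bullet> r x = 0) & \<alpha> x \<bullet> r x < 0 & (\<forall>i\<in>S. \<alpha> i \<bullet> r x <= 0) & \<alpha> k \<bullet> r x < 0" ..
 have r0: "\<alpha> i \<bullet> r x = 0" if "x \<in> tr" "i \<in> tr" "i ~= x" for x i using r that by blast
 have rx: "\<alpha> x \<bullet> r x < 0" and rk: "\<alpha> k \<bullet> r x < 0" if "x \<in> tr" for x using r that by blast+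
 have rS: "\<alpha> i \<bullet> r x <= 0" if "x \<in> tr" "i \<in> S" for x i using r that by blast
 \<comment> \<open>The point of the segment from \<open>P\<close> to \<open>r x\<close> at which
   \<open>\<alpha> k\<close> vanishes. Both weights are positive, because \<open>\<alpha> k\<close>
   has opposite signs at the two ends.\<close>
 define q where "q x = (\<alpha> k \<bullet> P) *\<^sub>R r x - (\<alpha> k \<bullet> r x) *\<^sub>R P" for x
 have qe: "f \<bullet> q x = (\<alpha> k \<bullet> P) * (f \<bullet> r x) - (\<alpha> k \<bullet> r x) * (f \<bullet> P)" for f x
  unfolding q_def by (simp add: inner_diff_right)
 have qk: "\<alpha> k \<bullet> q x = 0" for x unfolding qe by simp
 have q0: "\<alpha> i \<bullet> q x = 0" if "x \<in> tr" "i \<in> tr" "i ~= x" for i x unfolding qe using r0[OF that] P0[OF that(2)] by simp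
 have qneg: "\<alpha> i \<bullet> q x < 0" if "x \<in> tr" "i \<in> S" "i \<notin> tr \<or> i = x" for i x
 proof (cases "i = x")
  case True
  thus ?thesis unfolding qe using kP rx[OF that(1)] P0[OF that(1)] by (simp add: mult_pos_neg)
 next
  case False
  hence i: "i \<notin> tr" using that by auto
  have "(\<alpha> k \<bullet> P) * (\<alpha> i \<bullet> r x) <= 0" using kP rS[OF that(1,2)] by (simp add: mult_le_0_iff)
  moreover have "(\<alpha> k \<bullet> r x) * (\<alpha> i \<bullet> P) > 0" using rk[OF that(1)] Pneg[OF that(2) i] by (rule mult_neg_neg)
  ultimately show ?thesis unfolding qe by linarith
 qed
 \<comment> \<open>New vertices lie in the cone of the old vectors and \<open>P\<close>, which makes
   the old polar forms negative on them. \<open>h\<close> is nonnegative because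
   \<open>\<alpha> k\<close> vanishes at \<open>q x\<close> and is nonpositive on the vectors of
   \<open>tr\<close>.\<close>
 have qcone: "\<exists>j h. (\<forall>f. f \<bullet> q x = (\<Sum>i\<in>tr. j i * (f \<bullet> v i)) + h * (f \<bullet> P)) & (\<forall>i\<in>tr. 0 < j i) & 0 <= h" if x: "x \<in> tr" for x
 proof -
  have ne: "\<exists>i\<in>tr. \<alpha> i \<bullet> q x ~= 0" using qneg[OF x, of x] x tr(2) by force
  have le: "\<alpha> i \<bullet> q x <= 0" if "i \<in> tr" for i using qneg[OF x, of i] q0[OF x that] that tr(2) by (cases "i = x") auto
  obtain j h where j': "\<forall>f. f \<bullet> q x = (\<Sum>i\<in>tr. j i * (f \<bullet> v i)) + h * (f \<bullet> P)"
   "(\<forall>i\<in>tr. \<alpha> i \<bullet> q x <= 0) & (\<exists>i\<in>tr. \<alpha> i \<bullet> q x ~= 0) --> (\<forall>i\<in>tr. 0 < j i)"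
   by (rule cone_vec_set[OF hs abc(2,1) nds P0 Pd, of "q x"])
  have j: "f \<bullet> q x = (\<Sum>i\<in>tr. j i * (f \<bullet> v i)) + h * (f \<bullet> P)" "\<forall>i\<in>tr. 0 < j i" for f
   using j' le ne by blast+
  have "(\<Sum>i\<in>tr. j i * (\<alpha> k \<bullet> v i)) <= 0" using j(2) kn by (intro wsum_nonpos) (auto intro: less_imp_le)
  hence "0 <= h * (\<alpha> k \<bullet> P)" using j(1)[of "\<alpha> k"] qk by simp
  hence "0 <= h" using kP by (simp add: zero_le_mult_iff)
  thus ?thesis using j by blast
 qed
 have hyp_c: "\<exists>i\<in>insert k (tr - {x}). \<alpha> x \<bullet> v i ~= 0" if x: "x \<in> tr" for x
 proof -
  obtain y z where yz: "tr = {x,y,z}" "distinct [x,y,z]" using card3E[OF tr(1) x] .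
  have "\<alpha> x \<bullet> v y ~= 0 \<or> \<alpha> x \<bullet> v z ~= 0"
   using hyp_connected[OF hyptr[OF yz]] by blast
  thus ?thesis using yz by auto
 qed
 have "\<exists>\<pi>'. H (insert k (tr - {x})) --> polar_form \<alpha> v (insert k (tr - {x})) x \<pi>' &
   (\<forall>q. (\<forall>i\<in>tr. \<alpha> i \<bullet> q <= 0) & PP \<bullet> q <= 0 & ((\<exists>i\<in>tr. \<alpha> i \<bullet> q < 0) \<or> PP \<bullet> q < 0) --> \<pi>' \<bullet> q < 0)"
  if x: "x \<in> tr" for x
 proof (cases "H (insert k (tr - {x}))")
  case H: True
  obtain y z where yz: "tr = {x,y,z}" "distinct [x,y,z]" using card3E[OF tr(1) x] .
  hence yz': "tr = {y,z,x}" "distinct [y,z,x]" by auto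
  have e: "insert k (tr - {x}) = {y,z,k}" using yz by auto
  have d4: "D4 (\<alpha> y) (\<alpha> z) (\<alpha> x) (\<alpha> d) ~= 0" using nds unfolding yz'(1) nd_D4[symmetric] by (simp add: insert_commute)
  have hy: "hyp (cartan \<alpha> v) y z k" using hypk[OF yz'] H unfolding e .
  have m: "y \<in> tr" "z \<in> tr" "x \<in> tr" using yz by auto
  obtain \<pi>' where pf: "polar_form \<alpha> v {y,z,k} x \<pi>'"
   and pn: "\<forall>q. \<alpha> y \<bullet> q <= 0 & \<alpha> z \<bullet> q <= 0 & \<alpha> x \<bullet> q <= 0 & PP \<bullet> q <= 0 &
    (\<alpha> y \<bullet> q < 0 \<or> \<alpha> z \<bullet> q < 0 \<or> \<alpha> x \<bullet> q < 0 \<or> PP \<bullet> q < 0) --> \<pi>' \<bullet> q < 0"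
   by (rule polar_form_new[OF hyptr[OF yz'] d4 P0[OF m(1)] P0[OF m(2)] P0[OF m(3)] Pneg[OF tr(3,4)]
      PP0[OF m(1)] PP0[OF m(2)] PP0[OF m(3)] PPP kn(1)[OF m(1)] kn(1)[OF m(2)] kn(1)[OF m(3)]
      kn(2)[OF m(1)] kn(2)[OF m(2)] kn(2)[OF m(3)] kk kP hy])
  have "\<pi>' \<bullet> q < 0" if "\<forall>i\<in>tr. \<alpha> i \<bullet> q <= 0" "PP \<bullet> q <= 0" "(\<exists>i\<in>tr. \<alpha> i \<bullet> q < 0) \<or> PP \<bullet> q < 0" for q
   using pn that unfolding yz'(1) by blast
  thus ?thesis unfolding e using pf by blast
 qed simp
 hence "\<exists>\<pi>n. \<forall>x\<in>tr. H (insert k (tr - {x})) --> polar_form \<alpha> v (insert k (tr - {x})) x (\<pi>n x) &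
   (\<forall>q. (\<forall>i\<in>tr. \<alpha> i \<bullet> q <= 0) & PP \<bullet> q <= 0 & ((\<exists>i\<in>tr. \<alpha> i \<bullet> q < 0) \<or> PP \<bullet> q < 0) --> \<pi>n x \<bullet> q < 0)"
  by (intro bchoice ballI)
 then obtain \<pi>n where \<pi>n: "\<forall>x\<in>tr. H (insert k (tr - {x})) --> polar_form \<alpha> v (insert k (tr - {x})) x (\<pi>n x) &
   (\<forall>q. (\<forall>i\<in>tr. \<alpha> i \<bullet> q <= 0) & PP \<bullet> q <= 0 & ((\<exists>i\<in>tr. \<alpha> i \<bullet> q < 0) \<or> PP \<bullet> q < 0) --> \<pi>n x \<bullet> q < 0)" ..
 have pf: "polar_form \<alpha> v (insert k (tr - {x})) x (\<pi>n x)" if "x \<in> tr" "H (insert k (tr - {x}))" for x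
  using \<pi>n that by blast
 have pn: "\<pi>n x \<bullet> q < 0" if "x \<in> tr" "H (insert k (tr - {x}))" "!!i. i \<in> tr ==> \<alpha> i \<bullet> q <= 0" "PP \<bullet> q <= 0"
  "(\<exists>i\<in>tr. \<alpha> i \<bullet> q < 0) \<or> PP \<bullet> q < 0" for x q
  using \<pi>n that by blast
 \<comment> \<open>The new triangles are those containing \<open>k\<close>. Each of them omits
   exactly one element of \<open>tr\<close>, which the description recovers.\<close>
 define p' where "p' \<tau> = (if k \<in> \<tau> then q (THE x. x \<in> tr & x \<notin> \<tau>) else p \<tau>)" for \<tau>
 define \<pi>' where "\<pi>' \<tau> = (if k \<in> \<tau> then \<pi>n (THE x. x \<in> tr & x \<notin> \<tau>) else \<pi> \<tau>)" for \<tau>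
 have the: "(THE y. y \<in> tr & y \<notin> insert k (tr - {x})) = x" if "x \<in> tr" for x
  using that ktr by (intro the_equality) auto
 have p'new: "p' (insert k (tr - {x})) = q x" "\<pi>' (insert k (tr - {x})) = \<pi>n x" if "x \<in> tr" for x
  unfolding p'_def \<pi>'_def the[OF that] by simp_all
 have p'old: "p' \<tau> = p \<tau>" "\<pi>' \<tau> = \<pi> \<tau>" if "(\<tau>, e) \<in> T" for \<tau> e
  unfolding p'_def \<pi>'_def using cell(4)[OF that] by simp_all
 have cases_T: "((\<tau>, e) \<in> T & \<tau> ~= tr) \<or> (e \<in> tr & \<tau> = insert k (tr - {e}))" if "(\<tau>, e) \<in> step_cells T k tr d" for \<tau> e
  using that stk_apex[OF s _ trT, of e] unfolding step_cells_def by auto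
 \<comment> \<open>After the step all polar values at foreign vertices are strict: an old marked
   triangle has a nonorthogonal apex by \<open>Z\<close>, applied together with \<open>tr\<close>,
   and a new one by \<open>hyp_c\<close>. The four cases pair an old or new triangle with an old or
   new vertex.\<close>
 have strict: "\<pi>' \<tau>1 \<bullet> p' \<tau>2 < 0"
  if T1: "(\<tau>1, e1) \<in> step_cells T k tr d" and H1: "H \<tau>1" and T2: "(\<tau>2, e2) \<in> step_cells T k tr d" and ne: "\<tau>2 ~= \<tau>1"
  for \<tau>1 e1 \<tau>2 e2
 proof -
  have letr: "\<alpha> i \<bullet> p \<tau> <= 0" if "(\<tau>, e) \<in> T" "i \<in> tr" for i \<tau> e
   using pneg[OF that(1), of i] p0[OF that(1), of i] that tr(2) by (cases "i \<in> \<tau>") auto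
  from cases_T[OF T1] show ?thesis
  proof
   assume o: "(\<tau>1, e1) \<in> T & \<tau>1 ~= tr"
   have z: "\<exists>i\<in>\<tau>1. \<alpha> e1 \<bullet> v i ~= 0" using Z[of \<tau>1 e1 tr d] o H1 trT Htr by auto
   from cases_T[OF T2] show ?thesis
   proof
    assume o2: "(\<tau>2, e2) \<in> T & \<tau>2 ~= tr"
    have "\<pi> \<tau>1 \<bullet> p \<tau>2 < 0" using pips[of \<tau>1 e1 \<tau>2 e2] o o2 H1 ne z by blast
    thus ?thesis using p'old[of \<tau>1 e1] p'old[of \<tau>2 e2] o o2 by simp
   next
    assume n2: "e2 \<in> tr & \<tau>2 = insert k (tr - {e2})"
    obtain j h where j: "!!f. f \<bullet> q e2 = (\<Sum>i\<in>tr. j i * (f \<bullet> v i)) + h * (f \<bullet> P)" "!!i. i \<in> tr ==> 0 < j i" "0 <= h"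
     using qcone[of e2] n2 by blast
    have "\<pi> \<tau>1 \<bullet> P <= 0" unfolding P_def using pip[of \<tau>1 e1 tr d] o H1 trT by blast
    hence "h * (\<pi> \<tau>1 \<bullet> P) <= 0" using j(3) by (simp add: mult_le_0_iff)
    moreover have le: "\<pi> \<tau>1 \<bullet> v i <= 0" if "i \<in> tr" for i
     using pi0[of \<tau>1 e1 i] pineg[of \<tau>1 e1 i] o H1 that tr(2) by (cases "i \<in> \<tau>1") auto
    obtain i where i: "i \<in> tr" "i \<notin> \<tau>1" using not_sub o by blast
    have "\<pi> \<tau>1 \<bullet> v i < 0" using pineg[of \<tau>1 e1 i] i o H1 tr(2) by blast
    hence "(\<Sum>i\<in>tr. j i * (\<pi> \<tau>1 \<bullet> v i)) < 0" by (intro wsum_neg[where i = i]) (use fin j(2) le i(1) in auto)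
    ultimately have "\<pi> \<tau>1 \<bullet> q e2 < 0" using j(1)[of "\<pi> \<tau>1"] by linarith
    thus ?thesis using p'old[of \<tau>1 e1] o p'new[of e2] n2 by simp
   qed
  next
   assume n1: "e1 \<in> tr & \<tau>1 = insert k (tr - {e1})"
   hence e1: "e1 \<in> tr" and He: "H (insert k (tr - {e1}))" using H1 by auto
   from cases_T[OF T2] show ?thesis
   proof
    assume o2: "(\<tau>2, e2) \<in> T & \<tau>2 ~= tr"
    hence T2': "(\<tau>2, e2) \<in> T" "\<tau>2 ~= tr" by auto
    obtain i where i: "i \<in> tr" "i \<notin> \<tau>2" using not_sub[OF T2'] by blast
    have "\<alpha> i \<bullet> p \<tau>2 < 0" using pneg[OF T2'(1), of i] i tr(2) by blast
    moreover have "PP \<bullet> p \<tau>2 <= 0" unfolding PP_def by (rule pip[OF trT Htr T2'])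
    ultimately have "\<pi>n e1 \<bullet> p \<tau>2 < 0" using pn[OF e1 He letr[OF T2'(1)]] i by blast
    thus ?thesis using p'new(2)[OF e1] n1 p'old(1)[OF T2'(1)] by simp
   next
    assume n2: "e2 \<in> tr & \<tau>2 = insert k (tr - {e2})"
    hence e2: "e2 \<in> tr" "e2 ~= e1" using n1 ne by auto
    have neg: "\<alpha> e2 \<bullet> q e2 < 0" using qneg[of e2 e2] e2 tr(2) by auto
    have "\<forall>i\<in>insert k (tr - {e1}). \<alpha> i \<bullet> q e2 <= 0" using qk[of e2] q0[OF e2(1)] neg by (metis DiffE insertE less_imp_le order_refl)
    moreover have "\<alpha> e1 \<bullet> q e2 = 0" using q0[OF e2(1) e1] e2 by simp
    moreover have "\<exists>i\<in>insert k (tr - {e1}). \<alpha> i \<bullet> q e2 < 0" using neg e2 by blast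
    ultimately have "\<pi>n e1 \<bullet> q e2 < 0" using pf[OF e1 He] hyp_c[OF e1] unfolding polar_form_def by blast
    thus ?thesis using p'new(2)[OF e1] n1 p'new(1)[OF e2(1)] n2 by simp
   qed
  qed
 qed
 have "polar_inv (insert k S) (step_cells T k tr d) H \<alpha> v p' \<pi>'"
 proof (unfold_locales, goal_cases)
  case (1 i j)
  have A: "\<alpha> k \<bullet> v t <= 0" if "t \<in> S" for t
  proof (cases "t \<in> tr")
   case True thus ?thesis by (rule kn)
  next
   case False
   have "PP \<bullet> v t < 0" unfolding PP_def by (rule pineg[OF trT Htr that False])
   hence "\<eta> * (PP \<bullet> v t) < 0" using \<eta> by (simp add: mult_less_0_iff)
   moreover have "(\<Sum>i\<in>tr. y i * (\<alpha> i \<bullet> v t)) <= 0" using n[OF _ that] False tr(2) by (intro wsum_nonpos y0) auto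
   ultimately show ?thesis using ay[of "v t"] by linarith
  qed
  have B: "\<alpha> t \<bullet> v k <= 0" if "t \<in> S" for t
  proof (cases "t \<in> tr")
   case True thus ?thesis by (rule kn)
  next
   case False
   have "g * (\<alpha> t \<bullet> P) < 0" using g Pneg[OF that False] by (simp add: mult_less_0_iff)
   moreover have "(\<Sum>i\<in>tr. z i * (\<alpha> t \<bullet> v i)) <= 0" using n[OF that] False tr(2) by (intro wsum_nonpos z0) auto
   ultimately show ?thesis using vz[of "\<alpha> t"] by linarith
  qed
  show ?case using 1 A B n by auto
 next
  case (2 \<tau> e)
  from cases_T[OF 2] show ?case
  proof
   assume "(\<tau>, e) \<in> T & \<tau> ~= tr" thus ?thesis using ndT by blast
  next
   assume "e \<in> tr & \<tau> = insert k (tr - {e})"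
   hence "insert e \<tau> = insert k tr" by blast
   thus ?thesis using ndk by simp
  qed
 next
  case (3 \<tau> e i)
  from cases_T[OF 3(1)] show ?case
  proof
   assume "(\<tau>, e) \<in> T & \<tau> ~= tr" thus ?thesis using p0[of \<tau> e i] p'old(1)[of \<tau> e] 3(2) by simp
  next
   assume t: "e \<in> tr & \<tau> = insert k (tr - {e})"
   show ?thesis
   proof (cases "i = k")
    case True thus ?thesis using t qk p'new(1)[of e] by simp
   next
    case False
    hence "i \<in> tr" "i ~= e" using t 3(2) by auto
    thus ?thesis using t q0[of e i] p'new(1)[of e] by simp
   qed
  qed
 next
  case (4 \<tau> e i)
  from cases_T[OF 4(1)] show ?case
  proof
   assume t: "(\<tau>, e) \<in> T & \<tau> ~= tr"
   thus ?thesis using 4 pneg[of \<tau> e i] knew[of \<tau> e] p'old(1)[of \<tau> e] by auto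
  next
   assume t: "e \<in> tr & \<tau> = insert k (tr - {e})"
   thus ?thesis using 4 qneg[of e i] p'new(1)[of e] by auto
  qed
 next
  case (5 \<tau> e i)
  from cases_T[OF 5(1)] show ?case
  proof
   assume t: "(\<tau>, e) \<in> T & \<tau> ~= tr"
   thus ?thesis using 5 pi0[of \<tau> e i] p'old(2)[of \<tau> e] by auto
  next
   assume t: "e \<in> tr & \<tau> = insert k (tr - {e})"
   thus ?thesis using 5 pf[of e] p'new(2)[of e] unfolding polar_form_def by metis
  qed
 next
  case (6 \<tau> e t)
  from cases_T[OF 6(1)] show ?case
  proof
   assume o: "(\<tau>, e) \<in> T & \<tau> ~= tr"
   show ?thesis
   proof (cases "t = k")
    case False thus ?thesis using 6 o pineg[of \<tau> e t] p'old(2)[of \<tau> e] by auto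
   next
    case True
    have "\<pi> \<tau> \<bullet> P < 0" unfolding P_def
     by (rule pips[of \<tau> e tr d]) (use o 6 trT Htr Z[of \<tau> e tr d] in auto)
    hence "g * (\<pi> \<tau> \<bullet> P) < 0" using g by (simp add: mult_less_0_iff)
    moreover have "(\<Sum>i\<in>tr. z i * (\<pi> \<tau> \<bullet> v i)) <= 0"
    proof (intro wsum_nonpos z0)
     fix i assume "i \<in> tr" thus "\<pi> \<tau> \<bullet> v i <= 0" using pi0[of \<tau> e i] pineg[of \<tau> e i] o 6 tr(2) by (cases "i \<in> \<tau>") auto
    qed
    ultimately have "\<pi> \<tau> \<bullet> v k < 0" using vz[of "\<pi> \<tau>"] by linarith
    thus ?thesis using True p'old(2)[of \<tau> e] o by simp
   qed
  next
   assume o: "e \<in> tr & \<tau> = insert k (tr - {e})"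
   show ?thesis
   proof (cases "t = e")
    case True
    thus ?thesis using 6 o pf[of e] p'new(2)[of e] unfolding polar_form_def by metis
   next
    case False
    hence t: "t \<in> S" "t \<notin> tr" using 6 o by auto
    have "\<pi>n e \<bullet> v t < 0"
    proof (rule pn)
     show "e \<in> tr" "H (insert k (tr - {e}))" using o 6 by auto
     show "\<alpha> i \<bullet> v t <= 0" if "i \<in> tr" for i using n[of i t] that t tr(2) by auto
     show "PP \<bullet> v t <= 0" "(\<exists>i\<in>tr. \<alpha> i \<bullet> v t < 0) \<or> PP \<bullet> v t < 0" using pineg[OF trT Htr t] unfolding PP_def by auto
    qed
    thus ?thesis using o p'new(2)[of e] by simp
   qed
  qed
 next
  case (7 \<tau> e)
  from cases_T[OF 7(1)] show ?case
  proof
   assume t: "(\<tau>, e) \<in> T & \<tau> ~= tr"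
   thus ?thesis using 7 pipos[of \<tau> e] p'old[of \<tau> e] by auto
  next
   assume t: "e \<in> tr & \<tau> = insert k (tr - {e})"
   have "\<forall>i\<in>insert k (tr - {e}). \<alpha> i \<bullet> q e = 0" using t qk q0 by auto
   hence "\<pi>n e \<bullet> q e = - (\<alpha> e \<bullet> q e)" using pf[of e] t 7 unfolding polar_form_def by blast
   thus ?thesis using t p'new[of e] qneg[of e e] tr(2) by auto
  qed
 next
  case (8 \<tau>1 e1 \<tau>2 e2)
  thus ?case using strict by (simp add: less_imp_le)
 next
  case (9 \<tau>1 e1 \<tau>2 e2)
  thus ?case using strict by simp
 next
  case (10 \<tau>1 e1 \<tau>2 e2)
  from cases_T[OF 10(1)] show ?case
  proof
   assume o: "(\<tau>1, e1) \<in> T & \<tau>1 ~= tr"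
   thus ?thesis using Z[of \<tau>1 e1 tr d] trT Htr 10 by auto
  next
   assume o: "e1 \<in> tr & \<tau>1 = insert k (tr - {e1})"
   thus ?thesis using hyp_c[of e1] by auto
  qed
 qed
 thus ?thesis by blast
qed

lemma card4E:
 assumes "card S = 4" "x \<in> S" obtains a b c where "S = {a,b,c,x}" "distinct [a,b,c,x]" "S - {x} = {a,b,c}"
proof -
 have "card (S - {x}) = 3" using assms by (simp add: card_Diff_singleton)
 from this[unfolded card3_iff_distinct] obtain a b c where abc: "S - {x} = {a,b,c}" "distinct [a,b,c]" by blast
 have "x \<notin> {a,b,c}" using abc(1) by (metis Diff_iff insertI1)
 moreover have "S = {a,b,c,x}" using assms(2) abc(1) by (metis insert_Diff insert_commute)
 ultimately show ?thesis using that[of a b c] abc by auto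
qed

text \<open>In a single tetrahedron the vertices form a dual system of the forms. Polar forms exist
  over hyperbolic triangles, so they are chosen only where \<open>H\<close> holds.\<close>

lemma polar_base:
 assumes S: "card S = 4" and nd: "nd \<alpha> S"
  and sgn: "!!s t. s \<in> S ==> t \<in> S ==> s ~= t ==> \<alpha> s \<bullet> v t <= 0"
  and diag: "!!s. s \<in> S ==> \<alpha> s \<bullet> v s = 2"
  and hypH: "!!a b c. {a,b,c} \<subseteq> S ==> H {a,b,c} ==> distinct [a,b,c] ==> hyp (cartan \<alpha> v) a b c"
 shows "\<exists>p \<pi>. polar_inv S ((\<lambda>x. (S - {x}, x)) ` S) H \<alpha> v p \<pi>"
proof -
 have "\<exists>p. (\<forall>i\<in>S - {x}. \<alpha> i \<bullet> p = 0) & \<alpha> x \<bullet> p < 0" if x: "x \<in> S" for x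
 proof -
  obtain a b c where abc: "S = {a,b,c,x}" "distinct [a,b,c,x]" "S - {x} = {a,b,c}" using card4E[OF S x] .
  have "D4 (\<alpha> a) (\<alpha> b) (\<alpha> c) (\<alpha> x) ~= 0" using nd unfolding abc(1) nd_D4 .
  then obtain p where "\<alpha> a \<bullet> p = 0 & \<alpha> b \<bullet> p = 0 & \<alpha> c \<bullet> p = 0 & \<alpha> x \<bullet> p = -1" using D4_surj by blast
  thus ?thesis unfolding abc(3) by (intro exI[of _ p]) auto
 qed
 hence "\<exists>P. \<forall>x\<in>S. (\<forall>i\<in>S - {x}. \<alpha> i \<bullet> P x = 0) & \<alpha> x \<bullet> P x < 0" by (intro bchoice ballI)
 then obtain P where P: "\<forall>x\<in>S. (\<forall>i\<in>S - {x}. \<alpha> i \<bullet> P x = 0) & \<alpha> x \<bullet> P x < 0" ..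
 have "\<exists>\<pi>. H (S - {x}) --> polar_form \<alpha> v (S - {x}) x \<pi>" if x: "x \<in> S" for x
 proof (cases "H (S - {x})")
  case True
  obtain a b c where abc: "S = {a,b,c,x}" "distinct [a,b,c,x]" "S - {x} = {a,b,c}" using card4E[OF S x] .
  have h: "hyp (cartan \<alpha> v) a b c" using hypH[of a b c] True abc by auto
  have m: "a \<in> S" "b \<in> S" "c \<in> S" "x \<in> S" "a ~= x" "b ~= x" "c ~= x" using abc by auto
  show ?thesis unfolding abc(3)
   by (rule polar_form_exists[OF h sgn[OF m(4,1) m(5)[symmetric]] sgn[OF m(4,2) m(6)[symmetric]] sgn[OF m(4,3) m(7)[symmetric]]
     sgn[OF m(1,4,5)] sgn[OF m(2,4,6)] sgn[OF m(3,4,7)] diag[OF m(4)]]) blast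
 qed simp
 hence "\<exists>\<pi>. \<forall>x\<in>S. H (S - {x}) --> polar_form \<alpha> v (S - {x}) x (\<pi> x)" by (intro bchoice ballI)
 then obtain \<pi> where \<pi>: "\<forall>x\<in>S. H (S - {x}) --> polar_form \<alpha> v (S - {x}) x (\<pi> x)" ..
 define p' where "p' \<tau> = P (THE x. x \<in> S & x \<notin> \<tau>)" for \<tau>
 define \<pi>' where "\<pi>' \<tau> = \<pi> (THE x. x \<in> S & x \<notin> \<tau>)" for \<tau>
 have the: "(THE y. y \<in> S & y \<notin> S - {x}) = x" if "x \<in> S" for x
  using that by (intro the_equality) auto
 have new: "p' (S - {x}) = P x" "\<pi>' (S - {x}) = \<pi> x" if "x \<in> S" for x
  unfolding p'_def \<pi>'_def the[OF that] by simp_all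
 \<comment> \<open>This yields \<open>Z\<close>: a second marked triangle contains \<open>x\<close>,
   and in a hyperbolic triple no element is orthogonal to both others.\<close>
 have other: "\<exists>i\<in>S - {x}. \<alpha> x \<bullet> v i ~= 0" if "H \<tau>" "\<tau> ~= S - {x}" "x \<in> S" "\<tau> = S - {y}" "y \<in> S" for x y \<tau>
 proof -
  have xy: "x \<in> \<tau>" using that by auto
  have "card \<tau> = 3" using that S by (simp add: card_Diff_singleton)
  from card3E[OF this xy] obtain u w where u: "\<tau> = {x,u,w}" "distinct [x,u,w]" .
  have "{x,u,w} \<subseteq> S" using u(1) that(4) by blast
  hence "hyp (cartan \<alpha> v) x u w" using hypH[of x u w] that(1) u by simp
  from hyp_connected[OF this] have "\<alpha> x \<bullet> v u ~= 0 \<or> \<alpha> x \<bullet> v w ~= 0" by blast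
  moreover have "u \<in> S - {x}" "w \<in> S - {x}" using \<open>{x,u,w} \<subseteq> S\<close> u(2) by auto
  ultimately show ?thesis by blast
 qed
 have polar_neg: "\<pi> x \<bullet> P y <= 0 & ((\<exists>i\<in>S - {x}. \<alpha> x \<bullet> v i ~= 0) --> \<pi> x \<bullet> P y < 0)"
  if "x \<in> S" "y \<in> S" "x ~= y" "H (S - {x})" for x y
 proof -
  have z: "\<forall>i\<in>S. i ~= y --> \<alpha> i \<bullet> P y = 0" "\<alpha> y \<bullet> P y < 0" using P that(2) by auto
  hence "\<forall>i\<in>S - {x}. \<alpha> i \<bullet> P y <= 0" "\<alpha> x \<bullet> P y = 0" "\<exists>i\<in>S - {x}. \<alpha> i \<bullet> P y < 0" using that
   by (auto simp: less_imp_le)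
  moreover have "polar_form \<alpha> v (S - {x}) x (\<pi> x)" using \<pi> that by blast
  ultimately show ?thesis unfolding polar_form_def by blast
 qed
 have "polar_inv S ((\<lambda>x. (S - {x}, x)) ` S) H \<alpha> v p' \<pi>'"
 proof (unfold_locales, goal_cases)
  case (1 s t) thus ?case by (rule sgn)
 next
  case (2 tr d)
  hence "insert d tr = S" by auto
  thus ?case using nd by simp
 next
  case (3 \<tau> d s) thus ?case using P new by auto
 next
  case (4 \<tau> d s) thus ?case using P new by auto
 next
  case (5 tr d t)
  hence "tr = S - {d}" "d \<in> S" by auto
  thus ?case using 5 \<pi> new(2)[of d] unfolding polar_form_def by metis
 next
  case (6 tr d t)
  hence d: "tr = S - {d}" "d \<in> S" by auto
  hence "t = d" using 6 by auto
  thus ?case using 6 d \<pi> new(2)[of d] unfolding polar_form_def by metis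
 next
  case (7 tr d)
  hence d: "tr = S - {d}" "d \<in> S" by auto
  have "polar_form \<alpha> v (S - {d}) d (\<pi> d)" using 7 d \<pi> by blast
  hence "\<pi> d \<bullet> P d = - (\<alpha> d \<bullet> P d)" using P d unfolding polar_form_def by blast
  thus ?case using d new[of d] P by auto
 next
  case (8 tr d \<tau> e)
  hence d: "tr = S - {d}" "d \<in> S" "\<tau> = S - {e}" "e \<in> S" "d ~= e" by auto
  thus ?case using 8 polar_neg[of d e] new by simp
 next
  case (9 tr d \<tau> e)
  hence d: "tr = S - {d}" "d \<in> S" "\<tau> = S - {e}" "e \<in> S" "d ~= e" by auto
  thus ?case using 9 polar_neg[of d e] new by simp
 next
  case (10 tr d \<tau> e)
  hence d: "tr = S - {d}" "d \<in> S" "\<tau> = S - {e}" "e \<in> S" by auto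
  thus ?case using 10 other[of \<tau> d e] by auto
 qed
 thus ?thesis by blast
qed

text \<open>On the common kernel of \<open>tr\<close> the form \<open>\<alpha> k\<close> is a
  negative multiple of \<open>\<alpha> d\<close>, so the plane of \<open>k\<close> cuts off the
  vertex of \<open>tr\<close>. Over a hyperbolic triangle the coefficients \<open>c\<close> are
  determined by \<open>e\<close> and Cartan entries.\<close>

definition beyond :: "('s => real^4) => 's => 's set => 's => bool" where
 "beyond \<alpha> k tr d \<longleftrightarrow> (\<exists>c e. 0 < e & \<alpha> k = (\<Sum>i\<in>tr. c i *\<^sub>R \<alpha> i) - e *\<^sub>R \<alpha> d)"

lemma beyond_nd:
 assumes "beyond \<alpha> k tr d" "nd \<alpha> (insert d tr)"
 shows "nd \<alpha> (insert k tr)"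
 unfolding nd_def
proof (intro allI impI)
 fix x assume x: "\<forall>s\<in>insert k tr. \<alpha> s \<bullet> x = 0"
 obtain c e where e: "0 < e" "\<alpha> k = (\<Sum>i\<in>tr. c i *\<^sub>R \<alpha> i) - e *\<^sub>R \<alpha> d" using assms(1) unfolding beyond_def by blast
 have "\<alpha> k \<bullet> x = (\<Sum>i\<in>tr. c i * (\<alpha> i \<bullet> x)) - e * (\<alpha> d \<bullet> x)"
  unfolding e(2) by (simp add: inner_diff_left inner_sum_left)
 hence "\<alpha> d \<bullet> x = 0" using x e(1) by simp
 thus "x = 0" using assms(2) x unfolding nd_def by blast
qed

lemma beyond_pos:
 assumes "beyond \<alpha> k tr d" "!!i. i \<in> tr ==> \<alpha> i \<bullet> p = 0" "\<alpha> d \<bullet> p < 0"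
 shows "\<alpha> k \<bullet> p > 0"
proof -
 obtain c e where e: "0 < e" "\<alpha> k = (\<Sum>i\<in>tr. c i *\<^sub>R \<alpha> i) - e *\<^sub>R \<alpha> d" using assms(1) unfolding beyond_def by blast
 have "\<alpha> k \<bullet> p = (\<Sum>i\<in>tr. c i * (\<alpha> i \<bullet> p)) - e * (\<alpha> d \<bullet> p)"
  unfolding e(2) by (simp add: inner_diff_left inner_sum_left)
 thus ?thesis using assms(2,3) e(1) by (simp add: mult_less_0_iff)
qed

lemma stk_Nil: "stk S T [] ==> card S = 4 & T = (\<lambda>x. (S - {x}, x)) ` S"
 by (erule stk.cases) auto

lemma stk_Nil_cell: "stk S T [] ==> (tr, d) \<in> T ==> insert d tr = S"
 using stk_Nil[of S T] by auto

text \<open>All hypotheses refer to the final stack; \<open>adj_step\<close> carries them back to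
  the earlier stages. \<open>H\<close> is meant to hold for every triangle truncated at some stage,
  so that its polar form is already at hand when the truncation comes.\<close>

theorem polar_inv_exists:
 assumes "stk S T L"
  and "!!s t. adj T s t ==> \<alpha> s \<bullet> v t <= 0 & (\<alpha> s \<bullet> v t = 0 \<longleftrightarrow> \<alpha> t \<bullet> v s = 0)"
  and "!!s. s \<in> S ==> \<alpha> s \<bullet> v s = 2"
  and "!!a b c. H {a,b,c} ==> adj T a b ==> adj T a c ==> adj T b c ==> hyp (cartan \<alpha> v) a b c"
  and "!!k tr d. (k, tr, d) \<in> set L ==> H tr & nd \<alpha> (insert d tr) & beyond \<alpha> k tr d &
    ((\<exists>i\<in>tr. \<alpha> k \<bullet> v i ~= 0) \<or> (\<exists>i\<in>tr. \<alpha> d \<bullet> v i ~= 0))"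
  and "L = [] ==> nd \<alpha> S"
 shows "\<exists>p \<pi>. polar_inv S T H \<alpha> v p \<pi>"
 using assms
proof (induction rule: stk.induct)
 case (base S)
 have adj: "adj ((\<lambda>x. (S - {x}, x)) ` S) s t" if "s \<in> S" "t \<in> S" "s ~= t" for s t
  using adj_tetra[OF stk.base[OF base(1)], of "S - {s}" s s t] that by auto
 show ?case
 proof (rule polar_base[OF base(1)])
  show "nd \<alpha> S" using base.prems by simp
  show "\<alpha> s \<bullet> v t <= 0" if "s \<in> S" "t \<in> S" "s ~= t" for s t using base.prems(1)[OF adj[OF that]] by simp
  show "\<alpha> s \<bullet> v s = 2" if "s \<in> S" for s using base.prems(2)[OF that] .
  show "hyp (cartan \<alpha> v) a b c" if "{a,b,c} \<subseteq> S" "H {a,b,c}" "distinct [a,b,c]" for a b c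
   using base.prems(3)[OF that(2)] adj that by auto
 qed
next
 case (step S T L tr d k)
 let ?T = "step_cells T k tr d"
 note adjS = adj_step[OF step.hyps(1,2)]
 have last: "H tr" "nd \<alpha> (insert d tr)" "beyond \<alpha> k tr d" "(\<exists>i\<in>tr. \<alpha> k \<bullet> v i ~= 0) \<or> (\<exists>i\<in>tr. \<alpha> d \<bullet> v i ~= 0)"
  using step.prems(4)[of k tr d] by auto
 have tr: "card tr = 3" "tr \<subseteq> S" "d \<in> S" "d \<notin> tr" using stk_cell[OF step.hyps(1,2)] by auto
 have ktr: "k \<notin> tr" using tr step.hyps by auto
 have "\<exists>p \<pi>. polar_inv S T H \<alpha> v p \<pi>"
 proof (rule step.IH)
  show "\<alpha> s \<bullet> v t <= 0 & (\<alpha> s \<bullet> v t = 0 \<longleftrightarrow> \<alpha> t \<bullet> v s = 0)" if "adj T s t" for s t using step.prems(1)[OF adjS[OF that]] .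
  show "\<alpha> s \<bullet> v s = 2" if "s \<in> S" for s using step.prems(2) that by auto
  show "hyp (cartan \<alpha> v) a b c" if "H {a,b,c}" "adj T a b" "adj T a c" "adj T b c" for a b c
   using step.prems(3)[OF that(1) adjS[OF that(2)] adjS[OF that(3)] adjS[OF that(4)]] .
  show "H tr & nd \<alpha> (insert d tr) & beyond \<alpha> k tr d & ((\<exists>i\<in>tr. \<alpha> k \<bullet> v i ~= 0) \<or> (\<exists>i\<in>tr. \<alpha> d \<bullet> v i ~= 0))"
   if "(k, tr, d) \<in> set L" for k tr d using step.prems(4) that by auto
  show "nd \<alpha> S" if "L = []" using stk_Nil_cell[of S T tr d] step.hyps that last(2) by auto
 qed
 then obtain p \<pi> where inv: "polar_inv S T H \<alpha> v p \<pi>" by blast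
 interpret polar_inv S T H \<alpha> v p \<pi> by (rule inv)
 have adjk: "adj ?T k i" "adj ?T i k" if "i \<in> tr" for i
  using adj_new[OF step.hyps that] adj_sym by metis+
 have adjtr: "adj ?T i j" if "i \<in> tr" "j \<in> tr" "i ~= j" for i j
  using adjS[OF adj_tetra[OF step.hyps(1,2), of i j]] that by auto
 show ?case
 proof (rule polar_step[OF step.hyps inv last(1)])
  show "hyp (cartan \<alpha> v) a b c" if "tr = {a,b,c}" "distinct [a,b,c]" for a b c
   using step.prems(3)[of a b c] last(1) adjtr that by auto
  show "hyp (cartan \<alpha> v) a b k" if "tr = {a,b,c}" "distinct [a,b,c]" "H {a,b,k}" for a b c
   using step.prems(3)[of a b k] that(3) adjtr[of a b] adjk(2) that by auto
  show "\<alpha> k \<bullet> v k = 2" using step.prems(2) by auto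
  show "\<alpha> k \<bullet> v i <= 0" "\<alpha> i \<bullet> v k <= 0" "\<alpha> k \<bullet> v i = 0 \<longleftrightarrow> \<alpha> i \<bullet> v k = 0" if "i \<in> tr" for i
   using step.prems(1) adjk[OF that] by blast+
  show "(\<exists>i\<in>tr. \<alpha> k \<bullet> v i ~= 0) \<or> (\<exists>i\<in>tr. \<alpha> d \<bullet> v i ~= 0)" by (rule last)
  show "nd \<alpha> (insert k tr)" by (rule beyond_nd[OF last(3,2)])
  show "\<alpha> k \<bullet> p tr > 0" 
  proof (rule beyond_pos[OF last(3)])
   show "\<alpha> i \<bullet> p tr = 0" if "i \<in> tr" for i by (rule p0[OF step.hyps(2) that])
   show "\<alpha> d \<bullet> p tr < 0" by (rule pneg[OF step.hyps(2) tr(3,4)])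
  qed
 qed
qed

section \<open>Cones and their faces\<close>

text \<open>The meeting point of both inclusions in \<open>Y_space_eq\<close>: a mirror polyhedron
  yields such vertices, and such vertices yield a polyhedron of the right combinatorial
  type.\<close>

definition VS :: "'s set => ('s set \<times> 's) set => ('s => real^4) => ('s set => real^4) => bool" where
 "VS S T \<alpha> p \<longleftrightarrow> (\<forall>\<tau>\<in>fst ` T. (\<forall>s\<in>\<tau>. \<alpha> s \<bullet> p \<tau> = 0) & (\<forall>s\<in>S - \<tau>. \<alpha> s \<bullet> p \<tau> < 0))"

lemma VS_D: assumes "VS S T \<alpha> p" "\<tau> \<in> fst ` T"
 shows "s \<in> \<tau> ==> \<alpha> s \<bullet> p \<tau> = 0" "s \<in> S ==> s \<notin> \<tau> ==> \<alpha> s \<bullet> p \<tau> < 0"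
 using assms unfolding VS_def by auto

lemma stk_cover: "stk S T L ==> s \<in> S ==> \<exists>\<tau>\<in>fst ` T. s \<in> \<tau>"
proof (induction rule: stk.induct)
 case (base S)
 have "card (S - {s}) = 3" using base by (simp add: card_Diff_singleton)
 then obtain x where "x \<in> S - {s}" by (metis all_not_in_conv card.empty zero_neq_numeral)
 hence "S - {x} \<in> fst ` (\<lambda>x. (S - {x}, x)) ` S" "s \<in> S - {x}" using base by (auto simp: image_image)
 thus ?case by blast
next
 case (step S T L tr d k)
 note it = step_cells_iff[OF step.hyps(1,2)]
 have tr: "card tr = 3" using stk_cell[OF step.hyps(1,2)] by simp
 obtain x0 where x0: "x0 \<in> tr" "x0 ~= s" using card3_third[OF tr, of s s] by blast
 have n: "insert k (tr - {x0}) \<in> fst ` step_cells T k tr d" unfolding it using x0 by blast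
 show ?case
 proof (cases "s = k \<or> s \<in> tr")
  case True hence "s \<in> insert k (tr - {x0})" using x0 by blast
  thus ?thesis using n by blast
 next
  case False
  then obtain \<tau> where "\<tau> \<in> fst ` T" "s \<in> \<tau>" using step by blast
  hence "\<tau> \<in> fst ` step_cells T k tr d" unfolding it using False by blast
  thus ?thesis using \<open>s \<in> \<tau>\<close> by blast
 qed
qed

text \<open>Undoing a truncation. An edge cut by \<open>k\<close> is prolonged beyond it to the
  former vertex \<open>p0\<close>. The signs at the three vertices on \<open>k\<close> then show
  that every face outside \<open>tr\<close> is a positive combination of \<open>tr\<close> minus a
  positive multiple of \<open>k\<close>; applied to \<open>d\<close> and solved for
  \<open>\<alpha> k\<close>, this is \<open>beyond\<close>.\<close>

lemma VS_down:
 assumes st: "stk S T L" and trT: "(tr, d) \<in> T" and kS: "k \<notin> S" and vs: "VS (insert k S) (step_cells T k tr d) \<alpha> p'"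
 shows "\<exists>p. VS S T \<alpha> p & \<alpha> k \<bullet> p tr > 0" and "nd \<alpha> (insert k tr)" and "beyond \<alpha> k tr d"
  and "!!s. s \<in> S ==> s \<notin> tr ==> \<exists>y e. (\<forall>i\<in>tr. 0 < y i) & 0 < e & \<alpha> s = (\<Sum>i\<in>tr. y i *\<^sub>R \<alpha> i) - e *\<^sub>R \<alpha> k"
proof -
 let ?T = "step_cells T k tr d"
 note it = step_cells_iff[OF st trT]
 have tr: "card tr = 3" "tr \<subseteq> S" "d \<in> S" "d \<notin> tr" using stk_cell[OF st trT] by auto
 have ktr: "k \<notin> tr" using tr kS by auto
 have fin: "finite tr" using tr(1) by (intro card_ge_0_finite) simp
 have trF: "tr \<in> fst ` T" using trT by force
 define q where "q i = p' (insert k (tr - {i}))" for i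
 have qT: "insert k (tr - {i}) \<in> fst ` ?T" if "i \<in> tr" for i unfolding it using that by blast
 have q0: "\<alpha> j \<bullet> q i = 0" if "i \<in> tr" "j \<in> insert k (tr - {i})" for i j
  unfolding q_def using VS_D(1)[OF vs qT[OF that(1)] that(2)] .
 have qn: "\<alpha> j \<bullet> q i < 0" if "i \<in> tr" "j \<in> S" "j \<notin> tr - {i}" for i j
  unfolding q_def by (rule VS_D(2)[OF vs qT[OF that(1)]]) (use that kS in auto)
 obtain a b c where abc: "tr = {a,b,c}" "distinct [a,b,c]" using tr(1) unfolding card3_iff_distinct by blast
 have m: "a \<in> tr" "b \<in> tr" "c \<in> tr" and ne: "a ~= b" "a ~= c" "b ~= c" using abc by auto
 obtain u where u: "u \<notin> tr" "insert u (tr - {a}) \<in> fst ` T" by (rule stk_neighbour[OF st trF m(1)])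
 define \<tau> where "\<tau> = insert u (tr - {a})"
 have \<tau>T: "\<tau> \<in> fst ` ?T" unfolding it \<tau>_def using u by blast
 have \<tau>S: "\<tau> \<subseteq> S" using stk_cell[OF st] u(2) unfolding \<tau>_def by (metis imageE prod.collapse)
 define r where "r = p' \<tau>"
 have "b \<in> \<tau>" "c \<in> \<tau>" unfolding \<tau>_def using m ne by auto
 hence r0: "\<alpha> b \<bullet> r = 0" "\<alpha> c \<bullet> r = 0" unfolding r_def by (auto intro: VS_D(1)[OF vs \<tau>T])
 have an: "a \<notin> \<tau>" using u m unfolding \<tau>_def by auto
 have ra: "\<alpha> a \<bullet> r < 0" unfolding r_def by (rule VS_D(2)[OF vs \<tau>T]) (use m tr an in auto)
 have rk: "\<alpha> k \<bullet> r < 0" unfolding r_def by (rule VS_D(2)[OF vs \<tau>T]) (use \<tau>S kS in auto)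
 \<comment> \<open>The point at which \<open>\<alpha> a\<close> vanishes on the line through
   \<open>r\<close> and \<open>q a\<close>, on the side of \<open>q a\<close> away from
   \<open>r\<close>. The other two forms of \<open>tr\<close> vanish on the whole line.\<close>
 define p0 where "p0 = (- (\<alpha> a \<bullet> r)) *\<^sub>R q a + (\<alpha> a \<bullet> q a) *\<^sub>R r"
 have p0e: "\<alpha> s \<bullet> p0 = - (\<alpha> a \<bullet> r) * (\<alpha> s \<bullet> q a) + (\<alpha> a \<bullet> q a) * (\<alpha> s \<bullet> r)" for s
  unfolding p0_def by (simp add: inner_add_right inner_diff_right)
 have qaa: "\<alpha> a \<bullet> q a < 0" "\<alpha> b \<bullet> q b < 0" "\<alpha> c \<bullet> q c < 0" by (rule qn, use m tr in auto)+
 have qz: "\<alpha> b \<bullet> q a = 0" "\<alpha> c \<bullet> q a = 0" "\<alpha> k \<bullet> q a = 0" "\<alpha> a \<bullet> q b = 0" "\<alpha> c \<bullet> q b = 0" "\<alpha> k \<bullet> q b = 0"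
  "\<alpha> a \<bullet> q c = 0" "\<alpha> b \<bullet> q c = 0" "\<alpha> k \<bullet> q c = 0" by (rule q0, use m ne in auto)+
 have p00: "\<alpha> a \<bullet> p0 = 0" "\<alpha> b \<bullet> p0 = 0" "\<alpha> c \<bullet> p0 = 0" unfolding p0e using r0 qz by auto
 have p0k: "\<alpha> k \<bullet> p0 > 0" unfolding p0e using qz(3) qaa(1) rk by (simp add: mult_neg_neg)
 \<comment> \<open>\<open>q a\<close>, \<open>q b\<close>, \<open>q c\<close> and \<open>p0\<close>
   form a dual system for these four forms.\<close>
 have D: "D4 (\<alpha> a) (\<alpha> b) (\<alpha> c) (\<alpha> k) ~= 0"
  by (rule D4_nonzeroI[of _ "q a" _ _ _ "q b" "q c" p0]) (use qaa qz p00 p0k in auto)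
 show nd: "nd \<alpha> (insert k tr)" using D unfolding nd_D4[symmetric] abc(1) by (simp add: insert_commute)
 show ex: "\<exists>y e. (\<forall>i\<in>tr. 0 < y i) & 0 < e & \<alpha> s = (\<Sum>i\<in>tr. y i *\<^sub>R \<alpha> i) - e *\<^sub>R \<alpha> k" if s: "s \<in> S" "s \<notin> tr" for s
 proof -
  obtain ya yb yc e where e: "\<alpha> s = ya *\<^sub>R \<alpha> a + yb *\<^sub>R \<alpha> b + yc *\<^sub>R \<alpha> c + e *\<^sub>R \<alpha> k" using D4_expand[OF D] by blast
  have ev: "\<alpha> s \<bullet> x = ya * (\<alpha> a \<bullet> x) + yb * (\<alpha> b \<bullet> x) + yc * (\<alpha> c \<bullet> x) + e * (\<alpha> k \<bullet> x)" for x
   unfolding e by (simp add: inner_add_left)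
  have sq: "\<alpha> s \<bullet> q i < 0" if "i \<in> tr" for i using qn[OF that s(1)] s(2) by blast
  have "ya * (\<alpha> a \<bullet> q a) < 0" "yb * (\<alpha> b \<bullet> q b) < 0" "yc * (\<alpha> c \<bullet> q c) < 0"
   using ev[of "q a"] ev[of "q b"] ev[of "q c"] sq[OF m(1)] sq[OF m(2)] sq[OF m(3)] qz by simp_all
  hence y: "ya > 0" "yb > 0" "yc > 0" using qaa by (simp_all add: mult_less_0_iff)
  \<comment> \<open>Otherwise \<open>\<alpha> s\<close> is a nonnegative combination of the forms of
    \<open>tr\<close> and \<open>k\<close>. At a vertex on the face \<open>s\<close> all forms of
    \<open>tr\<close> would have to vanish, so that this vertex would lie on four faces.\<close>
  have en: "e < 0"
  proof (rule ccontr)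
   assume "\<not> e < 0"
   obtain \<tau>' where \<tau>': "\<tau>' \<in> fst ` ?T" "s \<in> \<tau>'" using stk_cover[OF stk.step[OF st trT kS], of s] s by blast
   have le: "\<alpha> i \<bullet> p' \<tau>' <= 0" if "i \<in> insert k S" for i
    using VS_D(1)[OF vs \<tau>'(1), of i] VS_D(2)[OF vs \<tau>'(1), of i] that by (cases "i \<in> \<tau>'") auto
   have l: "\<alpha> a \<bullet> p' \<tau>' <= 0" "\<alpha> b \<bullet> p' \<tau>' <= 0" "\<alpha> c \<bullet> p' \<tau>' <= 0" "\<alpha> k \<bullet> p' \<tau>' <= 0" using le m tr(2) by auto
   have "ya * (\<alpha> a \<bullet> p' \<tau>') <= 0" "yb * (\<alpha> b \<bullet> p' \<tau>') <= 0" "yc * (\<alpha> c \<bullet> p' \<tau>') <= 0" "e * (\<alpha> k \<bullet> p' \<tau>') <= 0"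
    using l y \<open>\<not> e < 0\<close> by (auto intro: mult_nonneg_nonpos)
   moreover have "\<alpha> s \<bullet> p' \<tau>' = 0" using VS_D(1)[OF vs \<tau>'] .
   ultimately have "ya * (\<alpha> a \<bullet> p' \<tau>') = 0" "yb * (\<alpha> b \<bullet> p' \<tau>') = 0" "yc * (\<alpha> c \<bullet> p' \<tau>') = 0" using ev[of "p' \<tau>'"] by linarith+
   hence z: "\<alpha> a \<bullet> p' \<tau>' = 0" "\<alpha> b \<bullet> p' \<tau>' = 0" "\<alpha> c \<bullet> p' \<tau>' = 0" using y by auto
   have "a \<in> \<tau>'" by (rule ccontr) (use VS_D(2)[OF vs \<tau>'(1), of a] z(1) m tr(2) in auto)
   moreover have "b \<in> \<tau>'" by (rule ccontr) (use VS_D(2)[OF vs \<tau>'(1), of b] z(2) m tr(2) in auto)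
   moreover have "c \<in> \<tau>'" by (rule ccontr) (use VS_D(2)[OF vs \<tau>'(1), of c] z(3) m tr(2) in auto)
   ultimately have sub: "insert s tr \<subseteq> \<tau>'" using \<tau>'(2) abc(1) by auto
   obtain e' where "(\<tau>', e') \<in> ?T" using \<tau>'(1) by auto
   hence "card \<tau>' = 3" using stk_cell[OF stk.step[OF st trT kS]] by blast
   moreover have "card (insert s tr) = 4" using s(2) fin tr(1) by simp
   moreover have "finite \<tau>'" using \<open>card \<tau>' = 3\<close> by (intro card_ge_0_finite) simp
   ultimately show False using card_mono[OF _ sub] by simp
  qed
  define y where "y i = (if i = a then ya else if i = b then yb else yc)" for i
  have "(\<Sum>i\<in>tr. y i *\<^sub>R \<alpha> i) = ya *\<^sub>R \<alpha> a + yb *\<^sub>R \<alpha> b + yc *\<^sub>R \<alpha> c" unfolding abc(1) using ne by (simp add: y_def)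
  hence "\<alpha> s = (\<Sum>i\<in>tr. y i *\<^sub>R \<alpha> i) - (- e) *\<^sub>R \<alpha> k" unfolding e by simp
  moreover have "\<forall>i\<in>tr. 0 < y i" unfolding y_def using y by simp
  ultimately show ?thesis using en by (intro exI[of _ y] exI[of _ "- e"]) simp
 qed
 obtain y e where e: "0 < e" "\<alpha> d = (\<Sum>i\<in>tr. y i *\<^sub>R \<alpha> i) - e *\<^sub>R \<alpha> k" using ex[OF tr(3,4)] by blast
 have "\<alpha> k = (\<Sum>i\<in>tr. (y i / e) *\<^sub>R \<alpha> i) - (1 / e) *\<^sub>R \<alpha> d"
 proof -
  have "e *\<^sub>R \<alpha> k = (\<Sum>i\<in>tr. y i *\<^sub>R \<alpha> i) - \<alpha> d" unfolding e(2) by simp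
  hence "(1 / e) *\<^sub>R (e *\<^sub>R \<alpha> k) = (1 / e) *\<^sub>R ((\<Sum>i\<in>tr. y i *\<^sub>R \<alpha> i) - \<alpha> d)" by simp
  thus ?thesis using e(1) by (simp add: scaleR_diff_right scaleR_sum_right)
 qed
 thus "beyond \<alpha> k tr d" unfolding beyond_def using e(1) by (intro exI[of _ "\<lambda>i. y i / e"] exI[of _ "1 / e"]) simp
 define p where "p = p'(tr := p0)"
 have "VS S T \<alpha> p"
  unfolding VS_def
 proof
  fix \<tau> assume \<tau>: "\<tau> \<in> fst ` T"
  show "(\<forall>s\<in>\<tau>. \<alpha> s \<bullet> p \<tau> = 0) & (\<forall>s\<in>S - \<tau>. \<alpha> s \<bullet> p \<tau> < 0)"
  proof (cases "\<tau> = tr")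
   case False
   hence "\<tau> \<in> fst ` ?T" unfolding it using \<tau> by blast
   thus ?thesis using VS_D[OF vs] False unfolding p_def by simp
  next
   case True
   have "\<alpha> s \<bullet> p0 < 0" if s: "s \<in> S" "s \<notin> tr" for s
   proof -
    obtain y e where e: "0 < e" "\<alpha> s = (\<Sum>i\<in>tr. y i *\<^sub>R \<alpha> i) - e *\<^sub>R \<alpha> k" using ex[OF s] by blast
    have "\<alpha> i \<bullet> p0 = 0" if "i \<in> tr" for i using that p00 unfolding abc(1) by auto
    hence "\<alpha> s \<bullet> p0 = - e * (\<alpha> k \<bullet> p0)" unfolding e(2) by (simp add: inner_diff_left inner_sum_left)
    thus ?thesis using e(1) p0k by (simp add: mult_less_0_iff)
   qed
   thus ?thesis using True p00 unfolding p_def abc(1) by auto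
  qed
 qed
 thus "\<exists>p. VS S T \<alpha> p & \<alpha> k \<bullet> p tr > 0" using p0k by (intro exI[of _ p]) (simp add: p_def)
qed

lemma VS_nd: "stk S T L ==> VS S T \<alpha> p ==> (tr, d) \<in> T ==> nd \<alpha> (insert d tr)"
proof (induction arbitrary: p tr d rule: stk.induct)
 case (base S)
 have S: "insert d tr = S" "d \<in> S" using base by auto
 obtain a b c where abc: "S = {a,b,c,d}" "distinct [a,b,c,d]" by (rule card4E[OF base(1) S(2)])
 define q where "q x = p (S - {x})" for x
 have qn: "\<alpha> x \<bullet> q x < 0" if "x \<in> S" for x unfolding q_def by (rule VS_D(2)[OF base(2)]) (use that in \<open>auto simp: image_image\<close>)
 have q0: "\<alpha> y \<bullet> q x = 0" if "x \<in> S" "y \<in> S" "x ~= y" for x y unfolding q_def by (rule VS_D(1)[OF base(2)]) (use that in \<open>auto simp: image_image\<close>)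
 have m: "a \<in> S" "b \<in> S" "c \<in> S" "d \<in> S" using abc by auto
 have "D4 (\<alpha> a) (\<alpha> b) (\<alpha> c) (\<alpha> d) ~= 0"
  by (rule D4_nonzeroI[of _ "q a" _ _ _ "q b" "q c" "q d"]) (use qn[OF m(1)] qn[OF m(2)] qn[OF m(3)] qn[OF m(4)] q0 m abc(2) in auto)
 thus ?case unfolding S(1) unfolding abc(1) nd_D4 .
next
 case (step S T L tr0 d0 k)
 show ?case
 proof (cases "(tr, d) \<in> T")
  case True
  obtain p0 where "VS S T \<alpha> p0" using VS_down(1)[OF step.hyps step.prems(1)] by blast
  thus ?thesis by (rule step.IH[OF _ True])
 next
  case False
  hence "insert d tr = insert k tr0" using step.prems(2) unfolding step_cells_def by auto
  thus ?thesis using VS_down(2)[OF step.hyps step.prems(1)] by simp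
 qed
qed

text \<open>Peeling off the truncations from the last one recovers the vertices of every earlier
  stage, and with them the data of each step.\<close>

lemma VS_steps: "stk S T L ==> VS S T \<alpha> p ==> (k, tr, d) \<in> set L ==> nd \<alpha> (insert d tr) & beyond \<alpha> k tr d"
proof (induction arbitrary: p k tr d rule: stk.induct)
 case (base S) thus ?case by simp
next
 case (step S T L tr0 d0 k0)
 obtain p0 where p0: "VS S T \<alpha> p0" using VS_down(1)[OF step.hyps step.prems(1)] by blast
 show ?case
 proof (cases "(k, tr, d) \<in> set L")
  case True thus ?thesis by (rule step.IH[OF p0])
 next
  case False
  hence e: "k = k0" "tr = tr0" "d = d0" using step.prems(2) by auto
  show ?thesis unfolding e using VS_nd[OF step.hyps(1) p0 step.hyps(2)] VS_down(3)[OF step.hyps step.prems(1)] by simp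
 qed
qed

text \<open>This makes the face lattice of the cone that of the stack. A point on the last face
  \<open>k\<close> cannot lie on faces outside \<open>tr\<close>, since on \<open>k\<close> these
  are positive combinations of \<open>tr\<close>. A point off \<open>k\<close> cannot lie on all of
  \<open>tr\<close>, since it would be a positive multiple of the removed vertex, where
  \<open>\<alpha> k\<close> is positive.\<close>

lemma VS_face:
 "stk S T L ==> VS S T \<alpha> p ==> x ~= 0 ==> \<forall>s\<in>S. \<alpha> s \<bullet> x <= 0 ==> \<exists>\<tau>\<in>fst ` T. {s\<in>S. \<alpha> s \<bullet> x = 0} \<subseteq> \<tau>"
proof (induction arbitrary: p rule: stk.induct)
 case (base S)
 have "S ~= {}" using base(1) by auto
 then obtain d where d: "d \<in> S" by blast
 have "nd \<alpha> (insert d (S - {d}))" by (rule VS_nd[OF stk.base[OF base(1)] base(2)]) (use d in auto)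
 hence "nd \<alpha> S" using d by (simp add: insert_absorb)
 then obtain s where "s \<in> S" "\<alpha> s \<bullet> x ~= 0" using base(3) unfolding nd_def by blast
 thus ?case by (intro bexI[of _ "S - {s}"]) (auto simp: image_image)
next
 case (step S T L tr d k)
 note it = step_cells_iff[OF step.hyps(1,2)]
 note dn = VS_down[OF step.hyps step.prems(1)]
 have tr: "card tr = 3" "tr \<subseteq> S" "d \<in> S" "d \<notin> tr" using stk_cell[OF step.hyps(1,2)] by auto
 have fin: "finite tr" using tr(1) by (intro card_ge_0_finite) simp
 obtain p0 where p0: "VS S T \<alpha> p0" "\<alpha> k \<bullet> p0 tr > 0" using dn(1) by blast
 have xS: "\<forall>s\<in>S. \<alpha> s \<bullet> x <= 0" and xk: "\<alpha> k \<bullet> x <= 0" using step.prems(3) by auto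
 define I where "I = {s\<in>S. \<alpha> s \<bullet> x = 0}"
 obtain \<tau> where \<tau>: "\<tau> \<in> fst ` T" "I \<subseteq> \<tau>" using step.IH[OF p0(1) step.prems(2) xS] unfolding I_def by blast
 have trF: "tr \<in> fst ` T" using step.hyps(2) by force
 have new: "insert k (tr - {i}) \<in> fst ` step_cells T k tr d" if "i \<in> tr" for i unfolding it using that by blast
 show ?case
 proof (cases "\<alpha> k \<bullet> x = 0")
  case True
  have "I \<subseteq> tr"
  proof
   fix s assume s: "s \<in> I"
   show "s \<in> tr"
   proof (rule ccontr)
    assume ns: "s \<notin> tr"
    have sS: "s \<in> S" "\<alpha> s \<bullet> x = 0" using s unfolding I_def by auto
    obtain y e where y: "\<forall>i\<in>tr. 0 < y i" "\<alpha> s = (\<Sum>i\<in>tr. y i *\<^sub>R \<alpha> i) - e *\<^sub>R \<alpha> k" using dn(4)[OF sS(1) ns] by blast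
    have sm: "(\<Sum>i\<in>tr. y i * (\<alpha> i \<bullet> x)) = 0"
     using sS(2) True unfolding y(2) by (simp add: inner_diff_left inner_sum_left)
    have "\<forall>i\<in>tr. \<alpha> i \<bullet> x = 0"
    proof (rule ccontr)
     assume "\<not> (\<forall>i\<in>tr. \<alpha> i \<bullet> x = 0)"
     then obtain i where i: "i \<in> tr" "\<alpha> i \<bullet> x < 0" using xS tr(2) by (metis less_eq_real_def subsetD)
     have "(\<Sum>i\<in>tr. y i * (\<alpha> i \<bullet> x)) < 0" by (intro wsum_neg[where i = i]) (use y(1) xS tr(2) i fin in auto)
     thus False using sm by simp
    qed
    hence "x = 0" using dn(2) True unfolding nd_def by blast
    thus False using step.prems(2) by simp
   qed
  qed
  moreover have "\<not> tr \<subseteq> I"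
  proof
   assume "tr \<subseteq> I"
   hence "x = 0" using dn(2) True unfolding nd_def I_def by blast
   thus False using step.prems(2) by simp
  qed
  ultimately obtain i where i: "i \<in> tr" "I \<subseteq> tr - {i}" by blast
  have "{s \<in> insert k S. \<alpha> s \<bullet> x = 0} \<subseteq> insert k (tr - {i})" using i(2) unfolding I_def by blast
  thus ?thesis using new[OF i(1)] by blast
 next
  case False
  hence Ik: "{s \<in> insert k S. \<alpha> s \<bullet> x = 0} = I" unfolding I_def by auto
  show ?thesis
  proof (cases "I \<subseteq> tr")
   case sub: True
   have "\<not> tr \<subseteq> I"
   proof
    assume c: "tr \<subseteq> I"
    have ndd: "nd \<alpha> (insert d tr)" by (rule VS_nd[OF step.hyps(1) p0(1) step.hyps(2)])
    have pd: "\<alpha> d \<bullet> p0 tr < 0" by (rule VS_D(2)[OF p0(1) trF tr(3,4)])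
    define t where "t = (\<alpha> d \<bullet> x) / (\<alpha> d \<bullet> p0 tr)"
    have "t \<ge> 0" unfolding t_def using pd xS tr(3) by (simp add: divide_nonpos_neg)
    have "x - t *\<^sub>R p0 tr = 0"
    proof -
     have "\<forall>s\<in>insert d tr. \<alpha> s \<bullet> (x - t *\<^sub>R p0 tr) = 0"
      using c VS_D(1)[OF p0(1) trF] pd unfolding I_def t_def by (auto simp: inner_diff_right)
     thus ?thesis using ndd unfolding nd_def by blast
    qed
    hence x: "x = t *\<^sub>R p0 tr" by simp
    hence "t > 0" using \<open>t \<ge> 0\<close> step.prems(2) by (cases "t = 0") auto
    hence "\<alpha> k \<bullet> x > 0" unfolding x using p0(2) by simp
    thus False using xk by simp
   qed
   then obtain i where i: "i \<in> tr" "I \<subseteq> tr - {i}" using sub by blast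
   hence "{s \<in> insert k S. \<alpha> s \<bullet> x = 0} \<subseteq> insert k (tr - {i})" unfolding Ik by blast
   thus ?thesis using new[OF i(1)] by blast
  next
   case False
   hence "\<tau> ~= tr" using \<tau> by blast
   hence "\<tau> \<in> fst ` step_cells T k tr d" unfolding it using \<tau> by blast
   thus ?thesis using \<tau>(2) unfolding Ik by blast
  qed
 qed
qed

section \<open>Calculus of smooth real functions\<close>

primrec ck :: "nat => 'a::real_normed_vector set => ('a => real) => bool" where
 "ck 0 U f = True"
| "ck (Suc n) U f = ((\<forall>x\<in>U. f differentiable (at x)) & (\<forall>h. ck n U (\<lambda>x. frechet_derivative f (at x) h)))"

text \<open>Explicit orders replace coinduction by induction on \<open>n\<close>. A product rule or
  chain rule produces sums of products, to which a coinduction hypothesis would not apply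
  directly.\<close>

lemma C_infinity_on_ck: "C_infinity_on U f \<longleftrightarrow> (\<forall>n. ck n U f)"
proof
 assume f: "C_infinity_on U f"
 have "C_infinity_on U f ==> ck n U f" for n f
 proof (induction n arbitrary: f)
  case (Suc n)
  from Suc.prems show ?case by (rule C_infinity_on.cases) (use Suc.IH in auto)
 qed simp
 thus "\<forall>n. ck n U f" using f by blast
next
 assume "\<forall>n. ck n U f"
 thus "C_infinity_on U f"
 proof (coinduction arbitrary: f)
  case C_infinity_on
  have "ck (Suc n) U f" for n using C_infinity_on by blast
  thus ?case by auto
 qed
qed

lemma frechet_derivative_cong_open:
 assumes "open U" "x \<in> U" "!!y. y \<in> U ==> f y = g y"
 shows "f differentiable (at x) \<longleftrightarrow> g differentiable (at x)"
  and "frechet_derivative f (at x) = frechet_derivative g (at x)"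
proof -
 have *: "(f has_derivative D) (at x) \<longleftrightarrow> (g has_derivative D) (at x)" for D
  using assms has_derivative_transform_within_open[of f D x UNIV U g] has_derivative_transform_within_open[of g D x UNIV U f]
  by (auto simp: eq_commute)
 thus "f differentiable (at x) \<longleftrightarrow> g differentiable (at x)" unfolding differentiable_def by simp
 show "frechet_derivative f (at x) = frechet_derivative g (at x)" unfolding frechet_derivative_def using * by simp
qed

lemma ck_cong:
 assumes "open U" "!!x. x \<in> U ==> f x = g x" "ck n U f"
 shows "ck n U g"
 using assms(2,3)
proof (induction n arbitrary: f g)
 case (Suc n)
 have "ck n U (\<lambda>x. frechet_derivative g (at x) h)" for h
  by (rule Suc.IH[of "\<lambda>x. frechet_derivative f (at x) h"])
   (use Suc.prems frechet_derivative_cong_open(2)[OF assms(1)] in \<open>metis, simp\<close>)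
 moreover have "g differentiable (at x)" if "x \<in> U" for x
  using frechet_derivative_cong_open(1)[OF assms(1) that, of f g] Suc.prems that by simp
 ultimately show ?case by simp
qed simp

lemma ck_local: "(!!x. x \<in> U ==> \<exists>V. x \<in> V & ck n V f) ==> ck n U f"
proof (induction n arbitrary: f)
 case (Suc n)
 have "f differentiable (at x)" if "x \<in> U" for x using Suc.prems[OF that] by auto
 moreover have "ck n U (\<lambda>x. frechet_derivative f (at x) h)" for h
  by (rule Suc.IH) (use Suc.prems in fastforce)
 ultimately show ?case by simp
qed simp

lemma ck_subset: "ck n U f ==> V \<subseteq> U ==> ck n V f"
 by (rule ck_local) blast

lemma ck_Suc: "ck (Suc n) U f ==> ck n U f"
 by (induction n arbitrary: f) auto

lemma ck_const: "ck n U (\<lambda>x. c)"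
 by (induction n arbitrary: c) simp_all

lemmas frechet_derivative_worksI = frechet_derivative_works[THEN iffD1]

lemma frechet_add: "f differentiable (at x) ==> g differentiable (at x) ==>
  frechet_derivative (\<lambda>x. f x + g x) (at x) h = frechet_derivative f (at x) h + (frechet_derivative g (at x) h :: real)"
 by (metis (no_types) frechet_derivative_at frechet_derivative_works has_derivative_add)

lemma frechet_mult: "f differentiable (at x) ==> g differentiable (at x) ==>
  frechet_derivative (\<lambda>x. f x * g x) (at x) h = f x * frechet_derivative g (at x) h + frechet_derivative f (at x) h * (g x :: real)"
proof -
 assume "f differentiable (at x)" "g differentiable (at x)"
 hence "((\<lambda>x. f x * g x) has_derivative (\<lambda>h. f x * frechet_derivative g (at x) h + frechet_derivative f (at x) h * g x)) (at x)"
  by (intro has_derivative_mult frechet_derivative_worksI)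
 from fun_cong[OF frechet_derivative_at[OF this], of h] show ?thesis by simp
qed

lemma ck_add: "open U ==> ck n U f ==> ck n U g ==> ck n U (\<lambda>x. f x + g x)"
proof (induction n arbitrary: f g)
 case (Suc n)
 have "ck n U (\<lambda>x. frechet_derivative (\<lambda>x. f x + g x) (at x) h)" for h
  by (rule ck_cong[OF Suc.prems(1) _ Suc.IH[of "\<lambda>x. frechet_derivative f (at x) h" "\<lambda>x. frechet_derivative g (at x) h"]])
   (use Suc.prems in \<open>auto simp: frechet_add\<close>)
 thus ?case using Suc.prems by simp
qed simp

lemma ck_mult: "open U ==> ck n U f ==> ck n U g ==> ck n U (\<lambda>x. f x * g x)"
proof (induction n arbitrary: f g)
 case (Suc n)
 have "ck n U (\<lambda>x. frechet_derivative (\<lambda>x. f x * g x) (at x) h)" for h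
 proof (rule ck_cong[OF Suc.prems(1)])
  show "ck n U (\<lambda>x. f x * frechet_derivative g (at x) h + frechet_derivative f (at x) h * g x)"
   using Suc.prems by (intro ck_add Suc.IH) (auto intro: ck_Suc simp del: ck.simps(2) simp: ck.simps(2)[of n])
 qed (use Suc.prems in \<open>simp add: frechet_mult\<close>)
 thus ?case using Suc.prems by simp
qed simp

lemma ck_sum: "finite I ==> open U ==> (!!i. i \<in> I ==> ck n U (f i)) ==> ck n U (\<lambda>x. \<Sum>i\<in>I. f i x)"
 by (induction I rule: finite_induct) (auto intro: ck_const ck_add)

text \<open>By the chain rule in coordinates a derivative of the composite is a sum of products of
  first derivatives of \<open>g\<close> with composed partial derivatives of \<open>f\<close>. All
  factors have order \<open>n\<close>, the latter by the induction hypothesis.\<close>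

lemma ck_compose:
 fixes g :: "'a::real_normed_vector => 'b::euclidean_space"
 assumes "open U" "g ` U \<subseteq> V"
 shows "ck n V f ==> (!!b. b \<in> Basis ==> ck n U (\<lambda>x. g x \<bullet> b)) ==> ck n U (\<lambda>x. f (g x))"
proof (induction n arbitrary: f)
 case (Suc n)
 have gb: "(\<lambda>x. g x \<bullet> b) differentiable (at x)" if "x \<in> U" "b \<in> Basis" for x b using Suc.prems(2)[OF that(2)] that by simp
 have gd: "(g has_derivative (\<lambda>h. \<Sum>b\<in>Basis. frechet_derivative (\<lambda>x. g x \<bullet> b) (at x) h *\<^sub>R b)) (at x)" if "x \<in> U" for x
  by (subst has_derivative_componentwise_within)
   (use frechet_derivative_worksI[OF gb[OF that]] in \<open>auto simp: inner_sum_left inner_Basis if_distrib cong: if_cong\<close>)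
 have fd: "(f has_derivative frechet_derivative f (at (g x))) (at (g x))" if "x \<in> U" for x
  using Suc.prems(1) that assms(2) by (auto intro: frechet_derivative_worksI)
 have fgd: "((\<lambda>x. f (g x)) has_derivative (\<lambda>h. frechet_derivative f (at (g x)) (\<Sum>b\<in>Basis. frechet_derivative (\<lambda>x. g x \<bullet> b) (at x) h *\<^sub>R b))) (at x)"
  if "x \<in> U" for x
  using has_derivative_compose[OF gd[OF that] fd[OF that]] .
 have e: "frechet_derivative (\<lambda>x. f (g x)) (at x) h =
   (\<Sum>b\<in>Basis. frechet_derivative (\<lambda>x. g x \<bullet> b) (at x) h * frechet_derivative f (at (g x)) b)" if "x \<in> U" for x h
 proof -
  have l: "linear (frechet_derivative f (at (g x)))" using fd[OF that] by (rule has_derivative_linear)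
  show ?thesis unfolding frechet_derivative_at[OF fgd[OF that], symmetric] by (simp add: linear_sum[OF l] linear_cmul[OF l])
 qed
 have "ck n U (\<lambda>x. frechet_derivative (\<lambda>x. f (g x)) (at x) h)" for h
 proof (rule ck_cong[OF assms(1)])
  show "ck n U (\<lambda>x. \<Sum>b\<in>Basis. frechet_derivative (\<lambda>x. g x \<bullet> b) (at x) h * frechet_derivative f (at (g x)) b)"
  proof (intro ck_sum ck_mult assms(1) finite_Basis)
   fix b :: 'b assume b: "b \<in> Basis"
   show "ck n U (\<lambda>x. frechet_derivative (\<lambda>x. g x \<bullet> b) (at x) h)" using Suc.prems(2)[OF b] by simp
   show "ck n U (\<lambda>x. frechet_derivative f (at (g x)) b)"
    by (rule Suc.IH[of "\<lambda>y. frechet_derivative f (at y) b"]) (use Suc.prems(1) ck_Suc[OF Suc.prems(2)] in auto)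
  qed
 qed (simp add: e)
 moreover have "(\<lambda>x. f (g x)) differentiable (at x)" if "x \<in> U" for x using fgd[OF that] unfolding differentiable_def by blast
 ultimately show ?case by simp
qed simp

lemma C_infinity_on_cong: "open U ==> (!!x. x \<in> U ==> f x = g x) ==> C_infinity_on U f ==> C_infinity_on U g"
 unfolding C_infinity_on_ck using ck_cong by blast

lemma C_infinity_on_local: "(!!x. x \<in> U ==> \<exists>V. x \<in> V & C_infinity_on V f) ==> C_infinity_on U f"
 unfolding C_infinity_on_ck by (intro allI ck_local) meson

lemma C_infinity_on_subset: "C_infinity_on U f ==> V \<subseteq> U ==> C_infinity_on V f"
 unfolding C_infinity_on_ck using ck_subset by blast

lemma C_infinity_on_const: "C_infinity_on U (\<lambda>x. c)"
 unfolding C_infinity_on_ck using ck_const by blast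

lemma C_infinity_on_add: "open U ==> C_infinity_on U f ==> C_infinity_on U g ==> C_infinity_on U (\<lambda>x. f x + g x)"
 unfolding C_infinity_on_ck using ck_add by blast

lemma C_infinity_on_mult: "open U ==> C_infinity_on U f ==> C_infinity_on U g ==> C_infinity_on U (\<lambda>x. f x * g x)"
 unfolding C_infinity_on_ck using ck_mult by blast

lemma C_infinity_on_minus: "open U ==> C_infinity_on U f ==> C_infinity_on U (\<lambda>x. - f x)"
 using C_infinity_on_mult[OF _ C_infinity_on_const[of U "-1"], of f] by simp

lemma C_infinity_on_diff: "open U ==> C_infinity_on U f ==> C_infinity_on U g ==> C_infinity_on U (\<lambda>x. f x - g x)"
 using C_infinity_on_add[OF _ _ C_infinity_on_minus, of U f g] by simp

lemma C_infinity_on_sum: "open U ==> finite I ==> (!!i. i \<in> I ==> C_infinity_on U (f i)) ==> C_infinity_on U (\<lambda>x. \<Sum>i\<in>I. f i x)"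
 unfolding C_infinity_on_ck by (intro allI ck_sum) auto

lemma C_infinity_on_compose:
 fixes g :: "'a::real_normed_vector => 'b::euclidean_space"
 assumes "open U" "g ` U \<subseteq> V" "C_infinity_on V f" "!!b. b \<in> Basis ==> C_infinity_on U (\<lambda>x. g x \<bullet> b)"
 shows "C_infinity_on U (\<lambda>x. f (g x))"
 using ck_compose[OF assms(1,2)] assms(3,4) unfolding C_infinity_on_ck by blast

lemma C_infinity_on_differentiable: "C_infinity_on U f ==> x \<in> U ==> f differentiable (at x)"
 by (erule C_infinity_on.cases) auto

lemma C_infinity_on_continuous: "C_infinity_on U f ==> continuous_on U f"
 by (meson C_infinity_on_differentiable continuous_at_imp_continuous_on differentiable_imp_continuous_within)

lemma C_infinity_on_linear: "bounded_linear f ==> C_infinity_on U f"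
proof (rule C_infinity_on.intros)
 assume f: "bounded_linear f"
 show "f differentiable (at x)" for x using f by (rule bounded_linear_imp_differentiable)
 have "frechet_derivative f (at x) = f" for x
  using bounded_linear_imp_has_derivative[OF f] frechet_derivative_at by metis
 thus "C_infinity_on U (\<lambda>x. frechet_derivative f (at x) h)" for h by (simp add: C_infinity_on_const)
qed

lemma frechet_real: "(f has_real_derivative D) (at x) ==> frechet_derivative f (at x) h = D * h"
 using frechet_derivative_at[of f "\<lambda>h. D * h" x] unfolding has_field_derivative_def by metis

lemma open_nonzero: "open {x::real. x ~= 0}"
 by (simp add: open_Collect_neq)

text \<open>Generalised over \<open>c\<close> and \<open>k\<close> because this family is closed
  under differentiation, while \<open>inverse\<close> alone is not.\<close>

lemma ck_inverse_power: "ck n {x::real. x ~= 0} (\<lambda>x. c * inverse x ^ k)"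
proof (induction n arbitrary: c k)
 case (Suc n)
 have d: "((\<lambda>x. c * inverse x ^ k) has_real_derivative (- c * real k * inverse x ^ (k + 1))) (at x)" if "x ~= 0" for x
 proof -
  have "((\<lambda>x. c * inverse x ^ k) has_real_derivative c * (real k * (- (inverse x ^ Suc (Suc 0)) * inverse x ^ (k - Suc 0)))) (at x)"
   by (intro DERIV_cmult DERIV_power DERIV_inverse that)
  moreover have "c * (real k * (- (inverse x ^ Suc (Suc 0)) * inverse x ^ (k - Suc 0))) = - c * real k * inverse x ^ (k + 1)"
   by (cases k) (simp_all add: algebra_simps)
  ultimately show ?thesis by metis
 qed
 have "ck n {x::real. x ~= 0} (\<lambda>x. frechet_derivative (\<lambda>x. c * inverse x ^ k) (at x) h)" for h
  by (rule ck_cong[OF open_nonzero _ Suc.IH[of "- c * real k * h" "k+1"]]) (simp add: frechet_real[OF d])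
 thus ?case using d by (auto simp: real_differentiable_def)
qed simp

lemma ck_exp: "ck n U (\<lambda>x::real. c * exp x)"
proof (rule ck_subset[of n UNIV], induction n arbitrary: c)
 case (Suc n)
 have d: "((\<lambda>x. c * exp x) has_real_derivative (c * exp x)) (at x)" for x
  by (auto intro!: derivative_eq_intros)
 have "ck n UNIV (\<lambda>x. frechet_derivative (\<lambda>x. c * exp x) (at x) h)" for h
  by (rule ck_cong[OF open_UNIV _ Suc.IH[of "c * h"]]) (simp add: frechet_real[OF d])
 thus ?case using d by (auto simp: real_differentiable_def)
qed simp_all

lemma open_positive: "open {x::real. 0 < x}"
 by (simp add: open_Collect_less)

lemma ck_ln: "ck n {x::real. 0 < x} ln"
proof (cases n)
 case (Suc m)
 have d: "(ln has_real_derivative inverse x) (at x)" if "0 < x" for x :: real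
  using that by (rule DERIV_ln)
 have "ck m {x::real. 0 < x} (\<lambda>x. frechet_derivative ln (at x) h)" for h
  by (rule ck_cong[OF open_positive _ ck_subset[OF ck_inverse_power[of m h 1]]]) (auto simp add: frechet_real[OF d])
 thus ?thesis using d Suc by (auto simp: real_differentiable_def)
qed simp

lemma C_infinity_on_compose_real:
 assumes "open U" "f ` U \<subseteq> V" "C_infinity_on V g" "C_infinity_on U f"
 shows "C_infinity_on U (\<lambda>x. g (f x :: real))"
 using assms by (intro C_infinity_on_compose[of U f V g]) simp_all

lemma C_infinity_on_inverse: "open U ==> C_infinity_on U f ==> (!!x. x \<in> U ==> f x ~= 0) ==> C_infinity_on U (\<lambda>x. inverse (f x))"
 using ck_inverse_power[of _ 1 1] by (intro C_infinity_on_compose_real[of U f "{x. x ~= 0}" inverse]) (auto simp: C_infinity_on_ck)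

lemma C_infinity_on_divide: "open U ==> C_infinity_on U f ==> C_infinity_on U g ==> (!!x. x \<in> U ==> g x ~= 0) ==> C_infinity_on U (\<lambda>x. f x / g x)"
 unfolding divide_inverse by (intro C_infinity_on_mult C_infinity_on_inverse)

lemma C_infinity_on_exp: "open U ==> C_infinity_on U f ==> C_infinity_on U (\<lambda>x. exp (f x))"
 using ck_exp[of _ UNIV 1] by (intro C_infinity_on_compose_real[of U f UNIV exp]) (auto simp: C_infinity_on_ck)

lemma C_infinity_on_ln: "open U ==> C_infinity_on U f ==> (!!x. x \<in> U ==> 0 < f x) ==> C_infinity_on U (\<lambda>x. ln (f x))"
 using ck_ln by (intro C_infinity_on_compose_real[of U f "{x. 0 < x}" ln]) (auto simp: C_infinity_on_ck)

section \<open>Smooth structures on subsets and quotients\<close>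

lemma topspace_quotient_topology [simp]: "topspace (quotient_topology X q) = q ` topspace X"
proof -
 have "openin (quotient_topology X q) (q ` topspace X)"
 proof -
  have "{x \<in> topspace X. q x \<in> q ` topspace X} = topspace X" by auto
  thus ?thesis unfolding openin_quotient_topology by simp
 qed
 moreover have "!!U. openin (quotient_topology X q) U ==> U \<subseteq> q ` topspace X" unfolding openin_quotient_topology by simp
 ultimately show ?thesis by (meson openin_subset openin_topspace subset_antisym)
qed

lemma smooth_top_sub [simp]: "smooth_top (sub_smooth M A) = subtopology (smooth_top M) A"
 by (simp add: sub_smooth_def)

lemma smooth_funs_sub: "f \<in> smooth_funs (sub_smooth M A) U \<longleftrightarrow> (\<forall>x\<in>U. \<exists>V g. openin (smooth_top M) V & x \<in> V &
    g \<in> smooth_funs M V & (\<forall>y\<in>U \<inter> V. f y = g y))"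
 by (simp add: sub_smooth_def)

lemma smooth_top_quot [simp]: "smooth_top (quotient_smooth M q) = quotient_topology (smooth_top M) q"
 by (simp add: quotient_smooth_def)

lemma smooth_funs_quot: "f \<in> smooth_funs (quotient_smooth M q) U \<longleftrightarrow> f \<circ> q \<in> smooth_funs M {x \<in> topspace (smooth_top M). q x \<in> U}"
 by (simp add: quotient_smooth_def)

lemma smooth_top_euclidean [simp]: "smooth_top euclidean_smooth = euclidean"
 by (simp add: euclidean_smooth_def)

lemma smooth_funs_euclidean: "f \<in> smooth_funs euclidean_smooth U \<longleftrightarrow> C_infinity_on U f"
 by (simp add: euclidean_smooth_def)

lemma smooth_funs_sub_open:
 fixes U :: "'a::euclidean_space set"
 assumes "open U"
 shows "f \<in> smooth_funs (sub_smooth euclidean_smooth A) U \<longleftrightarrow> C_infinity_on U f"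
proof
 assume f: "f \<in> smooth_funs (sub_smooth euclidean_smooth A) U"
 show "C_infinity_on U f"
 proof (rule C_infinity_on_local)
  fix x assume "x \<in> U"
  then obtain V g where V: "open V" "x \<in> V" "C_infinity_on V g" "\<forall>y\<in>U \<inter> V. f y = g y"
   using f unfolding smooth_funs_sub smooth_funs_euclidean by auto
  have "C_infinity_on (U \<inter> V) f"
   by (rule C_infinity_on_cong[of _ g]) (use V assms in \<open>auto intro: C_infinity_on_subset\<close>)
  thus "\<exists>V. x \<in> V & C_infinity_on V f" using V \<open>x \<in> U\<close> by blast
 qed
next
 assume "C_infinity_on U f"
 thus "f \<in> smooth_funs (sub_smooth euclidean_smooth A) U"
  unfolding smooth_funs_sub smooth_funs_euclidean using assms by (auto intro!: exI[of _ U] exI[of _ f])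
qed

text \<open>\<open>\<Phi>\<close> is a coordinate map on representatives and \<open>\<sigma>\<close> a global section of it; together they make
  the quotient of \<open>Y\<close> by \<open>orb\<close> diffeomorphic to \<open>W\<close>.\<close>

locale quotient_chart =
 fixes \<Omega>0 :: "'c::euclidean_space set" and q :: "'c => 'y" and Y :: "'y set" and orb :: "'y => 'x"
  and \<Omega> :: "'c set" and \<Phi> :: "'c => 'w::euclidean_space" and W :: "'w set" and \<sigma> :: "'w => 'c"
 assumes open0: "open \<Omega>0" and open\<Omega>: "open \<Omega>" and sub: "\<Omega> \<subseteq> \<Omega>0" and Y: "Y \<subseteq> q ` \<Omega>"
  and sat: "c \<in> \<Omega> ==> c' \<in> \<Omega>0 ==> q c = q c' ==> c' \<in> \<Omega>"
  and inv: "c \<in> \<Omega> ==> c' \<in> \<Omega> ==> q c = q c' ==> \<Phi> c = \<Phi> c'"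
  and smooth\<Phi>: "b \<in> Basis ==> C_infinity_on \<Omega> (\<lambda>c. \<Phi> c \<bullet> b)"
  and smooth\<sigma>: "b' \<in> Basis ==> C_infinity_on UNIV (\<lambda>w. \<sigma> w \<bullet> b')"
  and \<Phi>W: "c \<in> \<Omega> ==> q c \<in> Y ==> \<Phi> c \<in> W"
  and \<sigma>\<Omega>0: "\<sigma> w \<in> \<Omega>0" and \<sigma>Y: "w \<in> W ==> q (\<sigma> w) \<in> Y" and \<Phi>\<sigma>: "w \<in> W ==> \<Phi> (\<sigma> w) = w"
  and orb: "c \<in> \<Omega> ==> c' \<in> \<Omega> ==> q c \<in> Y ==> q c' \<in> Y ==> orb (q c) = orb (q c') \<longleftrightarrow> \<Phi> c = \<Phi> c'"
begin

definition "M = quotient_smooth (sub_smooth euclidean_smooth \<Omega>0) q"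
definition "X = quotient_smooth (sub_smooth M Y) orb"
definition "rep y = (SOME c. c \<in> \<Omega> & q c = y)"
definition "\<phi> x = \<Phi> (SOME c. c \<in> \<Omega> & q c \<in> Y & orb (q c) = x)"

lemma topM: "smooth_top M = quotient_topology (top_of_set \<Omega>0) q" by (simp add: M_def)

lemma topspaceM: "topspace (smooth_top M) = q ` \<Omega>0" by (simp add: topM)

lemma YM: "Y \<subseteq> q ` \<Omega>0" using Y sub by blast

lemma topspaceX: "topspace (smooth_top X) = orb ` Y"
 using YM by (auto simp: X_def topspaceM Int_absorb1)

lemma \<phi>: assumes "c \<in> \<Omega>" "q c \<in> Y" shows "\<phi> (orb (q c)) = \<Phi> c"
proof -
 have "\<exists>c'. c' \<in> \<Omega> & q c' \<in> Y & orb (q c') = orb (q c)" using assms by blast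
 from someI_ex[OF this] show ?thesis unfolding \<phi>_def using orb assms by blast
qed

lemma rep: assumes "y \<in> q ` \<Omega>" shows "rep y \<in> \<Omega>" "q (rep y) = y"
 using someI_ex[of "\<lambda>c. c \<in> \<Omega> & q c = y"] assms unfolding rep_def by blast+

lemma \<sigma>\<Omega>: "w \<in> W ==> \<sigma> w \<in> \<Omega>"
 using \<sigma>Y[of w] Y sat[of _ "\<sigma> w"] \<sigma>\<Omega>0[of w] by (metis image_iff subsetD)

lemma cont\<Phi>: "continuous_on \<Omega> \<Phi>"
proof -
 have "continuous_on \<Omega> (\<lambda>c. \<Phi> c \<bullet> b)" if "b \<in> Basis" for b
  using C_infinity_on_continuous[OF smooth\<Phi>[OF that]] .
 thus ?thesis by (subst continuous_on_componentwise) blast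
qed

lemma cont\<sigma>: "continuous_on UNIV \<sigma>"
proof -
 have "continuous_on UNIV (\<lambda>c. \<sigma> c \<bullet> b)" if "b \<in> Basis" for b
  using C_infinity_on_continuous[OF smooth\<sigma>[OF that]] .
 thus ?thesis by (subst continuous_on_componentwise) blast
qed

text \<open>Openness in the quotient needs a saturated set of representatives. Saturation inside
  \<open>\<Omega>\<close> suffices, because \<open>\<Omega>\<close> is itself saturated in
  \<open>\<Omega>0\<close> by \<open>sat\<close>.\<close>

lemma open_image:
 assumes "open V" "V \<subseteq> \<Omega>" "!!c c'. c \<in> V ==> c' \<in> \<Omega> ==> q c = q c' ==> c' \<in> V"
 shows "openin (smooth_top M) (q ` V)" "{c \<in> \<Omega>0. q c \<in> q ` V} = V"
proof -
 show e: "{c \<in> \<Omega>0. q c \<in> q ` V} = V"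
 proof
  show "{c \<in> \<Omega>0. q c \<in> q ` V} \<subseteq> V"
  proof clarify
   fix c c' assume c: "c \<in> \<Omega>0" "q c = q c'" "c' \<in> V"
   hence "c \<in> \<Omega>" using sat[of c' c] assms(2) by (metis subsetD)
   thus "c \<in> V" using assms(3)[of c' c] c by simp
  qed
 qed (use assms(2) sub in auto)
 show "openin (smooth_top M) (q ` V)"
  unfolding topM openin_quotient_topology using e assms sub
  by (auto simp: openin_open_eq open0)
qed

lemma open_preimage:
 assumes "open U"
 shows "openin (smooth_top M) (q ` {c \<in> \<Omega>. \<Phi> c \<in> U})" "{c \<in> \<Omega>0. q c \<in> q ` {c \<in> \<Omega>. \<Phi> c \<in> U}} = {c \<in> \<Omega>. \<Phi> c \<in> U}"
  "open {c \<in> \<Omega>. \<Phi> c \<in> U}"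
proof -
 have "{c \<in> \<Omega>. \<Phi> c \<in> U} = \<Omega> \<inter> \<Phi> -` U" by auto
 thus o: "open {c \<in> \<Omega>. \<Phi> c \<in> U}" using continuous_open_preimage[OF cont\<Phi> open\<Omega> assms] by simp
 show "openin (smooth_top M) (q ` {c \<in> \<Omega>. \<Phi> c \<in> U})" by (rule open_image(1)[OF o]) (auto dest: inv)
 show "{c \<in> \<Omega>0. q c \<in> q ` {c \<in> \<Omega>. \<Phi> c \<in> U}} = {c \<in> \<Omega>. \<Phi> c \<in> U}" by (rule open_image(2)[OF o]) (auto dest: inv)
qed

lemma bij\<phi>: "\<phi> ` (orb ` Y) = W" "inj_on \<phi> (orb ` Y)"
proof -
 show "\<phi> ` (orb ` Y) = W"
 proof
  show "\<phi> ` (orb ` Y) \<subseteq> W" using Y \<phi> \<Phi>W by (fastforce simp: image_iff)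
  show "W \<subseteq> \<phi> ` (orb ` Y)"
  proof
   fix w assume w: "w \<in> W"
   hence "\<phi> (orb (q (\<sigma> w))) = w" using \<phi>[OF \<sigma>\<Omega>[OF w] \<sigma>Y[OF w]] \<Phi>\<sigma> by simp
   thus "w \<in> \<phi> ` (orb ` Y)" using \<sigma>Y[OF w] by (metis image_eqI)
  qed
 qed
 show "inj_on \<phi> (orb ` Y)"
 proof (rule inj_onI)
  fix x x' assume x: "x \<in> orb ` Y" "x' \<in> orb ` Y" "\<phi> x = \<phi> x'"
  obtain c where c: "c \<in> \<Omega>" "q c \<in> Y" "x = orb (q c)" using x(1) Y by auto
  obtain c' where c': "c' \<in> \<Omega>" "q c' \<in> Y" "x' = orb (q c')" using x(2) Y by auto
  show "x = x'" using x(3) c c' \<phi> orb by metis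
 qed
qed

lemma cont\<phi>: "continuous_map (smooth_top X) (top_of_set W) \<phi>"
 unfolding continuous_map_def
proof (intro conjI allI impI)
 show "\<phi> \<in> topspace (smooth_top X) \<rightarrow> topspace (top_of_set W)" using bij\<phi>(1) unfolding topspaceX by auto
 fix U assume "openin (top_of_set W) U"
 then obtain U' where U': "open U'" "U = W \<inter> U'" unfolding openin_open by blast
 have "{y \<in> Y. \<phi> (orb y) \<in> U} = Y \<inter> q ` {c \<in> \<Omega>. \<Phi> c \<in> U'}"
 proof (intro set_eqI iffI)
  fix y assume y: "y \<in> {y \<in> Y. \<phi> (orb y) \<in> U}"
  then obtain c where c: "c \<in> \<Omega>" "q c = y" using Y by auto
  thus "y \<in> Y \<inter> q ` {c \<in> \<Omega>. \<Phi> c \<in> U'}" using y \<phi>[of c] U' by auto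
 next
  fix y assume "y \<in> Y \<inter> q ` {c \<in> \<Omega>. \<Phi> c \<in> U'}"
  thus "y \<in> {y \<in> Y. \<phi> (orb y) \<in> U}" using \<phi> \<Phi>W U' by auto
 qed
 hence "openin (subtopology (smooth_top M) Y) {y \<in> Y. \<phi> (orb y) \<in> U}"
  using open_preimage(1)[OF U'(1)] by (metis Int_commute openin_subtopology)
 moreover have "{x \<in> topspace (subtopology (smooth_top M) Y). orb x \<in> {x \<in> topspace (smooth_top X). \<phi> x \<in> U}} = {y \<in> Y. \<phi> (orb y) \<in> U}"
  unfolding topspaceX using YM by (auto simp: topspaceM)
 moreover have "{x \<in> topspace (smooth_top X). \<phi> x \<in> U} \<subseteq> orb ` topspace (subtopology (smooth_top M) Y)"
  unfolding topspaceX using YM by (auto simp: topspaceM)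
 ultimately show "openin (smooth_top X) {x \<in> topspace (smooth_top X). \<phi> x \<in> U}"
  unfolding X_def smooth_top_quot smooth_top_sub openin_quotient_topology by simp
qed

lemma continuous_map_quotient: "continuous_map Z (quotient_topology Z f) f"
 unfolding continuous_map_def openin_quotient_topology by auto

lemma cont_inv: "continuous_map (top_of_set W) (smooth_top X) (\<lambda>w. orb (q (\<sigma> w)))"
proof -
 have "continuous_map (top_of_set W) (top_of_set \<Omega>0) \<sigma>"
  using cont\<sigma> \<sigma>\<Omega>0 by (auto intro: continuous_on_subset)
 hence "continuous_map (top_of_set W) (smooth_top M) (q \<circ> \<sigma>)"
  unfolding topM using continuous_map_quotient continuous_map_compose by blast
 hence "continuous_map (top_of_set W) (subtopology (smooth_top M) Y) (q \<circ> \<sigma>)"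
  using \<sigma>Y by (auto simp: continuous_map_in_subtopology)
 moreover have "continuous_map (subtopology (smooth_top M) Y) (smooth_top X) orb"
  unfolding X_def smooth_top_quot smooth_top_sub by (rule continuous_map_quotient)
 ultimately show ?thesis using continuous_map_compose[of _ _ "q \<circ> \<sigma>" _ orb] by (simp add: o_def)
qed

lemma homeo\<phi>: "homeomorphic_map (smooth_top X) (top_of_set W) \<phi>"
proof -
 have "homeomorphic_maps (smooth_top X) (top_of_set W) \<phi> (\<lambda>w. orb (q (\<sigma> w)))"
  unfolding homeomorphic_maps_def
 proof (intro conjI ballI)
  fix x assume "x \<in> topspace (smooth_top X)"
  then obtain c where c: "c \<in> \<Omega>" "q c \<in> Y" "x = orb (q c)" using Y unfolding topspaceX by auto
  hence w: "\<phi> x = \<Phi> c" "\<Phi> c \<in> W" using \<phi> \<Phi>W by auto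
  thus "orb (q (\<sigma> (\<phi> x))) = x" using orb[OF \<sigma>\<Omega>[OF w(2)] c(1) \<sigma>Y[OF w(2)] c(2)] \<Phi>\<sigma>[OF w(2)] c by simp
 next
  fix w assume "w \<in> topspace (top_of_set W)"
  hence w: "w \<in> W" by simp
  thus "\<phi> (orb (q (\<sigma> w))) = w" using \<phi>[OF \<sigma>\<Omega>[OF w] \<sigma>Y[OF w]] \<Phi>\<sigma> by simp
 qed (use cont\<phi> cont_inv in auto)
 thus ?thesis using homeomorphic_map_maps by blast
qed

lemma smooth_funs_M:
 assumes "openin (smooth_top M) V"
 shows "g \<in> smooth_funs M V \<longleftrightarrow> C_infinity_on {c \<in> \<Omega>0. q c \<in> V} (\<lambda>c. g (q c))"
proof -
 have "openin (top_of_set \<Omega>0) {c \<in> \<Omega>0. q c \<in> V}" using assms unfolding topM openin_quotient_topology by simp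
 hence "open {c \<in> \<Omega>0. q c \<in> V}" using open0 openin_open_eq by blast
 thus ?thesis unfolding M_def smooth_funs_quot using smooth_funs_sub_open by (simp add: o_def)
qed

text \<open>Smoothness on \<open>W\<close> and on \<open>Y\<close> both mean local extendability to
  open sets of the ambient space. Extensions are carried from \<open>W\<close> to configurations by
  composition with \<open>\<Phi>\<close>, and back by composition with
  \<open>\<sigma>\<close>.\<close>

theorem diffeo: "diffeomorphism X (sub_smooth euclidean_smooth W) \<phi>"
 unfolding diffeomorphism_def smooth_top_sub smooth_top_euclidean
proof (intro conjI allI impI homeo\<phi>)
 fix U :: "'w set" and f
 assume U: "openin (top_of_set W) U"
 have UW: "U \<subseteq> W" using openin_imp_subset[OF U] .
 define Z where "Z = {y \<in> Y. \<phi> (orb y) \<in> U}"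
 have Ztop: "{x \<in> topspace (smooth_top (sub_smooth M Y)). orb x \<in> {x \<in> topspace (smooth_top X). \<phi> x \<in> U}} = Z"
  unfolding topspaceX Z_def using YM by (auto simp: topspaceM)
 have iff: "f \<circ> \<phi> \<in> smooth_funs X {x \<in> topspace (smooth_top X). \<phi> x \<in> U} \<longleftrightarrow>
   (\<forall>y\<in>Z. \<exists>V g. openin (smooth_top M) V & y \<in> V & g \<in> smooth_funs M V & (\<forall>y\<in>Z \<inter> V. f (\<phi> (orb y)) = g y))"
  by (subst X_def, subst smooth_funs_quot, subst Ztop, subst smooth_funs_sub) simp
 show "f \<in> smooth_funs (sub_smooth euclidean_smooth W) U \<longleftrightarrow> f \<circ> \<phi> \<in> smooth_funs X {x \<in> topspace (smooth_top X). \<phi> x \<in> U}"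
  unfolding iff
 proof
  assume f: "f \<in> smooth_funs (sub_smooth euclidean_smooth W) U"
  show "\<forall>y\<in>Z. \<exists>V g. openin (smooth_top M) V & y \<in> V & g \<in> smooth_funs M V & (\<forall>y\<in>Z \<inter> V. f (\<phi> (orb y)) = g y)"
  proof
   fix y assume y: "y \<in> Z"
   then obtain c where c: "c \<in> \<Omega>" "q c = y" "q c \<in> Y" unfolding Z_def using Y by auto
   have "\<Phi> c \<in> U" using y c \<phi> unfolding Z_def by auto
   then obtain V g where V: "open V" "\<Phi> c \<in> V" "C_infinity_on V g" "\<forall>w\<in>U \<inter> V. f w = g w"
    using f unfolding smooth_funs_sub smooth_funs_euclidean by (metis openin_subtopology_self open_openin smooth_top_euclidean)
   define V' where "V' = {c \<in> \<Omega>. \<Phi> c \<in> V}"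
   note oV = open_preimage[OF V(1), folded V'_def]
   \<comment> \<open>\<open>\<Phi>\<close> is defined on an open set of representatives and not only
     over \<open>Y\<close>, so this composite is a smooth extension. It does not depend on the
     representative, by \<open>inv\<close>.\<close>
   define G where "G y = g (\<Phi> (rep y))" for y
   have Grep: "\<Phi> (rep (q c)) = \<Phi> c" if "c \<in> \<Omega>" for c using rep[of "q c"] inv that by blast
   have "C_infinity_on V' (\<lambda>c. g (\<Phi> c))"
    by (rule C_infinity_on_compose[OF oV(3) _ V(3)]) (auto simp: V'_def intro: C_infinity_on_subset smooth\<Phi>)
   hence "C_infinity_on V' (\<lambda>c. G (q c))"
    by (rule C_infinity_on_cong[OF oV(3), rotated]) (simp add: G_def V'_def Grep)
   hence "G \<in> smooth_funs M (q ` V')" unfolding smooth_funs_M[OF oV(1)] oV(2) .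
   moreover have "y \<in> q ` V'" using c V unfolding V'_def by auto
   moreover have "\<forall>y\<in>Z \<inter> q ` V'. f (\<phi> (orb y)) = G y"
   proof
    fix y' assume y': "y' \<in> Z \<inter> q ` V'"
    then obtain c' where c': "c' \<in> V'" "y' = q c'" by blast
    hence c'': "c' \<in> \<Omega>" "\<Phi> c' \<in> V" "q c' \<in> Y" using y' unfolding V'_def Z_def by auto
    have "\<phi> (orb y') = \<Phi> c'" using \<phi> c'' c' by simp
    moreover hence "\<Phi> c' \<in> U" using y' unfolding Z_def by simp
    ultimately show "f (\<phi> (orb y')) = G y'" unfolding G_def using c' c'' V(4) Grep by simp
   qed
   ultimately show "\<exists>V g. openin (smooth_top M) V & y \<in> V & g \<in> smooth_funs M V & (\<forall>y\<in>Z \<inter> V. f (\<phi> (orb y)) = g y)"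
    using oV(1) by blast
  qed
 next
  assume f: "\<forall>y\<in>Z. \<exists>V g. openin (smooth_top M) V & y \<in> V & g \<in> smooth_funs M V & (\<forall>y\<in>Z \<inter> V. f (\<phi> (orb y)) = g y)"
  show "f \<in> smooth_funs (sub_smooth euclidean_smooth W) U"
   unfolding smooth_funs_sub smooth_funs_euclidean smooth_top_euclidean
  proof
   fix w assume w: "w \<in> U"
   hence wW: "w \<in> W" using UW by blast
   have \<phi>\<sigma>: "\<phi> (orb (q (\<sigma> w))) = w" if "w \<in> W" for w using \<phi>[OF \<sigma>\<Omega>[OF that] \<sigma>Y[OF that]] \<Phi>\<sigma>[OF that] by simp
   have "q (\<sigma> w) \<in> Z" unfolding Z_def using \<sigma>Y[OF wW] \<phi>\<sigma>[OF wW] w by simp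
   then obtain V g where V: "openin (smooth_top M) V" "q (\<sigma> w) \<in> V" "g \<in> smooth_funs M V" "\<forall>y\<in>Z \<inter> V. f (\<phi> (orb y)) = g y"
    using f by blast
   \<comment> \<open>\<open>\<sigma>\<close> is smooth on the whole ambient space of
     \<open>W\<close>, so its composite with the given extension is smooth on an open neighbourhood
     of \<open>w\<close>.\<close>
   define V' where "V' = {c \<in> \<Omega>0. q c \<in> V}"
   have oV': "open V'" using V(1) open0 unfolding topM openin_quotient_topology V'_def by (simp add: openin_open_eq)
   have c1: "C_infinity_on V' (\<lambda>c. g (q c))" using V(3) unfolding smooth_funs_M[OF V(1)] V'_def .
   have oW: "open (\<sigma> -` V')" using cont\<sigma> oV' by (simp add: continuous_on_open_vimage)
   have c2: "C_infinity_on (\<sigma> -` V') (\<lambda>w. \<sigma> w \<bullet> b)" if "b \<in> Basis" for b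
    by (rule C_infinity_on_subset[OF smooth\<sigma>[OF that]]) simp
   have s1: "C_infinity_on (\<sigma> -` V') (\<lambda>w. g (q (\<sigma> w)))"
    by (rule C_infinity_on_compose[OF oW _ c1 c2]) auto
   have s2: "w \<in> \<sigma> -` V'" using V(2) \<sigma>\<Omega>0 unfolding V'_def by simp
   have s3: "\<forall>u\<in>U \<inter> \<sigma> -` V'. f u = g (q (\<sigma> u))"
   proof
    fix u assume u: "u \<in> U \<inter> \<sigma> -` V'"
    hence uW: "u \<in> W" using UW by blast
    have "q (\<sigma> u) \<in> Z \<inter> V" using u \<sigma>Y[OF uW] \<phi>\<sigma>[OF uW] unfolding Z_def V'_def by simp
    thus "f u = g (q (\<sigma> u))" using V(4) \<phi>\<sigma>[OF uW] by metis
   qed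
   show "\<exists>V g. openin euclidean V & w \<in> V & C_infinity_on V g & (\<forall>y\<in>U \<inter> V. f y = g y)"
    by (rule exI[of _ "\<sigma> -` V'"], rule exI[of _ "\<lambda>w. g (q (\<sigma> w))"]) (intro conjI s1 s2 s3, simp add: oW)
  qed
 qed
qed

end

section \<open>Rays, polyhedral cones and their faces\<close>

lemma ray_eqD: assumes "ray x = ray y" shows "\<exists>t>0. y = t *\<^sub>R x"
proof -
 have "y \<in> ray y" unfolding ray_def by (intro CollectI exI[of _ 1]) simp
 thus ?thesis using assms unfolding ray_def by blast
qed

lemma ray_scale: "t > 0 ==> ray (t *\<^sub>R x) = ray x"
 unfolding ray_def
proof (intro set_eqI iffI; clarify)
 fix s :: real assume t: "t > 0" "s > 0"
 show "\<exists>t'. s *\<^sub>R t *\<^sub>R x = t' *\<^sub>R x & 0 < t'" using t by (intro exI[of _ "s * t"]) simp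
 show "\<exists>t'. s *\<^sub>R x = t' *\<^sub>R t *\<^sub>R x & 0 < t'" using t by (intro exI[of _ "s / t"]) simp
qed

lemma cone_over_rays:
 assumes "0 \<in> K" "!!x t. x \<in> K ==> t > 0 ==> t *\<^sub>R x \<in> K"
 shows "cone_over (ray ` (K - {0})) = K"
proof (intro set_eqI iffI)
 fix x assume "x \<in> cone_over (ray ` (K - {0}))"
 thus "x \<in> K" unfolding cone_over_def
 proof (elim insertE CollectE conjE imageE)
  fix y assume "ray x = ray y" "y \<in> K - {0}"
  thus "x \<in> K" using ray_eqD[of y x] assms(2) by auto
 qed (use assms(1) in simp)
next
 fix x assume "x \<in> K" thus "x \<in> cone_over (ray ` (K - {0}))" unfolding cone_over_def by auto
qed

lemma ray_cone_over: "F \<subseteq> ray ` (- {0}) ==> ray ` (cone_over F - {0}) = F"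
 unfolding cone_over_def by (auto simp: subset_iff image_iff)

definition hcone :: "('s => real^4) => 's set => (real^4) set" where
 "hcone \<alpha> I = {x. (\<forall>s. \<alpha> s \<bullet> x <= 0) & (\<forall>s\<in>I. \<alpha> s \<bullet> x = 0)}"

lemma hcone_0: "0 \<in> hcone \<alpha> I" unfolding hcone_def by simp

lemma hcone_scale: "x \<in> hcone \<alpha> I ==> t > 0 ==> t *\<^sub>R x \<in> hcone \<alpha> I"
 unfolding hcone_def by (simp add: mult_le_0_iff)

lemma hcone_mono: "I \<subseteq> J ==> hcone \<alpha> J \<subseteq> hcone \<alpha> I" unfolding hcone_def by auto

definition hface :: "('s => real^4) => 's set => ppoint set" where
 "hface \<alpha> I = ray ` (hcone \<alpha> I - {0})"

lemma cone_over_hface: "cone_over (hface \<alpha> I) = hcone \<alpha> I"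
 unfolding hface_def by (rule cone_over_rays[OF hcone_0 hcone_scale])

lemma hface_subset: "hface \<alpha> I \<subseteq> hface \<alpha> J \<longleftrightarrow> hcone \<alpha> I \<subseteq> hcone \<alpha> J"
proof
 assume "hface \<alpha> I \<subseteq> hface \<alpha> J"
 hence "cone_over (hface \<alpha> I) \<subseteq> cone_over (hface \<alpha> J)" unfolding cone_over_def by auto
 thus "hcone \<alpha> I \<subseteq> hcone \<alpha> J" unfolding cone_over_hface .
qed (auto simp: hface_def)

lemma convex_hcone: "convex (hcone \<alpha> I)"
proof -
 have "hcone \<alpha> I = (\<Inter>s. {x. \<alpha> s \<bullet> x <= 0}) \<inter> (\<Inter>s\<in>I. {x. \<alpha> s \<bullet> x = 0})" unfolding hcone_def by auto
 thus ?thesis by (auto intro!: convex_Int convex_INT convex_halfspace_le convex_hyperplane)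
qed

lemma closed_hcone: "closed (hcone \<alpha> I)"
proof -
 have "hcone \<alpha> I = (\<Inter>s. {x. \<alpha> s \<bullet> x <= 0}) \<inter> (\<Inter>s\<in>I. {x. \<alpha> s \<bullet> x = 0})" unfolding hcone_def by auto
 thus ?thesis by (auto intro!: closed_Int closed_INT closed_halfspace_le closed_hyperplane)
qed

lemma hcone_face: "hcone \<alpha> I face_of hcone \<alpha> {}"
 unfolding face_of_def
proof (intro conjI ballI impI convex_hcone)
 show "hcone \<alpha> I \<subseteq> hcone \<alpha> {}" by (rule hcone_mono) simp
 fix a b x assume ab: "a \<in> hcone \<alpha> {}" "b \<in> hcone \<alpha> {}" "x \<in> hcone \<alpha> I" "x \<in> open_segment a b"
 obtain u where u: "0 < u" "u < 1" "x = (1 - u) *\<^sub>R a + u *\<^sub>R b" using ab(4) by (auto simp: in_segment)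
 have "\<alpha> s \<bullet> a = 0 & \<alpha> s \<bullet> b = 0" if "s \<in> I" for s
 proof -
  have l: "\<alpha> s \<bullet> a <= 0" "\<alpha> s \<bullet> b <= 0" using ab unfolding hcone_def by auto
  have "(1 - u) * (\<alpha> s \<bullet> a) + u * (\<alpha> s \<bullet> b) = 0" using ab(3) that unfolding hcone_def u(3) by (simp add: inner_add_right)
  moreover have "(1 - u) * (\<alpha> s \<bullet> a) <= 0" "u * (\<alpha> s \<bullet> b) <= 0" using u l by (auto intro: mult_nonneg_nonpos)
  ultimately have "(1 - u) * (\<alpha> s \<bullet> a) = 0" "u * (\<alpha> s \<bullet> b) = 0" by linarith+
  thus ?thesis using u by auto
 qed
 thus "a \<in> hcone \<alpha> I" "b \<in> hcone \<alpha> I" using ab unfolding hcone_def by auto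
qed

lemma small_step:
 fixes \<alpha> :: "'s::finite => real^4"
 assumes x: "!!s. s \<notin> I ==> \<alpha> s \<bullet> x < 0"
 shows "\<exists>e>0. \<forall>s. s \<notin> I --> \<alpha> s \<bullet> (x + e *\<^sub>R y) <= 0"
proof -
 have "\<exists>e>0. \<forall>s\<in>J. s \<notin> I --> \<alpha> s \<bullet> (x + e *\<^sub>R y) <= 0" for J
 proof (induction J rule: finite_induct[OF finite])
  case 1 show ?case by (rule exI[of _ 1]) simp
 next
  case (2 t J)
  then obtain e where e: "e > 0" "\<forall>s\<in>J. s \<notin> I --> \<alpha> s \<bullet> (x + e *\<^sub>R y) <= 0" by blast
  show ?case
  proof (cases "t \<in> I")
   case True thus ?thesis using e by auto
  next
   case False
   \<comment> \<open>The second bound limits the change of the form \<open>\<alpha> t\<close> to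
     \<open>- (\<alpha> t \<bullet> x)\<close>; the summand \<open>1\<close> keeps the denominator
     positive.\<close>
   define e' where "e' = min e (- (\<alpha> t \<bullet> x) / (1 + \<bar>\<alpha> t \<bullet> y\<bar>))"
   have e'0: "e' > 0" unfolding e'_def using e x[OF False] by (simp add: divide_neg_pos)
   have "\<alpha> s \<bullet> (x + e' *\<^sub>R y) <= 0" if "s \<in> J" "s \<notin> I" for s
   proof -
    have a: "\<alpha> s \<bullet> x + e * (\<alpha> s \<bullet> y) <= 0" using e(2) that by (simp add: inner_add_right)
    have "e' <= e" unfolding e'_def by simp
    show ?thesis
    proof (cases "\<alpha> s \<bullet> y <= 0")
     case True thus ?thesis using x[OF that(2)] e'0 by (simp add: inner_add_right add_nonpos_nonpos mult_nonneg_nonpos less_imp_le)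
    next
     case False
     hence "e' * (\<alpha> s \<bullet> y) <= e * (\<alpha> s \<bullet> y)" using \<open>e' <= e\<close> by (intro mult_right_mono) auto
     thus ?thesis using a by (simp add: inner_add_right)
    qed
   qed
   moreover have "\<alpha> t \<bullet> (x + e' *\<^sub>R y) <= 0"
   proof -
    have "e' * (\<alpha> t \<bullet> y) <= e' * (1 + \<bar>\<alpha> t \<bullet> y\<bar>)" using e'0 by (intro mult_left_mono) auto
    also have "\<dots> <= (- (\<alpha> t \<bullet> x) / (1 + \<bar>\<alpha> t \<bullet> y\<bar>)) * (1 + \<bar>\<alpha> t \<bullet> y\<bar>)"
     unfolding e'_def by (intro mult_right_mono) auto
    also have "\<dots> = - (\<alpha> t \<bullet> x)"
    proof -
     have "1 + \<bar>\<alpha> t \<bullet> y\<bar> ~= 0" by linarith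
     thus ?thesis by simp
    qed
    finally show ?thesis by (simp add: inner_add_right)
   qed
   ultimately show ?thesis using e'0 by blast
  qed
 qed
 from this[of UNIV] show ?thesis by simp
qed

text \<open>\<open>I\<close> collects the constraints that vanish on all of \<open>K\<close>.
  Averaging produces a point \<open>x\<close> of \<open>K\<close> at which the others are strict. A
  segment from any \<open>y\<close> in the cone of \<open>I\<close> can be prolonged a little past
  \<open>x\<close>, and the face property puts \<open>y\<close> into \<open>K\<close>.\<close>

lemma face_is_hcone:
 fixes \<alpha> :: "'s::finite => real^4"
 assumes K: "K face_of hcone \<alpha> {}" "K ~= {}"
 obtains I x where "K = hcone \<alpha> I" "x \<in> K" "!!s. s \<notin> I ==> \<alpha> s \<bullet> x < 0"
proof -
 define I where "I = {s. \<forall>x\<in>K. \<alpha> s \<bullet> x = 0}"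
 have Ksub: "K \<subseteq> hcone \<alpha> {}" and Kconv: "convex K" using K(1) face_of_imp_subset face_of_imp_convex by blast+
 have KI: "K \<subseteq> hcone \<alpha> I" using Ksub unfolding hcone_def I_def by auto
 have "\<exists>x\<in>K. \<forall>s\<in>J. s \<notin> I --> \<alpha> s \<bullet> x < 0" for J
 proof (induction J rule: finite_induct[OF finite])
  case 1 thus ?case using K(2) by auto
 next
  case (2 t J)
  then obtain x where x: "x \<in> K" "\<forall>s\<in>J. s \<notin> I --> \<alpha> s \<bullet> x < 0" by blast
  show ?case
  proof (cases "t \<in> I")
   case True thus ?thesis using x by auto
  next
   case False
   then obtain y where y: "y \<in> K" "\<alpha> t \<bullet> y ~= 0" unfolding I_def by auto
   have le: "\<alpha> s \<bullet> x <= 0" "\<alpha> s \<bullet> y <= 0" for s using x(1) y(1) Ksub unfolding hcone_def by auto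
   have "(1/2) *\<^sub>R x + (1/2) *\<^sub>R y \<in> K" by (rule convexD[OF Kconv x(1) y(1)]) auto
   moreover have "\<alpha> s \<bullet> ((1/2) *\<^sub>R x + (1/2) *\<^sub>R y) < 0" if "s \<in> insert t J" "s \<notin> I" for s
    using x(2) y(2) le[of s] le[of t] that by (auto simp: inner_add_right)
   ultimately show ?thesis by blast
  qed
 qed
 from this[of UNIV] obtain x where x: "x \<in> K" "!!s. s \<notin> I ==> \<alpha> s \<bullet> x < 0" by auto
 have "hcone \<alpha> I \<subseteq> K"
 proof
  fix y assume y: "y \<in> hcone \<alpha> I"
  have xh: "x \<in> hcone \<alpha> I" using x(1) KI by blast
  obtain e where e: "e > 0" "!!s. s \<notin> I ==> \<alpha> s \<bullet> (x + e *\<^sub>R (x - y)) <= 0"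
   using small_step[of I \<alpha> x "x - y"] x(2) by blast
  define z where "z = x + e *\<^sub>R (x - y)"
  have z: "z \<in> hcone \<alpha> {}"
  proof -
   have "\<alpha> s \<bullet> z <= 0" for s
   proof (cases "s \<in> I")
    case True thus ?thesis using xh y unfolding hcone_def z_def by (simp add: inner_add_right inner_diff_right)
   qed (use e in \<open>simp add: z_def\<close>)
   thus ?thesis unfolding hcone_def by simp
  qed
  have yC: "y \<in> hcone \<alpha> {}" using y hcone_mono[of "{}" I] by blast
  show "y \<in> K"
  proof (cases "y = x")
   case True thus ?thesis using x by simp
  next
   case False
   have "x = (1 - 1 / (1 + e)) *\<^sub>R y + (1 / (1 + e)) *\<^sub>R z"
   proof -
    have "(1 + e) *\<^sub>R x = e *\<^sub>R y + z" unfolding z_def by (simp add: algebra_simps)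
    hence "(1 / (1 + e)) *\<^sub>R ((1 + e) *\<^sub>R x) = (1 / (1 + e)) *\<^sub>R (e *\<^sub>R y + z)" by simp
    moreover have "1 - 1 / (1 + e) = e / (1 + e)" using e(1) by (simp add: field_simps)
    ultimately show ?thesis using e(1) by (simp add: scaleR_add_right)
   qed
   moreover have "y ~= z" using False e(1) unfolding z_def by (metis add_diff_cancel_left' diff_add_cancel eq_iff_diff_eq_0 scaleR_left.add scaleR_one add.commute calculation scaleR_collapse z_def)
   ultimately have "x \<in> open_segment y z" using e(1) unfolding in_segment
    by (intro conjI exI[of _ "1 / (1 + e)"]) (auto simp: field_simps)
   thus ?thesis using face_ofD[OF K(1) _ yC z x(1)] by blast
  qed
 qed
 thus ?thesis using that[of I x] KI x by blast
qed

lemma nd_independent: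
 assumes nd: "nd \<alpha> Q" and Q: "card Q = 4"
 shows "inj_on \<alpha> Q" "independent (\<alpha> ` Q)"
proof -
 have fin: "finite Q" using Q by (intro card_ge_0_finite) simp
 have "span (\<alpha> ` Q) = UNIV"
 proof (rule ccontr)
  assume "span (\<alpha> ` Q) ~= UNIV"
  then obtain x where x: "x ~= 0" "!!y. y \<in> span (\<alpha> ` Q) ==> orthogonal x y"
   using orthogonal_to_subspace_exists_gen[of "\<alpha> ` Q" UNIV] by (metis psubsetI span_UNIV subset_UNIV)
  have "\<alpha> s \<bullet> x = 0" if "s \<in> Q" for s
   using x(2)[OF span_base[of "\<alpha> s"]] that by (simp add: orthogonal_def inner_commute)
  thus False using nd x(1) unfolding nd_def by blast
 qed
 hence d: "dim (\<alpha> ` Q) = 4" using dim_span[of "\<alpha> ` Q"] by simp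
 have "card (\<alpha> ` Q) \<ge> 4" using dim_le_card'[of "\<alpha> ` Q"] d fin by simp
 hence c: "card (\<alpha> ` Q) = 4" using card_image_le[OF fin, of \<alpha>] Q by simp
 thus "inj_on \<alpha> Q" using Q fin by (intro eq_card_imp_inj_on) auto
 show "independent (\<alpha> ` Q)" 
  by (rule card_le_dim_spanning[of _ UNIV]) (use c fin \<open>span (\<alpha> ` Q) = UNIV\<close> in auto)
qed

text \<open>A point that is strict off \<open>I\<close> can be moved a little in every direction of
  the subspace \<open>Z\<close>, so the cone spans \<open>Z\<close>, whose dimension is known from
  the independence of the forms.\<close>

lemma dim_hcone:
 fixes \<alpha> :: "'s::finite => real^4"
 assumes nd: "nd \<alpha> Q" "card Q = 4" and I: "I \<subseteq> Q" and x: "x \<in> hcone \<alpha> I" "!!s. s \<notin> I ==> \<alpha> s \<bullet> x < 0"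
 shows "aff_dim (hcone \<alpha> I) = 4 - int (card I)"
proof -
 note ind = nd_independent[OF nd]
 have finI: "finite I" by simp
 define Z where "Z = {y. \<forall>s\<in>I. \<alpha> s \<bullet> y = 0}"
 have subZ: "subspace Z" unfolding Z_def subspace_def by (auto simp: inner_add_right)
 have "hcone \<alpha> I \<subseteq> Z" unfolding hcone_def Z_def by auto
 moreover have "Z \<subseteq> span (hcone \<alpha> I)"
 proof
  fix y assume y: "y \<in> Z"
  obtain e where e: "e > 0" "!!s. s \<notin> I ==> \<alpha> s \<bullet> (x + e *\<^sub>R y) <= 0" using small_step[of I \<alpha> x y] x(2) by blast
  have z: "x + e *\<^sub>R y \<in> hcone \<alpha> I"
   using e x(1) y unfolding hcone_def Z_def by (auto simp: inner_add_right) (metis inner_add_right inner_scaleR_right add.right_neutral mult_zero_right order_refl)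
  have "(1 / e) *\<^sub>R ((x + e *\<^sub>R y) - x) \<in> span (hcone \<alpha> I)"
   by (intro span_scale span_diff span_base z x(1))
  thus "y \<in> span (hcone \<alpha> I)" using e(1) by simp
 qed
 ultimately have "dim (hcone \<alpha> I) = dim Z" by (metis dim_mono dim_span dim_subset le_antisym)
 moreover have "dim Z + card I = 4"
 proof -
  have Zo: "Z = {y \<in> UNIV. \<forall>a\<in>span (\<alpha> ` I). orthogonal a y}"
  proof (intro set_eqI iffI)
   fix y assume "y \<in> Z"
   hence "!!b. b \<in> \<alpha> ` I ==> orthogonal y b" unfolding Z_def by (auto simp: orthogonal_def inner_commute)
   thus "y \<in> {y \<in> UNIV. \<forall>a\<in>span (\<alpha> ` I). orthogonal a y}" using orthogonal_to_span orthogonal_commute by blast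
  next
   fix y assume "y \<in> {y \<in> UNIV. \<forall>a\<in>span (\<alpha> ` I). orthogonal a y}"
   thus "y \<in> Z" unfolding Z_def by (auto simp: orthogonal_def intro: span_base)
  qed
  have "dim {y \<in> UNIV. \<forall>a\<in>span (\<alpha> ` I). orthogonal a y} + dim (span (\<alpha> ` I)) = dim (UNIV :: (real^4) set)"
   by (rule dim_subspace_orthogonal_to_vectors) auto
  moreover have "dim (span (\<alpha> ` I)) = card I"
  proof -
   have "independent (\<alpha> ` I)" using ind(2) I by (meson image_mono independent_mono)
   hence "dim (\<alpha> ` I) = card (\<alpha> ` I)" by (rule dim_eq_card_independent)
   also have "\<dots> = card I" using ind(1) I by (meson card_image inj_on_subset)
   finally show ?thesis by simp
  qed
  ultimately show ?thesis unfolding Zo by simp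
 qed
 ultimately show ?thesis using aff_dim_zero[OF hull_inc[OF hcone_0[of \<alpha> I]]] by simp
qed

section \<open>The mirror polyhedron of a vertex system\<close>

locale vertex_system =
 fixes T :: "('s::finite set \<times> 's) set" and L \<alpha> p
 assumes st: "stk UNIV T L" and vs: "VS UNIV T \<alpha> p"
begin

lemma cell: assumes "\<tau> \<in> fst ` T" shows "card \<tau> = 3" "\<exists>d. d \<notin> \<tau> & nd \<alpha> (insert d \<tau>) & card (insert d \<tau>) = 4"
proof -
 obtain d where d: "(\<tau>, d) \<in> T" using assms by auto
 have c: "card \<tau> = 3" "d \<notin> \<tau>" using stk_cell[OF st d] by auto
 thus "card \<tau> = 3" "\<exists>d. d \<notin> \<tau> & nd \<alpha> (insert d \<tau>) & card (insert d \<tau>) = 4" using VS_nd[OF st vs d] by auto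
qed

lemma p_hcone: assumes "\<tau> \<in> fst ` T" "I \<subseteq> \<tau>" shows "p \<tau> \<in> hcone \<alpha> I"
proof -
 have "\<alpha> s \<bullet> p \<tau> <= 0" for s using VS_D[OF vs assms(1), of s] by (cases "s \<in> \<tau>") auto
 thus ?thesis unfolding hcone_def using VS_D(1)[OF vs assms(1)] assms(2) by auto
qed

text \<open>The sum of all vertices on the face works. For \<open>s\<close> outside \<open>I\<close>
  one of these vertices avoids the face \<open>s\<close>: either \<open>\<tau>\<close> itself or its
  neighbour away from \<open>s\<close>.\<close>

lemma interior_point:
 assumes \<tau>: "\<tau> \<in> fst ` T" "I \<subseteq> \<tau>"
 obtains x where "x \<in> hcone \<alpha> I" "!!s. s \<notin> I ==> \<alpha> s \<bullet> x < 0"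
proof -
 define N where "N = {\<tau>' \<in> fst ` T. I \<subseteq> \<tau>'}"
 define x where "x = (\<Sum>\<tau>'\<in>N. p \<tau>')"
 have finN: "finite N" by simp
 have e: "\<alpha> s \<bullet> x = (\<Sum>\<tau>'\<in>N. \<alpha> s \<bullet> p \<tau>')" for s unfolding x_def by (simp add: inner_sum_right)
 have le: "\<alpha> s \<bullet> p \<tau>' <= 0" if "\<tau>' \<in> N" for s \<tau>' using p_hcone[of \<tau>' I] that unfolding N_def hcone_def by blast
 have z: "\<alpha> s \<bullet> x = 0" if "s \<in> I" for s
  unfolding e using p_hcone[of _ I] that unfolding N_def hcone_def by (intro sum.neutral) blast
 have ng: "\<alpha> s \<bullet> x < 0" if s: "s \<notin> I" for s
 proof -
  have "\<exists>\<tau>'\<in>N. s \<notin> \<tau>'"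
  proof (cases "s \<in> \<tau>")
   case False thus ?thesis using \<tau> unfolding N_def by blast
  next
   case True
   obtain u where u: "u \<notin> \<tau>" "insert u (\<tau> - {s}) \<in> fst ` T" by (rule stk_neighbour[OF st \<tau>(1) True])
   have "I \<subseteq> insert u (\<tau> - {s})" "s \<notin> insert u (\<tau> - {s})" using \<tau>(2) s u(1) True by auto
   thus ?thesis using u(2) unfolding N_def by blast
  qed
  then obtain \<tau>' where t: "\<tau>' \<in> N" "s \<notin> \<tau>'" by blast
  have "\<alpha> s \<bullet> p \<tau>' < 0" using VS_D(2)[OF vs, of \<tau>' s] t unfolding N_def by blast
  moreover have "(\<Sum>\<tau>'\<in>N - {\<tau>'}. \<alpha> s \<bullet> p \<tau>') <= 0" using le by (intro sum_nonpos) auto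
  ultimately show ?thesis unfolding e using sum.remove[OF finN t(1), of "\<lambda>\<tau>'. \<alpha> s \<bullet> p \<tau>'"] by simp
 qed
 have "\<alpha> s \<bullet> x <= 0" for s using z[of s] ng[of s] by (cases "s \<in> I") auto
 hence "x \<in> hcone \<alpha> I" unfolding hcone_def using z by blast
 thus ?thesis using that ng by blast
qed

lemma hface_mono_iff:
 assumes "\<tau> \<in> fst ` T" "I \<subseteq> \<tau>" shows "hface \<alpha> I \<subseteq> hface \<alpha> J \<longleftrightarrow> J \<subseteq> I"
proof
 obtain x where x: "x \<in> hcone \<alpha> I" "!!s. s \<notin> I ==> \<alpha> s \<bullet> x < 0" by (rule interior_point[OF assms]) blast
 assume "hface \<alpha> I \<subseteq> hface \<alpha> J"
 hence "x \<in> hcone \<alpha> J" using x(1) unfolding hface_subset by blast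
 thus "J \<subseteq> I" using x(2) unfolding hcone_def by force
qed (simp add: hface_subset hcone_mono)

lemma dim_face: assumes "\<tau> \<in> fst ` T" "I \<subseteq> \<tau>" shows "aff_dim (hcone \<alpha> I) = 4 - int (card I)"
proof -
 obtain x where x: "x \<in> hcone \<alpha> I" "!!s. s \<notin> I ==> \<alpha> s \<bullet> x < 0" by (rule interior_point[OF assms]) blast
 obtain d where "nd \<alpha> (insert d \<tau>)" "card (insert d \<tau>) = 4" using cell(2)[OF assms(1)] by blast
 thus ?thesis by (rule dim_hcone[OF _ _ _ x]) (use assms(2) in auto)
qed

lemma pointed: assumes "x ~= 0" "x \<in> hcone \<alpha> {}" shows "\<exists>\<tau>\<in>fst ` T. {s. \<alpha> s \<bullet> x = 0} \<subseteq> \<tau>"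
 using VS_face[OF st vs assms(1)] assms(2) unfolding hcone_def by simp

lemma T_ne: "fst ` T ~= {}" using stk_cover[OF st] by blast

text \<open>A relatively interior point of the face is nonzero, since \<open>k <= 3\<close> excludes
  the apex of the cone. \<open>pointed\<close> then places the active constraints inside a vertex,
  where \<open>dim_face\<close> identifies their number.\<close>

lemma codim_face_iff:
 assumes k: "1 <= k" "k <= 3"
 shows "codim_face k (hface \<alpha> {}) F \<longleftrightarrow> (\<exists>I. card I = k & (\<exists>\<tau>\<in>fst ` T. I \<subseteq> \<tau>) & F = hface \<alpha> I)"
proof
 assume F: "codim_face k (hface \<alpha> {}) F"
 define K where "K = cone_over F"
 have Kf: "K face_of hcone \<alpha> {}" and Kd: "aff_dim K = 4 - int k" and FP: "F \<subseteq> hface \<alpha> {}"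
  using F unfolding codim_face_def cone_over_hface K_def by auto
 have F0: "F = ray ` (K - {0})" unfolding K_def
  by (rule ray_cone_over[symmetric]) (use FP in \<open>auto simp: hface_def\<close>)
 have "K ~= {}" unfolding K_def cone_over_def by simp
 then obtain I x where I: "K = hcone \<alpha> I" "x \<in> K" "!!s. s \<notin> I ==> \<alpha> s \<bullet> x < 0" by (rule face_is_hcone[OF Kf]) blast
 have "x ~= 0"
 proof
  assume "x = 0"
  hence "I = UNIV" using I(3) by force
  have "K \<subseteq> {0}"
  proof
   fix y assume y: "y \<in> K"
   obtain \<tau> where "\<tau> \<in> fst ` T" using T_ne by blast
   then obtain d where "nd \<alpha> (insert d \<tau>)" using cell(2) by blast
   thus "y \<in> {0}" using y unfolding I(1) \<open>I = UNIV\<close> hcone_def nd_def by blast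
  qed
  hence "aff_dim K <= 0" by (metis aff_dim_sing aff_dim_subset)
  thus False using Kd k by simp
 qed
 have xC: "x \<in> hcone \<alpha> {}" using I(1,2) hcone_mono[of "{}" I] by blast
 obtain \<tau> where \<tau>: "\<tau> \<in> fst ` T" "{s. \<alpha> s \<bullet> x = 0} \<subseteq> \<tau>" using pointed[OF \<open>x ~= 0\<close> xC] by blast
 have "I \<subseteq> \<tau>" using \<tau>(2) I(1,2) unfolding hcone_def by blast
 hence "card I = k" using dim_face[OF \<tau>(1)] Kd unfolding I(1) by simp
 thus "\<exists>I. card I = k & (\<exists>\<tau>\<in>fst ` T. I \<subseteq> \<tau>) & F = hface \<alpha> I"
  using \<tau>(1) \<open>I \<subseteq> \<tau>\<close> F0 I(1) unfolding hface_def by blast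
next
 assume "\<exists>I. card I = k & (\<exists>\<tau>\<in>fst ` T. I \<subseteq> \<tau>) & F = hface \<alpha> I"
 then obtain I \<tau> where I: "card I = k" "\<tau> \<in> fst ` T" "I \<subseteq> \<tau>" "F = hface \<alpha> I" by blast
 show "codim_face k (hface \<alpha> {}) F"
  unfolding codim_face_def I(4) cone_over_hface hface_subset
  using hcone_mono[of "{}" I \<alpha>] hcone_face dim_face[OF I(2,3)] I(1) by simp
qed

lemma P_eq: "hface \<alpha> {} = ray ` {x. x ~= 0 & (\<forall>s. \<alpha> s \<bullet> x <= 0)}"
 unfolding hface_def hcone_def by (rule arg_cong[of _ _ "image ray"]) auto

lemma polyhedron: "projective_polyhedron (hface \<alpha> {})"
 unfolding projective_polyhedron_def
proof (intro conjI)
 have top: "topspace proj_top = ray ` (- {0})" unfolding proj_top_def by simp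
 have pre: "{x \<in> topspace (top_of_set (- {0})). ray x \<in> ray ` (- {0}) - hface \<alpha> {}} = - {0} \<inter> - hcone \<alpha> {}"
 proof -
  have "ray x \<in> hface \<alpha> {} \<longleftrightarrow> x \<in> hcone \<alpha> {}" if "x ~= 0" for x
  proof -
   have "x \<in> cone_over (hface \<alpha> {}) \<longleftrightarrow> ray x \<in> hface \<alpha> {}" using that unfolding cone_over_def by simp
   thus ?thesis unfolding cone_over_hface by simp
  qed
  thus ?thesis by auto
 qed
 show "closedin proj_top (hface \<alpha> {})"
  unfolding closedin_def top
 proof
  show "hface \<alpha> {} \<subseteq> ray ` (- {0})" unfolding hface_def by auto
  have "open (- {0} \<inter> - hcone \<alpha> {})" using closed_hcone[of \<alpha> "{}"] by (intro open_Int) auto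
  hence "openin (top_of_set (- {0})) (- {0} \<inter> - hcone \<alpha> {})" by (simp add: openin_open_Int open_Compl closed_hcone)
  thus "openin proj_top (ray ` (- {0}) - hface \<alpha> {})"
   unfolding proj_top_def openin_quotient_topology pre by auto
 qed
 \<comment> \<open>The forms are nonpositive on the cone and have no common zero except the origin,
   so minus their sum is positive on the rest of the cone and its chart contains the whole
   polyhedron.\<close>
 define \<beta> where "\<beta> = - (\<Sum>s\<in>UNIV. \<alpha> s)"
 have \<beta>: "\<beta> \<bullet> x = - (\<Sum>s\<in>UNIV. \<alpha> s \<bullet> x)" for x unfolding \<beta>_def by (simp add: inner_sum_left)
 have \<beta>pos: "\<beta> \<bullet> x > 0" if x: "x \<in> hcone \<alpha> {}" "x ~= 0" for x
 proof -
  have le: "\<alpha> s \<bullet> x <= 0" for s using x(1) unfolding hcone_def by simp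
  have "\<exists>s. \<alpha> s \<bullet> x < 0"
  proof (rule ccontr)
   assume "\<not> ?thesis"
   hence z: "\<alpha> s \<bullet> x = 0" for s using le[of s] by (metis less_eq_real_def)
   obtain \<tau> where "\<tau> \<in> fst ` T" using T_ne by blast
   then obtain d where "nd \<alpha> (insert d \<tau>)" using cell(2) by blast
   thus False using z x(2) unfolding nd_def by blast
  qed
  then obtain s where s: "\<alpha> s \<bullet> x < 0" by blast
  have "(\<Sum>s\<in>UNIV. \<alpha> s \<bullet> x) = \<alpha> s \<bullet> x + (\<Sum>s\<in>UNIV - {s}. \<alpha> s \<bullet> x)" by (rule sum.remove) auto
  moreover have "(\<Sum>s\<in>UNIV - {s}. \<alpha> s \<bullet> x) <= 0" using le by (intro sum_nonpos) auto
  ultimately show ?thesis unfolding \<beta> using s by linarith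
 qed
 obtain \<tau>0 where \<tau>0: "\<tau>0 \<in> fst ` T" using T_ne by blast
 obtain x0 where x0: "x0 \<in> hcone \<alpha> {}" "!!s. \<alpha> s \<bullet> x0 < 0" by (rule interior_point[OF \<tau>0, of "{}"]) auto
 have x0ne: "x0 ~= 0" using x0(2) by force
 have in_hface: "ray x \<in> hface \<alpha> {} \<longleftrightarrow> x \<in> hcone \<alpha> {}" if "x ~= 0" for x
 proof -
  have "x \<in> cone_over (hface \<alpha> {}) \<longleftrightarrow> ray x \<in> hface \<alpha> {}" using that unfolding cone_over_def by simp
  thus ?thesis unfolding cone_over_hface by simp
 qed
 have slice: "{x. \<beta> \<bullet> x = 1 & ray x \<in> hface \<alpha> {}} = {x. \<beta> \<bullet> x = 1} \<inter> hcone \<alpha> {}"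
 proof -
  have "\<beta> \<bullet> x = 1 ==> x ~= 0" for x by auto
  thus ?thesis using in_hface by blast
 qed
 show "properly_convex (hface \<alpha> {})"
  unfolding properly_convex_def
 proof (intro exI[of _ \<beta>] conjI)
  show "\<beta> ~= 0" using \<beta>pos[OF x0(1) x0ne] by auto
  show "hface \<alpha> {} \<subseteq> ray ` {x. 0 < \<beta> \<bullet> x}" unfolding hface_def using \<beta>pos by blast
  show "convex {x. \<beta> \<bullet> x = 1 & ray x \<in> hface \<alpha> {}}" unfolding slice by (intro convex_Int convex_hyperplane convex_hcone)
  show "bounded {x. \<beta> \<bullet> x = 1 & ray x \<in> hface \<alpha> {}}"
  proof -
   \<comment> \<open>Compactness: \<open>\<beta>\<close> has a positive minimum on the unit vectors
     of the cone, and its inverse bounds the slice.\<close>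
   define B where "B = sphere 0 1 \<inter> hcone \<alpha> {}"
   have cB: "compact B" unfolding B_def by (intro compact_Int_closed closed_hcone compact_sphere)
   have "(1 / norm x0) *\<^sub>R x0 \<in> B" unfolding B_def using x0ne hcone_scale[OF x0(1), of "1 / norm x0"] by simp
   hence Bne: "B ~= {}" by blast
   have "continuous_on B (\<lambda>x. \<beta> \<bullet> x)" by (intro continuous_intros)
   from continuous_attains_inf[OF cB Bne this] obtain b where b: "b \<in> B" "!!x. x \<in> B ==> \<beta> \<bullet> b <= \<beta> \<bullet> x" by blast
   have m: "\<beta> \<bullet> b > 0" using b(1) unfolding B_def by (intro \<beta>pos) auto
   have "norm x <= 1 / (\<beta> \<bullet> b)" if x: "\<beta> \<bullet> x = 1" "x \<in> hcone \<alpha> {}" for x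
   proof -
    have xn: "norm x > 0" using x(1) by auto
    hence "(1 / norm x) *\<^sub>R x \<in> B" unfolding B_def using hcone_scale[OF x(2), of "1 / norm x"] by simp
    hence "\<beta> \<bullet> b <= 1 / norm x" using b(2) x(1) by fastforce
    thus ?thesis using xn m by (simp add: field_simps)
   qed
   thus ?thesis unfolding slice bounded_iff by blast
  qed
 qed
 show "proj_top interior_of (hface \<alpha> {}) ~= {}"
 proof -
  define V where "V = {x. \<forall>s. \<alpha> s \<bullet> x < 0}"
  have Vinter: "V = (\<Inter>s. {x. \<alpha> s \<bullet> x < 0})" unfolding V_def by auto
  have oV: "open V" unfolding Vinter by (intro open_INT) (auto intro: open_halfspace_lt)
  have V0: "x ~= 0" if "x \<in> V" for x using that unfolding V_def by force
  have pre: "{x \<in> topspace (top_of_set (- {0})). ray x \<in> ray ` V} = V"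
  proof -
   have "x \<in> V" if "ray x = ray y" "y \<in> V" for x y
    using ray_eqD[of y x] that unfolding V_def by (auto simp: mult_pos_neg)
   thus ?thesis using V0 by auto
  qed
  have "openin proj_top (ray ` V)"
   unfolding proj_top_def openin_quotient_topology pre
  proof
   show "ray ` V \<subseteq> ray ` topspace (top_of_set (- {0}))" using V0 by auto
   show "openin (top_of_set (- {0})) V" by (rule open_subset[OF _ oV]) (use V0 in auto)
  qed
  moreover have "ray ` V \<subseteq> hface \<alpha> {}" unfolding hface_def hcone_def V_def using V0 V_def by (auto simp: less_imp_le)
  ultimately have "ray ` V \<subseteq> proj_top interior_of (hface \<alpha> {})" by (intro interior_of_maximal)
  moreover have "x0 \<in> V" using x0 unfolding V_def by blast
  ultimately show ?thesis by blast
 qed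
 show "\<exists>A. finite A & hface \<alpha> {} = ray ` {x. x ~= 0 & (\<forall>\<alpha>\<in>A. \<alpha> \<bullet> x <= 0)}"
  by (rule exI[of _ "range \<alpha>"]) (simp add: P_eq)
qed

lemma face_bij: "bij_betw (\<lambda>s. hface \<alpha> {s}) UNIV {F. codim_face 1 (hface \<alpha> {}) F}"
proof -
 have cov: "\<exists>\<tau>\<in>fst ` T. {s} \<subseteq> \<tau>" for s using stk_cover[OF st, of s] by blast
 have "inj (\<lambda>s. hface \<alpha> {s})"
 proof (rule injI)
  fix s t assume "hface \<alpha> {s} = hface \<alpha> {t}"
  moreover obtain \<tau> where "\<tau> \<in> fst ` T" "{s} \<subseteq> \<tau>" using cov by blast
  ultimately have "{t} \<subseteq> {s}" using hface_mono_iff by blast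
  thus "s = t" by simp
 qed
 moreover have "range (\<lambda>s. hface \<alpha> {s}) = {F. codim_face 1 (hface \<alpha> {}) F}"
 proof -
  have "codim_face 1 (hface \<alpha> {}) F \<longleftrightarrow> (\<exists>s. F = hface \<alpha> {s})" for F
  proof -
   have one: "(1::nat) <= 1" "(1::nat) <= 3" by simp_all
   have "codim_face 1 (hface \<alpha> {}) F \<longleftrightarrow> (\<exists>I. card I = 1 & (\<exists>\<tau>\<in>fst ` T. I \<subseteq> \<tau>) & F = hface \<alpha> I)"
    by (rule codim_face_iff[OF one])
   also have "\<dots> \<longleftrightarrow> (\<exists>s. F = hface \<alpha> {s})"
   proof
    assume "\<exists>I. card I = 1 & (\<exists>\<tau>\<in>fst ` T. I \<subseteq> \<tau>) & F = hface \<alpha> I"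
    then obtain I where I: "card I = 1" "F = hface \<alpha> I" by (elim exE conjE)
    from I(1) obtain s where "I = {s}" by (rule card_1_singletonE)
    thus "\<exists>s. F = hface \<alpha> {s}" using I(2) by auto
   next
    assume "\<exists>s. F = hface \<alpha> {s}"
    then obtain s where s: "F = hface \<alpha> {s}" ..
    have "card {s} = 1" by simp
    thus "\<exists>I. card I = 1 & (\<exists>\<tau>\<in>fst ` T. I \<subseteq> \<tau>) & F = hface \<alpha> I" using cov[of s] s by (intro exI[of _ "{s}"] conjI)
   qed
   finally show ?thesis .
  qed
  thus ?thesis by auto
 qed
 ultimately show ?thesis unfolding bij_betw_def by blast
qed

lemma adjacent_adj:
 assumes "adjacent_in (hface \<alpha> {}) (hface \<alpha> {s}) (hface \<alpha> {t})" shows "adj T s t"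
proof -
 obtain e where e: "codim_face 2 (hface \<alpha> {}) e" "e \<subseteq> hface \<alpha> {s}" "e \<subseteq> hface \<alpha> {t}" and ne: "s ~= t"
  using assms unfolding adjacent_in_def by auto
 obtain I \<tau> where I: "\<tau> \<in> fst ` T" "I \<subseteq> \<tau>" "e = hface \<alpha> I" using e(1) codim_face_iff[of 2 e] by auto
 have "s \<in> I" "t \<in> I" using e(2,3) hface_mono_iff[OF I(1,2)] unfolding I(3) by auto
 thus ?thesis using I ne by (intro adjI[OF I(1)]) auto
qed

theorem mirror:
 assumes two: "!!s. \<alpha> s \<bullet> v s = 2"
  and adj: "!!s t. adj T s t ==> \<alpha> s \<bullet> v t <= 0 & (\<alpha> s \<bullet> v t = 0 \<longleftrightarrow> \<alpha> t \<bullet> v s = 0) & (\<exists>\<theta>. has_dihedral_angle \<alpha> v s t \<theta>)"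
 shows "mirror_polyhedron (hface \<alpha> {}) (\<lambda>s. hface \<alpha> {s}) \<alpha> v"
 unfolding mirror_polyhedron_def
proof (intro conjI allI impI polyhedron face_bij two P_eq)
 fix s x assume x: "x ~= 0 & ray x \<in> hface \<alpha> {s}"
 hence "x \<in> cone_over (hface \<alpha> {s})" unfolding cone_over_def by simp
 thus "reflection (\<alpha> s) (v s) x = x" unfolding cone_over_hface hcone_def reflection_def by simp
next
 fix s t assume "adjacent_in (hface \<alpha> {}) (hface \<alpha> {s}) (hface \<alpha> {t})"
 hence "adj T s t" by (rule adjacent_adj)
 from adj[OF this] show "0 <= - (\<alpha> s \<bullet> v t)" "(\<alpha> s \<bullet> v t = 0) = (\<alpha> t \<bullet> v s = 0)" "\<exists>\<theta>. has_dihedral_angle \<alpha> v s t \<theta>" by auto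
qed

theorem realizes:
 assumes bij: "bij_betw \<tau> (pverts G) (fst ` T)" and \<tau>: "!!u. \<tau> u = {s. u \<in> face_verts (mark s)}"
  and arcs: "!!u w. u \<in> pverts G ==> w \<in> pverts G ==> u ~= w ==> (u, w) \<in> parcs G \<longleftrightarrow> (\<exists>s t. s ~= t & {s, t} \<subseteq> \<tau> u \<inter> \<tau> w)"
 shows "realizes_graph G mark (hface \<alpha> {}) (\<lambda>s. hface \<alpha> {s})"
 unfolding realizes_graph_def
proof (intro exI[of _ "\<lambda>u. hface \<alpha> (\<tau> u)"] conjI ballI impI allI)
 have \<tau>T: "\<tau> u \<in> fst ` T" if "u \<in> pverts G" for u using bij that unfolding bij_betw_def by blast
 have sub: "hface \<alpha> (\<tau> u) \<subseteq> hface \<alpha> I \<longleftrightarrow> I \<subseteq> \<tau> u" if "u \<in> pverts G" for u I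
  using hface_mono_iff[OF \<tau>T[OF that] order_refl] .
 show "bij_betw (\<lambda>u. hface \<alpha> (\<tau> u)) (pverts G) {q. codim_face 3 (hface \<alpha> {}) q}"
  unfolding bij_betw_def
 proof
  show "inj_on (\<lambda>u. hface \<alpha> (\<tau> u)) (pverts G)"
  proof (rule inj_onI)
   fix u w assume uw: "u \<in> pverts G" "w \<in> pverts G" "hface \<alpha> (\<tau> u) = hface \<alpha> (\<tau> w)"
   hence "\<tau> u = \<tau> w" using sub[OF uw(1), of "\<tau> w"] sub[OF uw(2), of "\<tau> u"] by auto
   thus "u = w" using bij uw(1,2) unfolding bij_betw_def by (meson inj_onD)
  qed
  show "(\<lambda>u. hface \<alpha> (\<tau> u)) ` pverts G = {q. codim_face 3 (hface \<alpha> {}) q}"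
  proof (intro set_eqI iffI)
   fix q assume "q \<in> (\<lambda>u. hface \<alpha> (\<tau> u)) ` pverts G"
   then obtain u where u: "u \<in> pverts G" "q = hface \<alpha> (\<tau> u)" by blast
   hence "card (\<tau> u) = 3" using cell(1)[OF \<tau>T] by blast
   thus "q \<in> {q. codim_face 3 (hface \<alpha> {}) q}" using \<tau>T[OF u(1)] u(2) codim_face_iff[of 3 q] by auto
  next
   fix q assume "q \<in> {q. codim_face 3 (hface \<alpha> {}) q}"
   then obtain I \<tau>' where I: "card I = 3" "\<tau>' \<in> fst ` T" "I \<subseteq> \<tau>'" "q = hface \<alpha> I" using codim_face_iff[of 3 q] by auto
   hence "I = \<tau>'" using cell(1)[OF I(2)] by (intro card_subset_eq) (auto intro: card_ge_0_finite)
   moreover obtain u where "u \<in> pverts G" "\<tau>' = \<tau> u" using bij I(2) unfolding bij_betw_def by blast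
   ultimately show "q \<in> (\<lambda>u. hface \<alpha> (\<tau> u)) ` pverts G" using I(4) by blast
  qed
 qed
 fix u assume u: "u \<in> pverts G"
 show "hface \<alpha> (\<tau> u) \<subseteq> hface \<alpha> {s} \<longleftrightarrow> u \<in> face_verts (mark s)" for s
  unfolding sub[OF u] using \<tau>[of u] by auto
 fix w assume w: "w \<in> pverts G" "u ~= w"
 show "(u, w) \<in> parcs G \<longleftrightarrow> (\<exists>e. codim_face 2 (hface \<alpha> {}) e & hface \<alpha> (\<tau> u) \<subseteq> e & hface \<alpha> (\<tau> w) \<subseteq> e)"
  unfolding arcs[OF u w]
 proof
  assume "\<exists>s t. s ~= t & {s, t} \<subseteq> \<tau> u \<inter> \<tau> w"
  then obtain s t where s: "s ~= t" "{s,t} \<subseteq> \<tau> u" "{s,t} \<subseteq> \<tau> w" by blast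
  have two: "(1::nat) <= 2" "(2::nat) <= 3" by simp_all
  have "codim_face 2 (hface \<alpha> {}) (hface \<alpha> {s,t})"
   unfolding codim_face_iff[OF two]
   by (intro exI[of _ "{s,t}"] conjI bexI[of _ "\<tau> u"] refl s(2) \<tau>T[OF u]) (use s(1) in simp)
  thus "\<exists>e. codim_face 2 (hface \<alpha> {}) e & hface \<alpha> (\<tau> u) \<subseteq> e & hface \<alpha> (\<tau> w) \<subseteq> e"
   using sub[OF u] sub[OF w(1)] s by blast
 next
  assume "\<exists>e. codim_face 2 (hface \<alpha> {}) e & hface \<alpha> (\<tau> u) \<subseteq> e & hface \<alpha> (\<tau> w) \<subseteq> e"
  then obtain e where e: "codim_face 2 (hface \<alpha> {}) e" "hface \<alpha> (\<tau> u) \<subseteq> e" "hface \<alpha> (\<tau> w) \<subseteq> e" by blast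
  obtain I where I: "card I = 2" "e = hface \<alpha> I" using e(1) codim_face_iff[of 2 e] by auto
  have "I \<subseteq> \<tau> u" "I \<subseteq> \<tau> w" using e(2,3) sub[OF u] sub[OF w(1)] I(2) by auto
  thus "\<exists>s t. s ~= t & {s, t} \<subseteq> \<tau> u \<inter> \<tau> w" using I(1) by (auto simp: card_2_iff)
 qed
qed

end

text \<open>The reflection fixes \<open>face s\<close> pointwise, so the cone over it lies in the
  kernel of \<open>\<alpha> s\<close>, and a comparison of dimensions shows that it is the full
  slice. Incidences thus become the vanishing of forms, and a nonzero point on the ray over each
  vertex can serve as \<open>p\<close>.\<close>

theorem mirror_vertices:
 fixes \<alpha> v :: "'s::finite => real^4"
 assumes st: "stk UNIV T L" and M: "mirror_polyhedron P face \<alpha> v" and R: "realizes_graph G mark P face"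
  and bij: "bij_betw \<tau> (pverts G) (fst ` T)" and \<tau>: "!!u. \<tau> u = {s. u \<in> face_verts (mark s)}"
  and arcs: "!!u w. u \<in> pverts G ==> w \<in> pverts G ==> u ~= w ==> (u, w) \<in> parcs G \<longleftrightarrow> (\<exists>s t. s ~= t & {s, t} \<subseteq> \<tau> u \<inter> \<tau> w)"
 shows "\<exists>p. VS UNIV T \<alpha> p" and "!!s t. adj T s t ==> adjacent_in P (face s) (face t)"
proof -
 have Peq: "P = hface \<alpha> {}" using M unfolding mirror_polyhedron_def hface_def hcone_def by (auto intro!: arg_cong[of _ _ "image ray"])
 have fbij: "bij_betw face UNIV {F. codim_face 1 P F}" and two: "!!s. \<alpha> s \<bullet> v s = 2"
  and refl: "!!s x. x ~= 0 ==> ray x \<in> face s ==> reflection (\<alpha> s) (v s) x = x"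
  using M unfolding mirror_polyhedron_def by auto
 have face1: "codim_face 1 P (face s)" for s using fbij unfolding bij_betw_def by blast
 have \<alpha>0: "\<alpha> s ~= 0" for s using two[of s] by auto
 have v0: "v s ~= 0" for s using two[of s] by auto
 have Ksub: "cone_over (face s) \<subseteq> hcone \<alpha> {s}" for s
 proof
  fix x assume x: "x \<in> cone_over (face s)"
  have "cone_over (face s) \<subseteq> hcone \<alpha> {}" using face1[of s] unfolding codim_face_def Peq cone_over_hface using face_of_imp_subset by blast
  hence xC: "x \<in> hcone \<alpha> {}" using x by blast
  show "x \<in> hcone \<alpha> {s}"
  proof (cases "x = 0")
   case True thus ?thesis using hcone_0 by simp
  next
   case False
   hence "ray x \<in> face s" using x unfolding cone_over_def by simp
   hence "(\<alpha> s \<bullet> x) *\<^sub>R v s = 0" using refl[OF False] unfolding reflection_def by simp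
   thus ?thesis using v0[of s] xC unfolding hcone_def by simp
  qed
 qed
 \<comment> \<open>A proper face would have smaller dimension, but the slice lies in a hyperplane
   and has dimension at most 3.\<close>
 have K_eq: "cone_over (face s) = hcone \<alpha> {s}" for s
 proof -
  have f: "cone_over (face s) face_of hcone \<alpha> {}" "aff_dim (cone_over (face s)) = 3"
   using face1[of s] unfolding codim_face_def Peq cone_over_hface by auto
  have f2: "cone_over (face s) face_of hcone \<alpha> {s}"
   by (rule face_of_subset[OF f(1) Ksub hcone_mono]) simp
  have "hcone \<alpha> {s} \<subseteq> {x. \<alpha> s \<bullet> x = 0}" unfolding hcone_def by auto
  hence "aff_dim (hcone \<alpha> {s}) <= aff_dim {x. \<alpha> s \<bullet> x = 0}" by (rule aff_dim_subset)
  hence le: "aff_dim (hcone \<alpha> {s}) <= 3" using aff_dim_hyperplane[OF \<alpha>0[of s], of 0] by simp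
  show ?thesis
  proof (rule ccontr)
   assume "cone_over (face s) ~= hcone \<alpha> {s}"
   from face_of_aff_dim_lt[OF convex_hcone f2 this] show False using f(2) le by simp
  qed
 qed
 have in_face: "F \<subseteq> face s" if F: "F \<subseteq> P" and z: "!!x. x \<in> cone_over F ==> \<alpha> s \<bullet> x = 0" for F s
 proof
  fix y assume y: "y \<in> F"
  then obtain x where x: "y = ray x" "x ~= 0" "x \<in> hcone \<alpha> {}" using F unfolding Peq hface_def by auto
  have "x \<in> cone_over F" using x y unfolding cone_over_def by simp
  hence "x \<in> hcone \<alpha> {s}" using z x(3) unfolding hcone_def by simp
  thus "y \<in> face s" using x unfolding K_eq[symmetric] cone_over_def by auto
 qed
 obtain \<psi> where \<psi>: "bij_betw \<psi> (pverts G) {q. codim_face 3 P q}"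
  and \<psi>arc: "!!u w. u \<in> pverts G ==> w \<in> pverts G ==> u ~= w ==> (u, w) \<in> parcs G \<longleftrightarrow> (\<exists>e. codim_face 2 P e & \<psi> u \<subseteq> e & \<psi> w \<subseteq> e)"
  and \<psi>face: "!!u s. u \<in> pverts G ==> \<psi> u \<subseteq> face s \<longleftrightarrow> u \<in> face_verts (mark s)"
 proof -
  from R[unfolded realizes_graph_def] obtain \<psi> where a: "bij_betw \<psi> (pverts G) {q. codim_face 3 P q}"
   "\<forall>u\<in>pverts G. \<forall>w\<in>pverts G. u ~= w --> ((u, w) \<in> parcs G \<longleftrightarrow> (\<exists>e. codim_face 2 P e & \<psi> u \<subseteq> e & \<psi> w \<subseteq> e))"
   "\<forall>s. \<forall>u\<in>pverts G. \<psi> u \<subseteq> face s \<longleftrightarrow> u \<in> face_verts (mark s)" by (elim exE conjE)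
  show thesis
  proof (rule that[OF a(1)])
   show "(u, w) \<in> parcs G \<longleftrightarrow> (\<exists>e. codim_face 2 P e & \<psi> u \<subseteq> e & \<psi> w \<subseteq> e)" if "u \<in> pverts G" "w \<in> pverts G" "u ~= w" for u w
    by (rule a(2)[rule_format, OF that])
   show "\<psi> u \<subseteq> face s \<longleftrightarrow> u \<in> face_verts (mark s)" if "u \<in> pverts G" for u s using a(3) that by simp
  qed
 qed
 have "\<exists>x. x ~= 0 & x \<in> cone_over (\<psi> u) & (\<forall>s. \<alpha> s \<bullet> x <= 0 & (\<alpha> s \<bullet> x = 0 \<longleftrightarrow> s \<in> \<tau> u))" if u: "u \<in> pverts G" for u
 proof -
  have c: "codim_face 3 P (\<psi> u)" using \<psi> u unfolding bij_betw_def by blast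
  define K where "K = cone_over (\<psi> u)"
  have Kf: "K face_of hcone \<alpha> {}" and d: "aff_dim K = 1" and sub: "\<psi> u \<subseteq> P"
   using c unfolding codim_face_def K_def Peq cone_over_hface by auto
  have K0: "0 \<in> K" unfolding K_def cone_over_def by simp
  have "\<not> K \<subseteq> {0}"
  proof
   assume "K \<subseteq> {0}" hence "aff_dim K <= 0" by (metis aff_dim_sing aff_dim_subset)
   thus False using d by simp
  qed
  then obtain x where x: "x \<in> K" "x ~= 0" by auto
  have dimK: "dim K = 1" using d aff_dim_zero[OF hull_inc[OF K0]] by simp
  have line: "\<exists>t. y = t *\<^sub>R x" if "y \<in> K" for y
  proof (rule ccontr)
   assume n: "\<not> (\<exists>t. y = t *\<^sub>R x)"
   hence "y \<notin> span {x}" by (auto simp: span_singleton)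
   moreover have "independent {x}" using x(2) by simp
   ultimately have "independent {y, x}" using independent_insert by metis
   moreover have "y ~= x" using n by (metis scaleR_one)
   ultimately have "dim {y, x} = 2" using dim_eq_card_independent by fastforce
   moreover have "dim {y, x} <= dim K" using that x(1) by (intro dim_subset) auto
   ultimately show False using dimK by simp
  qed
  have xC: "x \<in> hcone \<alpha> {}" using x(1) Kf face_of_imp_subset by blast
  have "\<alpha> s \<bullet> x = 0 \<longleftrightarrow> s \<in> \<tau> u" for s
  proof
   assume z: "\<alpha> s \<bullet> x = 0"
   have "\<psi> u \<subseteq> face s"
   proof (rule in_face[OF sub])
    fix y assume "y \<in> cone_over (\<psi> u)"
    then obtain t where "y = t *\<^sub>R x" using line unfolding K_def by blast
    thus "\<alpha> s \<bullet> y = 0" using z by simp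
   qed
   thus "s \<in> \<tau> u" using \<psi>face[OF u] \<tau> by auto
  next
   assume "s \<in> \<tau> u"
   hence "\<psi> u \<subseteq> face s" using \<psi>face[OF u] \<tau> by auto
   hence "K \<subseteq> cone_over (face s)" unfolding K_def cone_over_def by auto
   thus "\<alpha> s \<bullet> x = 0" using x(1) unfolding K_eq hcone_def by auto
  qed
  thus ?thesis using x xC unfolding K_def hcone_def by blast
 qed
 hence "\<exists>q. \<forall>u\<in>pverts G. q u ~= 0 & q u \<in> cone_over (\<psi> u) & (\<forall>s. \<alpha> s \<bullet> q u <= 0 & (\<alpha> s \<bullet> q u = 0 \<longleftrightarrow> s \<in> \<tau> u))"
  by (intro bchoice ballI)
 then obtain q where q: "\<forall>u\<in>pverts G. q u ~= 0 & q u \<in> cone_over (\<psi> u) & (\<forall>s. \<alpha> s \<bullet> q u <= 0 & (\<alpha> s \<bullet> q u = 0 \<longleftrightarrow> s \<in> \<tau> u))" ..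
 define p where "p tr = q (inv_into (pverts G) \<tau> tr)" for tr
 have p\<tau>: "p (\<tau> u) = q u" if "u \<in> pverts G" for u
  unfolding p_def using bij that unfolding bij_betw_def by (simp add: inv_into_f_f)
 show "\<exists>p. VS UNIV T \<alpha> p"
 proof (rule exI[of _ p])
  show "VS UNIV T \<alpha> p"
   unfolding VS_def
  proof
   fix tr assume "tr \<in> fst ` T"
   then obtain u where u: "u \<in> pverts G" "tr = \<tau> u" using bij unfolding bij_betw_def by blast
   have "\<alpha> s \<bullet> q u <= 0 & (\<alpha> s \<bullet> q u = 0 \<longleftrightarrow> s \<in> \<tau> u)" for s using q u(1) by blast
   thus "(\<forall>s\<in>tr. \<alpha> s \<bullet> p tr = 0) & (\<forall>s\<in>UNIV - tr. \<alpha> s \<bullet> p tr < 0)"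
    unfolding u(2) p\<tau>[OF u(1)] by (metis DiffD2 less_eq_real_def)
  qed
 qed
 fix s t assume st': "adj T s t"
 hence ne: "s ~= t" unfolding adj_def by blast
 \<comment> \<open>The two ends of \<open>st\<close> give two vertices that are joined in the graph.
   The cone over the geometric edge between them has dimension 2 and is therefore spanned by these
   vertices, so the edge lies in both faces.\<close>
 obtain x y where xy: "x ~= y" "ends T s t = {x, y}" using stk_ends[OF st st'] by blast
 have "x \<in> ends T s t" "y \<in> ends T s t" using xy(2) by auto
 hence c: "{s,t,x} \<in> fst ` T" "{s,t,y} \<in> fst ` T" and xn: "x ~= s" "x ~= t" "y ~= s" "y ~= t" unfolding ends_def by auto
 obtain u where u: "u \<in> pverts G" "\<tau> u = {s,t,x}" using c(1) bij unfolding bij_betw_def by (metis imageE)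
 obtain w where w: "w \<in> pverts G" "\<tau> w = {s,t,y}" using c(2) bij unfolding bij_betw_def by (metis imageE)
 have xw: "x \<notin> \<tau> w" using xn xy(1) unfolding w(2) by auto
 hence uw: "u ~= w" using u(2) by auto
 have "(u, w) \<in> parcs G" unfolding arcs[OF u(1) w(1) uw] u(2) w(2) using ne by blast
 then obtain e where e: "codim_face 2 P e" "\<psi> u \<subseteq> e" "\<psi> w \<subseteq> e" using \<psi>arc[OF u(1) w(1) uw] by blast
 have qu: "q u ~= 0" "q u \<in> cone_over (\<psi> u)" "\<alpha> x \<bullet> q u = 0" "\<alpha> s \<bullet> q u = 0" "\<alpha> t \<bullet> q u = 0" using q u by auto
 have qw: "q w \<in> cone_over (\<psi> w)" "\<alpha> x \<bullet> q w ~= 0" "\<alpha> s \<bullet> q w = 0" "\<alpha> t \<bullet> q w = 0" using q w xw by auto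
 define K where "K = cone_over e"
 have eP: "e \<subseteq> P" and d: "aff_dim K = 2" using e(1) unfolding codim_face_def K_def by auto
 have K0: "0 \<in> K" unfolding K_def cone_over_def by simp
 have dimK: "dim K = 2" using d aff_dim_zero[OF hull_inc[OF K0]] by simp
 have qK: "q u \<in> K" "q w \<in> K" using qu(2) qw(1) e(2,3) unfolding K_def cone_over_def by auto
 have "q w \<notin> span {q u}" using qu(3) qw(2) by (auto simp: span_singleton)
 hence ind: "independent {q w, q u}" and nw: "q w ~= q u" using qu(1) independent_insert[of "q w" "{q u}"] qw(2) qu(3) by auto
 have "K \<subseteq> span {q w, q u}"
  by (rule card_ge_dim_independent[OF _ ind]) (use qK dimK nw in auto)
 hence z: "\<alpha> r \<bullet> y = 0" if "y \<in> cone_over e" "\<alpha> r \<bullet> q u = 0" "\<alpha> r \<bullet> q w = 0" for r y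
 proof -
  have "y \<in> span {q w, q u}" using that(1) \<open>K \<subseteq> span {q w, q u}\<close> unfolding K_def by blast
  moreover have "subspace {y. \<alpha> r \<bullet> y = 0}" by (simp add: subspace_hyperplane)
  ultimately have "y \<in> {y. \<alpha> r \<bullet> y = 0}" using span_minimal[of "{q w, q u}" "{y. \<alpha> r \<bullet> y = 0}"] that by blast
  thus ?thesis by simp
 qed
 have "e \<subseteq> face s" by (rule in_face[OF eP]) (rule z[OF _ qu(4) qw(3)])
 moreover have "e \<subseteq> face t" by (rule in_face[OF eP]) (rule z[OF _ qu(5) qw(4)])
 moreover have "face s ~= face t" using fbij ne unfolding bij_betw_def by (meson injD)
 ultimately show "adjacent_in P (face s) (face t)" unfolding adjacent_in_def using e(1) by blast
qed

section \<open>From graphs to stacks\<close>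

definition nbrs :: "'v pair_pre_digraph => 'v => 'v set" where
 "nbrs G u = {w. (u, w) \<in> parcs G}"

lemma pair_graphD:
 assumes "pair_graph G"
 shows "finite (pverts G)" "finite (parcs G)" "(u, w) \<in> parcs G ==> u \<in> pverts G" "(u, w) \<in> parcs G ==> w \<in> pverts G"
  "(u, w) \<in> parcs G ==> u ~= w" "(u, w) \<in> parcs G ==> (w, u) \<in> parcs G"
proof -
 interpret pair_graph G by (rule assms)
 show "finite (pverts G)" "finite (parcs G)" by (rule finite_verts finite_arcs)+
 show "(u, w) \<in> parcs G ==> u \<in> pverts G" "(u, w) \<in> parcs G ==> w \<in> pverts G" by (auto dest: in_arcsD1 in_arcsD2)
 show "(u, w) \<in> parcs G ==> u ~= w" using no_loops' by auto
 show "(u, w) \<in> parcs G ==> (w, u) \<in> parcs G" by (rule arcs_symmetric)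
qed

lemma edge_iff: assumes "pair_graph G" shows "{u, w} \<in> edges G \<longleftrightarrow> (u, w) \<in> parcs G"
 unfolding edges_def using pair_graphD(6)[OF assms] by (auto simp: doubleton_eq_iff)

lemma edgeE: assumes "e \<in> edges G" obtains u w where "e = {u, w}" "(u, w) \<in> parcs G"
 using assms unfolding edges_def by blast

lemma finite_edges: assumes "pair_graph G" shows "finite (edges G)"
proof -
 have "edges G = (\<lambda>(u, w). {u, w}) ` parcs G" unfolding edges_def by auto
 thus ?thesis using pair_graphD(2)[OF assms] by simp
qed

text \<open>Cycles modulo 2, as symmetric predicates on arcs.\<close>

definition flow :: "'v pair_pre_digraph => ('v => 'v => bool) => bool" where
 "flow G \<psi> \<longleftrightarrow> (\<forall>u w. (u, w) \<in> parcs G --> \<psi> u w = \<psi> w u) &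
   (\<forall>u\<in>pverts G. even (card {w \<in> nbrs G u. \<psi> u w}))"

lemma even_card_three:
 assumes "N = {x,y,z}" "distinct [x,y,z]"
 shows "even (card {w \<in> N. P w}) \<longleftrightarrow> ((P x ~= P y) = P z)"
proof -
 have "card {w \<in> N. P w} = (\<Sum>w\<in>N. if P w then 1 else 0)"
  using assms(1) by (simp add: sum.If_cases Int_def)
 also have "\<dots> = (if P x then 1 else 0) + (if P y then 1 else 0) + (if P z then 1 else 0)"
  using assms by simp
 finally show ?thesis by simp
qed

text \<open>Equivalently, the edges outside \<open>N\<close> contain no cycle. In a connected graph
  the smallest size of such a set is the cycle rank \<open>E - V + 1\<close>.\<close>

definition determining :: "'v pair_pre_digraph => 'v set set => bool" where
 "determining G N \<longleftrightarrow> N \<subseteq> edges G &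
   (\<forall>\<psi>. flow G \<psi> & (\<forall>u w. {u, w} \<in> N --> \<not> \<psi> u w) --> (\<forall>u w. (u, w) \<in> parcs G --> \<not> \<psi> u w))"

text \<open>Names for what \<open>truncation\<close> quantifies: \<open>v\<close> is cut off,
  \<open>x\<close>, \<open>y\<close>, \<open>z\<close> are its neighbours and \<open>a\<close>,
  \<open>b\<close>, \<open>c\<close> the new vertices. One of the latter may be \<open>v\<close>
  again, so they are disjoint only from the remaining vertices.\<close>

locale trunc =
 fixes G G' :: "'v pair_pre_digraph" and v x y z a b c
 assumes pG: "pair_graph G" and pG': "pair_graph G'" and v: "v \<in> pverts G"
  and dx: "distinct [x,y,z]" and nv: "nbrs G v = {x,y,z}"
  and da: "distinct [a,b,c]" and new: "{a,b,c} \<inter> (pverts G - {v}) = {}"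
  and V': "pverts G' = (pverts G - {v}) \<union> {a,b,c}"
  and E': "edges G' = {e \<in> edges G. v \<notin> e} \<union> {{a, x}, {b, y}, {c, z}, {a, b}, {b, c}, {c, a}}"
begin

definition "t u = (if u = x then a else if u = y then b else c)"
definition "h u w = (if w = v then t u else w)"
text \<open>Embeds the arcs of \<open>G\<close> into those of \<open>G'\<close>: an end at
  \<open>v\<close> moves to the corner of the triangle that belongs to the other end.\<close>

definition "\<kappa> = (\<lambda>(u, w). (h w u, h u w))"

lemma t: "t x = a" "t y = b" "t z = c" using dx unfolding t_def by auto

lemma xV: "x \<in> pverts G" "y \<in> pverts G" "z \<in> pverts G" "x ~= v" "y ~= v" "z ~= v"
 "(v,x) \<in> parcs G" "(v,y) \<in> parcs G" "(v,z) \<in> parcs G" "(x,v) \<in> parcs G" "(y,v) \<in> parcs G" "(z,v) \<in> parcs G"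
proof -
 show "(v,x) \<in> parcs G" "(v,y) \<in> parcs G" "(v,z) \<in> parcs G" using nv unfolding nbrs_def by auto
 thus "x \<in> pverts G" "y \<in> pverts G" "z \<in> pverts G" "x ~= v" "y ~= v" "z ~= v"
  "(x,v) \<in> parcs G" "(y,v) \<in> parcs G" "(z,v) \<in> parcs G" using pair_graphD(4-6)[OF pG] by blast+
qed

lemma ndisj: "u \<in> pverts G ==> u ~= v ==> u ~= a & u ~= b & u ~= c"
 using new by auto

lemma v_arc: "(v, w) \<in> parcs G \<longleftrightarrow> w = x \<or> w = y \<or> w = z" "(w, v) \<in> parcs G \<longleftrightarrow> w = x \<or> w = y \<or> w = z"
proof -
 show "(v, w) \<in> parcs G \<longleftrightarrow> w = x \<or> w = y \<or> w = z" using nv unfolding nbrs_def by blast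
 thus "(w, v) \<in> parcs G \<longleftrightarrow> w = x \<or> w = y \<or> w = z" using pair_graphD(6)[OF pG] by blast
qed

lemma arcs': "(u, w) \<in> parcs G' \<longleftrightarrow> ((u, w) \<in> parcs G & u ~= v & w ~= v) \<or>
  (u, w) \<in> {(a,x),(x,a),(b,y),(y,b),(c,z),(z,c),(a,b),(b,a),(b,c),(c,b),(c,a),(a,c)}"
 unfolding edge_iff[OF pG', symmetric] E'
 by (auto simp: edge_iff[OF pG] doubleton_eq_iff)

lemma nbrs_new: "nbrs G' a = {x,b,c}" "nbrs G' b = {y,c,a}" "nbrs G' c = {z,a,b}" 
proof -
 have V: "(u, w) \<in> parcs G ==> u ~= v ==> u ~= a & u ~= b & u ~= c" for u w using pair_graphD(3)[OF pG] ndisj by blast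
 have X: "x ~= a" "x ~= b" "x ~= c" "y ~= a" "y ~= b" "y ~= c" "z ~= a" "z ~= b" "z ~= c" using xV ndisj by auto
 show "nbrs G' a = {x,b,c}" "nbrs G' b = {y,c,a}" "nbrs G' c = {z,a,b}"
  unfolding nbrs_def arcs' using V X da by auto
qed

lemma nbrs_old: assumes u: "u \<in> pverts G" "u ~= v" shows "nbrs G' u = h u ` nbrs G u" "inj_on (h u) (nbrs G u)"
proof -
 have n: "u ~= a" "u ~= b" "u ~= c" using ndisj u by auto
 have w: "w \<in> nbrs G' u \<longleftrightarrow> (w \<in> nbrs G u & w ~= v) \<or> (v \<in> nbrs G u & w = t u)" for w
  unfolding nbrs_def mem_Collect_eq arcs' v_arc using n u(2) dx by (auto simp: t_def)
 thus "nbrs G' u = h u ` nbrs G u" unfolding h_def by (auto simp: image_iff)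
 have "t u \<in> {a,b,c}" unfolding t_def by auto
 moreover have "w \<in> nbrs G u ==> w ~= v ==> w \<notin> {a,b,c}" for w using pair_graphD(4)[OF pG] ndisj unfolding nbrs_def by blast
 ultimately show "inj_on (h u) (nbrs G u)" unfolding h_def inj_on_def by metis
qed

lemma \<kappa>_arc: "(u, w) \<in> parcs G ==> \<kappa> (u, w) \<in> parcs G'"
 unfolding \<kappa>_def h_def using v_arc(1)[of w] v_arc(2)[of u] t pair_graphD(5)[OF pG] by (auto simp: arcs')

lemma \<kappa>_v: "\<kappa> (v,x) = (a,x)" "\<kappa> (x,v) = (x,a)" "\<kappa> (v,y) = (b,y)" "\<kappa> (y,v) = (y,b)" "\<kappa> (v,z) = (c,z)" "\<kappa> (z,v) = (z,c)"
 using xV t unfolding \<kappa>_def h_def by auto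

lemma \<kappa>_image: "(a,x) \<in> \<kappa> ` parcs G" "(x,a) \<in> \<kappa> ` parcs G" "(b,y) \<in> \<kappa> ` parcs G" "(y,b) \<in> \<kappa> ` parcs G"
 "(c,z) \<in> \<kappa> ` parcs G" "(z,c) \<in> \<kappa> ` parcs G"
 unfolding \<kappa>_v[symmetric] by (rule imageI, rule xV)+

lemma arcs'_\<kappa>: "parcs G' = \<kappa> ` parcs G \<union> {(a,b),(b,a),(b,c),(c,b),(c,a),(a,c)}"
proof
 have k: "\<kappa> (u, w) = (u, w)" if "u ~= v" "w ~= v" for u w using that unfolding \<kappa>_def h_def by simp
 have k2: "\<kappa> (v,x) = (a,x)" "\<kappa> (x,v) = (x,a)" "\<kappa> (v,y) = (b,y)" "\<kappa> (y,v) = (y,b)" "\<kappa> (v,z) = (c,z)" "\<kappa> (z,v) = (z,c)"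
  using xV t unfolding \<kappa>_def h_def by auto
 show "parcs G' \<subseteq> \<kappa> ` parcs G \<union> {(a,b),(b,a),(b,c),(c,b),(c,a),(a,c)}"
 proof (rule subrelI)
  fix u w assume "(u, w) \<in> parcs G'"
  hence "((u, w) \<in> parcs G & u ~= v & w ~= v) \<or> (u, w) \<in> {(a,x),(x,a),(b,y),(y,b),(c,z),(z,c)}
   \<or> (u, w) \<in> {(a,b),(b,a),(b,c),(c,b),(c,a),(a,c)}" unfolding arcs' by simp
  then consider "(u, w) \<in> parcs G & u ~= v & w ~= v" | "(u, w) \<in> {(a,x),(x,a),(b,y),(y,b),(c,z),(z,c)}"
   | "(u, w) \<in> {(a,b),(b,a),(b,c),(c,b),(c,a),(a,c)}" by argo
  thus "(u, w) \<in> \<kappa> ` parcs G \<union> {(a,b),(b,a),(b,c),(c,b),(c,a),(a,c)}"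
  proof cases
   case 1 thus ?thesis using k by (metis UnI1 image_eqI)
  next
   case 2
   thus ?thesis by (elim insertE emptyE) (simp_all add: \<kappa>_image)
  qed blast
 qed
 show "\<kappa> ` parcs G \<union> {(a,b),(b,a),(b,c),(c,b),(c,a),(a,c)} \<subseteq> parcs G'"
  using \<kappa>_arc by (auto simp: arcs')
qed

lemma \<kappa>_swap: "\<kappa> (w, u) = prod.swap (\<kappa> (u, w))" unfolding \<kappa>_def by simp

lemma card_verts: "card (pverts G') = card (pverts G) + 2"
proof -
 have "card ((pverts G - {v}) \<union> {a,b,c}) = card (pverts G - {v}) + card {a,b,c}"
  using pair_graphD(1)[OF pG] new by (intro card_Un_disjoint) auto
 moreover have "card (pverts G) = Suc (card (pverts G - {v}))" using pair_graphD(1)[OF pG] v by (metis card.remove)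
 ultimately show ?thesis unfolding V' using da by simp
qed

definition "kE e = (if v \<in> e then insert (t (THE w. w \<in> e & w ~= v)) (e - {v}) else e)"

lemma kE: "(u, w) \<in> parcs G ==> kE {u, w} = {fst (\<kappa> (u, w)), snd (\<kappa> (u, w))}"
proof -
 assume uw: "(u, w) \<in> parcs G"
 hence ne: "u ~= w" using pair_graphD(5)[OF pG] by blast
 have "u = v ==> (THE p. p \<in> {u, w} & p ~= v) = w" "w = v ==> (THE p. p \<in> {u, w} & p ~= v) = u"
  using ne by (auto intro!: the_equality)
 thus ?thesis using ne unfolding kE_def \<kappa>_def h_def by auto
qed

lemma edges'_kE: "edges G' = kE ` edges G \<union> {{a,b},{b,c},{c,a}}"
proof -
 have "e \<in> edges G' \<longleftrightarrow> e \<in> kE ` edges G \<or> e \<in> {{a,b},{b,c},{c,a}}" for e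
 proof
  assume "e \<in> edges G'"
  then obtain u w where e: "e = {u, w}" "(u, w) \<in> parcs G'" by (rule edgeE)
  from e(2)[unfolded arcs'_\<kappa>] show "e \<in> kE ` edges G \<or> e \<in> {{a,b},{b,c},{c,a}}"
  proof
   assume "(u, w) \<in> \<kappa> ` parcs G"
   then obtain p q where p: "(p, q) \<in> parcs G" "(u, w) = \<kappa> (p, q)" by auto
   hence "e = kE {p, q}" using kE[OF p(1)] e(1) by (metis fst_conv snd_conv)
   thus ?thesis using p(1) edge_iff[OF pG] by blast
  next
   assume "(u, w) \<in> {(a,b),(b,a),(b,c),(c,b),(c,a),(a,c)}"
   thus ?thesis unfolding e(1) by auto
  qed
 next
  assume "e \<in> kE ` edges G \<or> e \<in> {{a,b},{b,c},{c,a}}"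
  thus "e \<in> edges G'"
  proof
   assume "e \<in> kE ` edges G"
   then obtain p q where p: "(p, q) \<in> parcs G" "e = kE {p, q}" by (metis edgeE imageE)
   have "(fst (\<kappa> (p, q)), snd (\<kappa> (p, q))) \<in> parcs G'" using \<kappa>_arc[OF p(1)] by simp
   thus ?thesis unfolding p(2) kE[OF p(1)] by (simp add: edge_iff[OF pG'])
  next
   assume "e \<in> {{a,b},{b,c},{c,a}}" thus ?thesis unfolding E' by blast
  qed
 qed
 thus ?thesis by blast
qed

text \<open>An edge can be reconstructed from its image: it contains \<open>v\<close> exactly if the
  image meets the new triangle, and then \<open>v\<close> takes the place of that corner.\<close>

lemma kE_inj: "inj_on kE (edges G)"
proof (rule inj_onI)
 fix e f assume e: "e \<in> edges G" and f: "f \<in> edges G" and eq: "kE e = kE f"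
 have rec: "e = (if kE e \<inter> {a,b,c} = {} then e else insert v (kE e - {a,b,c})) & (kE e \<inter> {a,b,c} = {} \<longleftrightarrow> v \<notin> e) & (v \<notin> e --> kE e = e)"
  if "e \<in> edges G" for e
 proof -
  obtain u w where uw: "e = {u, w}" "(u, w) \<in> parcs G" using \<open>e \<in> edges G\<close> by (rule edgeE)
  have ne: "u ~= w" "u \<in> pverts G" "w \<in> pverts G" using pair_graphD(3-5)[OF pG] uw(2) by blast+
  have tin: "t p \<in> {a,b,c}" for p unfolding t_def by auto
  have nin: "p ~= v ==> p \<in> {u,w} ==> p \<notin> {a,b,c}" for p using ndisj ne by blast
  show ?thesis unfolding uw(1) kE[OF uw(2)] \<kappa>_def h_def using ne tin nin by (cases "u = v"; cases "w = v") auto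
 qed
 show "e = f" using rec[OF e] rec[OF f] eq by metis
qed

lemma card_edges: "card (edges G') = card (edges G) + 3"
proof -
 have i: "kE e \<notin> {{a,b},{b,c},{c,a}}" if e: "e \<in> edges G" for e
 proof -
  obtain u w where uw: "e = {u, w}" "(u, w) \<in> parcs G" using e by (rule edgeE)
  have ne: "u ~= w" "u \<in> pverts G" "w \<in> pverts G" using pair_graphD(3-5)[OF pG] uw(2) by blast+
  hence "\<exists>p\<in>kE e. p \<notin> {a,b,c}" unfolding uw(1) kE[OF uw(2)] \<kappa>_def h_def using ndisj by (cases "u = v") auto
  thus ?thesis by auto
 qed
 have "card (kE ` edges G \<union> {{a,b},{b,c},{c,a}}) = card (kE ` edges G) + card {{a,b},{b,c},{c,a}}"
  using finite_edges[OF pG] i by (intro card_Un_disjoint) auto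
 moreover have "card {{a,b},{b,c},{c,a}} = 3" using da by (auto simp: card_insert_if doubleton_eq_iff)
 ultimately show ?thesis unfolding edges'_kE using card_image[OF kE_inj] by simp
qed

lemma nbrs_card: "(!!u. u \<in> pverts G ==> card (nbrs G u) = 3) ==> u \<in> pverts G' ==> card (nbrs G' u) = 3"
proof -
 assume c: "!!u. u \<in> pverts G ==> card (nbrs G u) = 3" and u: "u \<in> pverts G'"
 have X: "x ~= b" "x ~= c" "y ~= c" "y ~= a" "z ~= a" "z ~= b" using xV ndisj by auto
 show ?thesis
 proof (cases "u \<in> {a,b,c}")
  case True thus ?thesis using nbrs_new da X by auto
 next
  case False
  hence "u \<in> pverts G" "u ~= v" using u unfolding V' by auto
  thus ?thesis using nbrs_old[of u] card_image c by metis
 qed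
qed

text \<open>Adding the parity conditions at \<open>a\<close>, \<open>b\<close>, \<open>c\<close>
  counts each triangle edge twice, and what is left is the condition at \<open>v\<close>.\<close>

lemma flow_contract:
 assumes "flow G' \<psi>"
 shows "flow G (\<lambda>u w. \<psi> (fst (\<kappa> (u, w))) (snd (\<kappa> (u, w))))"
 unfolding flow_def
proof (intro conjI allI impI ballI)
 have sym: "(u, w) \<in> parcs G' ==> \<psi> u w = \<psi> w u" for u w using assms unfolding flow_def by blast
 have ev: "u \<in> pverts G' ==> even (card {w \<in> nbrs G' u. \<psi> u w})" for u using assms unfolding flow_def by blast
 fix u w assume uw: "(u, w) \<in> parcs G"
 show "\<psi> (fst (\<kappa> (u, w))) (snd (\<kappa> (u, w))) = \<psi> (fst (\<kappa> (w, u))) (snd (\<kappa> (w, u)))"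
  using sym[of "fst (\<kappa> (u, w))" "snd (\<kappa> (u, w))"] \<kappa>_arc[OF uw] unfolding \<kappa>_swap[of w u] by simp
next
 have sym: "(u, w) \<in> parcs G' ==> \<psi> u w = \<psi> w u" for u w using assms unfolding flow_def by blast
 have ev: "u \<in> pverts G' ==> even (card {w \<in> nbrs G' u. \<psi> u w})" for u using assms unfolding flow_def by blast
 fix u assume u: "u \<in> pverts G"
 show "even (card {w \<in> nbrs G u. \<psi> (fst (\<kappa> (u, w))) (snd (\<kappa> (u, w)))})"
 proof (cases "u = v")
  case False
  have k: "\<kappa> (u, w) = (u, h u w)" if "w \<in> nbrs G u" for w using False unfolding \<kappa>_def h_def by simp
  have "{w \<in> nbrs G' u. \<psi> u w} = h u ` {w \<in> nbrs G u. \<psi> (fst (\<kappa> (u, w))) (snd (\<kappa> (u, w)))}"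
   unfolding nbrs_old(1)[OF u False] using k by auto
  moreover have "inj_on (h u) {w \<in> nbrs G u. \<psi> (fst (\<kappa> (u, w))) (snd (\<kappa> (u, w)))}"
   using nbrs_old(2)[OF u False] by (rule inj_on_subset) blast
  ultimately have "card {w \<in> nbrs G' u. \<psi> u w} = card {w \<in> nbrs G u. \<psi> (fst (\<kappa> (u, w))) (snd (\<kappa> (u, w)))}"
   by (simp add: card_image)
  thus ?thesis using ev[of u] u False unfolding V' by simp
 next
  case True
  have k: "\<kappa> (v,x) = (a,x)" "\<kappa> (v,y) = (b,y)" "\<kappa> (v,z) = (c,z)"
   using xV t unfolding \<kappa>_def h_def by auto
  have X: "distinct [x,b,c]" "distinct [y,c,a]" "distinct [z,a,b]" using xV ndisj da by auto
  have "(\<psi> a x ~= \<psi> a b) = \<psi> a c" using ev[of a] even_card_three[OF nbrs_new(1) X(1)] unfolding V' by blast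
  moreover have "(\<psi> b y ~= \<psi> b c) = \<psi> b a" using ev[of b] even_card_three[OF nbrs_new(2) X(2)] unfolding V' by blast
  moreover have "(\<psi> c z ~= \<psi> c a) = \<psi> c b" using ev[of c] even_card_three[OF nbrs_new(3) X(3)] unfolding V' by blast
  moreover have "\<psi> a b = \<psi> b a" "\<psi> b c = \<psi> c b" "\<psi> c a = \<psi> a c" using sym by (auto simp: arcs')
  ultimately have "(\<psi> a x ~= \<psi> b y) = \<psi> c z" by argo
  thus ?thesis unfolding True even_card_three[OF nv dx] k by simp
 qed
qed

text \<open>A flow that vanishes on the image of \<open>N\<close> vanishes on all old edges. It is
  then constant around the triangle, and the additional edge \<open>e\<close> makes this constant
  zero.\<close>

lemma determining_new:
 assumes N: "determining G N" and e: "e \<in> {{a,b},{b,c},{c,a}}"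
 shows "determining G' (insert e (kE ` N))"
 unfolding determining_def
proof (intro conjI allI impI)
 show "insert e (kE ` N) \<subseteq> edges G'" using N e unfolding determining_def edges'_kE by blast
 fix \<psi> u w assume A: "flow G' \<psi> & (\<forall>u w. {u, w} \<in> insert e (kE ` N) --> \<not> \<psi> u w)" and uw: "(u, w) \<in> parcs G'"
 define \<psi>0 where "\<psi>0 = (\<lambda>u w. \<psi> (fst (\<kappa> (u, w))) (snd (\<kappa> (u, w))))"
 have sym: "(u, w) \<in> parcs G' ==> \<psi> u w = \<psi> w u" for u w using A unfolding flow_def by blast
 have ev: "u \<in> pverts G' ==> even (card {w \<in> nbrs G' u. \<psi> u w})" for u using A unfolding flow_def by blast
 have "flow G \<psi>0" unfolding \<psi>0_def using flow_contract A by blast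
 moreover have "\<not> \<psi>0 p q" if "{p, q} \<in> N" for p q
 proof -
  have pq: "(p, q) \<in> parcs G" using N that edge_iff[OF pG] unfolding determining_def by blast
  hence "{fst (\<kappa> (p, q)), snd (\<kappa> (p, q))} \<in> insert e (kE ` N)" using kE[OF pq] that by blast
  thus ?thesis using A unfolding \<psi>0_def by blast
 qed
 ultimately have "flow G \<psi>0 & (\<forall>u w. {u, w} \<in> N --> \<not> \<psi>0 u w)" by blast
 from mp[OF spec[OF conjunct2[OF N[unfolded determining_def]], of \<psi>0] this]
 have z0: "\<not> \<psi>0 p q" if "(p, q) \<in> parcs G" for p q using that by simp
 have z1: "\<not> \<psi> p q" if "(p, q) \<in> \<kappa> ` parcs G" for p q
 proof -
  obtain r s where rs: "(r, s) \<in> parcs G" "\<kappa> (r, s) = (p, q)" using \<open>(p, q) \<in> \<kappa> ` parcs G\<close> by (metis imageE surj_pair)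
  show ?thesis using z0[OF rs(1)] unfolding \<psi>0_def rs(2) by simp
 qed
 have k: "\<kappa> (v,x) = (a,x)" "\<kappa> (v,y) = (b,y)" "\<kappa> (v,z) = (c,z)"
  using xV t unfolding \<kappa>_def h_def by auto
 have o: "\<not> \<psi> a x" "\<not> \<psi> b y" "\<not> \<psi> c z" by (rule z1, rule \<kappa>_image)+
 have X: "distinct [x,b,c]" "distinct [y,c,a]" "distinct [z,a,b]" using xV ndisj da by auto
 have "(\<psi> a x ~= \<psi> a b) = \<psi> a c" using ev[of a] even_card_three[OF nbrs_new(1) X(1)] unfolding V' by blast
 moreover have "(\<psi> b y ~= \<psi> b c) = \<psi> b a" using ev[of b] even_card_three[OF nbrs_new(2) X(2)] unfolding V' by blast
 moreover have "(\<psi> c z ~= \<psi> c a) = \<psi> c b" using ev[of c] even_card_three[OF nbrs_new(3) X(3)] unfolding V' by blast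
 moreover have s: "\<psi> a b = \<psi> b a" "\<psi> b c = \<psi> c b" "\<psi> c a = \<psi> a c" using sym by (auto simp: arcs')
 moreover have "\<not> \<psi> a b \<or> \<not> \<psi> b c \<or> \<not> \<psi> c a" using A e by blast
 ultimately have "\<not> \<psi> a b & \<not> \<psi> b a & \<not> \<psi> b c & \<not> \<psi> c b & \<not> \<psi> c a & \<not> \<psi> a c" using o by argo
 thus "\<not> \<psi> u w" using uw z1 unfolding arcs'_\<kappa> by blast
qed

lemma card_insert_kE:
 assumes "N \<subseteq> edges G" "e \<in> {{a,b},{b,c},{c,a}}"
 shows "card (insert e (kE ` N)) = card N + 1"
proof -
 have "finite N" using assms(1) finite_edges[OF pG] finite_subset by blast
 have "e \<notin> kE ` N"
 proof
  assume "e \<in> kE ` N"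
  then obtain f where f: "f \<in> edges G" "e = kE f" using assms by blast
  obtain u w where uw: "f = {u, w}" "(u, w) \<in> parcs G" using f(1) by (rule edgeE)
  have ne: "u ~= w" "u \<in> pverts G" "w \<in> pverts G" using pair_graphD(3-5)[OF pG] uw(2) by blast+
  hence "\<exists>p\<in>kE f. p \<notin> {a,b,c}" unfolding uw(1) kE[OF uw(2)] \<kappa>_def h_def using ndisj by (cases "u = v") auto
  thus False using f assms(2) by auto
 qed
 moreover have "card (kE ` N) = card N" using kE_inj assms(1) by (meson card_image inj_on_subset)
 ultimately show ?thesis using \<open>finite N\<close> by simp
qed

end

section \<open>Connectedness and cycle rank of ecimahedra\<close>

lemma truncationE:
 assumes "truncation G G'" "pair_graph G"
 obtains v x y z a b c where "trunc G G' v x y z a b c"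
proof -
 from assms(1) obtain v x y z a b c where "v \<in> pverts G" "distinct [x, y, z]" "{w. (v, w) \<in> parcs G} = {x, y, z}"
    "distinct [a, b, c]" "{a, b, c} \<inter> (pverts G - {v}) = {}"
    "pverts G' = (pverts G - {v}) \<union> {a, b, c}"
    "edges G' = {e \<in> edges G. v \<notin> e} \<union> {{a, x}, {b, y}, {c, z}, {a, b}, {b, c}, {c, a}}" "pair_graph G'"
  unfolding truncation_def by (elim bexE exE conjE)
 hence "trunc G G' v x y z a b c" using assms(2) unfolding trunc_def nbrs_def by blast
 thus ?thesis using that by blast
qed

lemma tetra_iff: "tetrahedron_graph G \<longleftrightarrow> finite (pverts G) & card (pverts G) = 4 & parcs G = {(u,v). (u,v) \<in> (pverts G \<times> pverts G) & u ~= v}"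
 by (rule complete_digraph_pair_def)

lemma tetra_pair_graph: "tetrahedron_graph G ==> pair_graph G"
 by (rule pair_graphI_complete)

lemma tetra_nbrs: "tetrahedron_graph G ==> u \<in> pverts G ==> nbrs G u = pverts G - {u}"
 unfolding tetra_iff nbrs_def by auto

lemma ecim_basic:
 assumes "combinatorial_ecimahedron G"
 shows "pair_graph G & (\<forall>u\<in>pverts G. card (nbrs G u) = 3)"
 using assms
proof (induction rule: combinatorial_ecimahedron.induct)
 case (1 G)
 have "card (pverts G) = 4" using 1 unfolding tetra_iff by simp
 thus ?case using tetra_pair_graph[OF 1] tetra_nbrs[OF 1] by (simp add: card_Diff_singleton)
next
 case (2 G G')
 then obtain v x y z a b c where "trunc G G' v x y z a b c" by (meson truncationE)
 then interpret trunc G G' v x y z a b c .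
 show ?case using 2 pG' nbrs_card by blast
qed

text \<open>Connectedness is phrased by functions constant along arcs, the form in which it meets
  face labellings. Such a function is constant on the triangle and so descends to the contracted
  graph.\<close>

lemma ecim_connected:
 fixes f :: "'v => bool"
 assumes "combinatorial_ecimahedron G" "!!u w. (u, w) \<in> parcs G ==> f u = f w" "u \<in> pverts G" "w \<in> pverts G"
 shows "f u = f w"
 using assms
proof (induction arbitrary: f u w rule: combinatorial_ecimahedron.induct)
 case (1 G) thus ?case by (cases "u = w") (auto simp: tetra_iff)
next
 case (2 G G')
 then obtain v x y z a b c where "trunc G G' v x y z a b c" using ecim_basic by (meson truncationE)
 then interpret trunc G G' v x y z a b c .
 have e: "f a = f x" "f b = f y" "f c = f z" "f a = f b" "f b = f c" using 2(4)[of a x] 2(4)[of b y] 2(4)[of c z] 2(4)[of a b] 2(4)[of b c]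
  by (auto simp: arcs')
 define f0 where "f0 p = (if p = v then f a else f p)" for p
 have f0: "f0 p = f0 q" if "(p, q) \<in> parcs G" for p q
 proof -
  consider "p = v" | "q = v" | "p ~= v" "q ~= v" by blast
  thus ?thesis
  proof cases
   case 1 thus ?thesis using that e xV(4-6) v_arc by (auto simp: f0_def)
  next
   case 2 thus ?thesis using that e xV(4-6) v_arc by (auto simp: f0_def)
  next
   case 3 thus ?thesis using 2(4)[of p q] that by (simp add: f0_def arcs')
  qed
 qed
 have "f p = f0 (if p \<in> pverts G - {v} then p else v) & (if p \<in> pverts G - {v} then p else v) \<in> pverts G" if "p \<in> pverts G'" for p
  using that e v unfolding V' f0_def by auto
 thus ?case using 2(3)[of f0, OF f0] 2(5,6) by metis
qed

lemma tetra_edges_card: assumes "tetrahedron_graph G" shows "card (edges G) = 6"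
proof -
 have V: "finite (pverts G)" "card (pverts G) = 4" using assms unfolding tetra_iff by auto
 have "edges G = {e. e \<subseteq> pverts G & card e = 2}"
 proof (intro set_eqI iffI)
  fix e assume "e \<in> edges G" thus "e \<in> {e. e \<subseteq> pverts G & card e = 2}"
   using assms unfolding tetra_iff by (auto elim!: edgeE)
 next
  fix e assume "e \<in> {e. e \<subseteq> pverts G & card e = 2}"
  then obtain u w where "e = {u, w}" "u ~= w" "e \<subseteq> pverts G" by (auto simp: card_2_iff)
  thus "e \<in> edges G" unfolding edge_iff[OF tetra_pair_graph[OF assms]] using assms unfolding tetra_iff 
   by (simp add: edge_iff[OF tetra_pair_graph[OF assms]])
 qed
 hence "card (edges G) = card (pverts G) choose 2" using n_subsets[OF V(1), of 2] by simp
 thus ?thesis using V(2) by (simp add: choose_two)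
qed

text \<open>The size is the cycle rank, so \<open>N\<close> is the complement of a spanning tree.
  The freedom to prescribe \<open>e\<close> serves to detect an edge with the same face on both
  sides.\<close>

lemma ecim_determining:
 assumes "combinatorial_ecimahedron G" "e \<in> edges G"
 shows "\<exists>N. determining G N & e \<in> N & card N + card (pverts G) = card (edges G) + 1"
 using assms
proof (induction arbitrary: e rule: combinatorial_ecimahedron.induct)
 case (1 G)
 note pG = tetra_pair_graph[OF 1(1)]
 obtain p q where pq: "e = {p, q}" "(p, q) \<in> parcs G" using 1(2) by (rule edgeE)
 have V: "finite (pverts G)" "card (pverts G) = 4" and arcs: "!!u w. (u, w) \<in> parcs G \<longleftrightarrow> u \<in> pverts G & w \<in> pverts G & u ~= w"
  using 1(1) unfolding tetra_iff by auto
 have pV: "p \<in> pverts G" "q \<in> pverts G" "p ~= q" using pq arcs by auto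
 have "card (pverts G - {p, q}) = 2" using V pV by (subst card_Diff_subset) auto
 then obtain r s where rs: "pverts G - {p, q} = {r, s}" "r ~= s" by (meson card_2_iff)
 hence Vs: "pverts G = {p,q,r,s}" and d: "distinct [p,q,r,s]" using pV by auto
 \<comment> \<open>A triangle through \<open>e\<close>; the other three edges form a star, which is
   a spanning tree.\<close>
 let ?N = "{{p,q},{q,r},{r,p}}"
 have cN: "card ?N = 3" using d by (auto simp: card_insert_if doubleton_eq_iff)
 have "determining G ?N"
  unfolding determining_def
 proof (intro conjI allI impI)
  show "?N \<subseteq> edges G" using d by (auto simp: edge_iff[OF pG] arcs Vs)
  fix \<psi> u w assume A: "flow G \<psi> & (\<forall>u w. {u, w} \<in> ?N --> \<not> \<psi> u w)" and uw: "(u, w) \<in> parcs G"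
  have sym: "(u, w) \<in> parcs G ==> \<psi> u w = \<psi> w u" for u w using A unfolding flow_def by blast
  have ev: "u \<in> pverts G ==> even (card {w \<in> nbrs G u. \<psi> u w})" for u using A unfolding flow_def by blast
  have n: "nbrs G p = {q,r,s}" "nbrs G q = {r,p,s}" "nbrs G r = {p,q,s}" unfolding nbrs_def arcs Vs using d by auto
  have z: "\<not> \<psi> p q" "\<not> \<psi> q p" "\<not> \<psi> q r" "\<not> \<psi> r q" "\<not> \<psi> r p" "\<not> \<psi> p r" using A by (auto simp: insert_commute)
  have "(\<psi> p q ~= \<psi> p r) = \<psi> p s" using ev[of p] even_card_three[OF n(1)] d Vs by auto
  moreover have "(\<psi> q r ~= \<psi> q p) = \<psi> q s" using ev[of q] even_card_three[OF n(2)] d Vs by auto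
  moreover have "(\<psi> r p ~= \<psi> r q) = \<psi> r s" using ev[of r] even_card_three[OF n(3)] d Vs by auto
  ultimately have zs: "\<not> \<psi> p s" "\<not> \<psi> q s" "\<not> \<psi> r s" using z by auto
  have zs': "\<not> \<psi> s p" "\<not> \<psi> s q" "\<not> \<psi> s r" using zs sym[of s p] sym[of s q] sym[of s r] d by (auto simp: arcs Vs)
  have "u \<in> {p,q,r,s}" "w \<in> {p,q,r,s}" "u ~= w" using uw unfolding arcs Vs by auto
  thus "\<not> \<psi> u w" using z zs zs' by auto
 qed
 thus ?case using cN V(2) tetra_edges_card[OF 1(1)] pq(1) by (intro exI[of _ ?N]) simp
next
 case (2 G G')
 then obtain v x y z a b c where "trunc G G' v x y z a b c" using ecim_basic by (meson truncationE)
 then interpret trunc G G' v x y z a b c .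
 show ?case
 proof (cases "e \<in> {{a,b},{b,c},{c,a}}")
  case True
  have "{v,x} \<in> edges G" using xV by (simp add: edge_iff[OF pG])
  then obtain N where N: "determining G N" "card N + card (pverts G) = card (edges G) + 1" using 2(3) by blast
  have "N \<subseteq> edges G" using N(1) unfolding determining_def by blast
  thus ?thesis using determining_new[OF N(1) True] card_insert_kE[OF _ True, of N] N(2) card_verts card_edges
   by (intro exI[of _ "insert e (kE ` N)"]) simp
 next
  case False
  then obtain f where f: "f \<in> edges G" "e = kE f" using 2(4) unfolding edges'_kE by blast
  then obtain N where N: "determining G N" "f \<in> N" "card N + card (pverts G) = card (edges G) + 1" using 2(3) by blast
  have "N \<subseteq> edges G" using N(1) unfolding determining_def by blast
  thus ?thesis using determining_new[OF N(1), of "{a,b}"] card_insert_kE[of N "{a,b}"] N(2,3) card_verts card_edges f(2)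
   by (intro exI[of _ "insert {a,b} (kE ` N)"]) simp
 qed
qed

text \<open>If the pairs of \<open>R\<close> connect all of \<open>A\<close>, there must be at least
  \<open>card A - 1\<close> of them. Connectedness is tested by boolean functions, and the induction
  contracts one pair of \<open>R\<close>.\<close>

lemma card_le_relation:
 fixes R :: "('l \<times> 'l) set"
 assumes "finite R" "finite A"
  and "!!g :: 'l => bool. \<forall>(p, q)\<in>R. g p = g q ==> \<forall>p\<in>A. \<forall>q\<in>A. g p = g q"
 shows "card A <= card R + 1"
 using assms
proof (induction "card R" arbitrary: R A rule: less_induct)
 case less
 show ?case
 proof (cases "R = {}")
  case True
  show ?thesis
  proof (rule ccontr)
   assume "\<not> card A <= card R + 1"
   hence "card A \<ge> 2" by simp
   then obtain B where "B \<subseteq> A" "card B = 2" by (meson obtain_subset_with_card_n)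
   then obtain p q where "p \<in> A" "q \<in> A" "p ~= q" by (auto simp: card_2_iff)
   thus False using less.prems(3)[of "\<lambda>l. l = p"] True by auto
  qed
 next
  case False
  then obtain p q where pq: "(p, q) \<in> R" by auto
  define f where "f l = (if l = q then p else l)" for l
  define R1 where "R1 = (\<lambda>(s, t). (f s, f t)) ` (R - {(p, q)})"
  have cR: "card R = card (R - {(p, q)}) + 1" using pq less.prems(1) by (metis Suc_eq_plus1 card.remove)
  have cR1: "card R1 <= card (R - {(p, q)})" unfolding R1_def using less.prems(1) by (intro card_image_le) auto
  have A1: "\<forall>s\<in>f ` A. \<forall>t\<in>f ` A. g s = g t" if g: "\<forall>(s, t)\<in>R1. g s = g t" for g :: "'l => bool"
  proof -
   have "\<forall>(s, t)\<in>R. (g \<circ> f) s = (g \<circ> f) t"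
   proof clarify
    fix s t assume "(s, t) \<in> R"
    show "(g \<circ> f) s = (g \<circ> f) t"
    proof (cases "(s, t) = (p, q)")
     case True thus ?thesis by (simp add: f_def)
    next
     case False
     hence "(f s, f t) \<in> R1" unfolding R1_def using \<open>(s, t) \<in> R\<close> by force
     thus ?thesis using g by auto
    qed
   qed
   note const = less.prems(3)[OF this]
   show ?thesis
   proof (intro ballI)
    fix s t assume "s \<in> f ` A" "t \<in> f ` A"
    then obtain s' t' where st: "s' \<in> A" "s = f s'" "t' \<in> A" "t = f t'" by blast
    show "g s = g t" using bspec[OF bspec[OF const st(1)] st(3)] unfolding st(2,4) by (simp only: o_apply)
   qed
  qed
  have fin: "finite R1" "finite (f ` A)" unfolding R1_def using less.prems by auto
  have "card (f ` A) <= card R1 + 1" by (rule less.hyps[OF _ fin A1]) (use cR cR1 in auto)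
  moreover have "A \<subseteq> insert q (f ` A)"
  proof
   fix l assume "l \<in> A" thus "l \<in> insert q (f ` A)" by (cases "l = q") (auto simp: f_def image_iff)
  qed
  hence "card A <= card (insert q (f ` A))" using fin(2) by (intro card_mono) auto
  moreover have "card (insert q (f ` A)) <= card (f ` A) + 1" using fin(2) by (simp add: card_insert_if)
  ultimately show ?thesis using cR cR1 by linarith
 qed
qed

text \<open>\<open>\<nu>\<close> assigns to an arc the face on one fixed side of it; at a vertex the incoming and outgoing arcs of each face
  have the same label.\<close>

definition rot :: "('v \<times> 'v => 'l) => 'v => 'v => 'v => 'v => bool" where
 "rot \<nu> u x y z \<longleftrightarrow> \<nu> (x, u) = \<nu> (u, y) & \<nu> (y, u) = \<nu> (u, z) & \<nu> (z, u) = \<nu> (u, x)"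

definition face_labelling :: "'v pair_pre_digraph => ('v \<times> 'v => 'l) => bool" where
 "face_labelling G \<nu> \<longleftrightarrow> (\<forall>u\<in>pverts G. \<exists>x y z. distinct [x,y,z] & nbrs G u = {x,y,z} & rot \<nu> u x y z)"

text \<open>Three neighbours have only two cyclic orders.\<close>

lemma rot_cases:
 assumes "face_labelling G \<nu>" "u \<in> pverts G" "nbrs G u = {p,q,r}" "distinct [p,q,r]"
 shows "rot \<nu> u p q r \<or> rot \<nu> u p r q"
proof -
 obtain x y z where xyz: "distinct [x,y,z]" "{p,q,r} = {x,y,z}" "rot \<nu> u x y z"
  using assms unfolding face_labelling_def by metis
 have "x \<in> {p,q,r}" "y \<in> {p,q,r}" "z \<in> {p,q,r}" using xyz(2) by auto
 thus ?thesis using xyz(1,3) assms(4) unfolding rot_def by auto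
qed

text \<open>The edges that separate the faces in \<open>g\<close> from the others form a cycle
  modulo 2: going once around a vertex, the value of \<open>g\<close> changes an even number of
  times.\<close>

lemma face_labelling_flow:
 fixes g :: "'l => bool"
 assumes "face_labelling G \<nu>"
 shows "flow G (\<lambda>u w. g (\<nu> (u, w)) ~= g (\<nu> (w, u)))"
 unfolding flow_def
proof (intro conjI allI impI ballI)
 fix u assume "u \<in> pverts G"
 then obtain x y z where xyz: "distinct [x,y,z]" "nbrs G u = {x,y,z}" "rot \<nu> u x y z"
  using assms unfolding face_labelling_def by metis
 show "even (card {w \<in> nbrs G u. g (\<nu> (u, w)) ~= g (\<nu> (w, u))})"
  unfolding even_card_three[OF xyz(2,1)] using xyz(3) unfolding rot_def by auto
qed auto

text \<open>If \<open>g\<close> never changes across an edge, it is constant around every vertex and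
  along every arc, and connectedness does the rest.\<close>

lemma face_labelling_const:
 fixes g :: "'l => bool"
 assumes "combinatorial_ecimahedron G" "face_labelling G \<nu>" "!!u w. (u, w) \<in> parcs G ==> g (\<nu> (u, w)) = g (\<nu> (w, u))"
  and "(u, w) \<in> parcs G" "(u', w') \<in> parcs G"
 shows "g (\<nu> (u, w)) = g (\<nu> (u', w'))"
proof -
 have pG: "pair_graph G" using ecim_basic[OF assms(1)] by simp
 define f where "f u = g (\<nu> (u, SOME w. (u, w) \<in> parcs G))" for u
 have f: "f u = g (\<nu> (u, w))" if "(u, w) \<in> parcs G" for u w
 proof -
  have u: "u \<in> pverts G" using pair_graphD(3)[OF pG that] .
  then obtain x y z where xyz: "distinct [x,y,z]" "nbrs G u = {x,y,z}" "rot \<nu> u x y z"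
   using assms(2) unfolding face_labelling_def by metis
  have ar: "(u, x) \<in> parcs G" "(u, y) \<in> parcs G" "(u, z) \<in> parcs G" using xyz(2) unfolding nbrs_def by auto
  have eq: "g (\<nu> (u, x)) = g (\<nu> (u, y))" "g (\<nu> (u, y)) = g (\<nu> (u, z))"
   using xyz(3) assms(3)[OF ar(1)] assms(3)[OF ar(2)] unfolding rot_def by auto
  have "(SOME w. (u, w) \<in> parcs G) \<in> {x,y,z}" using someI[of "\<lambda>w. (u, w) \<in> parcs G", OF that] xyz(2) unfolding nbrs_def by blast
  moreover have "w \<in> {x,y,z}" using that xyz(2) unfolding nbrs_def by blast
  ultimately show ?thesis unfolding f_def using eq by auto
 qed
 have "f u = f w" if "(u, w) \<in> parcs G" for u w using f[OF that] f[OF pair_graphD(6)[OF pG that]] assms(3)[OF that] by simp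
 hence "f u = f u'" using ecim_connected[OF assms(1), of f u u'] pair_graphD(3)[OF pG] assms(4,5) by blast
 thus ?thesis using f assms(4,5) by simp
qed

text \<open>Every edge of a determining set \<open>N\<close> relates the labels on its two sides. A
  boolean function respecting these relations induces a flow that vanishes on \<open>N\<close>, so
  it is constant; hence at most \<open>card N\<close> relations connect all labels. An edge with
  equal labels gives a void relation, which sharpens the bound by one.\<close>

lemma euler_bound:
 assumes E: "combinatorial_ecimahedron G" and F: "face_labelling G \<nu>" and e: "(p, q) \<in> parcs G"
 shows "card (\<nu> ` parcs G) + card (pverts G) <= card (edges G) + 2"
  and "\<nu> (p, q) = \<nu> (q, p) ==> card (\<nu> ` parcs G) + card (pverts G) <= card (edges G) + 1"
proof -
 have pG: "pair_graph G" using ecim_basic[OF E] by simp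
 have "{p, q} \<in> edges G" using e edge_iff[OF pG] by blast
 then obtain N where N: "determining G N" "{p, q} \<in> N" "card N + card (pverts G) = card (edges G) + 1"
  using ecim_determining[OF E] by blast
 have Ns: "N \<subseteq> edges G" using N(1) unfolding determining_def by blast
 hence Nf: "finite N" using finite_edges[OF pG] finite_subset by blast
 have bound: "card (\<nu> ` parcs G) <= card N' + 1" if N': "N' \<subseteq> N" "!!u w. {u, w} \<in> N - N' ==> \<nu> (u, w) = \<nu> (w, u)" for N'
 proof -
  have "\<forall>f\<in>N'. \<exists>uw. f = {fst uw, snd uw}" using N'(1) Ns by (metis edgeE fst_conv snd_conv subsetD)
  then obtain pick where pick: "!!f. f \<in> N' ==> f = {fst (pick f), snd (pick f)}" by metis
  define R where "R = (\<lambda>f. (\<nu> (pick f), \<nu> (prod.swap (pick f)))) ` N'"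
  have fN': "finite N'" using Nf N'(1) finite_subset by blast
  have "card (\<nu> ` parcs G) <= card R + 1"
  proof (rule card_le_relation)
   show "finite R" unfolding R_def using fN' by simp
   show "finite (\<nu> ` parcs G)" using pair_graphD(2)[OF pG] by simp
   fix g :: "'b => bool" assume g: "\<forall>(p, q)\<in>R. g p = g q"
   have "\<not> (g (\<nu> (u, w)) ~= g (\<nu> (w, u)))" if uw: "{u, w} \<in> N" for u w
   proof (cases "{u, w} \<in> N'")
    case False thus ?thesis using N'(2)[of u w] uw by simp
   next
    case True
    have "(\<nu> (pick {u,w}), \<nu> (prod.swap (pick {u,w}))) \<in> R" unfolding R_def using True by blast
    hence gg: "g (\<nu> (pick {u,w})) = g (\<nu> (prod.swap (pick {u,w})))" using g by auto
    have "pick {u,w} = (u, w) \<or> pick {u,w} = (w, u)" using pick[OF True] by (metis doubleton_eq_iff prod.collapse)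
    thus ?thesis using gg by auto
   qed
   hence "\<forall>u w. (u, w) \<in> parcs G --> \<not> (g (\<nu> (u, w)) ~= g (\<nu> (w, u)))"
    using N(1) face_labelling_flow[OF F, of g] unfolding determining_def by blast
   hence "!!u w. (u, w) \<in> parcs G ==> g (\<nu> (u, w)) = g (\<nu> (w, u))" by blast
   hence c: "g (\<nu> (u, w)) = g (\<nu> (u', w'))" if "(u, w) \<in> parcs G" "(u', w') \<in> parcs G" for u w u' w'
    using face_labelling_const[OF E F, of g u w u' w'] that by blast
   show "\<forall>s\<in>\<nu> ` parcs G. \<forall>t\<in>\<nu> ` parcs G. g s = g t"
   proof clarify
    fix u w u' w' assume "(u, w) \<in> parcs G" "(u', w') \<in> parcs G"
    thus "g (\<nu> (u, w)) = g (\<nu> (u', w'))" by (rule c)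
   qed
  qed
  also have "card R <= card N'" unfolding R_def using fN' by (rule card_image_le)
  finally show ?thesis by simp
 qed
 show "card (\<nu> ` parcs G) + card (pverts G) <= card (edges G) + 2" using bound[of N] N(3) by simp
 assume eq: "\<nu> (p, q) = \<nu> (q, p)"
 have "\<nu> (u, w) = \<nu> (w, u)" if "{u, w} \<in> N - (N - {{p, q}})" for u w
  using that eq by (auto simp: doubleton_eq_iff)
 hence "card (\<nu> ` parcs G) <= card (N - {{p, q}}) + 1" using bound[of "N - {{p, q}}"] by blast
 moreover have "card N = card (N - {{p, q}}) + 1" using N(2) Nf by (metis Suc_eq_plus1 card.remove)
 ultimately show "card (\<nu> ` parcs G) + card (pverts G) <= card (edges G) + 1" using N(3) by linarith
qed

section \<open>From face labellings to stacks\<close>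

definition cell :: "'v pair_pre_digraph => ('v \<times> 'v => 'l) => 'v => 'l set" where
 "cell G \<nu> u = (\<lambda>w. \<nu> (u, w)) ` nbrs G u"

definition face_count :: "'v pair_pre_digraph => ('v \<times> 'v => 'l) => bool" where
 "face_count G \<nu> \<longleftrightarrow> card (\<nu> ` parcs G) + card (pverts G) = card (edges G) + 2"

text \<open>Equal labels on both sides would bring in the sharper bound of
  \<open>euler_bound\<close>, which contradicts Euler's relation.\<close>

lemma two_sides:
 assumes "combinatorial_ecimahedron G" "face_labelling G \<nu>" "face_count G \<nu>" "(p, q) \<in> parcs G"
 shows "\<nu> (p, q) ~= \<nu> (q, p)"
 using euler_bound(2)[OF assms(1,2,4)] assms(3) unfolding face_count_def by linarith

text \<open>The labels of the arcs involved are abstracted to variables. Of the eight combinations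
  of orientations the six mixed ones force one of the excluded equalities.\<close>

lemma three_rotations:
 assumes "(xa = ab & ba = ac & ca = ax) \<or> (xa = ac & ca = ab & ba = ax)"
  and "(yb = bc & cb = ba & ab = yb') \<or> (yb = ba & ab = bc & cb = yb')"
  and "(zc = ca & ac = cb & bc = cz) \<or> (zc = cb & bc = ca & ac = cz)"
  and "ax ~= xa" "yb' ~= yb" "cz ~= zc"
 shows "((xa = ab & ba = ac & ca = ax) & (yb = bc & cb = ba & ab = yb') & (zc = ca & ac = cb & bc = cz)) \<or>
  ((xa = ac & ca = ab & ba = ax) & (yb = ba & ab = bc & cb = yb') & (zc = cb & bc = ca & ac = cz))"
 using assms by (elim disjE conjE) auto

text \<open>A triangle with one flipped vertex would have an edge with the same face on both sides.\<close>

lemma triangle_consistent: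
 assumes "rot \<nu> a x b c \<or> rot \<nu> a x c b" "rot \<nu> b y c a \<or> rot \<nu> b y a c" "rot \<nu> c z a b \<or> rot \<nu> c z b a"
  and "\<nu> (a, x) ~= \<nu> (x, a)" "\<nu> (b, y) ~= \<nu> (y, b)" "\<nu> (c, z) ~= \<nu> (z, c)"
 shows "(rot \<nu> a x b c & rot \<nu> b y c a & rot \<nu> c z a b) \<or> (rot \<nu> a x c b & rot \<nu> b y a c & rot \<nu> c z b a)"
 unfolding rot_def by (rule three_rotations[OF assms[unfolded rot_def]])

context trunc
begin

text \<open>Reverses the orientation of the triangle, which reduces the second alternative of
  \<open>new_rots\<close> to the first.\<close>

lemma swap_trunc: "trunc G G' v x z y a c b"
proof (rule trunc.intro, goal_cases)
 case 4 show ?case using dx by auto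
next
 case 5 show ?case using nv by (simp add: insert_commute)
next
 case 6 show ?case using da by auto
next
 case 7 show ?case using new by (simp add: insert_commute)
next
 case 8 show ?case using V' by (simp add: insert_commute)
next
 case 9
 have "{a,c} = {c,a}" "{c,b} = {b,c}" "{b,a} = {a,b}" by auto
 thus ?case unfolding E' by (simp only: insert_commute)
qed (fact pG pG' v)+

lemma new_rots:
 assumes E: "combinatorial_ecimahedron G'" and F: "face_labelling G' \<nu>" and C: "face_count G' \<nu>"
 shows "(rot \<nu> a x b c & rot \<nu> b y c a & rot \<nu> c z a b) \<or> (rot \<nu> a x c b & rot \<nu> b y a c & rot \<nu> c z b a)"
proof (rule triangle_consistent)
 have X: "distinct [x,b,c]" "distinct [y,c,a]" "distinct [z,a,b]" using xV ndisj da by auto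
 have V: "a \<in> pverts G'" "b \<in> pverts G'" "c \<in> pverts G'" unfolding V' by auto
 show "rot \<nu> a x b c \<or> rot \<nu> a x c b" by (rule rot_cases[OF F V(1) nbrs_new(1) X(1)])
 show "rot \<nu> b y c a \<or> rot \<nu> b y a c" by (rule rot_cases[OF F V(2) nbrs_new(2) X(2)])
 show "rot \<nu> c z a b \<or> rot \<nu> c z b a" by (rule rot_cases[OF F V(3) nbrs_new(3) X(3)])
 show "\<nu> (a, x) ~= \<nu> (x, a)" "\<nu> (b, y) ~= \<nu> (y, b)" "\<nu> (c, z) ~= \<nu> (z, c)"
  by (rule two_sides[OF E F C], simp add: arcs')+
qed

text \<open>The rotation at \<open>v\<close> is inherited from the coherent rotations at the three
  corners. The only label that can get lost is that of the triangle, which is carried by the inner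
  arcs \<open>(a,c)\<close>, \<open>(c,b)\<close>, \<open>(b,a)\<close>.\<close>

lemma contract_labelling:
 assumes F: "face_labelling G' \<nu>" and r: "rot \<nu> a x b c" "rot \<nu> b y c a" "rot \<nu> c z a b"
 shows "face_labelling G (\<nu> \<circ> \<kappa>)" "\<nu> ` parcs G' = insert (\<nu> (a,c)) ((\<nu> \<circ> \<kappa>) ` parcs G)"
proof -
 show "face_labelling G (\<nu> \<circ> \<kappa>)"
  unfolding face_labelling_def
 proof
  fix u assume u: "u \<in> pverts G"
  show "\<exists>p q r. distinct [p,q,r] & nbrs G u = {p,q,r} & rot (\<nu> \<circ> \<kappa>) u p q r"
  proof (cases "u = v")
   case True
   have "rot (\<nu> \<circ> \<kappa>) v x y z" using r unfolding rot_def by (simp add: \<kappa>_v)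
   thus ?thesis using True dx nv by blast
  next
   case False
   have "u \<in> pverts G'" using u False unfolding V' by blast
   then obtain p' q' r' where n': "distinct [p',q',r']" "nbrs G' u = {p',q',r'}" "rot \<nu> u p' q' r'"
    using F unfolding face_labelling_def by metis
   obtain p where p: "p \<in> nbrs G u" "p' = h u p" using n'(2) nbrs_old(1)[OF u False] by (metis imageE insertI1)
   obtain q where q: "q \<in> nbrs G u" "q' = h u q" using n'(2) nbrs_old(1)[OF u False] by (metis imageE insertI1 insertI2)
   obtain r where r: "r \<in> nbrs G u" "r' = h u r" using n'(2) nbrs_old(1)[OF u False] by (metis imageE insertI1 insertI2)
   have "nbrs G u \<subseteq> {p,q,r}"
   proof
    fix w assume w: "w \<in> nbrs G u"
    hence "h u w \<in> {h u p, h u q, h u r}" using n'(2) nbrs_old(1)[OF u False] p q r by (metis imageI)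
    thus "w \<in> {p,q,r}" using inj_onD[OF nbrs_old(2)[OF u False]] w p q r by (metis insert_iff singletonD)
   qed
   moreover have "distinct [p,q,r]" using n'(1) p q r by auto
   moreover have k: "\<kappa> (w, u) = (h u w, u)" "\<kappa> (u, w) = (u, h u w)" for w using False unfolding \<kappa>_def h_def by auto
   hence "rot (\<nu> \<circ> \<kappa>) u p q r" using n'(3) p q r unfolding rot_def by simp
   ultimately show ?thesis using p q r by blast
  qed
 qed
 have i: "\<nu> (x,a) \<in> (\<nu> \<circ> \<kappa>) ` parcs G" "\<nu> (y,b) \<in> (\<nu> \<circ> \<kappa>) ` parcs G" "\<nu> (z,c) \<in> (\<nu> \<circ> \<kappa>) ` parcs G"
  unfolding image_comp[symmetric] by (rule imageI, rule \<kappa>_image)+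
 have e: "\<nu> (a,b) = \<nu> (x,a)" "\<nu> (b,c) = \<nu> (y,b)" "\<nu> (c,a) = \<nu> (z,c)" "\<nu> (c,b) = \<nu> (a,c)" "\<nu> (b,a) = \<nu> (a,c)"
  using r unfolding rot_def by auto
 show "\<nu> ` parcs G' = insert (\<nu> (a,c)) ((\<nu> \<circ> \<kappa>) ` parcs G)"
  unfolding arcs'_\<kappa> image_Un image_comp using i e by auto
qed

end

lemma cell_rot: "nbrs G u = {p,q,r} ==> cell G \<nu> u = {\<nu> (u,p), \<nu> (u,q), \<nu> (u,r)}"
 unfolding cell_def by simp

text \<open>The face count of \<open>G'\<close> together with Euler's bound for \<open>G\<close>
  shows that the label \<open>k\<close> of the triangle occurs nowhere else, and that the contracted
  labelling satisfies Euler's relation again. The cells at \<open>a\<close>, \<open>b\<close>,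
  \<open>c\<close> are the ones that arise by truncating the cell of \<open>v\<close>.\<close>

lemma ecim_stack_step:
 fixes \<nu> :: "'v \<times> 'v => 'l"
 assumes T: "trunc G G' v x y z a b c" and E: "combinatorial_ecimahedron G"
  and F: "face_labelling G' \<nu>" and C: "face_count G' \<nu>"
  and r: "rot \<nu> a x b c" "rot \<nu> b y c a" "rot \<nu> c z a b"
  and IH: "!!\<nu> :: 'v \<times> 'v => 'l. face_labelling G \<nu> ==> face_count G \<nu> ==>
   \<exists>T L. stk (\<nu> ` parcs G) T L & fst ` T = cell G \<nu> ` pverts G & inj_on (cell G \<nu>) (pverts G)"
 shows "\<exists>T L. stk (\<nu> ` parcs G') T L & L ~= [] & fst ` T = cell G' \<nu> ` pverts G' & inj_on (cell G' \<nu>) (pverts G')"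
proof -
 interpret trunc G G' v x y z a b c by (rule T)
 define \<nu>0 where "\<nu>0 = \<nu> \<circ> \<kappa>"
 define k where "k = \<nu> (a, c)"
 note cl = contract_labelling[OF F r, folded \<nu>0_def k_def]
 have fin: "finite (\<nu>0 ` parcs G)" using pair_graphD(2)[OF pG] by simp
 have bnd: "card (\<nu>0 ` parcs G) + card (pverts G) <= card (edges G) + 2" using euler_bound(1)[OF E cl(1) xV(7)] .
 have C': "card (insert k (\<nu>0 ` parcs G)) + card (pverts G) = card (edges G) + 3"
  using C unfolding face_count_def cl(2) card_verts card_edges by simp
 hence k: "k \<notin> \<nu>0 ` parcs G" using bnd by (metis insert_absorb Suc_n_not_le_n add_Suc_right eval_nat_numeral(3))
 hence C0: "face_count G \<nu>0" unfolding face_count_def using C' fin by simp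
 obtain T L where st: "stk (\<nu>0 ` parcs G) T L" and Tc: "fst ` T = cell G \<nu>0 ` pverts G" and inj: "inj_on (cell G \<nu>0) (pverts G)"
  using IH[OF cl(1) C0] by blast
 define A B D where "A = \<nu> (a,x)" and "B = \<nu> (b,y)" and "D = \<nu> (c,z)"
 have cv: "cell G \<nu>0 v = {A,B,D}" unfolding cell_rot[OF nv] \<nu>0_def A_def B_def D_def by (simp add: \<kappa>_v)
 have "cell G \<nu>0 v \<in> fst ` T" using Tc v by blast
 then obtain d where d: "(cell G \<nu>0 v, d) \<in> T" by auto
 have "card {A,B,D} = 3" using stk_cell[OF st d] cv by simp
 hence ABD: "distinct [A,B,D]" by (auto simp: card_insert_if split: if_splits)
 have kABD: "k \<notin> {A,B,D}" using k stk_cell[OF st d] cv by blast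
 have ca: "cell G' \<nu> a = {A,B,k}" "cell G' \<nu> b = {B,D,k}" "cell G' \<nu> c = {D,k,A}"
  unfolding cell_rot[OF nbrs_new(1)] cell_rot[OF nbrs_new(2)] cell_rot[OF nbrs_new(3)] A_def B_def D_def k_def
  using r unfolding rot_def by auto
 have co: "cell G' \<nu> u = cell G \<nu>0 u" if "u \<in> pverts G" "u ~= v" for u
  unfolding cell_def nbrs_old(1)[OF that] \<nu>0_def image_image using that by (simp add: \<kappa>_def h_def)
 have rm: "insert k (cell G \<nu>0 v - {A}) = {B,D,k}" "insert k (cell G \<nu>0 v - {B}) = {D,k,A}" "insert k (cell G \<nu>0 v - {D}) = {A,B,k}"
  unfolding cv using ABD by auto
 have "stk (insert k (\<nu>0 ` parcs G)) (step_cells T k (cell G \<nu>0 v) d) (L @ [(k, cell G \<nu>0 v, d)])"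
  by (rule stk.step[OF st d k])
 moreover have "fst ` step_cells T k (cell G \<nu>0 v) d = cell G' \<nu> ` pverts G'"
 proof -
  have "\<tau> \<in> fst ` step_cells T k (cell G \<nu>0 v) d \<longleftrightarrow> (\<tau> \<in> fst ` T & \<tau> ~= cell G \<nu>0 v) \<or> \<tau> = {B,D,k} \<or> \<tau> = {D,k,A} \<or> \<tau> = {A,B,k}" for \<tau>
   unfolding step_cells_iff[OF st d] rm[symmetric] by (simp add: cv)
  moreover have "\<tau> \<in> cell G' \<nu> ` pverts G' \<longleftrightarrow> \<tau> \<in> cell G \<nu>0 ` (pverts G - {v}) \<or> \<tau> = {B,D,k} \<or> \<tau> = {D,k,A} \<or> \<tau> = {A,B,k}" for \<tau>
  proof -
   have "cell G' \<nu> ` pverts G' = cell G' \<nu> ` (pverts G - {v}) \<union> {{A,B,k},{B,D,k},{D,k,A}}"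
    unfolding V' image_Un by (simp add: ca)
   moreover have "cell G' \<nu> ` (pverts G - {v}) = cell G \<nu>0 ` (pverts G - {v})" using co by (intro image_cong) auto
   ultimately show ?thesis by auto
  qed
  moreover have "\<tau> \<in> cell G \<nu>0 ` (pverts G - {v}) \<longleftrightarrow> \<tau> \<in> fst ` T & \<tau> ~= cell G \<nu>0 v" for \<tau>
   unfolding Tc using inj_onD[OF inj _ _ v] by blast
  ultimately show ?thesis by (intro set_eqI) simp
 qed
 moreover have "inj_on (cell G' \<nu>) (pverts G')"
 proof -
  have old: "k \<notin> cell G' \<nu> u" if "u \<in> pverts G - {v}" for u
  proof -
   have "cell G \<nu>0 u \<in> fst ` T" unfolding Tc using that by blast
   then obtain e where "(cell G \<nu>0 u, e) \<in> T" by auto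
   from stk_cell[OF st this] have "cell G \<nu>0 u \<subseteq> \<nu>0 ` parcs G" by blast
   moreover have "cell G' \<nu> u = cell G \<nu>0 u" using co that by blast
   ultimately show ?thesis using k by blast
  qed
  have 1: "inj_on (cell G' \<nu>) (pverts G - {v})"
   using inj_on_subset[OF inj, of "pverts G - {v}"] co by (auto simp: inj_on_def)
  have n1: "D \<notin> {A,B,k}" "A \<notin> {B,D,k}" "B \<notin> {D,k,A}" using ABD kABD by auto
  have "{A,B,k} ~= {B,D,k}" "{A,B,k} ~= {D,k,A}" "{B,D,k} ~= {D,k,A}" using n1 by blast+
  hence 2: "inj_on (cell G' \<nu>) {a,b,c}" unfolding inj_on_def by (simp add: ca eq_commute)
  show ?thesis unfolding V'
  proof (rule inj_onI)
   fix p q assume pq: "p \<in> (pverts G - {v}) \<union> {a,b,c}" "q \<in> (pverts G - {v}) \<union> {a,b,c}" "cell G' \<nu> p = cell G' \<nu> q"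
   have kn: "k \<in> cell G' \<nu> u" if "u \<in> {a,b,c}" for u using that by (auto simp: ca)
   have "p \<in> {a,b,c} \<longleftrightarrow> q \<in> {a,b,c}" using pq old kn by blast
   thus "p = q" using pq inj_onD[OF 1] inj_onD[OF 2] by blast
  qed
 qed
 ultimately show ?thesis unfolding cl(2) by blast
qed

lemma ecim_stack:
 assumes "combinatorial_ecimahedron G" "face_labelling G \<nu>" "face_count G \<nu>"
 shows "\<exists>T L. stk (\<nu> ` parcs G) T L & fst ` T = cell G \<nu> ` pverts G & inj_on (cell G \<nu>) (pverts G)
  & (L = [] --> tetrahedron_graph G)"
 using assms
proof (induction arbitrary: \<nu> rule: combinatorial_ecimahedron.induct)
 case (1 G)
 note E = combinatorial_ecimahedron.intros(1)[OF 1(1)]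
 note pG = tetra_pair_graph[OF 1(1)]
 have V: "finite (pverts G)" "card (pverts G) = 4" and arcs: "!!u w. (u, w) \<in> parcs G \<longleftrightarrow> u \<in> pverts G & w \<in> pverts G & u ~= w"
  using 1(1) unfolding tetra_iff by auto
 have "pverts G ~= {}" using V by auto
 then obtain d where d: "d \<in> pverts G" by blast
 have "card (pverts G - {d}) = 3" using V d by (simp add: card_Diff_singleton)
 from this[unfolded card3_iff_distinct] obtain a0 b0 c0 where abc0: "pverts G - {d} = {a0,b0,c0}" "distinct [a0,b0,c0]" by blast
 have Vd: "{a0,b0,c0} \<subseteq> pverts G" "d \<notin> {a0,b0,c0}" using abc0(1) by (metis Diff_subset, metis Diff_iff insertI1)
 \<comment> \<open>The star of \<open>d\<close> in the tetrahedron has the pattern of a truncation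
   triangle with all three outer neighbours equal to \<open>d\<close>, so the same coherence
   argument applies.\<close>
 have triangle: "(rot \<nu> a d b c & rot \<nu> b d c a & rot \<nu> c d a b) \<or> (rot \<nu> a d c b & rot \<nu> b d a c & rot \<nu> c d b a)"
  if abc: "pverts G = {d,a,b,c}" "distinct [d,a,b,c]" for a b c
 proof (rule triangle_consistent)
  have n: "nbrs G a = {d,b,c}" "nbrs G b = {d,c,a}" "nbrs G c = {d,a,b}" unfolding nbrs_def arcs abc(1) using abc(2) by auto
  show "rot \<nu> a d b c \<or> rot \<nu> a d c b" by (rule rot_cases[OF 1(2) _ n(1)]) (use abc in auto)
  show "rot \<nu> b d c a \<or> rot \<nu> b d a c" by (rule rot_cases[OF 1(2) _ n(2)]) (use abc in auto)
  show "rot \<nu> c d a b \<or> rot \<nu> c d b a" by (rule rot_cases[OF 1(2) _ n(3)]) (use abc in auto)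
  have ar: "(a, d) \<in> parcs G" "(b, d) \<in> parcs G" "(c, d) \<in> parcs G" unfolding arcs abc(1) using abc(2) by auto
  show "\<nu> (a, d) ~= \<nu> (d, a)" "\<nu> (b, d) ~= \<nu> (d, b)" "\<nu> (c, d) ~= \<nu> (d, c)"
   by (rule two_sides[OF E 1(2,3)], rule ar)+
 qed
 have "\<exists>a b c. pverts G = {d,a,b,c} & distinct [d,a,b,c] & rot \<nu> a d b c & rot \<nu> b d c a & rot \<nu> c d a b"
 proof -
  have e: "pverts G = {d,a0,b0,c0}" "distinct [d,a0,b0,c0]" "pverts G = {d,a0,c0,b0}" "distinct [d,a0,c0,b0]"
   using abc0 d Vd by (auto simp: insert_commute)
  show ?thesis using triangle[OF e(1,2)] e by blast
 qed
 then obtain a b c where Ve: "pverts G = {d,a,b,c}" and di: "distinct [d,a,b,c]"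
  and r: "rot \<nu> a d b c" "rot \<nu> b d c a" "rot \<nu> c d a b" by blast
 have n: "nbrs G a = {d,b,c}" "nbrs G b = {d,c,a}" "nbrs G c = {d,a,b}" "nbrs G d = {a,b,c}" unfolding nbrs_def arcs Ve using di by auto
 \<comment> \<open>\<open>t\<close> is the face opposite \<open>d\<close>, and \<open>A\<close>,
   \<open>B\<close>, \<open>C\<close> are the faces through \<open>d\<close>. Euler's relation will
   make the four labels distinct.\<close>
 define t A B C where "t = \<nu> (b,a)" and "A = \<nu> (d,a)" and "B = \<nu> (d,b)" and "C = \<nu> (d,c)"
 have cells: "cell G \<nu> a = {C,A,t}" "cell G \<nu> b = {A,B,t}" "cell G \<nu> c = {B,C,t}" "cell G \<nu> d = {A,B,C}"
  unfolding cell_rot[OF n(1)] cell_rot[OF n(2)] cell_rot[OF n(3)] cell_rot[OF n(4)] t_def A_def B_def C_def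
  using r unfolding rot_def by auto
 have "parcs G = (\<Union>u\<in>{d,a,b,c}. (\<lambda>w. (u, w)) ` nbrs G u)" unfolding nbrs_def using arcs Ve by auto
 hence "\<nu> ` parcs G = (\<Union>u\<in>{d,a,b,c}. cell G \<nu> u)" unfolding cell_def by (simp add: image_Un image_image)
 hence labs: "\<nu> ` parcs G = {A,B,C,t}" using cells by auto
 have cl: "card {A,B,C,t} = 4" using 1(3) tetra_edges_card[OF 1(1)] V(2) unfolding face_count_def labs by simp
 hence dl: "distinct [A,B,C,t]" by (auto simp: card_insert_if split: if_splits)
 have S: "{A,B,C,t} - {A} = {B,C,t}" "{A,B,C,t} - {B} = {C,A,t}" "{A,B,C,t} - {C} = {A,B,t}" "{A,B,C,t} - {t} = {A,B,C}"
  using dl by auto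
 have "stk {A,B,C,t} ((\<lambda>x. ({A,B,C,t} - {x}, x)) ` {A,B,C,t}) []" by (rule stk.base[OF cl])
 moreover have "fst ` (\<lambda>x. ({A,B,C,t} - {x}, x)) ` {A,B,C,t} = {{B,C,t},{C,A,t},{A,B,t},{A,B,C}}"
  unfolding image_image fst_conv image_insert image_empty S ..
 moreover have "cell G \<nu> ` pverts G = {{A,B,C},{C,A,t},{A,B,t},{B,C,t}}" unfolding Ve by (simp add: cells)
 moreover have "inj_on (cell G \<nu>) (pverts G)"
 proof -
  have i: "A \<notin> {B,C,t}" "B \<notin> {C,A,t}" "C \<notin> {A,B,t}" "t \<notin> {A,B,C}" using dl by auto
  have "{A,B,C} ~= {C,A,t}" "{A,B,C} ~= {A,B,t}" "{A,B,C} ~= {B,C,t}" "{C,A,t} ~= {A,B,t}" "{C,A,t} ~= {B,C,t}" "{A,B,t} ~= {B,C,t}"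
   using i by blast+
  thus ?thesis unfolding inj_on_def Ve by (simp add: cells eq_commute)
 qed
 ultimately show ?case unfolding labs using 1(1) by (intro exI[of _ "(\<lambda>x. ({A,B,C,t} - {x}, x)) ` {A,B,C,t}"] exI[of _ "[]"]) (simp add: insert_commute)
next
 case (2 G G')
 then obtain v x y z a b c where T: "trunc G G' v x y z a b c" using ecim_basic by (meson truncationE)
 then interpret trunc G G' v x y z a b c .
 note E' = combinatorial_ecimahedron.intros(2)[OF 2(1,2)]
 have IH: "\<exists>T L. stk (\<nu> ` parcs G) T L & fst ` T = cell G \<nu> ` pverts G & inj_on (cell G \<nu>) (pverts G)"
  if "face_labelling G \<nu>" "face_count G \<nu>" for \<nu> :: "'a \<times> 'a => 'b" using 2(3)[OF that] by blast
 from new_rots[OF E' 2(4,5)] show ?case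
 proof
  assume "rot \<nu> a x b c & rot \<nu> b y c a & rot \<nu> c z a b"
  thus ?thesis using ecim_stack_step[OF T 2(1,4,5) _ _ _ IH] by blast
 next
  assume "rot \<nu> a x c b & rot \<nu> b y a c & rot \<nu> c z b a"
  thus ?thesis using ecim_stack_step[OF swap_trunc 2(1,4,5) _ _ _ IH] by blast
 qed
qed

lemma side_pair:
 assumes "face_labelling G \<nu>" "u \<in> pverts G" "s \<in> cell G \<nu> u" "t \<in> cell G \<nu> u" "s ~= t"
 obtains w where "(u, w) \<in> parcs G" "{s, t} = {\<nu> (u, w), \<nu> (w, u)}"
proof -
 obtain x y z where n: "nbrs G u = {x,y,z}" "rot \<nu> u x y z" using assms(1,2) unfolding face_labelling_def by metis
 have a: "(u,x) \<in> parcs G" "(u,y) \<in> parcs G" "(u,z) \<in> parcs G" using n(1) unfolding nbrs_def by auto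
 have "s \<in> {\<nu> (u,x), \<nu> (u,y), \<nu> (u,z)}" "t \<in> {\<nu> (u,x), \<nu> (u,y), \<nu> (u,z)}" using assms(3,4) unfolding cell_rot[OF n(1)] .
 moreover have "\<nu> (x,u) = \<nu> (u,y)" "\<nu> (y,u) = \<nu> (u,z)" "\<nu> (z,u) = \<nu> (u,x)" using n(2) unfolding rot_def by auto
 ultimately have "{s,t} = {\<nu> (u,x), \<nu> (x,u)} \<or> {s,t} = {\<nu> (u,y), \<nu> (y,u)} \<or> {s,t} = {\<nu> (u,z), \<nu> (z,u)}"
  using assms(5) by auto
 thus ?thesis using that a by blast
qed

lemma arc_cells:
 assumes "face_labelling G \<nu>" "pair_graph G" "(u, w) \<in> parcs G"
 shows "\<nu> (u, w) \<in> cell G \<nu> u" "\<nu> (w, u) \<in> cell G \<nu> u" "\<nu> (u, w) \<in> cell G \<nu> w" "\<nu> (w, u) \<in> cell G \<nu> w"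
proof -
 have *: "\<nu> (u, w) \<in> cell G \<nu> u & \<nu> (w, u) \<in> cell G \<nu> u" if uw: "(u, w) \<in> parcs G" for u w
 proof -
  have "u \<in> pverts G" using pair_graphD(3)[OF assms(2) uw] .
  then obtain x y z where n: "nbrs G u = {x,y,z}" "rot \<nu> u x y z" using assms(1) unfolding face_labelling_def by metis
  have "w \<in> {x,y,z}" using uw n(1) unfolding nbrs_def by blast
  thus ?thesis using n(2) unfolding cell_rot[OF n(1)] rot_def by auto
 qed
 show "\<nu> (u, w) \<in> cell G \<nu> u" "\<nu> (w, u) \<in> cell G \<nu> u" "\<nu> (u, w) \<in> cell G \<nu> w" "\<nu> (w, u) \<in> cell G \<nu> w"
  using *[OF assms(3)] *[OF pair_graphD(6)[OF assms(2,3)]] by auto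
qed

text \<open>Cells containing both \<open>s\<close> and \<open>t\<close> correspond to elements of
  \<open>ends T s t\<close>, of which there are two. This excludes two faces that meet in an edge
  and in a further vertex.\<close>

lemma at_most_two_cells:
 assumes st: "stk S T L" and T: "fst ` T = cell G \<nu> ` pverts G" and inj: "inj_on (cell G \<nu>) (pverts G)"
  and V: "u \<in> pverts G" "w \<in> pverts G" "q \<in> pverts G"
  and c: "{s,t} \<subseteq> cell G \<nu> u" "{s,t} \<subseteq> cell G \<nu> w" "{s,t} \<subseteq> cell G \<nu> q" and ne: "s ~= t" "u ~= w" "u ~= q"
 shows "w = q"
proof -
 have "\<exists>x. cell G \<nu> p = {s,t,x} & x \<in> ends T s t" if p: "p \<in> pverts G" "{s,t} \<subseteq> cell G \<nu> p" for p
 proof -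
  have "cell G \<nu> p \<in> fst ` T" using T p(1) by blast
  then obtain d where d: "(cell G \<nu> p, d) \<in> T" by auto
  have "card (cell G \<nu> p) = 3" using stk_cell[OF st d] by simp
  hence "card (cell G \<nu> p - {s,t}) = 1" using p(2) ne(1) by (subst card_Diff_subset) auto
  then obtain x where "cell G \<nu> p - {s,t} = {x}" by (meson card_1_singletonE)
  hence "cell G \<nu> p = {s,t,x}" "x ~= s" "x ~= t" using p(2) by auto
  thus ?thesis using \<open>cell G \<nu> p \<in> fst ` T\<close> unfolding ends_def by auto
 qed
 then obtain x y z where xyz: "cell G \<nu> u = {s,t,x}" "x \<in> ends T s t" "cell G \<nu> w = {s,t,y}" "y \<in> ends T s t"
  "cell G \<nu> q = {s,t,z}" "z \<in> ends T s t" using V c by metis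
 have "cell G \<nu> u \<in> fst ` T" using T V(1) by blast
 hence "adj T s t" using c(1) ne(1) by (intro adjI) auto
 then obtain a b where "a ~= b" "ends T s t = {a, b}" using stk_ends[OF st] by blast
 moreover have "x ~= y" "x ~= z" using xyz inj_onD[OF inj, of u w] inj_onD[OF inj, of u q] V ne by auto
 ultimately have "y = z" using xyz by auto
 thus "w = q" using xyz inj_onD[OF inj, of w q] V by auto
qed

text \<open>\<open>\<nu>\<close> sends an arc to the mark of its face orbit. Invariance along the
  orbit is the rotation condition itself: the arc arriving from \<open>x\<close> is followed by the
  arc leaving to the successor of \<open>x\<close> under \<open>\<rho>\<close>.\<close>

lemma marked_graph_labelling:
 fixes mark :: "'s::finite => ('v \<times> 'v) set"
 assumes M: "marked_labelled_graph G \<rho> \<theta> mark"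
 obtains \<nu> where "face_labelling G \<nu>" "\<nu> ` parcs G = UNIV" "face_count G \<nu>" "!!s. mark s = {a \<in> parcs G. \<nu> a = s}"
proof -
 have pG: "pair_graph G" and tri: "!!u. u \<in> pverts G ==> card (out_arcs (with_proj G) u) = 3"
  and perm: "\<rho> permutes parcs G" and cyc: "!!u. u \<in> pverts G ==> cyclic_on \<rho> (out_arcs (with_proj G) u)"
  and eul: "card (pverts G) + card (faces G \<rho>) = card (edges G) + 2" and bij: "bij_betw mark UNIV (faces G \<rho>)"
  using M unfolding marked_labelled_graph_def trivalent_def planar_embedding_def out_degree_def by auto
 define \<phi> where "\<phi> = \<rho> \<circ> prod.swap"
 \<comment> \<open>Set to the identity outside the arcs, so that it is a permutation of a finite set
   and its orbits are cycles.\<close>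
 define \<phi>' where "\<phi>' a = (if a \<in> parcs G then \<phi> a else a)" for a
 have sw: "prod.swap a \<in> parcs G" if "a \<in> parcs G" for a using that pair_graphD(6)[OF pG, of "fst a" "snd a"] by (simp add: prod.swap_def)
 have \<phi>in: "\<phi> a \<in> parcs G" if "a \<in> parcs G" for a unfolding \<phi>_def using sw[OF that] permutes_in_image[OF perm] by simp
 have inj\<rho>: "inj \<rho>" using permutes_inj[OF perm] .
 have "inj_on \<phi>' (parcs G)" 
 proof (rule inj_onI)
  fix a b assume ab: "a \<in> parcs G" "b \<in> parcs G" "\<phi>' a = \<phi>' b"
  hence "\<rho> (prod.swap a) = \<rho> (prod.swap b)" unfolding \<phi>'_def \<phi>_def by simp
  hence "prod.swap a = prod.swap b" by (rule injD[OF inj\<rho>])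
  hence "prod.swap (prod.swap a) = prod.swap (prod.swap b)" by (rule arg_cong)
  thus "a = b" by (simp only: swap_swap)
 qed
 moreover have "\<phi>' ` parcs G \<subseteq> parcs G" unfolding \<phi>'_def using \<phi>in by auto
 ultimately have "bij_betw \<phi>' (parcs G) (parcs G)" using pair_graphD(2)[OF pG] by (simp add: bij_betw_def endo_inj_surj)
 hence perm': "\<phi>' permutes parcs G" by (rule bij_imp_permutes) (simp add: \<phi>'_def)
 have orb: "orbit \<phi> a = orbit \<phi>' a" if "a \<in> parcs G" for a
  by (rule orbit_cong0[of a "parcs G"]) (use that \<phi>in in \<open>auto simp: \<phi>'_def\<close>)
 have F: "faces G \<rho> = orbit \<phi>' ` parcs G" unfolding faces_def \<phi>_def[symmetric] using orb by (intro image_cong) auto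
 have cyc': "cyclic_on \<phi>' (orbit \<phi>' a)" for a by (rule cyclic_on_orbit[OF perm' pair_graphD(2)[OF pG]])
 have self: "a \<in> orbit \<phi>' a" for a
  using permutation_self_in_orbit permutation_permutes perm' pair_graphD(2)[OF pG] by metis
 have osub: "orbit \<phi>' a \<subseteq> parcs G" if "a \<in> parcs G" for a by (rule permutes_orbit_subset[OF perm' that])
 have markF: "mark s \<in> orbit \<phi>' ` parcs G" for s using bij unfolding F bij_betw_def by blast
 have mark_orb: "mark s = orbit \<phi>' a" if a: "a \<in> mark s" for s a
 proof -
  obtain b where "mark s = orbit \<phi>' b" using markF[of s] by blast
  thus ?thesis using orbit_cyclic_eq3[OF cyc' , of a b] a by simp
 qed
 have mark_sub: "mark s \<subseteq> parcs G" for s using markF[of s] osub by blast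
 have ex: "\<exists>s. a \<in> mark s" if "a \<in> parcs G" for a
 proof -
  have "orbit \<phi>' a \<in> mark ` UNIV" using bij that unfolding F bij_betw_def by blast
  thus ?thesis using self by blast
 qed
 have uniq: "s = t" if "a \<in> mark s" "a \<in> mark t" for a s t
  using mark_orb[OF that(1)] mark_orb[OF that(2)] bij unfolding bij_betw_def by (metis injD)
 define \<nu> where "\<nu> a = (THE s. a \<in> mark s)" for a
 have \<nu>: "\<nu> a = s" if "a \<in> mark s" for a s unfolding \<nu>_def using that uniq by blast
 have \<nu>_iff: "a \<in> mark s \<longleftrightarrow> a \<in> parcs G & \<nu> a = s" for a s using \<nu> ex mark_sub by blast
 have \<nu>\<phi>: "\<nu> (\<phi> a) = \<nu> a" if aG: "a \<in> parcs G" for a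
 proof -
  obtain s where s: "a \<in> mark s" using ex[OF aG] by blast
  have "\<phi>' a \<in> mark s" unfolding mark_orb[OF s] by (rule orbit.base)
  thus ?thesis using \<nu>[of "\<phi> a" s] \<nu>[OF s] aG unfolding \<phi>'_def by simp
 qed
 have img: "\<nu> ` parcs G = UNIV"
 proof -
  have "s \<in> \<nu> ` parcs G" for s
  proof -
   obtain b where "mark s = orbit \<phi>' b" using markF[of s] by blast
   hence "b \<in> mark s" using self[of b] by simp
   thus ?thesis using \<nu>_iff[of b s] by auto
  qed
  thus ?thesis by blast
 qed
 have "card (UNIV :: 's set) = card (faces G \<rho>)" using bij by (rule bij_betw_same_card)
 hence cnt: "face_count G \<nu>" unfolding face_count_def img using eul by simp
 have "face_labelling G \<nu>"
  unfolding face_labelling_def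
 proof
  fix u assume u: "u \<in> pverts G"
  define Ou where "Ou = out_arcs (with_proj G) u"
  have Oin: "a \<in> Ou \<longleftrightarrow> a \<in> parcs G & fst a = u" for a unfolding Ou_def by simp
  have c3: "card Ou = 3" and cy: "cyclic_on \<rho> Ou" unfolding Ou_def using tri[OF u] cyc[OF u] by auto
  have "Ou ~= {}" using c3 by auto
  then obtain p where p: "p \<in> Ou" by blast
  have orbOu: "Ou = orbit \<rho> p" using orbit_cyclic_eq3[OF cy p] by simp
  have q: "\<rho> p \<in> Ou" and r: "\<rho> (\<rho> p) \<in> Ou" and r3: "\<rho> (\<rho> (\<rho> p)) \<in> Ou" using cyclic_on_inI[OF cy] p by blast+
  \<comment> \<open>On a cyclic set of three elements \<open>\<rho>\<close> has neither a fixed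
    point nor a 2-cycle.\<close>
  have d1: "\<rho> p ~= p"
  proof
   assume "\<rho> p = p" hence "Ou = {p}" using orbOu orbit_eq_singleton_iff by metis
   thus False using c3 by simp
  qed
  have d2: "\<rho> (\<rho> p) ~= p"
  proof
   assume e: "\<rho> (\<rho> p) = p"
   have "x \<in> {p, \<rho> p}" if "x \<in> orbit \<rho> p" for x using that by induction (use e in auto)
   hence "Ou \<subseteq> {p, \<rho> p}" unfolding orbOu by blast
   hence "card Ou <= card {p, \<rho> p}" by (intro card_mono) auto
   thus False using c3 d1 by simp
  qed
  have d3: "\<rho> (\<rho> p) ~= \<rho> p" using d1 inj\<rho> by (auto dest: injD)
  have sub3: "{p, \<rho> p, \<rho> (\<rho> p)} \<subseteq> Ou" using p q r by blast
  have "finite Ou" using c3 by (intro card_ge_0_finite) simp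
  hence O3: "Ou = {p, \<rho> p, \<rho> (\<rho> p)}" using card_subset_eq[OF _ sub3] c3 d1 d2 d3 by (simp add: eq_commute)
  have "\<rho> (\<rho> (\<rho> p)) ~= \<rho> p" "\<rho> (\<rho> (\<rho> p)) ~= \<rho> (\<rho> p)" using d2 d3 inj\<rho> by (auto dest: injD)
  hence e3: "\<rho> (\<rho> (\<rho> p)) = p" using r3 O3 by blast
  define x y z where "x = snd p" and "y = snd (\<rho> p)" and "z = snd (\<rho> (\<rho> p))"
  have ux: "p = (u, x)" "\<rho> p = (u, y)" "\<rho> (\<rho> p) = (u, z)" using Oin p q r unfolding x_def y_def z_def by (metis prod.collapse)+
  have "distinct [x,y,z]" using d1 d2 d3 ux by auto
  moreover have "nbrs G u = {x,y,z}"
  proof -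
   have "Ou = {(u, x), (u, y), (u, z)}" using O3[unfolded ux(3), unfolded ux(2), unfolded ux(1)] .
   moreover have "w \<in> nbrs G u \<longleftrightarrow> (u, w) \<in> Ou" for w unfolding nbrs_def Oin by simp
   ultimately have "w \<in> nbrs G u \<longleftrightarrow> w = x \<or> w = y \<or> w = z" for w by simp
   thus ?thesis by blast
  qed
  moreover have "rot \<nu> u x y z"
  proof -
   have ar: "(x, u) \<in> parcs G" "(y, u) \<in> parcs G" "(z, u) \<in> parcs G"
    using Oin p q r ux pair_graphD(6)[OF pG] by metis+
   have "\<phi> (x, u) = (u, y)" "\<phi> (y, u) = (u, z)" "\<phi> (z, u) = (u, x)" unfolding \<phi>_def using ux e3 by auto
   thus ?thesis unfolding rot_def using \<nu>\<phi>[OF ar(1)] \<nu>\<phi>[OF ar(2)] \<nu>\<phi>[OF ar(3)] by simp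
  qed
  ultimately show "\<exists>x y z. distinct [x,y,z] & nbrs G u = {x,y,z} & rot \<nu> u x y z" by blast
 qed
 moreover have "mark s = {a \<in> parcs G. \<nu> a = s}" for s using \<nu>_iff by blast
 ultimately show ?thesis using img cnt by (intro that)
qed

text \<open>A vertex becomes the set of faces through it. Vertices with two common faces are joined
  by an edge: one of them has an edge with these two sides, and its other end is the only further
  vertex on both faces.\<close>

theorem marked_graph_stack:
 fixes mark :: "'s::finite => ('v \<times> 'v) set"
 assumes M: "marked_labelled_graph G \<rho> \<theta> mark" and E: "combinatorial_ecimahedron G" and nt: "\<not> tetrahedron_graph G"
 defines "\<tau> \<equiv> \<lambda>u. {s. u \<in> face_verts (mark s)}"
 obtains T L where "stk (UNIV :: 's set) T L" "L ~= []" "bij_betw \<tau> (pverts G) (fst ` T)"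
  "!!s t e. s ~= t ==> e \<in> face_edges (mark s) \<inter> face_edges (mark t) \<longleftrightarrow>
    (\<exists>u\<in>pverts G. \<exists>w\<in>pverts G. u ~= w & e = {u, w} & {s, t} \<subseteq> \<tau> u \<inter> \<tau> w)"
  "!!u w. u \<in> pverts G ==> w \<in> pverts G ==> u ~= w ==> (u, w) \<in> parcs G \<longleftrightarrow> (\<exists>s t. s ~= t & {s, t} \<subseteq> \<tau> u \<inter> \<tau> w)"
  "!!s. face_verts (mark s) \<subseteq> pverts G"
proof -
 obtain \<nu> where F: "face_labelling G \<nu>" and img: "\<nu> ` parcs G = (UNIV :: 's set)" and C: "face_count G \<nu>"
  and mark: "!!s. mark s = {a \<in> parcs G. \<nu> a = s}" by (rule marked_graph_labelling[OF M]) blast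
 have pG: "pair_graph G" using ecim_basic[OF E] by blast
 obtain T L where st: "stk (UNIV :: 's set) T L" and Tc: "fst ` T = cell G \<nu> ` pverts G" and inj: "inj_on (cell G \<nu>) (pverts G)"
  and L: "L ~= []" using ecim_stack[OF E F C] nt unfolding img by blast
 have \<tau>: "\<tau> u = cell G \<nu> u" for u
  unfolding \<tau>_def face_verts_def mark cell_def nbrs_def by (auto simp: image_iff)
 have two: "\<nu> (u, w) ~= \<nu> (w, u)" if "(u, w) \<in> parcs G" for u w by (rule two_sides[OF E F C that])
 have adj1: "(u, w) \<in> parcs G & {s, t} = {\<nu> (u, w), \<nu> (w, u)}"
  if V: "u \<in> pverts G" "w \<in> pverts G" "u ~= w" "s ~= t" "{s, t} \<subseteq> \<tau> u \<inter> \<tau> w" for u w s t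
 proof -
  have c: "{s,t} \<subseteq> cell G \<nu> u" "{s,t} \<subseteq> cell G \<nu> w" using V(5) unfolding \<tau> by blast+
  obtain q where q: "(u, q) \<in> parcs G" "{s,t} = {\<nu> (u, q), \<nu> (q, u)}" using side_pair[OF F V(1) _ _ V(4)] c by blast
  have qV: "q \<in> pverts G" "u ~= q" using pair_graphD(4,5)[OF pG q(1)] by auto
  have "{s,t} \<subseteq> cell G \<nu> q" unfolding q(2) using arc_cells[OF F pG q(1)] by blast
  hence "w = q" using at_most_two_cells[OF st Tc inj V(1,2) qV(1) c] V(3,4) qV(2) by blast
  thus ?thesis using q by simp
 qed
 have adj2: "{\<nu> (u, w), \<nu> (w, u)} \<subseteq> \<tau> u \<inter> \<tau> w" if "(u, w) \<in> parcs G" for u w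
  unfolding \<tau> using arc_cells[OF F pG that] by blast
 show ?thesis
 proof (rule that[OF st L])
  show "bij_betw \<tau> (pverts G) (fst ` T)" unfolding bij_betw_def Tc using inj \<tau> by (simp add: inj_on_def)
  show "face_verts (mark s) \<subseteq> pverts G" for s unfolding face_verts_def mark using pair_graphD(3)[OF pG] by auto
  show "(u, w) \<in> parcs G \<longleftrightarrow> (\<exists>s t. s ~= t & {s, t} \<subseteq> \<tau> u \<inter> \<tau> w)" if V: "u \<in> pverts G" "w \<in> pverts G" "u ~= w" for u w
   using adj1[OF V] adj2[of u w] two[of u w] by blast
  fix s t :: 's and e assume ne: "s ~= t"
  show "e \<in> face_edges (mark s) \<inter> face_edges (mark t) \<longleftrightarrow>
    (\<exists>u\<in>pverts G. \<exists>w\<in>pverts G. u ~= w & e = {u, w} & {s, t} \<subseteq> \<tau> u \<inter> \<tau> w)"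
  proof
   assume "e \<in> face_edges (mark s) \<inter> face_edges (mark t)"
   then obtain u w u' w' where e: "e = {u, w}" "(u, w) \<in> parcs G" "\<nu> (u, w) = s" "e = {u', w'}" "(u', w') \<in> parcs G" "\<nu> (u', w') = t"
    unfolding face_edges_def mark by blast
   hence "u' = w & w' = u" using ne by (auto simp: doubleton_eq_iff)
   hence "{s, t} = {\<nu> (u, w), \<nu> (w, u)}" using e by simp
   thus "\<exists>u\<in>pverts G. \<exists>w\<in>pverts G. u ~= w & e = {u, w} & {s, t} \<subseteq> \<tau> u \<inter> \<tau> w"
    using e(1) adj2[OF e(2)] pair_graphD(3-5)[OF pG e(2)] by metis
  next
   assume "\<exists>u\<in>pverts G. \<exists>w\<in>pverts G. u ~= w & e = {u, w} & {s, t} \<subseteq> \<tau> u \<inter> \<tau> w"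
   then obtain u w where uw: "u \<in> pverts G" "w \<in> pverts G" "u ~= w" "e = {u, w}" "{s, t} \<subseteq> \<tau> u \<inter> \<tau> w" by blast
   have a: "(u, w) \<in> parcs G" "{s, t} = {\<nu> (u, w), \<nu> (w, u)}" using adj1[OF uw(1-3) ne uw(5)] by auto
   have a': "(w, u) \<in> parcs G" using pair_graphD(6)[OF pG a(1)] .
   have "(s = \<nu> (u, w) & t = \<nu> (w, u)) \<or> (s = \<nu> (w, u) & t = \<nu> (u, w))" using a(2) by (simp add: doubleton_eq_iff)
   moreover have "e = {w, u}" using uw(4) by (simp add: insert_commute)
   ultimately show "e \<in> face_edges (mark s) \<inter> face_edges (mark t)" unfolding face_edges_def mark using a(1) a' uw(4) by blast
  qed
 qed
qed

section \<open>Moduli of configurations on a stack\<close>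

text \<open>The expression is \<open>- (cos z + cos (x + y)) * (cos z + cos (x - y))\<close>.\<close>

lemma cos_triangle_neg:
 fixes x y z :: real
 assumes "0 < x" "x <= pi/2" "0 < y" "y <= pi/2" "0 < z" "z <= pi/2" "x + y + z < pi"
 shows "1 - (cos x)\<^sup>2 - (cos y)\<^sup>2 - (cos z)\<^sup>2 - 2 * cos x * cos y * cos z < 0"
proof -
 have "cos (pi - (x + y)) < cos z" by (rule cos_monotone_0_pi) (use assms in auto)
 hence 1: "0 < cos z + cos (x + y)" by simp
 have "cos (pi - \<bar>x - y\<bar>) < cos z" by (rule cos_monotone_0_pi) (use assms in auto)
 moreover have "cos (pi - \<bar>x - y\<bar>) = - cos (x - y)" unfolding cos_pi_minus cos_abs_real ..
 ultimately have 2: "0 < cos z + cos (x - y)" by linarith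
 have "cos (x + y) * cos (x - y) = (cos x)\<^sup>2 * (cos y)\<^sup>2 - (sin x)\<^sup>2 * (sin y)\<^sup>2"
  by (simp add: cos_add cos_diff power2_eq_square algebra_simps)
 also have "\<dots> = (cos x)\<^sup>2 + (cos y)\<^sup>2 - 1" by (simp add: sin_squared_eq algebra_simps)
 finally have p: "cos (x + y) * cos (x - y) = (cos x)\<^sup>2 + (cos y)\<^sup>2 - 1" .
 have s: "cos (x + y) + cos (x - y) = 2 * cos x * cos y" by (simp add: cos_add cos_diff)
 have "(cos z + cos (x + y)) * (cos z + cos (x - y)) = (cos z)\<^sup>2 + cos z * (cos (x + y) + cos (x - y)) + cos (x + y) * cos (x - y)"
  by (simp add: algebra_simps power2_eq_square)
 also have "\<dots> = (cos z)\<^sup>2 + 2 * cos x * cos y * cos z + (cos x)\<^sup>2 + (cos y)\<^sup>2 - 1" unfolding s p by simp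
 finally show ?thesis using mult_pos_pos[OF 1 2] by linarith
qed

text \<open>The cyclic products \<open>p\<close> and \<open>q\<close> are nonpositive with product
  \<open>64 * w^2\<close>, so \<open>- (p + q)\<close> is at least \<open>16 * w\<close> by the
  inequality of arithmetic and geometric means. The determinant is then at most eight times the
  expression of \<open>cos_triangle_neg\<close>.\<close>

lemma hyp_of_angles:
 assumes "0 < x" "x <= pi/2" "0 < y" "y <= pi/2" "0 < z" "z <= pi/2" "x + y + z < pi"
  and diag: "M a a = 2" "M b b = 2" "M c c = 2"
  and le: "M a b <= 0" "M b a <= 0" "M a c <= 0" "M c a <= 0" "M b c <= 0" "M c b <= 0"
  and zero: "M a b = 0 \<longleftrightarrow> M b a = 0" "M a c = 0 \<longleftrightarrow> M c a = 0" "M b c = 0 \<longleftrightarrow> M c b = 0"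
  and pr: "M a b * M b a = 4 * (cos x)\<^sup>2" "M a c * M c a = 4 * (cos y)\<^sup>2" "M b c * M c b = 4 * (cos z)\<^sup>2"
 shows "hyp M a b c"
proof -
 have lt: "4 * (cos t)\<^sup>2 < 4" if "0 < t" "t <= pi/2" for t :: real
 proof -
  have "0 < sin t" by (rule sin_gt_zero) (use that pi_half_less_two pi_gt_zero in linarith)+
  hence "0 < (sin t)\<^sup>2" by simp
  thus ?thesis by (simp add: cos_squared_eq)
 qed
 have cz: "0 <= cos x" "0 <= cos y" "0 <= cos z" by (intro cos_ge_zero; use assms(1-6) in linarith)+
 define p q w where "p = M a b * M b c * M c a" and "q = M a c * M c b * M b a" and "w = cos x * cos y * cos z"
 have w: "0 <= w" unfolding w_def using cz by simp
 have pq0: "p <= 0" "q <= 0" unfolding p_def q_def using le by (simp_all add: mult_nonneg_nonpos mult_nonpos_nonpos)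
 have "p * q = (M a b * M b a) * (M a c * M c a) * (M b c * M c b)" unfolding p_def q_def by (simp add: algebra_simps)
 also have "\<dots> = 64 * w\<^sup>2" unfolding pr w_def by (simp add: power_mult_distrib)
 finally have pq: "p * q = 64 * w\<^sup>2" .
 have "(16 * w)\<^sup>2 <= (- (p + q))\<^sup>2"
 proof -
  have "(- (p + q))\<^sup>2 = (p - q)\<^sup>2 + 4 * (p * q)" by (simp add: power2_eq_square algebra_simps)
  thus ?thesis using pq zero_le_power2[of "p - q"] by (simp add: power_mult_distrib)
 qed
 hence "16 * w <= - (p + q)" by (rule power2_le_imp_le) (use pq0 in simp)
 moreover have "1 - (cos x)\<^sup>2 - (cos y)\<^sup>2 - (cos z)\<^sup>2 - 2 * w < 0" using cos_triangle_neg[OF assms(1-7)] unfolding w_def by (simp add: algebra_simps)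
 ultimately have "8 - 2 * (M a b * M b a + M a c * M c a + M b c * M c b) + p + q < 0" unfolding pr by argo
 thus ?thesis unfolding hyp_def using diag le zero lt[OF assms(1,2)] lt[OF assms(3,4)] lt[OF assms(5,6)] pr
  unfolding p_def q_def by simp
qed

section \<open>Smooth dependence of solutions on parameters\<close>

definition solve4 :: "real^4 => real^4 => real^4 => real^4 => real => real => real => real => real^4" where
 "solve4 a b c d wa wb wc wd = (wd / D4 a b c d) *\<^sub>R cross4 a b c - (wc / D4 a b c d) *\<^sub>R cross4 a b d
   + (wb / D4 a b c d) *\<^sub>R cross4 a c d - (wa / D4 a b c d) *\<^sub>R cross4 b c d"

lemma solve4:
 assumes "D4 a b c d ~= 0"
 shows "a \<bullet> solve4 a b c d wa wb wc wd = wa" "b \<bullet> solve4 a b c d wa wb wc wd = wb"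
  "c \<bullet> solve4 a b c d wa wb wc wd = wc" "d \<bullet> solve4 a b c d wa wb wc wd = wd"
proof -
 have i: "y \<bullet> solve4 a b c d wa wb wc wd = wd / D4 a b c d * D4 a b c y - wc / D4 a b c d * D4 a b d y
   + wb / D4 a b c d * D4 a c d y - wa / D4 a b c d * D4 b c d y" for y
  unfolding solve4_def inner_commute[of y] by (simp add: inner_add_left inner_diff_left cross4_inner)
 have s: "D4 a b d c = - D4 a b c d" "D4 a c d b = D4 a b c d" "D4 b c d a = - D4 a b c d"
  by (simp_all add: D4_explicit algebra_simps)
 show "a \<bullet> solve4 a b c d wa wb wc wd = wa" "b \<bullet> solve4 a b c d wa wb wc wd = wb"
  "c \<bullet> solve4 a b c d wa wb wc wd = wc" "d \<bullet> solve4 a b c d wa wb wc wd = wd"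
  unfolding i s D4_alt using assms by simp_all
qed

lemmas smooth_rules = C_infinity_on_const C_infinity_on_add C_infinity_on_diff C_infinity_on_mult C_infinity_on_minus

lemma C_infinity_on_D4:
 assumes U: "open U" and "!!i. C_infinity_on U (\<lambda>x. a x $ i)" "!!i. C_infinity_on U (\<lambda>x. b x $ i)"
  "!!i. C_infinity_on U (\<lambda>x. c x $ i)" "!!i. C_infinity_on U (\<lambda>x. d x $ i)"
 shows "C_infinity_on U (\<lambda>x. D4 (a x) (b x) (c x) (d x))"
 unfolding D4_explicit by (intro smooth_rules U assms)

lemma C_infinity_on_cross4:
 assumes U: "open U" and "!!i. C_infinity_on U (\<lambda>x. a x $ i)" "!!i. C_infinity_on U (\<lambda>x. b x $ i)"
  "!!i. C_infinity_on U (\<lambda>x. c x $ i)"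
 shows "C_infinity_on U (\<lambda>x. cross4 (a x) (b x) (c x) $ i)"
 unfolding cross4_def vec_lambda_beta by (intro C_infinity_on_D4 U assms C_infinity_on_const)

lemma C_infinity_on_solve4:
 assumes U: "open U" and s: "!!i. C_infinity_on U (\<lambda>x. a x $ i)" "!!i. C_infinity_on U (\<lambda>x. b x $ i)"
  "!!i. C_infinity_on U (\<lambda>x. c x $ i)" "!!i. C_infinity_on U (\<lambda>x. d x $ i)"
  and w: "C_infinity_on U wa" "C_infinity_on U wb" "C_infinity_on U wc" "C_infinity_on U wd"
  and nz: "!!x. x \<in> U ==> D4 (a x) (b x) (c x) (d x) ~= 0"
 shows "C_infinity_on U (\<lambda>x. solve4 (a x) (b x) (c x) (d x) (wa x) (wb x) (wc x) (wd x) $ i)"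
 unfolding solve4_def vector_add_component vector_minus_component vector_scaleR_component real_scaleR_def
 by (intro C_infinity_on_add C_infinity_on_diff C_infinity_on_mult C_infinity_on_divide C_infinity_on_cross4 C_infinity_on_D4 U s w nz)

text \<open>The formulas of \<open>hyp_solvable\<close> with a parameter: polynomials in the data
  divided by the nonvanishing determinant.\<close>

lemma hyp_solve_smooth:
 assumes h: "!!x. hyp (M x) a b c" and M: "!!s t. C_infinity_on UNIV (\<lambda>x. M x s t)"
  and w: "C_infinity_on UNIV wa" "C_infinity_on UNIV wb" "C_infinity_on UNIV wc"
 shows "\<exists>ca cb cc. C_infinity_on UNIV ca & C_infinity_on UNIV cb & C_infinity_on UNIV cc &
  (\<forall>x. 2 * ca x + M x b a * cb x + M x c a * cc x = wa x & M x a b * ca x + 2 * cb x + M x c b * cc x = wb x &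
   M x a c * ca x + M x b c * cb x + 2 * cc x = wc x)"
proof -
 define D where "D x = 8 - 2 * (M x a b * M x b a + M x a c * M x c a + M x b c * M x c b) + M x a b * M x b c * M x c a + M x a c * M x c b * M x b a" for x
 have D: "D x ~= 0" for x using h[of x] unfolding hyp_def D_def by simp
 define X where "X x = (4 - M x b c * M x c b) * wa x + (M x b c * M x c a - 2 * M x b a) * wb x + (M x b a * M x c b - 2 * M x c a) * wc x" for x
 define Y where "Y x = (4 - M x a c * M x c a) * wb x + (M x a c * M x c b - 2 * M x a b) * wa x + (M x a b * M x c a - 2 * M x c b) * wc x" for x
 define Z where "Z x = (4 - M x b a * M x a b) * wc x + (M x b a * M x a c - 2 * M x b c) * wb x + (M x b c * M x a b - 2 * M x a c) * wa x" for x
 have e: "2 * X x + M x b a * Y x + M x c a * Z x = D x * wa x" "M x a b * X x + 2 * Y x + M x c b * Z x = D x * wb x"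
  "M x a c * X x + M x b c * Y x + 2 * Z x = D x * wc x" for x
  unfolding X_def Y_def Z_def D_def by (simp_all add: algebra_simps)
 note sm = smooth_rules M w open_UNIV
 have sD: "C_infinity_on UNIV D" and sX: "C_infinity_on UNIV X" and sY: "C_infinity_on UNIV Y" and sZ: "C_infinity_on UNIV Z"
  unfolding D_def X_def Y_def Z_def by (intro sm)+
 show ?thesis
 proof (intro exI conjI allI)
  show "C_infinity_on UNIV (\<lambda>x. X x / D x)" "C_infinity_on UNIV (\<lambda>x. Y x / D x)" "C_infinity_on UNIV (\<lambda>x. Z x / D x)"
   by (intro C_infinity_on_divide open_UNIV sX sY sZ sD D)+
  fix x
  have f: "r * (u / D x) = r * u / D x" for r u by simp
  show "2 * (X x / D x) + M x b a * (Y x / D x) + M x c a * (Z x / D x) = wa x"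
   "M x a b * (X x / D x) + 2 * (Y x / D x) + M x c b * (Z x / D x) = wb x"
   "M x a c * (X x / D x) + M x b c * (Y x / D x) + 2 * (Z x / D x) = wc x"
   unfolding f add_divide_distrib[symmetric] e using D[of x] by simp_all
 qed
qed

lemma stk_step_mem: "stk S T L ==> (k, tr, d) \<in> set L ==> k \<in> S & tr \<subseteq> S & d \<in> S & card tr = 3 & d \<notin> tr & k \<notin> insert d tr"
proof (induction rule: stk.induct)
 case (step S T L tr0 d0 k0)
 thus ?case using stk_cell[OF step.hyps(1,2)] by auto
qed simp

lemma adj_in: "stk S T L ==> adj T s t ==> s \<in> S & t \<in> S"
 using stk_cell[of S T L] unfolding adj_def by fastforce

lemma adj_step_cases:
 assumes s: "stk S T L" "(tr, d) \<in> T" "k \<notin> S" and a: "adj (step_cells T k tr d) s t"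
 shows "adj T s t \<or> (s = k & t \<in> tr) \<or> (t = k & s \<in> tr)"
proof -
 obtain \<tau> where \<tau>: "\<tau> \<in> fst ` step_cells T k tr d" "s \<in> \<tau>" "t \<in> \<tau>" "s ~= t" using a by (rule adjE)
 have trT: "tr \<in> fst ` T" using s(2) by force
 from \<tau>(1)[unfolded step_cells_iff[OF s(1,2)]] show ?thesis
 proof
  assume "\<tau> \<in> fst ` T & \<tau> ~= tr" thus ?thesis using \<tau> adjI by metis
 next
  assume "\<exists>x\<in>tr. \<tau> = insert k (tr - {x})"
  hence "s = k \<or> s \<in> tr" "t = k \<or> t \<in> tr" using \<tau>(2,3) by auto
  thus ?thesis using \<tau>(4) adjI[OF trT, of s t] by blast
 qed
qed

text \<open>On the base tetrahedron the forms are coordinate forms and \<open>v t\<close> is the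
  column of \<open>A\<close> at \<open>t\<close>. A later \<open>\<alpha> k\<close> is fixed by its
  coefficient at \<open>\<alpha> d\<close> and its values on the vectors of \<open>tr\<close>, which
  uses hyperbolicity; \<open>v k\<close> is fixed by the values of the forms of \<open>tr\<close>
  and by the normalisation.\<close>

theorem stack_section:
 fixes A :: "'x::euclidean_space => 's => 's => real"
 assumes "stk S T L"
  and A: "!!s t. C_infinity_on UNIV (\<lambda>x. A x s t)" and E: "!!k d. C_infinity_on UNIV (\<lambda>x. E x k d)"
  and Epos: "!!x k d. 0 < E x k d" and diag: "!!x s. A x s s = 2"
  and "!!x k a b c d. (k, {a,b,c}, d) \<in> set L ==> distinct [a,b,c] ==> hyp (A x) a b c"
 shows "\<exists>\<alpha> v. (\<forall>s i. C_infinity_on UNIV (\<lambda>x. \<alpha> x s $ i)) & (\<forall>s i. C_infinity_on UNIV (\<lambda>x. v x s $ i)) &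
   (\<forall>x. \<forall>s\<in>S. \<alpha> x s \<bullet> v x s = 2) & (\<forall>x s t. adj T s t --> \<alpha> x s \<bullet> v x t = A x s t) &
   (\<forall>x \<tau> d. (\<tau>, d) \<in> T --> nd (\<alpha> x) (insert d \<tau>)) &
   (\<forall>x k tr d. (k, tr, d) \<in> set L --> nd (\<alpha> x) (insert d tr) &
    (\<exists>c. \<alpha> x k = (\<Sum>i\<in>tr. c i *\<^sub>R \<alpha> x i) - E x k d *\<^sub>R \<alpha> x d))"
 using assms(1,6)
proof (induction rule: stk.induct)
 case (base S)
 have "S ~= {}" using base(1) by auto
 then obtain d where d: "d \<in> S" by blast
 obtain a b c where abc: "S = {a,b,c,d}" "distinct [a,b,c,d]" by (rule card4E[OF base(1) d])
 define \<alpha> :: "'x => 's => real^4" where "\<alpha> x s = axis (if s = a then 1 else if s = b then 2 else if s = c then 3 else 4) 1" for x s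
 define v :: "'x => 's => real^4" where "v x t = (\<chi> i. if i = 1 then A x a t else if i = 2 then A x b t else if i = 3 then A x c t else A x d t)" for x t
 have val: "\<alpha> x s \<bullet> v x t = A x s t" if "s \<in> S" for x s t
  using that abc unfolding \<alpha>_def v_def by (auto simp: inner_axis')
 have "C_infinity_on UNIV (\<lambda>x. v x s $ i)" for s i
  unfolding v_def vec_lambda_beta using A by (cases "i = 1"; cases "i = 2"; cases "i = 3") simp_all
 moreover have "C_infinity_on UNIV (\<lambda>x. \<alpha> x s $ i)" for s i unfolding \<alpha>_def by (rule C_infinity_on_const)
 moreover have "nd (\<alpha> x) S" for x
 proof -
  have "b ~= a" "c ~= a" "c ~= b" "d ~= a" "d ~= b" "d ~= c" using abc(2) by auto
  thus ?thesis unfolding nd_def abc(1) by (simp add: \<alpha>_def inner_axis' vec_eq_4)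
 qed
 hence "nd (\<alpha> x) (insert e \<tau>)" if "(\<tau>, e) \<in> (\<lambda>x. (S - {x}, x)) ` S" for \<tau> e x using that by (auto simp: insert_absorb)
 moreover have "s \<in> S" if "adj ((\<lambda>x. (S - {x}, x)) ` S) s t" for s t using adj_in[OF stk.base[OF base(1)] that] by blast
 ultimately show ?case by - (rule exI[of _ \<alpha>], rule exI[of _ v], simp add: val diag)
next
 case (step S T L tr d k)
 let ?T = "step_cells T k tr d"
 have "\<exists>\<alpha> v. (\<forall>s i. C_infinity_on UNIV (\<lambda>x. \<alpha> x s $ i)) & (\<forall>s i. C_infinity_on UNIV (\<lambda>x. v x s $ i)) &
   (\<forall>x. \<forall>s\<in>S. \<alpha> x s \<bullet> v x s = 2) & (\<forall>x s t. adj T s t --> \<alpha> x s \<bullet> v x t = A x s t) &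
   (\<forall>x \<tau> d. (\<tau>, d) \<in> T --> nd (\<alpha> x) (insert d \<tau>)) &
   (\<forall>x k tr d. (k, tr, d) \<in> set L --> nd (\<alpha> x) (insert d tr) &
    (\<exists>c. \<alpha> x k = (\<Sum>i\<in>tr. c i *\<^sub>R \<alpha> x i) - E x k d *\<^sub>R \<alpha> x d))"
 proof (rule step.IH)
  show "hyp (A x) a b c" if "(k', {a,b,c}, d') \<in> set L" "distinct [a,b,c]" for x k' a b c d'
   by (rule step.prems[of k' a b c d']) (use that in simp_all)
 qed
 then obtain \<alpha> v where H: "\<forall>s i. C_infinity_on UNIV (\<lambda>x. \<alpha> x s $ i)" "\<forall>s i. C_infinity_on UNIV (\<lambda>x. v x s $ i)"
   "\<forall>x. \<forall>s\<in>S. \<alpha> x s \<bullet> v x s = 2" "\<forall>x s t. adj T s t --> \<alpha> x s \<bullet> v x t = A x s t"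
   "\<forall>x \<tau> d. (\<tau>, d) \<in> T --> nd (\<alpha> x) (insert d \<tau>)"
   "\<forall>x k tr d. (k, tr, d) \<in> set L --> nd (\<alpha> x) (insert d tr) &
    (\<exists>c. \<alpha> x k = (\<Sum>i\<in>tr. c i *\<^sub>R \<alpha> x i) - E x k d *\<^sub>R \<alpha> x d)" by (elim exE conjE)
 have sm\<alpha>: "C_infinity_on UNIV (\<lambda>x. \<alpha> x s $ i)" and smv: "C_infinity_on UNIV (\<lambda>x. v x s $ i)" for s i using H(1,2) by simp_all
 have two: "\<alpha> x s \<bullet> v x s = 2" if "s \<in> S" for x s using H(3) that by simp
 have val: "\<alpha> x s \<bullet> v x t = A x s t" if "adj T s t" for x s t using H(4) that by simp
 have ndT: "nd (\<alpha> x) (insert d \<tau>)" if "(\<tau>, d) \<in> T" for x \<tau> d using H(5) that by simp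
 have ndL: "nd (\<alpha> x) (insert d tr)" and exL: "\<exists>c. \<alpha> x k = (\<Sum>i\<in>tr. c i *\<^sub>R \<alpha> x i) - E x k d *\<^sub>R \<alpha> x d"
  if "(k, tr, d) \<in> set L" for x k tr d using H(6)[rule_format, OF that] by (rule conjunct1, rule conjunct2)
 have tr: "card tr = 3" "tr \<subseteq> S" "d \<in> S" "d \<notin> tr" using stk_cell[OF step.hyps(1,2)] by auto
 have fin: "finite tr" using tr(1) by (intro card_ge_0_finite) simp
 have kS: "k \<notin> S" by (rule step.hyps)
 obtain a b c where abc: "tr = {a,b,c}" "distinct [a,b,c]" using tr(1)[unfolded card3_iff_distinct] by blast
 have ne: "a ~= b" "a ~= c" "b ~= c" "b ~= a" "c ~= a" "c ~= b" using abc(2) by auto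
 have m: "a \<in> tr" "b \<in> tr" "c \<in> tr" unfolding abc(1) by auto
 have D: "D4 (\<alpha> x a) (\<alpha> x b) (\<alpha> x c) (\<alpha> x d) ~= 0" for x
  using ndT[OF step.hyps(2), of x] unfolding abc(1) nd_D4[symmetric] by (simp add: insert_commute)
 have hx: "hyp (A x) a b c" for x by (rule step.prems[of k a b c d]) (use abc in simp_all)
 \<comment> \<open>Right-hand side of the equations for the coefficients of
   \<open>\<alpha> k\<close>, after moving its \<open>\<alpha> d\<close> term across.\<close>
 have sv: "C_infinity_on UNIV (\<lambda>x. A x k j + E x k d * A x d j)" for j by (intro smooth_rules A E open_UNIV)
 obtain ca cb cc where cs: "C_infinity_on UNIV ca" "C_infinity_on UNIV cb" "C_infinity_on UNIV cc"
  and ce: "!!x. 2 * ca x + A x b a * cb x + A x c a * cc x = A x k a + E x k d * A x d a"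
   "!!x. A x a b * ca x + 2 * cb x + A x c b * cc x = A x k b + E x k d * A x d b"
   "!!x. A x a c * ca x + A x b c * cb x + 2 * cc x = A x k c + E x k d * A x d c"
  using hyp_solve_smooth[OF hx A sv sv sv, of a b c] by (elim exE conjE) metis
 define \<alpha>k where "\<alpha>k x = ca x *\<^sub>R \<alpha> x a + cb x *\<^sub>R \<alpha> x b + cc x *\<^sub>R \<alpha> x c - E x k d *\<^sub>R \<alpha> x d" for x
 \<comment> \<open>The value of \<open>\<alpha> d\<close> on \<open>v k\<close> is chosen so that
   the form of \<open>k\<close> takes the value \<open>2\<close> on \<open>v k\<close>; this is
   possible because \<open>E\<close> is positive.\<close>
 define rd where "rd x = (ca x * A x a k + cb x * A x b k + cc x * A x c k - 2) / E x k d" for x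
 define vk where "vk x = solve4 (\<alpha> x a) (\<alpha> x b) (\<alpha> x c) (\<alpha> x d) (A x a k) (A x b k) (A x c k) (rd x)" for x
 have sm\<alpha>k: "C_infinity_on UNIV (\<lambda>x. \<alpha>k x $ i)" for i
  unfolding \<alpha>k_def vector_add_component vector_minus_component vector_scaleR_component real_scaleR_def
  by (intro smooth_rules open_UNIV cs sm\<alpha> E)
 have E0: "E x k d ~= 0" for x using Epos[of x k d] by simp
 have smrd: "C_infinity_on UNIV rd" unfolding rd_def by (intro C_infinity_on_divide smooth_rules open_UNIV cs A E E0)
 have smvk: "C_infinity_on UNIV (\<lambda>x. vk x $ i)" for i
  unfolding vk_def by (intro C_infinity_on_solve4 open_UNIV sm\<alpha> A smrd D)
 have sol: "\<alpha> x a \<bullet> vk x = A x a k" "\<alpha> x b \<bullet> vk x = A x b k" "\<alpha> x c \<bullet> vk x = A x c k" "\<alpha> x d \<bullet> vk x = rd x" for x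
  unfolding vk_def by (rule solve4[OF D])+
 have kk: "\<alpha>k x \<bullet> vk x = 2" for x
  unfolding \<alpha>k_def inner_diff_left inner_add_left inner_scaleR_left sol using E0[of x] by (simp add: rd_def)
 have vtr: "\<alpha> x i \<bullet> v x j = A x i j" if "i \<in> insert d tr" "j \<in> insert d tr" for x i j
 proof (cases "i = j")
  case True thus ?thesis using that two tr diag by auto
 next
  case False thus ?thesis using val[OF adj_tetra[OF step.hyps(1,2) that]] by blast
 qed
 have ktr: "\<alpha>k x \<bullet> v x j = A x k j" if "j \<in> tr" for x j
 proof -
  have "\<alpha> x i \<bullet> v x j = A x i j" if "i \<in> insert d tr" for i by (rule vtr[OF that]) (use \<open>j \<in> tr\<close> in simp)
  hence 1: "\<alpha>k x \<bullet> v x j = ca x * A x a j + cb x * A x b j + cc x * A x c j - E x k d * A x d j"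
   unfolding \<alpha>k_def inner_diff_left inner_add_left inner_scaleR_left using m by simp
  have "j = a \<or> j = b \<or> j = c" using that unfolding abc(1) by simp
  thus ?thesis unfolding 1 using ce[of x] diag[of x] by (auto simp: algebra_simps)
 qed
 have str: "\<alpha> x i \<bullet> vk x = A x i k" if "i \<in> tr" for x i using that sol[of x] unfolding abc(1) by auto
 define \<alpha>' where "\<alpha>' x = (\<alpha> x)(k := \<alpha>k x)" for x
 define v' where "v' x = (v x)(k := vk x)" for x
 have old: "\<alpha>' x s = \<alpha> x s" "v' x s = v x s" if "s \<in> S" for x s using that kS unfolding \<alpha>'_def v'_def by auto
 have new: "\<alpha>' x k = \<alpha>k x" "v' x k = vk x" for x unfolding \<alpha>'_def v'_def by auto
 have ktrn: "k \<notin> tr" "k ~= d" using tr kS by auto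
 have ndold: "nd (\<alpha>' x) Q \<longleftrightarrow> nd (\<alpha> x) Q" if "Q \<subseteq> S" for x Q
  unfolding nd_def using old(1) that by (metis subsetD)
 have bk: "\<alpha>' x k = (\<Sum>i\<in>tr. (if i = a then ca x else if i = b then cb x else cc x) *\<^sub>R \<alpha>' x i) - E x k d *\<^sub>R \<alpha>' x d" for x
 proof -
  have "\<alpha>' x a = \<alpha> x a" "\<alpha>' x b = \<alpha> x b" "\<alpha>' x c = \<alpha> x c" "\<alpha>' x d = \<alpha> x d" using old(1) m tr(2,3) by auto
  thus ?thesis unfolding new(1) \<alpha>k_def abc(1) using ne by simp
 qed
 have ndd: "nd (\<alpha>' x) (insert d tr)" for x using ndold[of "insert d tr" x] tr ndT[OF step.hyps(2)] by auto
 have bey: "beyond (\<alpha>' x) k tr d" for x unfolding beyond_def by (rule exI, rule exI, rule conjI, rule Epos, rule bk)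
 show ?case
 proof (rule exI[of _ \<alpha>'], rule exI[of _ v'], intro conjI allI ballI impI)
  fix s i
  show "C_infinity_on UNIV (\<lambda>x. \<alpha>' x s $ i)" using sm\<alpha>[of s i] sm\<alpha>k[of i] unfolding \<alpha>'_def by (cases "s = k") simp_all
  show "C_infinity_on UNIV (\<lambda>x. v' x s $ i)" using smv[of s i] smvk[of i] unfolding v'_def by (cases "s = k") simp_all
 next
  fix x s assume "s \<in> insert k S"
  thus "\<alpha>' x s \<bullet> v' x s = 2" using two old new kk by (cases "s = k") auto
 next
  fix x s t assume "adj ?T s t"
  from adj_step_cases[OF step.hyps this] show "\<alpha>' x s \<bullet> v' x t = A x s t"
  proof (elim disjE conjE)
   assume a: "adj T s t"
   thus ?thesis using adj_in[OF step.hyps(1) a] old val[OF a] by simp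
  next
   assume "s = k" "t \<in> tr" thus ?thesis using new(1) old(2)[of t] ktr tr(2) by auto
  next
   assume "t = k" "s \<in> tr" thus ?thesis using new(2) old(1)[of s] str tr(2) by auto
  qed
 next
  fix x \<tau> e assume \<tau>: "(\<tau>, e) \<in> ?T"
  show "nd (\<alpha>' x) (insert e \<tau>)"
  proof (cases "(\<tau>, e) \<in> T")
   case True
   thus ?thesis using ndold[of "insert e \<tau>" x] stk_cell[OF step.hyps(1) True] ndT[OF True] by auto
  next
   case False
   hence "insert e \<tau> = insert k tr" using \<tau> unfolding step_cells_def by auto
   thus ?thesis using beyond_nd[OF bey ndd] by simp
  qed
 next
  fix x k1 tr1 d1 assume "(k1, tr1, d1) \<in> set (L @ [(k, tr, d)])"
  then consider "(k1, tr1, d1) \<in> set L" | "k1 = k" "tr1 = tr" "d1 = d" by auto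
  hence "nd (\<alpha>' x) (insert d1 tr1) & (\<exists>c. \<alpha>' x k1 = (\<Sum>i\<in>tr1. c i *\<^sub>R \<alpha>' x i) - E x k1 d1 *\<^sub>R \<alpha>' x d1)"
  proof cases
   case 1
   hence i: "k1 \<in> S" "tr1 \<subseteq> S" "d1 \<in> S" using stk_step_mem[OF step.hyps(1)] by auto
   obtain c where "\<alpha> x k1 = (\<Sum>i\<in>tr1. c i *\<^sub>R \<alpha> x i) - E x k1 d1 *\<^sub>R \<alpha> x d1" using exL[OF 1] by blast
   moreover have "(\<Sum>i\<in>tr1. c i *\<^sub>R \<alpha> x i) = (\<Sum>i\<in>tr1. c i *\<^sub>R \<alpha>' x i)" using i(2) old(1) by (intro sum.cong) auto
   ultimately have "\<alpha>' x k1 = (\<Sum>i\<in>tr1. c i *\<^sub>R \<alpha>' x i) - E x k1 d1 *\<^sub>R \<alpha>' x d1" using old(1) i by simp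
   moreover have "nd (\<alpha>' x) (insert d1 tr1)" using ndL[OF 1] ndold[of "insert d1 tr1" x] i by simp
   ultimately show ?thesis by blast
  next
   case 2 show ?thesis unfolding 2 by (rule conjI[OF ndd], rule exI, rule bk)
  qed
  thus "nd (\<alpha>' x) (insert d1 tr1)" "\<exists>c. \<alpha>' x k1 = (\<Sum>i\<in>tr1. c i *\<^sub>R \<alpha>' x i) - E x k1 d1 *\<^sub>R \<alpha>' x d1" by blast+
 qed
qed

lemma matrix_inv_mult:
 fixes A :: "real^'n^'n"
 assumes "invertible A" shows "A ** matrix_inv A = mat 1" "matrix_inv A ** A = mat 1"
 using someI_ex[OF assms[unfolded invertible_def]] unfolding matrix_inv_def by auto

lemma invertible_matrix_inv: "invertible (A :: real^'n^'n) ==> invertible (matrix_inv A)"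
 using matrix_inv_mult unfolding invertible_def by blast

text \<open>On the base tetrahedron the forms determine \<open>g\<close>, and the Cartan entries
  then match the vectors. Every later pair satisfies the same linear equations on both sides, and
  hyperbolicity makes their solution unique.\<close>

theorem stack_unique:
 fixes \<alpha> v \<alpha>' v' :: "'s => real^4"
 assumes "stk S T L"
  and "!!s. s \<in> S ==> \<alpha> s \<bullet> v s = 2" and "!!s. s \<in> S ==> \<alpha>' s \<bullet> v' s = 2"
  and "!!s t. adj T s t ==> \<alpha> s \<bullet> v t = \<alpha>' s \<bullet> v' t"
  and "L = [] ==> nd \<alpha> S & nd \<alpha>' S"
  and "!!k tr d. (k, tr, d) \<in> set L ==> nd \<alpha> (insert d tr) & nd \<alpha>' (insert d tr) &
   (\<exists>e>0. \<exists>c c'. \<alpha> k = (\<Sum>i\<in>tr. c i *\<^sub>R \<alpha> i) - e *\<^sub>R \<alpha> d & \<alpha>' k = (\<Sum>i\<in>tr. c' i *\<^sub>R \<alpha>' i) - e *\<^sub>R \<alpha>' d)"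
  and "!!k a b c d. (k, {a,b,c}, d) \<in> set L ==> distinct [a,b,c] ==> hyp (cartan \<alpha> v) a b c"
 shows "\<exists>g::real^4^4. invertible g & (\<forall>s\<in>S. transpose g *v \<alpha>' s = \<alpha> s & g *v v s = v' s)"
 using assms
proof (induction rule: stk.induct)
 case (base S)
 have "S ~= {}" using base(1) by auto
 then obtain d where d: "d \<in> S" by blast
 obtain a b c where abc: "S = {a,b,c,d}" "distinct [a,b,c,d]" by (rule card4E[OF base(1) d])
 have nds: "nd \<alpha> S" "nd \<alpha>' S" using base(5) by auto
 define R where "R \<beta> = ((\<chi> i. if i = 1 then \<beta> a else if i = 2 then \<beta> b else if i = 3 then \<beta> c else \<beta> d) :: real^4^4)" for \<beta> :: "'s => real^4"
 have Rdet: "det (R \<beta>) = D4 (\<beta> a) (\<beta> b) (\<beta> c) (\<beta> d)" for \<beta> unfolding R_def D4_def ..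
 have inv: "invertible (R \<alpha>)" "invertible (R \<alpha>')" unfolding invertible_det_nz Rdet nd_D4[symmetric] using nds unfolding abc(1) by auto
 define g where "g = matrix_inv (R \<alpha>') ** R \<alpha>"
 have ig: "invertible g" unfolding g_def by (intro invertible_mult inv invertible_matrix_inv)
 have "R \<alpha>' ** g = (R \<alpha>' ** matrix_inv (R \<alpha>')) ** R \<alpha>" unfolding g_def by (rule matrix_mul_assoc)
 hence Rg: "R \<alpha>' ** g = R \<alpha>" by (simp add: matrix_inv_mult(1)[OF inv(2)])
 have g: "\<alpha>' s \<bullet> (g *v x) = \<alpha> s \<bullet> x" if "s \<in> S" for s x
 proof -
  have "(R \<beta> *v y) $ 1 = \<beta> a \<bullet> y" "(R \<beta> *v y) $ 2 = \<beta> b \<bullet> y" "(R \<beta> *v y) $ 3 = \<beta> c \<bullet> y" "(R \<beta> *v y) $ 4 = \<beta> d \<bullet> y" for \<beta> y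
   unfolding matrix_vector_mul_component R_def by simp_all
  moreover have "R \<alpha>' *v (g *v x) = R \<alpha> *v x" unfolding matrix_vector_mul_assoc Rg ..
  ultimately have "\<alpha>' a \<bullet> (g *v x) = \<alpha> a \<bullet> x" "\<alpha>' b \<bullet> (g *v x) = \<alpha> b \<bullet> x" "\<alpha>' c \<bullet> (g *v x) = \<alpha> c \<bullet> x" "\<alpha>' d \<bullet> (g *v x) = \<alpha> d \<bullet> x" by metis+
  thus ?thesis using that unfolding abc(1) by auto
 qed
 have g1: "transpose g *v \<alpha>' s = \<alpha> s" if "s \<in> S" for s
 proof -
  have "(transpose g *v \<alpha>' s) \<bullet> x = \<alpha> s \<bullet> x" for x
   using g[OF that, of x] by (metis dot_lmul_matrix vector_transpose_matrix transpose_transpose)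
  thus ?thesis by (metis vector_eq_rdot)
 qed
 have adj: "adj ((\<lambda>x. (S - {x}, x)) ` S) s t" if "s \<in> S" "t \<in> S" "s ~= t" for s t
  using adj_tetra[OF stk.base[OF base(1)], of "S - {s}" s s t] that by auto
 have g2: "g *v v t = v' t" if t: "t \<in> S" for t
 proof -
  have "\<alpha>' s \<bullet> (g *v v t) = \<alpha>' s \<bullet> v' t" if s: "s \<in> S" for s
  proof (cases "s = t")
   case True thus ?thesis using g[OF s] base(2,3) s by simp
  next
   case False thus ?thesis using g[OF s] base(4)[OF adj[OF s t]] by simp
  qed
  hence "\<forall>s\<in>S. \<alpha>' s \<bullet> (g *v v t - v' t) = 0" by (simp add: inner_diff_right)
  hence "g *v v t - v' t = 0" using nds(2) unfolding nd_def by blast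
  thus ?thesis by simp
 qed
 show ?case using ig g1 g2 by blast
next
 case (step S T L tr d k)
 let ?T = "step_cells T k tr d"
 note adjS = adj_step[OF step.hyps(1,2)]
 have tr: "card tr = 3" "tr \<subseteq> S" "d \<in> S" "d \<notin> tr" using stk_cell[OF step.hyps(1,2)] by auto
 have "(k, tr, d) \<in> set (L @ [(k, tr, d)])" by simp
 from step.prems(5)[OF this] obtain e y y' where ndd: "nd \<alpha> (insert d tr)" "nd \<alpha>' (insert d tr)" and e: "e > 0"
  and ky: "\<alpha> k = (\<Sum>i\<in>tr. y i *\<^sub>R \<alpha> i) - e *\<^sub>R \<alpha> d" and ky': "\<alpha>' k = (\<Sum>i\<in>tr. y' i *\<^sub>R \<alpha>' i) - e *\<^sub>R \<alpha>' d"
  by (elim exE conjE)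
 have "\<exists>g::real^4^4. invertible g & (\<forall>s\<in>S. transpose g *v \<alpha>' s = \<alpha> s & g *v v s = v' s)"
 proof (rule step.IH)
  show "\<alpha> s \<bullet> v s = 2" "\<alpha>' s \<bullet> v' s = 2" if "s \<in> S" for s using step.prems(1,2) that by auto
  show "\<alpha> s \<bullet> v t = \<alpha>' s \<bullet> v' t" if "adj T s t" for s t by (rule step.prems(3)[OF adjS[OF that]])
  show "nd \<alpha> S & nd \<alpha>' S" if "L = []" using stk_Nil_cell[of S T tr d] step.hyps that ndd by auto
  show "nd \<alpha> (insert d tr) & nd \<alpha>' (insert d tr) &
   (\<exists>e>0. \<exists>c c'. \<alpha> k = (\<Sum>i\<in>tr. c i *\<^sub>R \<alpha> i) - e *\<^sub>R \<alpha> d & \<alpha>' k = (\<Sum>i\<in>tr. c' i *\<^sub>R \<alpha>' i) - e *\<^sub>R \<alpha>' d)"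
   if "(k, tr, d) \<in> set L" for k tr d by (rule step.prems(5)) (use that in simp)
  show "hyp (cartan \<alpha> v) a b c" if "(k, {a,b,c}, d) \<in> set L" "distinct [a,b,c]" for k a b c d
   by (rule step.prems(6)[of k]) (use that in auto)
 qed
 then obtain g :: "real^4^4" where ig: "invertible g" and g1: "!!s. s \<in> S ==> transpose g *v \<alpha>' s = \<alpha> s" and g2: "!!s. s \<in> S ==> g *v v s = v' s" by blast
 obtain a b c where abc: "tr = {a,b,c}" "distinct [a,b,c]" using tr(1)[unfolded card3_iff_distinct] by blast
 have ne: "a ~= b" "a ~= c" "b ~= c" "b ~= a" "c ~= a" "c ~= b" using abc(2) by auto
 have m: "a \<in> tr" "b \<in> tr" "c \<in> tr" unfolding abc(1) by auto
 have hx: "hyp (cartan \<alpha> v) a b c" by (rule step.prems(6)[of k _ _ _ d]) (use abc in simp_all)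
 have adjk: "adj ?T k i" "adj ?T i k" if "i \<in> tr" for i
  using adj_new[OF step.hyps that] adj_sym by metis+
 have same: "\<alpha> i \<bullet> v j = \<alpha>' i \<bullet> v' j" if "i \<in> insert d tr" "j \<in> tr" for i j
 proof (cases "i = j")
  case True thus ?thesis using that step.prems(1)[of i] step.prems(2)[of i] tr by auto
 next
  case False
  thus ?thesis using step.prems(3)[OF adjS[OF adj_tetra[OF step.hyps(1,2) that(1), of j]]] that(2) by auto
 qed
 have inn: "\<alpha> k \<bullet> v j = (\<Sum>i\<in>tr. y i * (\<alpha> i \<bullet> v j)) - e * (\<alpha> d \<bullet> v j)"
   "\<alpha>' k \<bullet> v' j = (\<Sum>i\<in>tr. y' i * (\<alpha>' i \<bullet> v' j)) - e * (\<alpha>' d \<bullet> v' j)" for j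
  unfolding ky ky' by (simp_all add: inner_diff_left inner_sum_left)
 have z: "(\<Sum>i\<in>tr. (y i - y' i) * (\<alpha> i \<bullet> v j)) = 0" if j: "j \<in> tr" for j
 proof -
  have "(\<Sum>i\<in>tr. y' i * (\<alpha>' i \<bullet> v' j)) = (\<Sum>i\<in>tr. y' i * (\<alpha> i \<bullet> v j))"
   by (rule sum.cong[OF refl]) (use same[OF _ j] in auto)
  hence "(\<Sum>i\<in>tr. y i * (\<alpha> i \<bullet> v j)) = (\<Sum>i\<in>tr. y' i * (\<alpha> i \<bullet> v j))"
   using inn(1)[of j] inn(2)[of j] step.prems(3)[OF adjk(1)[OF j]] same[of d j] j by simp
  thus ?thesis by (simp add: left_diff_distrib sum_subtractf)
 qed
 define u where "u i = y i - y' i" for i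
 have s3: "(\<Sum>i\<in>tr. u i * (\<alpha> i \<bullet> v j)) = u a * (\<alpha> a \<bullet> v j) + u b * (\<alpha> b \<bullet> v j) + u c * (\<alpha> c \<bullet> v j)" for j
  unfolding abc(1) using ne by simp
 have d2: "\<alpha> a \<bullet> v a = 2" "\<alpha> b \<bullet> v b = 2" "\<alpha> c \<bullet> v c = 2" using step.prems(1) m tr(2) by auto
 let ?M = "cartan \<alpha> v"
 have eqs: "2 * u a + ?M b a * u b + ?M c a * u c = 0" "?M a b * u a + 2 * u b + ?M c b * u c = 0" "?M a c * u a + ?M b c * u b + 2 * u c = 0"
  using z[OF m(1), folded u_def, unfolded s3] z[OF m(2), folded u_def, unfolded s3] z[OF m(3), folded u_def, unfolded s3] d2 by (simp_all add: mult.commute)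
 \<comment> \<open>A solution of the homogeneous system and its negative are both
   nonnegative.\<close>
 have "0 <= u a & 0 <= u b & 0 <= u c" by (rule hyp_solve(1)[OF hx]) (use eqs in simp_all)
 moreover have "0 <= - u a & 0 <= - u b & 0 <= - u c" by (rule hyp_solve(1)[OF hx]) (use eqs in \<open>simp_all add: algebra_simps\<close>)
 ultimately have "u a = 0" "u b = 0" "u c = 0" by linarith+
 hence yy: "y i = y' i" if "i \<in> tr" for i using that unfolding u_def abc(1) by auto
 have tl: "linear (\<lambda>x. transpose g *v x)" by (rule matrix_vector_mul_linear)
 have "transpose g *v \<alpha>' k = (\<Sum>i\<in>tr. y' i *\<^sub>R (transpose g *v \<alpha>' i)) - e *\<^sub>R (transpose g *v \<alpha>' d)"
  unfolding ky' linear_diff[OF tl] linear_sum[OF tl] linear_cmul[OF tl] ..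
 also have "(\<Sum>i\<in>tr. y' i *\<^sub>R (transpose g *v \<alpha>' i)) = (\<Sum>i\<in>tr. y i *\<^sub>R \<alpha> i)"
  by (rule sum.cong[OF refl]) (use g1 tr(2) yy in auto)
 also have "transpose g *v \<alpha>' d = \<alpha> d" by (rule g1[OF tr(3)])
 finally have k1: "transpose g *v \<alpha>' k = \<alpha> k" unfolding ky .
 have trn: "\<alpha>' s \<bullet> (g *v x) = (transpose g *v \<alpha>' s) \<bullet> x" for s x
  by (metis dot_lmul_matrix vector_transpose_matrix transpose_transpose)
 have "g *v v k = v' k"
 proof -
  have "\<alpha>' i \<bullet> (g *v v k) = \<alpha>' i \<bullet> v' k" if "i \<in> insert k tr" for i
  proof (cases "i = k")
   case True thus ?thesis unfolding trn True k1 using step.prems(1,2) by simp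
  next
   case False
   hence i: "i \<in> tr" using that by simp
   hence "i \<in> S" using tr(2) by blast
   thus ?thesis unfolding trn using g1[of i] step.prems(3)[OF adjk(2)[OF i]] by simp
  qed
  hence "\<forall>s\<in>insert k tr. \<alpha>' s \<bullet> (g *v v k - v' k) = 0" by (simp add: inner_diff_right)
  moreover have "beyond \<alpha>' k tr d" unfolding beyond_def using ky' e by blast
  ultimately have "g *v v k - v' k = 0" using beyond_nd[OF _ ndd(2)] unfolding nd_def by blast
  thus ?thesis by simp
 qed
 thus ?case using ig g1 g2 k1 by (intro exI[of _ g]) auto
qed

section \<open>Linear algebra and counting for the parameter space\<close>

lemma norm_preserving_inner:
 assumes g: "linear g" and W: "subspace W" and n: "!!x. x \<in> W ==> norm (g x) = norm x" and "x \<in> W" "y \<in> W"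
 shows "g x \<bullet> g y = x \<bullet> (y :: 'w::real_inner)"
proof -
 have "g x + g y = g (x + y)" by (simp add: linear_add[OF g])
 thus ?thesis unfolding dot_norm using n subspace_add[OF W] assms(4,5) by simp
qed

text \<open>\<open>W\<close> is identified isometrically with the orthogonal complement
  \<open>K\<close> of \<open>I\<close> in \<open>Q\<close>. \<open>P\<close> is the orthogonal
  projection to \<open>K\<close> followed by that identification. \<open>R\<close> first projects to
  \<open>W\<close>, which makes it linear on the whole ambient space.\<close>

lemma subspace_quotient_coordinates:
 fixes Q I :: "'x::euclidean_space set" and W :: "'w::euclidean_space set"
 assumes Q: "subspace Q" and I: "subspace I" "I \<subseteq> Q" and W: "subspace W" and d: "dim W + dim I = dim Q"
 obtains P R where "linear P" "linear R" "!!x. P x \<in> W" "!!w. R w \<in> Q" "!!w. w \<in> W ==> P (R w) = w"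
  "!!x. x \<in> Q ==> P x = 0 \<longleftrightarrow> x \<in> I"
proof -
 define K where "K = {y \<in> Q. \<forall>x\<in>I. orthogonal x y}"
 have "dim K + dim I = dim Q" unfolding K_def by (rule dim_subspace_orthogonal_to_vectors[OF I(1) Q I(2)])
 hence dK: "dim K = dim W" using d by simp
 have sK: "subspace K" unfolding K_def subspace_def using subspace_0[OF Q] subspace_add[OF Q] subspace_scale[OF Q]
  by (auto simp: orthogonal_def inner_add_right)
 obtain f g where g: "linear g" "g ` W = K" "!!x. x \<in> W ==> norm (g x) = norm x"
  using isometries_subspaces[OF sK W dK] by metis
 note ginner = norm_preserving_inner[OF g(1) W g(3), simplified]
 obtain B where B: "B \<subseteq> W" "pairwise orthogonal B" "!!b. b \<in> B ==> norm b = 1" "independent B" "span B = W"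
  using orthonormal_basis_subspace[OF W] by metis
 have fB: "finite B" using B(4) by (rule independent_imp_finite)
 have expand: "(\<Sum>b\<in>B. (w \<bullet> b) *\<^sub>R b) = w" if w: "w \<in> W" for w
 proof -
  define u where "u = w - (\<Sum>b\<in>B. (w \<bullet> b) *\<^sub>R b)"
  have uW: "u \<in> W" unfolding u_def using w B(1) W by (intro subspace_diff subspace_sum subspace_scale) auto
  have "u \<bullet> c = 0" if c: "c \<in> B" for c
  proof -
   have "(\<Sum>b\<in>B. (w \<bullet> b) *\<^sub>R b) \<bullet> c = (\<Sum>b\<in>B. (w \<bullet> b) * (b \<bullet> c))" by (simp add: inner_sum_left)
   also have "\<dots> = (\<Sum>b\<in>B. if b = c then w \<bullet> c else 0)"
   proof (rule sum.cong[OF refl])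
    fix b assume b: "b \<in> B"
    show "(w \<bullet> b) * (b \<bullet> c) = (if b = c then w \<bullet> c else 0)"
    proof (cases "b = c")
     case True thus ?thesis using B(3)[OF c] by (simp add: norm_eq_1)
    next
     case False thus ?thesis using B(2) b c unfolding pairwise_def orthogonal_def by auto
    qed
   qed
   also have "\<dots> = w \<bullet> c" using fB c by simp
   finally show ?thesis unfolding u_def by (simp add: inner_diff_left)
  qed
  hence "orthogonal u x" if "x \<in> span B" for x
   by (intro orthogonal_to_span[OF that]) (simp add: orthogonal_def)
  hence "u = 0" using uW B(5) orthogonal_self by blast
  thus ?thesis unfolding u_def by simp
 qed
 define P where "P x = (\<Sum>b\<in>B. (x \<bullet> g b) *\<^sub>R b)" for x
 define pW where "pW w = (\<Sum>b\<in>B. (w \<bullet> b) *\<^sub>R b)" for w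
 have lP: "linear P" unfolding P_def
  by (rule linearI) (simp_all add: inner_add_left scaleR_add_left sum.distrib scaleR_sum_right)
 have lpW: "linear pW" unfolding pW_def
  by (rule linearI) (simp_all add: inner_add_left scaleR_add_left sum.distrib scaleR_sum_right)
 have pW: "pW w \<in> W" for w unfolding pW_def using B(1) W by (intro subspace_sum subspace_scale) auto
 have lR: "linear (g \<circ> pW)" by (rule linear_compose[OF lpW g(1)])
 show thesis
 proof (rule that[OF lP lR])
  show "P x \<in> W" for x unfolding P_def using B(1) W by (intro subspace_sum subspace_scale) auto
  show "(g \<circ> pW) w \<in> Q" for w using g(2) pW[of w] unfolding K_def by auto
  show "P ((g \<circ> pW) w) = w" if "w \<in> W" for w
  proof -
   have "(g \<circ> pW) w = g w" using expand[OF that] unfolding pW_def by simp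
   moreover have "P (g w) = (\<Sum>b\<in>B. (w \<bullet> b) *\<^sub>R b)" unfolding P_def
    by (rule sum.cong[OF refl], subst ginner[OF \<open>w \<in> W\<close>]) (use B(1) in auto)
   ultimately show ?thesis using expand[OF that] by simp
  qed
  show "P x = 0 \<longleftrightarrow> x \<in> I" if x: "x \<in> Q" for x
  proof
   assume xI: "x \<in> I"
   have "x \<bullet> g b = 0" if "b \<in> B" for b
   proof -
    have "g b \<in> K" using that B(1) g(2) by blast
    thus ?thesis using xI unfolding K_def orthogonal_def by blast
   qed
   thus "P x = 0" unfolding P_def by simp
  next
   assume z: "P x = 0"
   have "(\<Sum>b\<in>B. (x \<bullet> g b) *\<^sub>R b) = 0" using z unfolding P_def .
   hence xb: "x \<bullet> g b = 0" if "b \<in> B" for b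
    using independentD[OF B(4) fB subset_refl, of "\<lambda>b. x \<bullet> g b"] that by blast
   have xK: "x \<bullet> k = 0" if k: "k \<in> K" for k
   proof -
    obtain w where w: "w \<in> W" "k = g w" using k g(2) by blast
    have "g w = (\<Sum>b\<in>B. (w \<bullet> b) *\<^sub>R g b)"
     by (subst expand[OF w(1), symmetric]) (simp add: linear_sum[OF g(1)] linear_cmul[OF g(1)])
    thus ?thesis unfolding w(2) by (simp add: inner_sum_right xb)
   qed
   obtain y z where yz: "y \<in> span I" "!!w. w \<in> span I ==> orthogonal z w" "x = y + z"
    using orthogonal_subspace_decomp_exists[of I x] by blast
   have sI: "span I = I" using I(1) by (simp add: span_eq_iff)
   have yI: "y \<in> I" using yz(1) sI by simp
   have "z = x - y" using yz(3) by simp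
   hence "z \<in> Q" using x yI I(2) subspace_diff[OF Q] by blast
   moreover have "\<forall>w\<in>I. orthogonal w z" using yz(2) sI by (simp add: orthogonal_commute)
   ultimately have "z \<in> K" unfolding K_def by blast
   hence "x \<bullet> z = 0" by (rule xK)
   moreover have "y \<bullet> z = 0" using yz(2)[OF yz(1)] by (simp add: orthogonal_def inner_commute)
   ultimately have "z = 0" using yz(3) by (simp add: inner_add_left)
   thus "x \<in> I" using yI yz(3) by simp
  qed
 qed
qed

lemma stk_step_adj:
 "stk S T L ==> (k, tr, d) \<in> set L ==> s ~= t ==> (s \<in> insert d tr & t \<in> insert d tr) \<or> (s \<in> insert k tr & t \<in> insert k tr) ==> adj T s t"
proof (induction arbitrary: k tr d rule: stk.induct)
 case (step S T L tr0 d0 k0)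
 show ?case
 proof (cases "(k, tr, d) \<in> set L")
  case True
  thus ?thesis using adj_step[OF step.hyps(1,2) step.IH[OF True step.prems(2,3)]] by blast
 next
  case False
  hence e: "k = k0" "tr = tr0" "d = d0" using step.prems(1) by auto
  have old: "adj (step_cells T k0 tr0 d0) s t" if "s \<in> insert d tr" "t \<in> insert d tr"
   using adj_step[OF step.hyps(1,2) adj_tetra[OF step.hyps(1,2) _ _ step.prems(2)]] that unfolding e by blast
  from step.prems(3) show ?thesis
  proof
   assume "s \<in> insert d tr & t \<in> insert d tr" thus ?thesis using old by blast
  next
   assume "s \<in> insert k tr & t \<in> insert k tr"
   then consider "s \<in> tr" "t \<in> tr" | "s = k" "t \<in> tr" | "t = k" "s \<in> tr" using step.prems(2) by blast
   thus ?thesis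
   proof cases
    case 1 thus ?thesis using old by blast
   next
    case 2 thus ?thesis using adj_new[OF step.hyps, of t] unfolding e by blast
   next
    case 3 thus ?thesis using adj_sym[OF adj_new[OF step.hyps, of s]] unfolding e by blast
   qed
  qed
 qed
qed simp

text \<open>The apexes on the two sides of a covered triangle never become adjacent. A pair
  \<open>(k,d)\<close> can therefore index a coordinate without clashing with an edge.\<close>

lemma stk_step_nonadj: "stk S T L ==> (k, tr, d) \<in> set L ==> \<not> adj T k d"
proof (induction arbitrary: k tr d rule: stk.induct)
 case (step S T L tr0 d0 k0)
 show ?case
 proof
  assume a: "adj (step_cells T k0 tr0 d0) k d"
  show False
  proof (cases "(k, tr, d) \<in> set L")
   case True
   hence "k \<in> S" "d \<in> S" using stk_step_mem[OF step.hyps(1)] by auto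
   thus False using adj_step_cases[OF step.hyps a] step.IH[OF True] step.hyps(3) by blast
  next
   case False
   hence e: "k = k0" "tr = tr0" "d = d0" using step.prems(1) by auto
   have "d0 \<in> S" "d0 \<notin> tr0" using stk_cell[OF step.hyps(1,2)] by auto
   thus False using adj_step_cases[OF step.hyps a] adj_in[OF step.hyps(1)] step.hyps(3) unfolding e by blast
  qed
 qed
qed simp

lemma stk_card: "stk S T L ==> card S = 4 + length L & card ((\<lambda>(k, tr, d). (k, d)) ` set L) = length L &
  (\<forall>k tr d tr' d'. (k, tr, d) \<in> set L --> (k, tr', d') \<in> set L --> tr = tr' & d = d')"
proof (induction rule: stk.induct)
 case (step S T L tr0 d0 k0)
 have fin: "finite S" using stk_finite[OF step.hyps(1)] .
 have n: "k ~= k0" if "(k, tr, d) \<in> set L" for k tr d using stk_step_mem[OF step.hyps(1) that] step.hyps(3) by auto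
 have "card (insert k0 S) = 4 + length (L @ [(k0, tr0, d0)])" using step.IH fin step.hyps(3) by simp
 moreover have "(k0, d0) \<notin> (\<lambda>(k, tr, d). (k, d)) ` set L" using n by auto
 hence "card ((\<lambda>(k, tr, d). (k, d)) ` set (L @ [(k0, tr0, d0)])) = length (L @ [(k0, tr0, d0)])"
  using step.IH by simp
 moreover have "\<forall>k tr d tr' d'. (k, tr, d) \<in> set (L @ [(k0, tr0, d0)]) --> (k, tr', d') \<in> set (L @ [(k0, tr0, d0)]) --> tr = tr' & d = d'"
 proof (intro allI impI)
  fix k tr d tr' d' assume a: "(k, tr, d) \<in> set (L @ [(k0, tr0, d0)])" "(k, tr', d') \<in> set (L @ [(k0, tr0, d0)])"
  show "tr = tr' & d = d'"
  proof (cases "k = k0")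
   case True thus ?thesis using a n[of k tr d] n[of k tr' d'] by auto
  next
   case False thus ?thesis using a step.IH by auto
  qed
 qed
 ultimately show ?case by blast
qed simp

lemma two_right_angles:
 fixes x y z :: real
 assumes "x + y + z < pi" "0 < x" "0 < y" "0 < z"
 shows "(x ~= pi/2 & y ~= pi/2) \<or> (x ~= pi/2 & z ~= pi/2) \<or> (y ~= pi/2 & z ~= pi/2)"
 using assms by linarith

text \<open>The first truncated triangle has at most one right angle, so \<open>\<mu>\<close> is
  constant on it. A nonright angle at \<open>k\<close> or \<open>d\<close> then attaches these two,
  which share their value, and every later face is attached through its own
  \<open>d\<close>.\<close>

lemma stk_connected:
 assumes "stk S T L" "L ~= []"
  and "!!s t. s = t \<or> adj T s t ==> 0 < th s t"
  and "!!k a b c d. (k, {a,b,c}, d) \<in> set L ==> distinct [a,b,c] ==> th a b + th a c + th b c < (pi::real)"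
  and "!!k tr d. (k, tr, d) \<in> set L ==> \<exists>i\<in>tr. th k i ~= pi/2 \<or> th d i ~= pi/2"
  and "!!s t. adj T s t ==> th s t ~= pi/2 ==> \<mu> s = \<mu> t"
  and "!!k tr d. (k, tr, d) \<in> set L ==> \<mu> k = \<mu> d"
 shows "\<exists>m. \<forall>s\<in>S. \<mu> s = m"
 using assms
proof (induction rule: stk.induct)
 case (base S)
 show ?case using base.prems(1) refl by (rule notE)
next
 case (step S T L tr d k)
 let ?T = "step_cells T k tr d"
 have last: "(k, tr, d) \<in> set (L @ [(k, tr, d)])" by simp
 have kd: "\<mu> k = \<mu> d" by (rule step.prems(6)[OF last])
 have tr: "card tr = 3" "tr \<subseteq> S" "d \<in> S" "d \<notin> tr" using stk_cell[OF step.hyps(1,2)] by auto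
 note adjS = adj_step[OF step.hyps(1,2)]
 show ?case
 proof (cases "L = []")
  case False
  have "\<exists>m. \<forall>s\<in>S. \<mu> s = m"
  proof (rule step.IH[OF False])
   show "0 < th s t" if "s = t \<or> adj T s t" for s t by (rule step.prems(2)) (use that adjS in blast)
   show "th a b + th a c + th b c < pi" if "(k, {a,b,c}, d) \<in> set L" "distinct [a,b,c]" for k a b c d
    by (rule step.prems(3)[of k a b c d]) (use that in simp_all)
   show "\<exists>i\<in>tr. th k i ~= pi/2 \<or> th d i ~= pi/2" if "(k, tr, d) \<in> set L" for k tr d
    by (rule step.prems(4)) (use that in simp)
   show "\<mu> s = \<mu> t" if "adj T s t" "th s t ~= pi/2" for s t by (rule step.prems(5)[OF adjS[OF that(1)] that(2)])
   show "\<mu> k' = \<mu> d'" if "(k', tr', d') \<in> set L" for k' tr' d' by (rule step.prems(6)[of k' tr' d']) (use that in simp)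
  qed
  then obtain m where "\<forall>s\<in>S. \<mu> s = m" ..
  thus ?thesis using kd tr(3) by (intro exI[of _ m]) auto
 next
  case True
  obtain a b c where abc: "tr = {a,b,c}" "distinct [a,b,c]" using tr(1)[unfolded card3_iff_distinct] by blast
  have S: "S = insert d tr" using stk_Nil_cell[of S T tr d] step.hyps True by auto
  have adj: "adj ?T s t" if "s \<in> insert d tr" "t \<in> insert d tr" "s ~= t" for s t
   by (rule adjS[OF adj_tetra[OF step.hyps(1,2) that]])
  have ab: "adj ?T a b" "adj ?T a c" "adj ?T b c" by (rule adj; use abc in simp)+
  have sum: "th a b + th a c + th b c < pi" by (rule step.prems(3)[of k a b c d]) (use abc in simp_all)
  have pos: "0 < th a b" "0 < th a c" "0 < th b c" using step.prems(2) ab by blast+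
  have eq: "\<mu> a = \<mu> b" if "th a b ~= pi/2" using step.prems(5)[OF ab(1) that] .
  have eq2: "\<mu> a = \<mu> c" if "th a c ~= pi/2" using step.prems(5)[OF ab(2) that] .
  have eq3: "\<mu> b = \<mu> c" if "th b c ~= pi/2" using step.prems(5)[OF ab(3) that] .
  have all: "\<mu> a = \<mu> b" "\<mu> a = \<mu> c" using two_right_angles[OF sum pos] eq eq2 eq3 by auto
  hence trm: "\<mu> i = \<mu> a" if "i \<in> tr" for i using that unfolding abc(1) by auto
  obtain i where i: "i \<in> tr" "th k i ~= pi/2 \<or> th d i ~= pi/2" using step.prems(4)[OF last] by blast
  have "\<mu> d = \<mu> i"
  proof (cases "th d i ~= pi/2")
   case True
   thus ?thesis using step.prems(5)[OF adj[of d i]] i tr(4) by auto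
  next
   case False
   hence "th k i ~= pi/2" using i(2) by blast
   hence "\<mu> k = \<mu> i" using step.prems(5)[OF adj_new[OF step.hyps i(1)]] by blast
   thus ?thesis using kd by simp
  qed
  hence "\<mu> d = \<mu> a" using trm[OF i(1)] by simp
  thus ?thesis using trm kd unfolding S by (intro exI[of _ "\<mu> a"]) auto
 qed
qed

text \<open>The order of \<open>a, b, c\<close> is arbitrary but fixed, so that quotients of two values are well defined.\<close>

definition dd :: "('s => real^4) => 's set => 's => real" where
 "dd \<beta> tr u = (case (SOME (a, b, c). tr = {a,b,c} & distinct [a,b,c]) of (a, b, c) => D4 (\<beta> a) (\<beta> b) (\<beta> c) (\<beta> u))"

lemma dd_D4:
 assumes "card tr = 3"
 obtains a b c where "tr = {a,b,c}" "distinct [a,b,c]" "\<forall>\<beta> u. dd \<beta> tr u = D4 (\<beta> a) (\<beta> b) (\<beta> c) (\<beta> u)"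
proof -
 define p where "p = (SOME (a, b, c). tr = {a,b,c} & distinct [a,b,c])"
 obtain a b c where "tr = {a,b,c}" "distinct [a,b,c]" using assms[unfolded card3_iff_distinct] by blast
 hence "case (a, b, c) of (a, b, c) => tr = {a,b,c} & distinct [a,b,c]" by simp
 hence p: "case p of (a, b, c) => tr = {a,b,c} & distinct [a,b,c]" unfolding p_def by (rule someI)
 obtain x y z where xyz: "p = (x, y, z)" by (cases p)
 show thesis
 proof (rule that)
  show "tr = {x,y,z}" "distinct [x,y,z]" using p unfolding xyz by simp_all
  show "\<forall>\<beta> u. dd \<beta> tr u = D4 (\<beta> x) (\<beta> y) (\<beta> z) (\<beta> u)" unfolding dd_def p_def[symmetric] xyz by simp
 qed
qed

lemma dd_nd: "card tr = 3 ==> nd \<beta> (insert u tr) \<longleftrightarrow> dd \<beta> tr u ~= 0"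
proof -
 assume "card tr = 3"
 then obtain a b c where abc: "tr = {a,b,c}" "distinct [a,b,c]" "\<forall>\<beta> u. dd \<beta> tr u = D4 (\<beta> a) (\<beta> b) (\<beta> c) (\<beta> u)" by (rule dd_D4)
 note abc = abc(1) abc(3)[rule_format]
 have "insert u tr = {a,b,c,u}" unfolding abc(1) by auto
 thus ?thesis unfolding abc(2) nd_D4[symmetric] by simp
qed

lemma dd_combination:
 assumes "card tr = 3" "\<beta> k = (\<Sum>i\<in>tr. c i *\<^sub>R \<beta> i) - e *\<^sub>R \<beta> d"
 shows "dd \<beta> tr k = - e * dd \<beta> tr d"
proof -
 obtain x y z where abc: "tr = {x,y,z}" "distinct [x,y,z]" "\<forall>\<beta> u. dd \<beta> tr u = D4 (\<beta> x) (\<beta> y) (\<beta> z) (\<beta> u)" using assms(1) by (rule dd_D4)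
 note abc = abc(1,2) abc(3)[rule_format]
 have "\<beta> k = c x *\<^sub>R \<beta> x + c y *\<^sub>R \<beta> y + c z *\<^sub>R \<beta> z - e *\<^sub>R \<beta> d" unfolding assms(2) abc(1) using abc(2) by simp
 thus ?thesis unfolding abc(3) by (simp add: D4_add D4_diff D4_scale D4_alt)
qed

lemma dd_expand:
 assumes "card tr = 3" "dd \<beta> tr d ~= 0"
 shows "\<exists>c. \<beta> k = (\<Sum>i\<in>tr. c i *\<^sub>R \<beta> i) - (- dd \<beta> tr k / dd \<beta> tr d) *\<^sub>R \<beta> d"
proof -
 obtain x y z where abc: "tr = {x,y,z}" "distinct [x,y,z]" "\<forall>\<beta> u. dd \<beta> tr u = D4 (\<beta> x) (\<beta> y) (\<beta> z) (\<beta> u)" using assms(1) by (rule dd_D4)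
 note abc = abc(1,2) abc(3)[rule_format]
 have D: "D4 (\<beta> x) (\<beta> y) (\<beta> z) (\<beta> d) ~= 0" using assms(2) unfolding abc(3) .
 obtain p q r s where e: "\<beta> k = p *\<^sub>R \<beta> x + q *\<^sub>R \<beta> y + r *\<^sub>R \<beta> z + s *\<^sub>R \<beta> d" using D4_expand[OF D] by blast
 have "dd \<beta> tr k = s * dd \<beta> tr d" unfolding abc(3) e by (simp add: D4_add D4_scale D4_alt)
 hence s: "s = - (- dd \<beta> tr k / dd \<beta> tr d)" using assms(2) by simp
 have "(\<Sum>i\<in>tr. (if i = x then p else if i = y then q else r) *\<^sub>R \<beta> i) = p *\<^sub>R \<beta> x + q *\<^sub>R \<beta> y + r *\<^sub>R \<beta> z"
  unfolding abc(1) using abc(2) by auto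
 hence "\<beta> k = (\<Sum>i\<in>tr. (if i = x then p else if i = y then q else r) *\<^sub>R \<beta> i) - (- s) *\<^sub>R \<beta> d" unfolding e by simp
 thus ?thesis unfolding s by (intro exI) simp
qed

lemma D4_scales: "D4 (p *\<^sub>R a) (q *\<^sub>R b) (r *\<^sub>R c) (s *\<^sub>R d) = p * q * r * s * D4 a b c d"
 by (simp add: D4_explicit algebra_simps)

lemma D4_linear: "D4 (h *v a) (h *v b) (h *v c) (h *v d) = det h * D4 a b c d"
proof -
 define A where "A = ((\<chi> i. if i = 1 then a else if i = 2 then b else if i = 3 then c else d) :: real^4^4)"
 have "(\<chi> i. if i = 1 then h *v a else if i = 2 then h *v b else if i = 3 then h *v c else h *v d) = A ** transpose h"
  unfolding A_def vec_eq_iff by (simp add: matrix_matrix_mult_def matrix_vector_mult_def transpose_def mult.commute forall_4)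
 thus ?thesis unfolding D4_def A_def[symmetric] by (simp add: det_mul det_transpose)
qed

section \<open>Logarithmic coordinates of configurations\<close>

locale angled_stack =
 fixes T :: "('s::finite set \<times> 's) set" and L :: "('s \<times> 's set \<times> 's) list" and th :: "'s => 's => real" and f :: "'s => nat"
 assumes st: "stk UNIV T L" and L: "L ~= []" and sym: "th s t = th t s"
  and range: "adj T s t ==> 0 < th s t & th s t <= pi/2"
  and hyperb: "(k, {a,b,c}, d) \<in> set L ==> distinct [a,b,c] ==> th a b + th a c + th b c < pi"
  and nonexc: "(k, tr, d) \<in> set L ==> \<exists>i\<in>tr. th k i ~= pi/2 \<or> th d i ~= pi/2"
  and injf: "inj f"
begin

text \<open>The algebraic description of normalised points of \<open>Y_space\<close>. No polyhedron
  is mentioned; that one exists is the content of \<open>Y_space_eq\<close>.\<close>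

definition good :: "('s => real^4) => ('s => real^4) => bool" where
 "good \<alpha> v \<longleftrightarrow> (\<forall>s. \<alpha> s \<bullet> v s = 2) &
   (\<forall>s t. adj T s t --> \<alpha> s \<bullet> v t <= 0 & (\<alpha> s \<bullet> v t = 0 \<longleftrightarrow> \<alpha> t \<bullet> v s = 0) & (\<alpha> s \<bullet> v t) * (\<alpha> t \<bullet> v s) = 4 * (cos (th s t))\<^sup>2) &
   (\<forall>k tr d. (k, tr, d) \<in> set L --> nd \<alpha> (insert d tr) & beyond \<alpha> k tr d)"

lemma goodD:
 assumes "good \<alpha> v"
 shows "\<alpha> s \<bullet> v s = 2" and "adj T s t ==> \<alpha> s \<bullet> v t <= 0" and "adj T s t ==> \<alpha> s \<bullet> v t = 0 \<longleftrightarrow> \<alpha> t \<bullet> v s = 0"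
  and "adj T s t ==> (\<alpha> s \<bullet> v t) * (\<alpha> t \<bullet> v s) = 4 * (cos (th s t))\<^sup>2"
  and "(k, tr, d) \<in> set L ==> nd \<alpha> (insert d tr)" "(k, tr, d) \<in> set L ==> beyond \<alpha> k tr d"
 using assms unfolding good_def by blast+

lemma cos_th: "adj T s t ==> cos (th s t) = 0 \<longleftrightarrow> th s t = pi/2"
proof
 assume a: "adj T s t" and c: "cos (th s t) = 0"
 show "th s t = pi/2"
 proof (rule ccontr)
  assume "th s t ~= pi/2"
  hence "0 < cos (th s t)" using range[OF a] by (intro cos_gt_zero) auto
  thus False using c by simp
 qed
next
 assume e: "th s t = pi/2" show "cos (th s t) = 0" unfolding e by (rule cos_pi_half)
qed

lemma good_zero: "good \<alpha> v ==> adj T s t ==> \<alpha> s \<bullet> v t = 0 \<longleftrightarrow> th s t = pi/2"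
proof -
 assume g: "good \<alpha> v" "adj T s t"
 have "\<alpha> s \<bullet> v t = 0 \<longleftrightarrow> (\<alpha> s \<bullet> v t) * (\<alpha> t \<bullet> v s) = 0" using goodD(3)[OF g] by simp
 also have "\<dots> \<longleftrightarrow> cos (th s t) = 0" unfolding goodD(4)[OF g] by simp
 finally show ?thesis unfolding cos_th[OF g(2)] .
qed

lemma step_adj:
 assumes "(k, tr, d) \<in> set L" "s \<in> tr" "t \<in> tr" "s ~= t" shows "adj T s t"
 by (rule stk_step_adj[OF st assms(1,4)]) (use assms in blast)

lemma good_hyp:
 assumes g: "good \<alpha> v" and s: "(k, {a,b,c}, d) \<in> set L" "distinct [a,b,c]"
 shows "hyp (cartan \<alpha> v) a b c"
proof -
 have ad: "adj T a b" "adj T b a" "adj T a c" "adj T c a" "adj T b c" "adj T c b"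
  by (rule step_adj[OF s(1)]; use s(2) in auto)+
 show ?thesis
  by (rule hyp_of_angles[of "th a b" "th a c" "th b c"])
   (use range[OF ad(1)] range[OF ad(3)] range[OF ad(5)] hyperb[OF s] goodD(1)[OF g] goodD(2)[OF g] goodD(3)[OF g ad(1)] goodD(3)[OF g ad(3)]
    goodD(3)[OF g ad(5)] goodD(4)[OF g ad(1)] goodD(4)[OF g ad(3)] goodD(4)[OF g ad(5)] ad in auto)
qed

lemma good_scale:
 assumes g: "good \<alpha> v" and m: "!!s. 0 < \<mu> s"
 shows "good (\<lambda>s. (1 / \<mu> s) *\<^sub>R \<alpha> s) (\<lambda>s. \<mu> s *\<^sub>R v s)"
 unfolding good_def
proof (intro conjI allI impI)
 have m0: "\<mu> s ~= 0" for s using m[of s] by simp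
 show "((1 / \<mu> s) *\<^sub>R \<alpha> s) \<bullet> (\<mu> s *\<^sub>R v s) = 2" for s using goodD(1)[OF g, of s] m0[of s] by simp
 fix s t assume a: "adj T s t"
 have e: "((1 / \<mu> s) *\<^sub>R \<alpha> s) \<bullet> (\<mu> t *\<^sub>R v t) = (\<mu> t / \<mu> s) * (\<alpha> s \<bullet> v t)" for s t by simp
 have "0 < \<mu> t / \<mu> s" using m by simp
 thus "((1 / \<mu> s) *\<^sub>R \<alpha> s) \<bullet> (\<mu> t *\<^sub>R v t) <= 0" unfolding e using goodD(2)[OF g a] by (intro mult_nonneg_nonpos) simp_all
 show "(((1 / \<mu> s) *\<^sub>R \<alpha> s) \<bullet> (\<mu> t *\<^sub>R v t) = 0) = (((1 / \<mu> t) *\<^sub>R \<alpha> t) \<bullet> (\<mu> s *\<^sub>R v s) = 0)"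
  unfolding e using goodD(3)[OF g a] m0 by simp
 show "((1 / \<mu> s) *\<^sub>R \<alpha> s) \<bullet> (\<mu> t *\<^sub>R v t) * (((1 / \<mu> t) *\<^sub>R \<alpha> t) \<bullet> (\<mu> s *\<^sub>R v s)) = 4 * (cos (th s t))\<^sup>2"
  unfolding e goodD(4)[OF g a, symmetric] using m0[of s] m0[of t] by simp
next
 fix k tr d assume s: "(k, tr, d) \<in> set L"
 have m0: "\<mu> s ~= 0" for s using m[of s] by simp
 show "nd (\<lambda>s. (1 / \<mu> s) *\<^sub>R \<alpha> s) (insert d tr)" using goodD(5)[OF g s] m0 unfolding nd_def by simp
 obtain c e where e: "0 < e" "\<alpha> k = (\<Sum>i\<in>tr. c i *\<^sub>R \<alpha> i) - e *\<^sub>R \<alpha> d" using goodD(6)[OF g s] unfolding beyond_def by blast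
 have "(1 / \<mu> k) *\<^sub>R \<alpha> k = (\<Sum>i\<in>tr. (c i * \<mu> i / \<mu> k) *\<^sub>R ((1 / \<mu> i) *\<^sub>R \<alpha> i)) - (e * \<mu> d / \<mu> k) *\<^sub>R ((1 / \<mu> d) *\<^sub>R \<alpha> d)"
  unfolding e(2) using m0 by (simp add: scaleR_diff_right scaleR_sum_right)
 moreover have "0 < e * \<mu> d / \<mu> k" using e(1) m by simp
 ultimately show "beyond (\<lambda>s. (1 / \<mu> s) *\<^sub>R \<alpha> s) k tr d" unfolding beyond_def by (intro exI[of _ "\<lambda>i. c i * \<mu> i / \<mu> k"] exI[of _ "e * \<mu> d / \<mu> k"]) simp
qed

text \<open>Only one of the two entries at an edge is free, since their product is fixed by the
  angle. The numbering \<open>f\<close> selects its orientation.\<close>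

definition Ep where "Ep = {(i, j). adj T i j & th i j ~= pi/2 & f i < f j}"
definition Kd where "Kd = (\<lambda>(k, tr, d). (k, d)) ` set L"

lemma KdE: assumes "(k, d) \<in> Kd" obtains tr where "(k, tr, d) \<in> set L" using assms unfolding Kd_def by auto
lemma KdI: "(k, tr, d) \<in> set L ==> (k, d) \<in> Kd" unfolding Kd_def by force

lemma Ep_Kd: "Ep \<inter> Kd = {}"
 unfolding Ep_def Kd_def using stk_step_nonadj[OF st] by auto

definition sg where "sg k = (SOME tr. \<exists>d. (k, tr, d) \<in> set L)"

lemma sg: "(k, tr, d) \<in> set L ==> sg k = tr"
proof -
 assume a: "(k, tr, d) \<in> set L"
 hence "\<exists>tr d. (k, tr, d) \<in> set L" by blast
 hence "\<exists>d. (k, sg k, d) \<in> set L" unfolding sg_def by (rule someI_ex)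
 thus ?thesis using stk_card[OF st] a by blast
qed

text \<open>The number \<open>e\<close> of \<open>beyond\<close> as a ratio of determinants. In this
  form it is a smooth function of the forms and the ordering hidden in \<open>dd\<close>
  cancels.\<close>

definition er where "er \<beta> k d = - dd \<beta> (sg k) k / dd \<beta> (sg k) d"

lemma step3: "(k, tr, d) \<in> set L ==> card tr = 3" using stk_step_mem[OF st] by blast

lemma er_combination: "(k, tr, d) \<in> set L ==> nd \<beta> (insert d tr) ==> \<exists>c. \<beta> k = (\<Sum>i\<in>tr. c i *\<^sub>R \<beta> i) - er \<beta> k d *\<^sub>R \<beta> d"
 using dd_expand[OF step3] dd_nd[OF step3] unfolding er_def by (simp add: sg)

lemma er_eq: "(k, tr, d) \<in> set L ==> nd \<beta> (insert d tr) ==> \<beta> k = (\<Sum>i\<in>tr. c i *\<^sub>R \<beta> i) - e *\<^sub>R \<beta> d ==> er \<beta> k d = e"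
 using dd_combination[OF step3, of k tr d \<beta> k c e d] dd_nd[OF step3, of k tr d \<beta> d] unfolding er_def by (simp add: sg)

lemma er_pos: assumes "good \<beta> v" "(k, tr, d) \<in> set L" shows "0 < er \<beta> k d"
proof -
 obtain c e where "0 < e" "\<beta> k = (\<Sum>i\<in>tr. c i *\<^sub>R \<beta> i) - e *\<^sub>R \<beta> d" using goodD(6)[OF assms] unfolding beyond_def by blast
 thus ?thesis using er_eq[OF assms(2) goodD(5)[OF assms]] by simp
qed

lemma er_scale:
 assumes s: "(k, tr, d) \<in> set L" and t: "!!s. t s ~= 0"
 shows "er (\<lambda>s. t s *\<^sub>R \<beta> s) k d = (t k / t d) * er \<beta> k d"
proof -
 obtain x y z where abc: "tr = {x,y,z}" "distinct [x,y,z]" "\<forall>\<beta> u. dd \<beta> tr u = D4 (\<beta> x) (\<beta> y) (\<beta> z) (\<beta> u)" using step3[OF s] by (rule dd_D4)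
 note abc = abc(1,2) abc(3)[rule_format]
 show ?thesis unfolding er_def sg[OF s] abc(3) D4_scales using t by simp
qed

lemma er_linear:
 assumes s: "(k, tr, d) \<in> set L" and t: "det h ~= 0"
 shows "er (\<lambda>s. h *v \<beta> s) k d = er \<beta> k d"
proof -
 obtain x y z where abc: "tr = {x,y,z}" "distinct [x,y,z]" "\<forall>\<beta> u. dd \<beta> tr u = D4 (\<beta> x) (\<beta> y) (\<beta> z) (\<beta> u)" using step3[OF s] by (rule dd_D4)
 note abc = abc(1,2) abc(3)[rule_format]
 show ?thesis unfolding er_def sg[OF s] abc(3) D4_linear using t by simp
qed

definition Q :: "(real^('s\<times>'s)) set" where "Q = {x. \<forall>p. p \<notin> Ep \<union> Kd --> x $ p = 0}"
text \<open>The translation of the logarithmic coordinates that results from multiplying each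
  \<open>v s\<close> by \<open>exp (\<mu> $ s)\<close> and dividing \<open>\<alpha> s\<close> by it,
  see \<open>xi_scale\<close>.\<close>

definition Dm :: "real^'s => real^('s\<times>'s)" where "Dm \<mu> = (\<chi> p. if p \<in> Ep \<union> Kd then \<mu> $ snd p - \<mu> $ fst p else 0)"

lemma linear_Dm: "linear Dm"
 unfolding Dm_def by (rule linearI) (simp_all add: vec_eq_iff algebra_simps)

lemma subspace_Q: "subspace Q" unfolding Q_def subspace_def by simp

lemma dim_Q: "dim Q = card Ep + length L"
proof -
 let ?d = "(\<lambda>p. axis p 1) ` (Ep \<union> Kd) :: (real^('s\<times>'s)) set"
 have inj: "inj (\<lambda>p. axis p (1::real) :: real^('s\<times>'s))" by (rule injI) (simp add: axis_eq_axis)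
 have "Q = {x. \<forall>i\<in>Basis. i \<notin> ?d --> x \<bullet> i = 0}"
 proof -
  have "(\<forall>i\<in>Basis. i \<notin> ?d --> x \<bullet> i = 0) \<longleftrightarrow> (\<forall>p. p \<notin> Ep \<union> Kd --> x $ p = 0)" for x :: "real^('s\<times>'s)"
   by (auto simp: Basis_vec_def inner_axis axis_eq_axis image_iff)
  thus ?thesis unfolding Q_def by simp
 qed
 moreover have "?d \<subseteq> Basis" by (auto simp: Basis_vec_def)
 ultimately have "dim Q = card ?d" using dim_substandard[of ?d] by simp
 also have "\<dots> = card (Ep \<union> Kd)" by (rule card_image) (rule inj_on_subset[OF inj subset_UNIV])
 also have "\<dots> = card Ep + card Kd" by (rule card_Un_disjoint) (use Ep_Kd in auto)
 finally show ?thesis using stk_card[OF st] unfolding Kd_def by simp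
qed

lemma Dm_kernel: assumes "Dm \<mu> = 0" shows "\<mu> $ s = \<mu> $ t"
proof -
 have z: "\<mu> $ snd p = \<mu> $ fst p" if "p \<in> Ep \<union> Kd" for p
  using arg_cong[OF assms, of "\<lambda>x. x $ p"] that unfolding Dm_def by simp
 have ad: "\<mu> $ s = \<mu> $ t" if a: "adj T s t" "th s t ~= pi/2" for s t
 proof -
  have "f s ~= f t" using injf a(1) unfolding adj_def by (auto dest: injD)
  then consider "(s, t) \<in> Ep" | "(t, s) \<in> Ep" using a adj_sym[OF a(1)] sym[of s t] unfolding Ep_def by fastforce
  thus ?thesis using z[of "(s,t)"] z[of "(t,s)"] by cases auto
 qed
 have "\<exists>m. \<forall>s\<in>UNIV. \<mu> $ s = m"
 \<comment> \<open>\<open>th\<close> is an angle only at adjacent pairs, so its diagonal is set to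
   the positive value \<open>1\<close>.\<close>
 proof (rule stk_connected[OF st L, of "\<lambda>s t. if s = t then 1 else th s t"])
  show "0 < (if s = t then 1 else th s t)" if "s = t \<or> adj T s t" for s t using that range[of s t] by auto
  show "(if a = b then 1 else th a b) + (if a = c then 1 else th a c) + (if b = c then 1 else th b c) < pi"
   if "(k, {a,b,c}, d) \<in> set L" "distinct [a,b,c]" for k a b c d using hyperb[OF that] that(2) by simp
  show "\<exists>i\<in>tr. (if k = i then 1 else th k i) ~= pi/2 \<or> (if d = i then 1 else th d i) ~= pi/2" if "(k, tr, d) \<in> set L" for k tr d
  proof -
   obtain i where i: "i \<in> tr" "th k i ~= pi/2 \<or> th d i ~= pi/2" using nonexc[OF \<open>(k, tr, d) \<in> set L\<close>] by blast
   hence "k ~= i" "d ~= i" using stk_step_mem[OF st \<open>(k, tr, d) \<in> set L\<close>] by auto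
   thus ?thesis using i by (intro bexI[of _ i]) auto
  qed
  show "\<mu> $ s = \<mu> $ t" if "adj T s t" "(if s = t then 1 else th s t) ~= pi/2" for s t
   using ad[OF that(1)] that(2) by (cases "s = t") auto
  show "\<mu> $ k = \<mu> $ d" if "(k, tr, d) \<in> set L" for k tr d using z[of "(k, d)"] KdI[OF that] by simp
 qed
 then obtain m where "\<forall>s\<in>UNIV. \<mu> $ s = m" ..
 thus ?thesis by simp
qed

text \<open>The kernel consists of constants. Hence \<open>Dm\<close> is injective on the hyperplane
  of vectors vanishing at one chosen face, and subtracting a constant shows that this hyperplane
  already has the full image.\<close>

lemma dim_Dm: "dim (range Dm) + 1 = 4 + length L"
proof -
 obtain s0 :: 's where True by simp
 define Z where "Z = {\<mu> :: real^'s. axis s0 1 \<bullet> \<mu> = 0}"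
 have "axis s0 (1::real) ~= 0" by (simp add: axis_eq_0_iff)
 hence dZ: "dim Z = CARD('s) - 1" unfolding Z_def by (subst dim_hyperplane) simp_all
 have sZ: "span Z = Z" unfolding Z_def by (simp add: span_eq_iff subspace_hyperplane)
 have "inj_on Dm (span Z)" unfolding sZ
 proof (rule inj_onI)
  fix x y assume xy: "x \<in> Z" "y \<in> Z" "Dm x = Dm y"
  hence "Dm (x - y) = 0" by (simp add: linear_diff[OF linear_Dm])
  hence "(x - y) $ s = (x - y) $ s0" for s by (rule Dm_kernel)
  moreover have "(x - y) $ s0 = 0" using xy(1,2) unfolding Z_def by (simp add: inner_axis')
  ultimately show "x = y" by (simp add: vec_eq_iff)
 qed
 hence "dim (Dm ` Z) = dim Z" by (rule dim_image_eq[OF linear_Dm])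
 moreover have "Dm ` Z = range Dm"
 proof -
  have "Dm \<mu> \<in> Dm ` Z" for \<mu>
  proof (rule image_eqI)
   show "Dm \<mu> = Dm (\<chi> s. \<mu> $ s - \<mu> $ s0)" unfolding Dm_def by (simp add: vec_eq_iff)
   show "(\<chi> s. \<mu> $ s - \<mu> $ s0) \<in> Z" unfolding Z_def by (simp add: inner_axis')
  qed
  thus ?thesis by blast
 qed
 moreover have "CARD('s) = 4 + length L" using stk_card[OF st] by blast
 ultimately show ?thesis using dZ by simp
qed

lemma range_Dm: "range Dm \<subseteq> Q" unfolding Dm_def Q_def by auto

lemma subspace_range_Dm: "subspace (range Dm)" using linear_subspace_image[OF linear_Dm subspace_UNIV] .

text \<open>A comparison of dimensions: the translations form a space of dimension
  \<open>3 + length L\<close> inside \<open>Q\<close>. Thus the natural subtraction of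
  \<open>3\<close> is a genuine one.\<close>

lemma card_Ep: "3 <= card Ep"
 using dim_subset[OF range_Dm] dim_Q dim_Dm by simp

end

section \<open>The group action and representatives of configurations\<close>

lemma matrix_inv_unique:
 fixes A :: "real^'n^'n"
 assumes "A ** B = mat 1" "B ** A = mat 1" shows "matrix_inv A = B"
proof -
 have i: "invertible A" unfolding invertible_def using assms by blast
 have "matrix_inv A = matrix_inv A ** (A ** B)" unfolding assms(1) by simp
 also have "\<dots> = B" unfolding matrix_mul_assoc matrix_inv_mult(2)[OF i] by simp
 finally show ?thesis .
qed

lemma act_act:
 assumes "invertible h" "invertible g" shows "act h (act g y) = act (h ** g) y"
proof -
 have "(h ** g) ** (matrix_inv g ** matrix_inv h) = h ** (g ** matrix_inv g) ** matrix_inv h" by (simp add: matrix_mul_assoc)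
 also have "\<dots> = mat 1" by (simp add: matrix_inv_mult assms)
 finally have 1: "(h ** g) ** (matrix_inv g ** matrix_inv h) = mat 1" .
 have "(matrix_inv g ** matrix_inv h) ** (h ** g) = matrix_inv g ** (matrix_inv h ** h) ** g" by (simp add: matrix_mul_assoc)
 also have "\<dots> = mat 1" by (simp add: matrix_inv_mult assms)
 finally have "matrix_inv (h ** g) = matrix_inv g ** matrix_inv h" by (rule matrix_inv_unique[OF 1])
 hence "transpose (matrix_inv (h ** g)) = transpose (matrix_inv h) ** transpose (matrix_inv g)" by (simp add: matrix_transpose_mul)
 thus ?thesis unfolding act_def by (simp add: image_image matrix_vector_mul_assoc del: vector_transpose_matrix transpose_matrix_vector)
qed

lemma act_one: "act (mat 1) y = y"
proof -
 have "matrix_inv (mat 1 :: real^4^4) = mat 1" by (rule matrix_inv_unique) simp_all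
 thus ?thesis unfolding act_def by simp
qed

lemma invertible_unimodular: "det g = 1 \<or> det g = -1 ==> invertible (g :: real^4^4)"
 unfolding invertible_det_nz by auto

lemma SL_orbit_eq_iff: "SL_orbit y = SL_orbit y' \<longleftrightarrow> (\<exists>g. (det g = 1 \<or> det g = -1) & y' = act g y)"
proof
 assume "SL_orbit y = SL_orbit y'"
 moreover have "y' \<in> SL_orbit y'" unfolding SL_orbit_def using act_one[of y'] by (metis (mono_tags, lifting) det_I mem_Collect_eq)
 ultimately show "\<exists>g. (det g = 1 \<or> det g = -1) & y' = act g y" unfolding SL_orbit_def by blast
next
 have sub: "SL_orbit (act g y) \<subseteq> SL_orbit y" if g: "det g = 1 \<or> det g = -1" for g y
 proof
  fix z assume "z \<in> SL_orbit (act g y)"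
  then obtain h where h: "det h = 1 \<or> det h = -1" "z = act h (act g y)" unfolding SL_orbit_def by blast
  have "z = act (h ** g) y" unfolding h(2) by (rule act_act[OF invertible_unimodular[OF h(1)] invertible_unimodular[OF g]])
  moreover have "det (h ** g) = 1 \<or> det (h ** g) = -1" using h(1) g by (auto simp: det_mul)
  ultimately show "z \<in> SL_orbit y" unfolding SL_orbit_def by blast
 qed
 assume "\<exists>g. (det g = 1 \<or> det g = -1) & y' = act g y"
 then obtain g where g: "det g = 1 \<or> det g = -1" "y' = act g y" by blast
 note ig = invertible_unimodular[OF g(1)]
 have "act (matrix_inv g) y' = act (matrix_inv g ** g) y" unfolding g(2) by (rule act_act[OF invertible_matrix_inv[OF ig] ig])
 hence y: "y = act (matrix_inv g) y'" by (simp add: matrix_inv_mult(2)[OF ig] act_one)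
 have "det (matrix_inv g) * det g = 1" unfolding det_mul[symmetric] matrix_inv_mult(2)[OF ig] by simp
 hence "det (matrix_inv g) = 1 \<or> det (matrix_inv g) = -1" using g(1) by auto
 from sub[OF this, of y'] sub[OF g(1), of y] show "SL_orbit y = SL_orbit y'" unfolding y[symmetric] g(2)[symmetric] by blast
qed

lemma matrix_image_ray: "(\<lambda>x. h *v x) ` ray x = ray (h *v x)"
proof -
 have "h *v (t *\<^sub>R x) = t *\<^sub>R (h *v x)" for t :: real by (simp add: linear_cmul[OF matrix_vector_mul_linear])
 thus ?thesis unfolding ray_def by (auto simp: image_iff) metis
qed

definition cq :: "((real^4) \<times> (real^4))^'s => 's::finite config" where
 "cq c = (\<lambda>s. (ray (fst (c $ s)), ray (snd (c $ s))))"
definition fa :: "((real^4) \<times> (real^4))^'s => 's::finite => real^4" where "fa c s = fst (c $ s)"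
definition fw :: "((real^4) \<times> (real^4))^'s => 's::finite => real^4" where "fw c s = snd (c $ s)"
text \<open>The form normalised to take the value \<open>2\<close> on \<open>fw c s\<close>. This
  uses up the scaling of the form, and only that of the vector stays free.\<close>

definition al :: "((real^4) \<times> (real^4))^'s => 's::finite => real^4" where "al c s = (2 / (fa c s \<bullet> fw c s)) *\<^sub>R fa c s"
definition mk :: "('s::finite => real^4) => ('s => real^4) => ((real^4) \<times> (real^4))^'s" where "mk \<alpha> v = (\<chi> s. (\<alpha> s, v s))"

lemma fa_mk [simp]: "fa (mk \<alpha> v) = \<alpha>" and fw_mk [simp]: "fw (mk \<alpha> v) = v"
 unfolding fa_def fw_def mk_def by simp_all

lemma cq_eq: "cq c = (\<lambda>s. (ray (fa c s), ray (fw c s)))" unfolding cq_def fa_def fw_def ..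

lemma cq_scale:
 assumes "cq c = cq c'"
 obtains \<kappa> \<mu> where "!!s. 0 < \<kappa> s" "!!s. 0 < \<mu> s" "!!s. fa c' s = \<kappa> s *\<^sub>R fa c s" "!!s. fw c' s = \<mu> s *\<^sub>R fw c s"
proof -
 have "\<exists>t>0. fa c' s = t *\<^sub>R fa c s" "\<exists>t>0. fw c' s = t *\<^sub>R fw c s" for s
  using fun_cong[OF assms, of s] ray_eqD unfolding cq_eq by simp_all
 thus thesis using that by metis
qed

lemma al_scale:
 assumes "!!s. 0 < \<kappa> s" "!!s. 0 < \<mu> s" "!!s. fa c' s = \<kappa> s *\<^sub>R fa c s" "!!s. fw c' s = \<mu> s *\<^sub>R fw c s"
 shows "al c' s = (1 / \<mu> s) *\<^sub>R al c s"
 unfolding al_def assms(3,4) using assms(1,2)[of s] by simp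

lemma al_normal: "(!!s. fa c s \<bullet> fw c s = 2) ==> al c = fa c"
 unfolding al_def by (rule ext) simp

lemma ray_al: "0 < fa c s \<bullet> fw c s ==> ray (al c s) = ray (fa c s)"
 unfolding al_def by (rule ray_scale) simp

lemma act_cq: "act g (cq c) = cq (mk (\<lambda>s. transpose (matrix_inv g) *v fa c s) (\<lambda>s. g *v fw c s))"
 unfolding act_def cq_eq fa_mk fw_mk by (simp only: fst_conv snd_conv matrix_image_ray)

lemma transpose_inner: "(transpose g *v a) \<bullet> x = a \<bullet> (g *v (x :: real^4))"
 by (metis dot_lmul_matrix vector_transpose_matrix transpose_transpose)

context angled_stack begin

text \<open>The open conditions under which the logarithms in \<open>xi\<close> are defined. The
  equations among those of \<open>good\<close> are left out, so that smoothness can be stated on an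
  open set of representatives.\<close>

definition Om :: "(((real^4) \<times> (real^4))^'s) set" where
 "Om = {c. (\<forall>s. 0 < fa c s \<bullet> fw c s) & (\<forall>p\<in>Ep. fa c (fst p) \<bullet> fw c (snd p) < 0) &
   (\<forall>p\<in>Kd. dd (fa c) (sg (fst p)) (fst p) * dd (fa c) (sg (fst p)) (snd p) < 0)}"

definition xi :: "((real^4) \<times> (real^4))^'s => real^('s\<times>'s)" where
 "xi c = (\<chi> p. if p \<in> Ep then ln (- (al c (fst p) \<bullet> fw c (snd p))) else if p \<in> Kd then ln (er (al c) (fst p) (snd p)) else 0)"

definition YY :: "'s config set" where "YY = {\<lambda>s. (ray (\<alpha> s), ray (v s)) | \<alpha> v. good \<alpha> v}"

lemma OmD:
 assumes "c \<in> Om"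
 shows "0 < fa c s \<bullet> fw c s" and "(i, j) \<in> Ep ==> al c i \<bullet> fw c j < 0" and "(k, d) \<in> Kd ==> 0 < er (al c) k d"
proof -
 show p: "0 < fa c s \<bullet> fw c s" for s using assms unfolding Om_def by blast
 show "al c i \<bullet> fw c j < 0" if "(i, j) \<in> Ep"
 proof -
  have "fa c i \<bullet> fw c j < 0" using assms that unfolding Om_def by force
  thus ?thesis unfolding al_def using p[of i] by (simp add: divide_neg_pos)
 qed
 show "0 < er (al c) k d" if kd: "(k, d) \<in> Kd"
 proof -
  obtain tr where s: "(k, tr, d) \<in> set L" using kd by (rule KdE)
  have "dd (fa c) (sg k) k * dd (fa c) (sg k) d < 0" using assms kd unfolding Om_def by force
  hence "0 < er (fa c) k d" unfolding er_def by (auto simp: mult_less_0_iff divide_less_0_iff)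
  moreover have "er (al c) k d = ((2 / (fa c k \<bullet> fw c k)) / (2 / (fa c d \<bullet> fw c d))) * er (fa c) k d"
   unfolding al_def[abs_def] by (rule er_scale[OF s]) (use p in \<open>simp add: less_imp_neq[symmetric]\<close>)
  moreover have "0 < (2 / (fa c k \<bullet> fw c k)) / (2 / (fa c d \<bullet> fw c d))" using p[of k] p[of d] by simp
  ultimately show ?thesis by (simp only: mult_pos_pos)
 qed
qed

lemma Om_I:
 assumes g: "good (al c) (fw c)" and p: "!!s. 0 < fa c s \<bullet> fw c s" shows "c \<in> Om"
proof -
 have "fa c i \<bullet> fw c j < 0" if e: "(i, j) \<in> Ep" for i j
 proof -
  have a: "adj T i j" "th i j ~= pi/2" using e unfolding Ep_def by auto
  have "al c i \<bullet> fw c j ~= 0" "al c i \<bullet> fw c j <= 0" using good_zero[OF g a(1)] goodD(2)[OF g a(1)] a(2) by auto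
  hence "al c i \<bullet> fw c j < 0" by simp
  moreover have "al c i \<bullet> fw c j = (2 / (fa c i \<bullet> fw c i)) * (fa c i \<bullet> fw c j)" unfolding al_def by simp
  moreover have "0 < 2 / (fa c i \<bullet> fw c i)" using p[of i] by simp
  ultimately show ?thesis by (metis mult_less_cancel_left_pos mult_zero_right)
 qed
 moreover have "dd (fa c) (sg k) k * dd (fa c) (sg k) d < 0" if kd: "(k, d) \<in> Kd" for k d
 proof -
  obtain tr where s: "(k, tr, d) \<in> set L" using kd by (rule KdE)
  have "er (al c) k d = ((2 / (fa c k \<bullet> fw c k)) / (2 / (fa c d \<bullet> fw c d))) * er (fa c) k d"
   unfolding al_def[abs_def] by (rule er_scale[OF s]) (use p in \<open>simp add: less_imp_neq[symmetric]\<close>)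
  moreover have "0 < (2 / (fa c k \<bullet> fw c k)) / (2 / (fa c d \<bullet> fw c d))" using p[of k] p[of d] by simp
  ultimately have "0 < er (fa c) k d" using er_pos[OF g s] by (metis zero_less_mult_pos)
  thus ?thesis unfolding er_def by (auto simp: mult_less_0_iff divide_less_0_iff zero_less_divide_iff)
 qed
 ultimately show ?thesis unfolding Om_def using p by auto
qed

lemma cq_YY_iff:
 "cq c \<in> YY \<longleftrightarrow> good (al c) (fw c) & (\<forall>s. 0 < fa c s \<bullet> fw c s)"
proof
 assume "cq c \<in> YY"
 then obtain \<alpha> v where g: "good \<alpha> v" and e: "cq c = (\<lambda>s. (ray (\<alpha> s), ray (v s)))" unfolding YY_def by blast
 have "cq (mk \<alpha> v) = (\<lambda>s. (ray (\<alpha> s), ray (v s)))" unfolding cq_eq by simp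
 hence e': "cq (mk \<alpha> v) = cq c" unfolding e .
 obtain \<kappa> \<mu> where s: "!!s. 0 < \<kappa> s" "!!s. 0 < \<mu> s" "!!s. fa c s = \<kappa> s *\<^sub>R fa (mk \<alpha> v) s" "!!s. fw c s = \<mu> s *\<^sub>R fw (mk \<alpha> v) s"
  using cq_scale[OF e'] by metis
 have n: "al (mk \<alpha> v) = \<alpha>" using al_normal[of "mk \<alpha> v"] goodD(1)[OF g] by simp
 have "al c = (\<lambda>s. (1 / \<mu> s) *\<^sub>R \<alpha> s)" using al_scale[OF s] unfolding n by blast
 moreover have "fw c = (\<lambda>s. \<mu> s *\<^sub>R v s)" using s(4) by auto
 ultimately have "good (al c) (fw c)" using good_scale[OF g s(2)] by simp
 moreover have "0 < fa c s \<bullet> fw c s" for s unfolding s(3,4) using s(1,2)[of s] goodD(1)[OF g, of s] by simp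
 ultimately show "good (al c) (fw c) & (\<forall>s. 0 < fa c s \<bullet> fw c s)" by blast
next
 assume a: "good (al c) (fw c) & (\<forall>s. 0 < fa c s \<bullet> fw c s)"
 have "cq c = (\<lambda>s. (ray (al c s), ray (fw c s)))" unfolding cq_eq using a by (simp add: ray_al)
 thus "cq c \<in> YY" unfolding YY_def using a by blast
qed

lemma xi_scale:
 assumes c: "c \<in> Om" and s: "!!s. 0 < \<kappa> s" "!!s. 0 < \<mu> s" "!!s. fa c' s = \<kappa> s *\<^sub>R fa c s" "!!s. fw c' s = \<mu> s *\<^sub>R fw c s"
 shows "xi c' = xi c + Dm (\<chi> s. ln (\<mu> s))"
proof -
 have m0: "\<mu> s ~= 0" for s using s(2)[of s] by simp
 have a: "al c' s = (1 / \<mu> s) *\<^sub>R al c s" for s by (rule al_scale[OF s])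
 have 1: "ln (- (al c' i \<bullet> fw c' j)) = ln (- (al c i \<bullet> fw c j)) + (ln (\<mu> j) - ln (\<mu> i))" if "(i, j) \<in> Ep" for i j
 proof -
  have "- (al c' i \<bullet> fw c' j) = (\<mu> j / \<mu> i) * (- (al c i \<bullet> fw c j))" unfolding a s(4) by simp
  moreover have "0 < - (al c i \<bullet> fw c j)" using OmD(2)[OF c that] by simp
  ultimately show ?thesis using s(2)[of i] s(2)[of j] by (simp only: ln_mult_pos ln_divide_pos divide_pos_pos add.commute)
 qed
 have 2: "ln (er (al c') k d) = ln (er (al c) k d) + (ln (\<mu> d) - ln (\<mu> k))" if kd: "(k, d) \<in> Kd" for k d
 proof -
  obtain tr where L': "(k, tr, d) \<in> set L" using kd by (rule KdE)
  have "al c' = (\<lambda>s. (1 / \<mu> s) *\<^sub>R al c s)" using a by blast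
  hence "er (al c') k d = ((1 / \<mu> k) / (1 / \<mu> d)) * er (al c) k d" using er_scale[OF L', of "\<lambda>s. 1 / \<mu> s" "al c"] m0 by simp
  hence "er (al c') k d = (\<mu> d / \<mu> k) * er (al c) k d" by simp
  thus ?thesis using OmD(3)[OF c kd] s(2)[of k] s(2)[of d] by (simp only: ln_mult_pos ln_divide_pos divide_pos_pos add.commute)
 qed
 show ?thesis unfolding xi_def Dm_def vec_eq_iff using 1 2 by auto
qed

lemma Om_scale:
 assumes c: "c \<in> Om" and s: "!!s. 0 < \<kappa> s" "!!s. 0 < \<mu> s" "!!s. fa c' s = \<kappa> s *\<^sub>R fa c s" "!!s. fw c' s = \<mu> s *\<^sub>R fw c s"
 shows "c' \<in> Om"
proof -
 have "0 < fa c' s \<bullet> fw c' s" for s unfolding s(3,4) using OmD(1)[OF c, of s] s(1,2)[of s] by simp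
 moreover have "fa c' i \<bullet> fw c' j < 0" if "(i, j) \<in> Ep" for i j
 proof -
  have "fa c i \<bullet> fw c j < 0" using c that unfolding Om_def by force
  moreover have "fa c' i \<bullet> fw c' j = (\<kappa> i * \<mu> j) * (fa c i \<bullet> fw c j)" unfolding s(3,4) by simp
  moreover have "0 < \<kappa> i * \<mu> j" using s(1,2) by simp
  ultimately show ?thesis by (simp add: mult_pos_neg)
 qed
 moreover have "dd (fa c') (sg k) k * dd (fa c') (sg k) d < 0" if kd: "(k, d) \<in> Kd" for k d
 proof -
  obtain tr where L': "(k, tr, d) \<in> set L" using kd by (rule KdE)
  have n: "dd (fa c) (sg k) k * dd (fa c) (sg k) d < 0" using c kd unfolding Om_def by force
  obtain x y z where abc: "tr = {x,y,z}" "distinct [x,y,z]" "\<forall>\<beta> u. dd \<beta> tr u = D4 (\<beta> x) (\<beta> y) (\<beta> z) (\<beta> u)" using step3[OF L'] by (rule dd_D4)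
  have e: "dd (fa c') (sg k) u = \<kappa> x * \<kappa> y * \<kappa> z * \<kappa> u * dd (fa c) (sg k) u" for u
   unfolding sg[OF L'] abc(3)[rule_format] s(3) D4_scales ..
  have "dd (fa c') (sg k) k * dd (fa c') (sg k) d = ((\<kappa> x * \<kappa> y * \<kappa> z)\<^sup>2 * \<kappa> k * \<kappa> d) * (dd (fa c) (sg k) k * dd (fa c) (sg k) d)"
   unfolding e by (simp add: power2_eq_square)
  moreover have "0 < (\<kappa> x * \<kappa> y * \<kappa> z)\<^sup>2 * \<kappa> k * \<kappa> d" by (intro mult_pos_pos zero_less_power s(1))
  ultimately show ?thesis using n by (simp only: mult_pos_neg)
 qed
 ultimately show ?thesis unfolding Om_def by auto
qed

lemma xi_Q: "xi c \<in> Q" unfolding xi_def Q_def by simp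

text \<open>Equal coordinates give equal Cartan entries at all adjacent pairs: one orientation is
  read off, the opposite one follows from the product fixed by the angle, and right-angled entries
  vanish. \<open>stack_unique\<close> applies.\<close>

lemma xi_unique:
 assumes c: "c \<in> Om" "good (al c) (fw c)" and c': "c' \<in> Om" "good (al c') (fw c')" and e: "xi c = xi c'"
 shows "\<exists>g::real^4^4. invertible g & (\<forall>s. transpose g *v al c' s = al c s & g *v fw c s = fw c' s)"
proof -
 have ep: "al c i \<bullet> fw c j = al c' i \<bullet> fw c' j" if "(i, j) \<in> Ep" for i j
  using arg_cong[OF e, of "\<lambda>x. x $ (i, j)"] that OmD(2)[OF c(1) that] OmD(2)[OF c'(1) that] unfolding xi_def by simp
 have kd: "er (al c) k d = er (al c') k d" if "(k, d) \<in> Kd" for k d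
  using arg_cong[OF e, of "\<lambda>x. x $ (k, d)"] that OmD(3)[OF c(1) that] OmD(3)[OF c'(1) that] Ep_Kd unfolding xi_def by (auto split: if_splits)
 have A: "al c s \<bullet> fw c t = al c' s \<bullet> fw c' t" if a: "adj T s t" for s t
 proof (cases "th s t = pi/2")
  case True
  thus ?thesis using good_zero[OF c(2) a] good_zero[OF c'(2) a] by simp
 next
  case False
  have "f s ~= f t" using injf a unfolding adj_def by (auto dest: injD)
  then consider "(s, t) \<in> Ep" | "(t, s) \<in> Ep" using a False adj_sym[OF a] sym[of s t] unfolding Ep_def by fastforce
  thus ?thesis
  proof cases
   case 1 thus ?thesis by (rule ep)
  next
   case 2
   have "(al c s \<bullet> fw c t) * (al c t \<bullet> fw c s) = (al c' s \<bullet> fw c' t) * (al c' t \<bullet> fw c' s)"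
    unfolding goodD(4)[OF c(2) a] goodD(4)[OF c'(2) a] ..
   thus ?thesis using ep[OF 2] OmD(2)[OF c'(1) 2] by simp
  qed
 qed
 have "\<exists>g::real^4^4. invertible g & (\<forall>s\<in>UNIV. transpose g *v al c' s = al c s & g *v fw c s = fw c' s)"
 proof (rule stack_unique[OF st])
  show "al c s \<bullet> fw c s = 2" "al c' s \<bullet> fw c' s = 2" for s using goodD(1) c(2) c'(2) by blast+
  show "al c s \<bullet> fw c t = al c' s \<bullet> fw c' t" if "adj T s t" for s t by (rule A[OF that])
  show "nd (al c) UNIV & nd (al c') UNIV" if "L = []" using L that by simp
  show "nd (al c) (insert d tr) & nd (al c') (insert d tr) &
   (\<exists>e>0. \<exists>y y'. al c k = (\<Sum>i\<in>tr. y i *\<^sub>R al c i) - e *\<^sub>R al c d & al c' k = (\<Sum>i\<in>tr. y' i *\<^sub>R al c' i) - e *\<^sub>R al c' d)"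
   if s: "(k, tr, d) \<in> set L" for k tr d
  proof (intro conjI goodD(5)[OF c(2) s] goodD(5)[OF c'(2) s] exI[of _ "er (al c) k d"])
   show "0 < er (al c) k d" by (rule er_pos[OF c(2) s])
   show "\<exists>y y'. al c k = (\<Sum>i\<in>tr. y i *\<^sub>R al c i) - er (al c) k d *\<^sub>R al c d & al c' k = (\<Sum>i\<in>tr. y' i *\<^sub>R al c' i) - er (al c) k d *\<^sub>R al c' d"
    using er_combination[OF s goodD(5)[OF c(2) s]] er_combination[OF s goodD(5)[OF c'(2) s]] unfolding kd[OF KdI[OF s]] by blast
  qed
  show "hyp (cartan (al c) (fw c)) a b c''" if "(k, {a,b,c''}, d) \<in> set L" "distinct [a,b,c'']" for k a b c'' d
   by (rule good_hyp[OF c(2) that])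
 qed
 thus ?thesis by simp
qed

text \<open>Linear maps leave \<open>xi\<close> unchanged and rescalings translate it, which gives
  one direction. Conversely the translation is realised by rescaling the vectors of
  \<open>c\<close>; \<open>xi_unique\<close> then provides a linear map, and a positive multiple of
  it has determinant \<open>1\<close> or \<open>-1\<close> while acting on rays in the same
  way.\<close>

lemma orbit_xi:
 assumes c: "c \<in> Om" "good (al c) (fw c)" and c': "c' \<in> Om" "good (al c') (fw c')"
 shows "SL_orbit (cq c) = SL_orbit (cq c') \<longleftrightarrow> (\<exists>\<mu>. xi c' = xi c + Dm \<mu>)"
proof
 assume "SL_orbit (cq c) = SL_orbit (cq c')"
 then obtain g where g: "det g = 1 \<or> det g = -1" and e: "cq c' = act g (cq c)" unfolding SL_orbit_eq_iff by blast
 note ig = invertible_unimodular[OF g]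
 define h where "h = transpose (matrix_inv g)"
 define c1 where "c1 = mk (\<lambda>s. h *v fa c s) (\<lambda>s. g *v fw c s)"
 have q: "cq c1 = cq c'" unfolding e act_cq c1_def h_def ..
 have pair: "(h *v x) \<bullet> (g *v y) = x \<bullet> y" for x y
  unfolding h_def transpose_inner matrix_vector_mul_assoc matrix_inv_mult(2)[OF ig] by simp
 have "det h * det g = 1"
 proof -
  have "det (matrix_inv g) * det g = 1" unfolding det_mul[symmetric] matrix_inv_mult(2)[OF ig] by simp
  thus ?thesis unfolding h_def det_transpose .
 qed
 hence dh: "det h ~= 0" by auto
 have al1: "al c1 = (\<lambda>s. h *v al c s)"
  unfolding al_def c1_def fa_mk fw_mk pair by (simp add: linear_cmul[OF matrix_vector_mul_linear])
 have "al c1 i \<bullet> fw c1 j = al c i \<bullet> fw c j" for i j unfolding al1 unfolding c1_def fw_mk pair ..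
 moreover have "er (al c1) k d = er (al c) k d" if kd: "(k, d) \<in> Kd" for k d
 proof -
  obtain tr where s: "(k, tr, d) \<in> set L" using kd by (rule KdE)
  show ?thesis unfolding al1 by (rule er_linear[OF s dh])
 qed
 ultimately have x1: "xi c1 = xi c" unfolding xi_def vec_eq_iff by simp
 obtain \<kappa> \<mu> where s: "!!s. 0 < \<kappa> s" "!!s. 0 < \<mu> s" "!!s. fa c1 s = \<kappa> s *\<^sub>R fa c' s" "!!s. fw c1 s = \<mu> s *\<^sub>R fw c' s"
  using cq_scale[OF q[symmetric]] by metis
 have "xi c1 = xi c' + Dm (\<chi> s. ln (\<mu> s))" by (rule xi_scale[OF c'(1) s])
 hence "xi c' = xi c + Dm (- (\<chi> s. ln (\<mu> s)))" unfolding x1 linear_neg[OF linear_Dm] by simp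
 thus "\<exists>\<mu>. xi c' = xi c + Dm \<mu>" by blast
next
 assume "\<exists>\<mu>. xi c' = xi c + Dm \<mu>"
 then obtain \<mu> where m: "xi c' = xi c + Dm \<mu>" ..
 define c1 where "c1 = mk (fa c) (\<lambda>s. exp (\<mu> $ s) *\<^sub>R fw c s)"
 have s: "!!s. 0 < (1::real)" "!!s. 0 < exp (\<mu> $ s)" "!!s. fa c1 s = 1 *\<^sub>R fa c s" "!!s. fw c1 s = exp (\<mu> $ s) *\<^sub>R fw c s"
  unfolding c1_def by simp_all
 have q1: "cq c1 = cq c" unfolding cq_eq s(4) unfolding c1_def by (simp add: ray_scale)
 have "xi c1 = xi c + Dm (\<chi> s. ln (exp (\<mu> $ s)))" by (rule xi_scale[OF c(1) s])
 hence x1: "xi c1 = xi c'" unfolding m by simp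
 have O1: "c1 \<in> Om" by (rule Om_scale[OF c(1) s])
 have "cq c \<in> YY" unfolding cq_YY_iff using c OmD(1) by blast
 hence g1: "good (al c1) (fw c1)" unfolding q1[symmetric] cq_YY_iff by blast
 obtain g :: "real^4^4" where ig: "invertible g" and g: "!!s. transpose g *v al c' s = al c1 s" "!!s. g *v fw c1 s = fw c' s"
  using xi_unique[OF O1 g1 c' x1] by blast
 have dg: "det g ~= 0" using ig by (simp add: invertible_det_nz)
 \<comment> \<open>The determinant is homogeneous of degree four in the matrix.\<close>
 define r where "r = root 4 (1 / \<bar>det g\<bar>)"
 have r: "0 < r" "r ^ 4 = 1 / \<bar>det g\<bar>" unfolding r_def using dg by (simp_all add: real_root_pow_pos2)
 define g1 where "g1 = r *\<^sub>R g"
 have "det g1 = r ^ 4 * det g" unfolding g1_def det_4 by (simp add: algebra_simps power4_eq_xxxx)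
 hence d1: "det g1 = 1 \<or> det g1 = -1" unfolding r(2) using dg by (simp add: abs_if)
 note i1 = invertible_unimodular[OF d1]
 have g1v: "g1 *v x = r *\<^sub>R (g *v x)" for x unfolding g1_def by (simp add: scaleR_matrix_vector_assoc)
 have g1a: "transpose g1 *v x = r *\<^sub>R (transpose g *v x)" for x
  unfolding g1_def by (simp add: transpose_scalar scaleR_matrix_vector_assoc del: transpose_matrix_vector)
 have "act g1 (cq c1) = cq c'"
 proof
  fix s
  have pos: "0 < fa c1 s \<bullet> fw c1 s" "0 < fa c' s \<bullet> fw c' s" using OmD(1)[OF O1] OmD(1)[OF c'(1)] by blast+
  have "transpose (matrix_inv g1) *v (r *\<^sub>R al c1 s) = (transpose (matrix_inv g1) ** transpose g1) *v al c' s"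
   unfolding g(1)[of s, symmetric] g1a[symmetric] by (rule matrix_vector_mul_assoc)
  also have "\<dots> = al c' s" unfolding matrix_transpose_mul[symmetric] matrix_inv_mult(1)[OF i1] by simp
  finally have "(\<lambda>\<beta>. transpose (matrix_inv g1) *v \<beta>) ` ray (r *\<^sub>R al c1 s) = ray (al c' s)" unfolding matrix_image_ray by simp
  hence 1: "(\<lambda>\<beta>. transpose (matrix_inv g1) *v \<beta>) ` ray (fa c1 s) = ray (fa c' s)"
   unfolding ray_scale[OF r(1)] ray_al[OF pos(1)] ray_al[OF pos(2)] .
  have "(\<lambda>x. g1 *v x) ` ray (fw c1 s) = ray (g1 *v fw c1 s)" by (rule matrix_image_ray)
  also have "\<dots> = ray (fw c' s)" unfolding g1v g(2) by (rule ray_scale[OF r(1)])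
  finally have "(\<lambda>x. g1 *v x) ` ray (fw c1 s) = ray (fw c' s)" .
  thus "act g1 (cq c1) s = cq c' s" unfolding act_def cq_eq using 1 by simp
 qed
 thus "SL_orbit (cq c) = SL_orbit (cq c')" unfolding SL_orbit_eq_iff q1 using d1 by metis
qed

end

section \<open>Smoothness of the coordinates and the global section\<close>

lemma C_infinity_on_if: "(b ==> C_infinity_on U f) ==> (\<not> b ==> C_infinity_on U g) ==> C_infinity_on U (\<lambda>x. if b then f x else g x)"
 by (cases b) simp_all

lemma C_infinity_on_fa: "C_infinity_on U (\<lambda>c. fa c s $ i)" and C_infinity_on_fw: "C_infinity_on U (\<lambda>c. fw c s $ i)"
 unfolding fa_def fw_def
 by (intro C_infinity_on_linear bounded_linear_compose[OF bounded_linear_vec_nth] bounded_linear_compose[OF bounded_linear_fst]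
   bounded_linear_compose[OF bounded_linear_snd] bounded_linear_vec_nth)+

lemma C_infinity_on_inner4:
 fixes a b :: "'x::real_normed_vector => real^4"
 assumes "open U" "!!i. C_infinity_on U (\<lambda>x. a x $ i)" "!!i. C_infinity_on U (\<lambda>x. b x $ i)"
 shows "C_infinity_on U (\<lambda>x. a x \<bullet> b x)"
 unfolding inner_4 by (intro smooth_rules assms)

lemma C_infinity_on_dd:
 assumes "card tr = 3" "open U" "!!s i. C_infinity_on U (\<lambda>x. \<beta> x s $ i)"
 shows "C_infinity_on U (\<lambda>x. dd (\<beta> x) tr u)"
proof -
 obtain a b c where abc: "tr = {a,b,c}" "distinct [a,b,c]" "\<forall>\<beta> u. dd \<beta> tr u = D4 (\<beta> a) (\<beta> b) (\<beta> c) (\<beta> u)" using assms(1) by (rule dd_D4)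
 show ?thesis unfolding abc(3)[rule_format] by (intro C_infinity_on_D4 assms(2,3))
qed

lemma C_infinity_on_mk:
 assumes U: "open U" and s: "!!s i. C_infinity_on U (\<lambda>x. \<alpha> x s $ i)" "!!s i. C_infinity_on U (\<lambda>x. v x s $ i)"
 shows "C_infinity_on U (\<lambda>x. mk (\<alpha> x) (v x) \<bullet> b)"
proof -
 have "mk (\<alpha> x) (v x) \<bullet> b = (\<Sum>s\<in>UNIV. \<alpha> x s \<bullet> fst (b $ s) + v x s \<bullet> snd (b $ s))" for x
  unfolding mk_def inner_vec_def[of "vec_lambda _"] by (simp add: inner_prod_def)
 hence e: "(\<lambda>x. mk (\<alpha> x) (v x) \<bullet> b) = (\<lambda>x. \<Sum>s\<in>UNIV. \<alpha> x s \<bullet> fst (b $ s) + v x s \<bullet> snd (b $ s))" by (rule ext)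
 show ?thesis unfolding e by (intro C_infinity_on_sum U C_infinity_on_add C_infinity_on_inner4 s C_infinity_on_const) simp
qed

lemma open_negative_smooth: "C_infinity_on UNIV g ==> open {c. g c < 0}" and open_positive_smooth: "C_infinity_on UNIV g ==> open {c. 0 < g c}"
 using C_infinity_on_continuous[of UNIV g] by (auto intro: open_Collect_less)

context angled_stack begin

lemma open_Om: "open Om"
proof -
 note sm = C_infinity_on_fa C_infinity_on_fw open_UNIV
 have "Om = (\<Inter>s. {c. 0 < fa c s \<bullet> fw c s}) \<inter> (\<Inter>p\<in>Ep. {c. fa c (fst p) \<bullet> fw c (snd p) < 0}) \<inter>
  (\<Inter>p\<in>Kd. {c. dd (fa c) (sg (fst p)) (fst p) * dd (fa c) (sg (fst p)) (snd p) < 0})"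
  unfolding Om_def by auto
 moreover have "open {c. dd (fa c) (sg (fst p)) (fst p) * dd (fa c) (sg (fst p)) (snd p) < 0}" if pK: "p \<in> Kd" for p
 proof -
  obtain k d where p: "p = (k, d)" by (cases p)
  obtain tr where s: "(k, tr, d) \<in> set L" using pK[unfolded p] by (rule KdE)
  show ?thesis unfolding p fst_conv snd_conv sg[OF s]
   by (intro open_negative_smooth C_infinity_on_mult C_infinity_on_dd step3[OF s] sm)
 qed
 moreover have "open {c. 0 < fa c s \<bullet> fw c s}" for s by (intro open_positive_smooth C_infinity_on_inner4 sm)
 moreover have "open {c. fa c (fst p) \<bullet> fw c (snd p) < 0}" for p by (intro open_negative_smooth C_infinity_on_inner4 sm)
 ultimately show ?thesis by (auto intro!: open_Int open_INT)
qed

lemma smooth_xi: "C_infinity_on Om (\<lambda>c. xi c $ p)"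
proof -
 note sm = C_infinity_on_fa C_infinity_on_fw open_Om
 have pos: "fa c s \<bullet> fw c s ~= 0" if "c \<in> Om" for c s using OmD(1)[OF that, of s] by simp
 have al: "C_infinity_on Om (\<lambda>c. al c s $ i)" for s i
  unfolding al_def vector_scaleR_component real_scaleR_def
  by (intro C_infinity_on_mult C_infinity_on_divide C_infinity_on_const C_infinity_on_inner4 sm pos)
 obtain i j where p: "p = (i, j)" by (cases p)
 consider "p \<in> Ep" | "p \<notin> Ep" "p \<in> Kd" | "p \<notin> Ep" "p \<notin> Kd" by blast
 thus ?thesis
 proof cases
  case 1
  have "C_infinity_on Om (\<lambda>c. ln (- (al c i \<bullet> fw c j)))"
   by (intro C_infinity_on_ln C_infinity_on_minus C_infinity_on_inner4 al sm) (use OmD(2) 1 p in force)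
  thus ?thesis unfolding xi_def using 1 p by simp
 next
  case 2
  then obtain tr where s: "(i, tr, j) \<in> set L" unfolding p by (auto elim: KdE)
  have n: "dd (al c) tr j ~= 0" if "c \<in> Om" for c
   using OmD(3)[OF that 2(2)[unfolded p]] unfolding er_def sg[OF s] by auto
  have n2: "0 < - dd (al c) tr i / dd (al c) tr j" if "c \<in> Om" for c
   using OmD(3)[OF that 2(2)[unfolded p]] unfolding er_def sg[OF s] .
  have "C_infinity_on Om (\<lambda>c. ln (er (al c) i j))"
   unfolding er_def sg[OF s]
   by (intro C_infinity_on_ln C_infinity_on_divide C_infinity_on_minus C_infinity_on_dd step3[OF s] al sm n n2)
  thus ?thesis unfolding xi_def using 2 p by simp
 next
  case 3
  thus ?thesis unfolding xi_def by (simp add: C_infinity_on_const)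
 qed
qed

text \<open>Inverts the logarithmic coordinates: exponentials of \<open>R w\<close> prescribe the
  free Cartan entries and the truncation numbers, and \<open>stack_section\<close> realises them
  smoothly in \<open>w\<close>.\<close>

lemma section_good:
 fixes R :: "'w::euclidean_space => real^('s\<times>'s)"
 assumes R: "linear R" and RQ: "!!w. R w \<in> Q"
 shows "\<exists>\<alpha> v. (\<forall>s i. C_infinity_on UNIV (\<lambda>w. \<alpha> w s $ i)) & (\<forall>s i. C_infinity_on UNIV (\<lambda>w. v w s $ i)) &
   (\<forall>w. good (\<alpha> w) (v w) & xi (mk (\<alpha> w) (v w)) = R w)"
proof -
 \<comment> \<open>The entry against the orientation of \<open>f\<close> is forced, since the
   product of the two must be \<open>4 * (cos (th s t))^2\<close>; right angles force
   \<open>0\<close>.\<close>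
 define A where "A w s t = (if s = t then 2 else if th s t = pi/2 then 0 else if f s < f t then - exp (R w $ (s, t))
   else - (4 * (cos (th s t))\<^sup>2) * exp (- (R w $ (t, s))))" for w s t
 define E where "E w k d = exp (R w $ (k, d))" for w k d
 have sR: "C_infinity_on UNIV (\<lambda>w. R w $ p)" for p
  using R by (intro C_infinity_on_linear bounded_linear_compose[OF bounded_linear_vec_nth]) (simp add: linear_conv_bounded_linear)
 have sA: "C_infinity_on UNIV (\<lambda>w. A w s t)" for s t
  unfolding A_def by (intro C_infinity_on_if C_infinity_on_const C_infinity_on_mult C_infinity_on_minus C_infinity_on_exp sR open_UNIV)
 have sE: "C_infinity_on UNIV (\<lambda>w. E w k d)" for k d unfolding E_def by (intro C_infinity_on_exp sR open_UNIV)
 have A0: "A w s s = 2" for w s unfolding A_def by simp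
 have fne: "f s ~= f t" "s ~= t" if "adj T s t" for s t using injf that unfolding adj_def by (auto dest: injD)
 have c0: "0 < (cos (th s t))\<^sup>2" if "adj T s t" "th s t ~= pi/2" for s t using cos_th[OF that(1)] that(2) by simp
 have An: "A w s t < 0" if a: "adj T s t" "th s t ~= pi/2" for w s t
  unfolding A_def using fne[OF a(1)] a(2) c0[OF a] by (auto simp: mult_neg_pos)
 have Az: "A w s t = 0" if "adj T s t" "th s t = pi/2" for w s t unfolding A_def using that fne[OF that(1)] by simp
 have Aw: "A w s t <= 0" "A w s t = 0 \<longleftrightarrow> A w t s = 0" "A w s t * A w t s = 4 * (cos (th s t))\<^sup>2" if a: "adj T s t" for w s t
 proof -
  note b = adj_sym[OF a]
  show "A w s t <= 0" using An[OF a] Az[OF a] by (metis less_imp_le order_refl)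
  show "A w s t = 0 \<longleftrightarrow> A w t s = 0" using An[OF a, of w] Az[OF a, of w] An[OF b, of w] Az[OF b, of w] sym[of s t]
   by (metis less_irrefl)
  show "A w s t * A w t s = 4 * (cos (th s t))\<^sup>2"
  proof (cases "th s t = pi/2")
   case True thus ?thesis using Az[OF a] cos_th[OF a] by simp
  next
   case False
   hence F: "th t s ~= pi/2" using sym[of s t] by simp
   have ee: "exp x * exp (- x) = (1::real)" for x by (simp add: exp_minus_inverse)
   consider "f s < f t" "\<not> f t < f s" | "\<not> f s < f t" "f t < f s" using fne[OF a] by linarith
   thus ?thesis
   proof cases
    case 1
    hence "A w s t * A w t s = (exp (R w $ (s,t)) * exp (- (R w $ (s,t)))) * (4 * (cos (th s t))\<^sup>2)"
     unfolding A_def using False F fne[OF a] sym[of s t] by simp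
    thus ?thesis unfolding ee by simp
   next
    case 2
    hence "A w s t * A w t s = (exp (R w $ (t,s)) * exp (- (R w $ (t,s)))) * (4 * (cos (th s t))\<^sup>2)"
     unfolding A_def using False F fne[OF a] sym[of s t] by simp
    thus ?thesis unfolding ee by simp
   qed
  qed
 qed
 have hA: "hyp (A w) a b c" if s: "(k, {a,b,c}, d) \<in> set L" "distinct [a,b,c]" for w k a b c d
 proof -
  have ad: "adj T a b" "adj T b a" "adj T a c" "adj T c a" "adj T b c" "adj T c b"
   by (rule step_adj[OF s(1)]; use s(2) in auto)+
  show ?thesis
   by (rule hyp_of_angles[of "th a b" "th a c" "th b c"])
    (use range[OF ad(1)] range[OF ad(3)] range[OF ad(5)] hyperb[OF s] A0 Aw(1)[OF ad(1)] Aw(1)[OF ad(2)] Aw(1)[OF ad(3)] Aw(1)[OF ad(4)]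
     Aw(1)[OF ad(5)] Aw(1)[OF ad(6)] Aw(2)[OF ad(1)] Aw(2)[OF ad(3)] Aw(2)[OF ad(5)] Aw(3)[OF ad(1)] Aw(3)[OF ad(3)] Aw(3)[OF ad(5)] in auto)
 qed
 have E0: "0 < E w k d" for w k d unfolding E_def by simp
 have "\<exists>\<alpha> v. (\<forall>s i. C_infinity_on UNIV (\<lambda>x. \<alpha> x s $ i)) & (\<forall>s i. C_infinity_on UNIV (\<lambda>x. v x s $ i)) &
   (\<forall>x. \<forall>s\<in>UNIV. \<alpha> x s \<bullet> v x s = 2) & (\<forall>x s t. adj T s t --> \<alpha> x s \<bullet> v x t = A x s t) &
   (\<forall>x \<tau> d. (\<tau>, d) \<in> T --> nd (\<alpha> x) (insert d \<tau>)) &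
   (\<forall>x k tr d. (k, tr, d) \<in> set L --> nd (\<alpha> x) (insert d tr) &
    (\<exists>c. \<alpha> x k = (\<Sum>i\<in>tr. c i *\<^sub>R \<alpha> x i) - E x k d *\<^sub>R \<alpha> x d))"
  by (rule stack_section[OF st sA sE E0 A0]) (erule (1) hA)
 then obtain \<alpha> v where sm: "\<forall>s i. C_infinity_on UNIV (\<lambda>x. \<alpha> x s $ i)" "\<forall>s i. C_infinity_on UNIV (\<lambda>x. v x s $ i)"
  and two: "\<forall>x. \<forall>s\<in>UNIV. \<alpha> x s \<bullet> v x s = 2" and val: "\<forall>x s t. adj T s t --> \<alpha> x s \<bullet> v x t = A x s t"
  and "\<forall>x \<tau> d. (\<tau>, d) \<in> T --> nd (\<alpha> x) (insert d \<tau>)"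
  and st': "\<forall>x k tr d. (k, tr, d) \<in> set L --> nd (\<alpha> x) (insert d tr) &
    (\<exists>c. \<alpha> x k = (\<Sum>i\<in>tr. c i *\<^sub>R \<alpha> x i) - E x k d *\<^sub>R \<alpha> x d)" by (elim exE conjE)
 have good: "good (\<alpha> w) (v w)" for w
  unfolding good_def
 proof (intro conjI allI impI)
  show "\<alpha> w s \<bullet> v w s = 2" for s using two by simp
  fix s t assume a: "adj T s t"
  have v: "\<alpha> w s \<bullet> v w t = A w s t" "\<alpha> w t \<bullet> v w s = A w t s" using val a adj_sym[OF a] by simp_all
  show "\<alpha> w s \<bullet> v w t <= 0" "(\<alpha> w s \<bullet> v w t = 0) = (\<alpha> w t \<bullet> v w s = 0)" "\<alpha> w s \<bullet> v w t * (\<alpha> w t \<bullet> v w s) = 4 * (cos (th s t))\<^sup>2"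
   unfolding v using Aw[OF a] by auto
 next
  fix k tr d assume s: "(k, tr, d) \<in> set L"
  show "nd (\<alpha> w) (insert d tr)" using st' s by blast
  obtain c where "\<alpha> w k = (\<Sum>i\<in>tr. c i *\<^sub>R \<alpha> w i) - E w k d *\<^sub>R \<alpha> w d" using st' s by blast
  thus "beyond (\<alpha> w) k tr d" unfolding beyond_def using E0[of w k d] by (intro exI[of _ c] exI[of _ "E w k d"] conjI)
 qed
 have "xi (mk (\<alpha> w) (v w)) $ p = R w $ p" for w p
 proof -
  obtain i j where p: "p = (i, j)" by (cases p)
  have n: "al (mk (\<alpha> w) (v w)) = \<alpha> w" using al_normal[of "mk (\<alpha> w) (v w)"] goodD(1)[OF good] by simp
  consider "p \<in> Ep" | "p \<notin> Ep" "p \<in> Kd" | "p \<notin> Ep" "p \<notin> Kd" by blast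
  thus ?thesis
  proof cases
   case 1
   hence a: "adj T i j" "th i j ~= pi/2" "f i < f j" unfolding p Ep_def by auto
   have "\<alpha> w i \<bullet> v w j = - exp (R w $ (i, j))" using val a fne[OF a(1)] by (simp add: A_def)
   thus ?thesis unfolding xi_def using 1 p n by simp
  next
   case 2
   then obtain tr where s: "(i, tr, j) \<in> set L" unfolding p by (auto elim: KdE)
   obtain c where "\<alpha> w i = (\<Sum>l\<in>tr. c l *\<^sub>R \<alpha> w l) - E w i j *\<^sub>R \<alpha> w j" using st' s by blast
   hence "er (\<alpha> w) i j = E w i j" by (rule er_eq[OF s goodD(5)[OF good s]])
   thus ?thesis unfolding xi_def using 2 p n by (simp add: E_def)
  next
   case 3
   hence "R w $ p = 0" using RQ[of w] unfolding Q_def by blast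
   thus ?thesis unfolding xi_def using 3 by simp
  qed
 qed
 hence "xi (mk (\<alpha> w) (v w)) = R w" for w by (simp add: vec_eq_iff)
 thus ?thesis using sm good by blast
qed

text \<open>The chart is \<open>xi\<close> projected along the rescalings. Two representatives over
  \<open>YY\<close> lie in one orbit iff their \<open>xi\<close> differ by an element of
  \<open>range Dm\<close>, that is, iff \<open>P\<close> does not distinguish them.\<close>

theorem moduli_chart:
 fixes W :: "'w::euclidean_space set"
 assumes W: "subspace W" and d: "dim W = card Ep - 3"
 shows "diffeomorphic (quotient_smooth (sub_smooth config_smooth YY) SL_orbit) (sub_smooth euclidean_smooth W)"
proof -
 have "dim W + dim (range Dm) = dim Q" using d dim_Q dim_Dm card_Ep by simp
 then obtain P R where lP: "linear P" and lR: "linear R" and PW: "!!x. P x \<in> W" and RQ: "!!w. R w \<in> Q"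
  and PR: "!!w. w \<in> W ==> P (R w) = w" and Pker: "!!x. x \<in> Q ==> P x = 0 \<longleftrightarrow> x \<in> range Dm"
  using subspace_quotient_coordinates[OF subspace_Q subspace_range_Dm range_Dm W] by metis
 obtain \<alpha> v where sm: "\<forall>s i. C_infinity_on UNIV (\<lambda>w. \<alpha> w s $ i)" "\<forall>s i. C_infinity_on UNIV (\<lambda>w. v w s $ i)"
  and good: "!!w. good (\<alpha> w) (v w)" and xi: "!!w. xi (mk (\<alpha> w) (v w)) = R w"
  using section_good[OF lR RQ] by (elim exE conjE) simp
 let ?O = "{c :: ((real^4) \<times> (real^4))^'s. \<forall>s. fst (c $ s) ~= 0 & snd (c $ s) ~= 0}"
 have PD: "P (Dm \<mu>) = 0" for \<mu> using Pker range_Dm by blast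
 have Peq: "P x = P y \<longleftrightarrow> (\<exists>\<mu>. y = x + Dm \<mu>)" if "x \<in> Q" "y \<in> Q" for x y
 proof -
  have "P x = P y \<longleftrightarrow> P (y - x) = 0" by (auto simp: linear_diff[OF lP])
  also have "\<dots> \<longleftrightarrow> y - x \<in> range Dm" by (rule Pker) (use subspace_diff[OF subspace_Q] that in blast)
  also have "\<dots> \<longleftrightarrow> (\<exists>\<mu>. y = x + Dm \<mu>)" by (auto simp: algebra_simps image_iff)
  finally show ?thesis .
 qed
 have O: "c \<in> ?O \<longleftrightarrow> (\<forall>s. fa c s ~= 0 & fw c s ~= 0)" for c unfolding fa_def fw_def by simp
 have OmO: "c \<in> ?O" if "c \<in> Om" for c unfolding O using OmD(1)[OF that] by (metis inner_zero_left inner_zero_right less_irrefl)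
 interpret quotient_chart ?O cq YY SL_orbit Om "\<lambda>c. P (xi c)" W "\<lambda>w. mk (\<alpha> w) (v w)"
 proof
  have "?O = (\<Inter>s. {c. fst (c $ s) ~= 0} \<inter> {c. snd (c $ s) ~= 0})" by auto
  moreover have "open {c :: ((real^4) \<times> (real^4))^'s. fst (c $ s) ~= 0}" "open {c :: ((real^4) \<times> (real^4))^'s. snd (c $ s) ~= 0}" for s
   by (intro open_Collect_neq continuous_intros)+
  ultimately show "open ?O" by (auto intro!: open_INT open_Int)
  show "open Om" by (rule open_Om)
  show "Om \<subseteq> ?O" using OmO by blast
  show "YY \<subseteq> cq ` Om"
  proof
   fix y assume "y \<in> YY"
   then obtain \<beta> u where g: "good \<beta> u" "y = (\<lambda>s. (ray (\<beta> s), ray (u s)))" unfolding YY_def by blast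
   have "y = cq (mk \<beta> u)" unfolding g(2) cq_eq by simp
   moreover have "mk \<beta> u \<in> Om" by (rule Om_I) (use g(1) goodD(1)[OF g(1)] al_normal[of "mk \<beta> u"] in simp_all)
   ultimately show "y \<in> cq ` Om" by blast
  qed
  fix c :: "((real^4) \<times> (real^4))^'s" assume c: "c \<in> Om"
  show "P (xi c) \<in> W" by (rule PW)
  fix c' :: "((real^4) \<times> (real^4))^'s"
  { assume q: "cq c = cq c'"
   obtain \<kappa> \<mu> where s: "!!s. 0 < \<kappa> s" "!!s. 0 < \<mu> s" "!!s. fa c' s = \<kappa> s *\<^sub>R fa c s" "!!s. fw c' s = \<mu> s *\<^sub>R fw c s"
    using cq_scale[OF q] by metis
   show "c' \<in> Om" by (rule Om_scale[OF c s])
   show "P (xi c) = P (xi c')" unfolding xi_scale[OF c s] by (simp add: linear_add[OF lP] PD) }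
  assume c': "c' \<in> Om" and y: "cq c \<in> YY" "cq c' \<in> YY"
  show "SL_orbit (cq c) = SL_orbit (cq c') \<longleftrightarrow> P (xi c) = P (xi c')"
   unfolding Peq[OF xi_Q xi_Q] by (rule orbit_xi) (use c c' y cq_YY_iff in blast)+
 next
  fix b :: 'w
  have "P (xi c) \<bullet> b = (\<Sum>p\<in>UNIV. xi c $ p * (P (axis p 1) \<bullet> b))" for c
  proof -
   have "xi c = (\<Sum>p\<in>UNIV. xi c $ p *\<^sub>R axis p 1)" using basis_expansion[of "xi c"] by (simp only: scalar_mult_eq_scaleR)
   hence "P (xi c) = P (\<Sum>p\<in>UNIV. xi c $ p *\<^sub>R axis p 1)" by (rule arg_cong)
   also have "\<dots> = (\<Sum>p\<in>UNIV. xi c $ p *\<^sub>R P (axis p 1))" by (simp only: linear_sum[OF lP] linear_cmul[OF lP])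
   finally have "P (xi c) = (\<Sum>p\<in>UNIV. xi c $ p *\<^sub>R P (axis p 1))" .
   thus ?thesis by (simp add: inner_sum_left)
  qed
  hence e: "(\<lambda>c. P (xi c) \<bullet> b) = (\<lambda>c. \<Sum>p\<in>UNIV. xi c $ p * (P (axis p 1) \<bullet> b))" by (rule ext)
  show "C_infinity_on Om (\<lambda>c. P (xi c) \<bullet> b)"
   unfolding e by (intro C_infinity_on_sum C_infinity_on_mult C_infinity_on_const smooth_xi open_Om) simp
 next
  show "C_infinity_on UNIV (\<lambda>w. mk (\<alpha> w) (v w) \<bullet> b)" for b using sm by (intro C_infinity_on_mk) auto
  fix w
  have Om: "mk (\<alpha> w) (v w) \<in> Om" by (rule Om_I) (use good[of w] goodD(1)[OF good[of w]] al_normal[of "mk (\<alpha> w) (v w)"] in simp_all)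
  thus "mk (\<alpha> w) (v w) \<in> ?O" by (rule OmO)
  show "cq (mk (\<alpha> w) (v w)) \<in> YY" unfolding cq_eq YY_def using good[of w] by auto
  assume "w \<in> W"
  thus "P (xi (mk (\<alpha> w) (v w))) = w" unfolding xi by (rule PR)
 qed
 have "cq = (\<lambda>(c :: ((real^4) \<times> (real^4))^'s) s. (ray (fst (c $ s)), ray (snd (c $ s))))" by (intro ext) (simp add: cq_def)
 hence "X = quotient_smooth (sub_smooth config_smooth YY) SL_orbit"
  unfolding X_def M_def config_smooth_def by simp
 thus ?thesis using diffeo unfolding diffeomorphic_def by metis
qed

end

section \<open>Andreev conditions and the moduli space\<close>

text \<open>A truncated triangle becomes interior and stays so. Its three faces are pairwise
  adjacent without a common vertex, so they form a prismatic circuit.\<close>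

lemma stk_step_notcell: "stk S T L ==> (k, tr, d) \<in> set L ==> tr \<notin> fst ` T"
proof (induction arbitrary: k tr d rule: stk.induct)
 case (step S T L tr0 d0 k0)
 note it = step_cells_iff[OF step.hyps(1,2)]
 have k0: "k0 \<notin> tr"
 proof (cases "(k, tr, d) \<in> set L")
  case True thus ?thesis using stk_step_mem[OF step.hyps(1) True] step.hyps(3) by blast
 next
  case False
  hence "tr = tr0" using step.prems by auto
  thus ?thesis using stk_cell[OF step.hyps(1,2)] step.hyps(3) by blast
 qed
 have "\<not> (tr \<in> fst ` T & tr ~= tr0)"
 proof (cases "(k, tr, d) \<in> set L")
  case True thus ?thesis using step.IH by blast
 next
  case False thus ?thesis using step.prems by auto
 qed
 moreover have "\<not> (\<exists>x\<in>tr0. tr = insert k0 (tr0 - {x}))" using k0 by auto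
 ultimately show ?case unfolding it by blast
qed simp

text \<open>In a stack of at least two tetrahedra each one is glued to another, so the tetrahedron
  under a boundary triangle also contains a covered triangle.\<close>

lemma stk_cell_step:
 "stk S T L ==> L ~= [] ==> (\<tau>, d) \<in> T ==> \<exists>k' tr' d'. (k', tr', d') \<in> set L & tr' \<subseteq> insert d \<tau>"
proof (induction arbitrary: \<tau> d rule: stk.induct)
 case (step S T L tr0 d0 k0)
 have new: "(k0, tr0, d0) \<in> set (L @ [(k0, tr0, d0)])" by simp
 show ?case
 proof (cases "(\<tau>, d) \<in> T")
  case True
  show ?thesis
  proof (cases "L = []")
   case e: True
   have "insert d \<tau> = S" "insert d0 tr0 = S" using stk_Nil_cell[of S T] step.hyps(1,2) True e by auto
   hence "tr0 \<subseteq> insert d \<tau>" by blast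
   thus ?thesis using new by blast
  next
   case False
   then obtain k' tr' d' where s: "(k', tr', d') \<in> set L" "tr' \<subseteq> insert d \<tau>" using step.IH[OF False True] by blast
   have "(k', tr', d') \<in> set (L @ [(k0, tr0, d0)])" using s(1) by simp
   thus ?thesis using s(2) by blast
  qed
 next
  case False
  hence "insert d \<tau> = insert k0 tr0" using step.prems(2) unfolding step_cells_def by auto
  hence "tr0 \<subseteq> insert d \<tau>" by blast
  thus ?thesis using new by blast
 qed
qed simp

lemma stk_single:
 assumes "stk S T [(k, tr, d)]"
 obtains S0 where "card S0 = 4" "S0 = insert d tr" "k \<notin> S0" "S = insert k S0" "d \<notin> tr" "card tr = 3" "T = step_cells ((\<lambda>x. (S0 - {x}, x)) ` S0) k tr d"
 using assms
proof (cases rule: stk.cases)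
 case (step S0 T0 L0 tr0 d0 k0)
 hence e: "L0 = []" "tr0 = tr" "d0 = d" "k0 = k" by auto
 have s: "stk S0 T0 []" "(tr, d) \<in> T0" using step e by auto
 have "card S0 = 4" "T0 = (\<lambda>x. (S0 - {x}, x)) ` S0" "insert d tr = S0" using stk_Nil[OF s(1)] stk_Nil_cell[OF s] by auto
 moreover have "d \<notin> tr" "card tr = 3" using stk_cell[OF s] by auto
 moreover have "k \<notin> S0" "S = insert k S0" "T = step_cells T0 k tr d" using step(1,2,6) e by simp_all
 ultimately show ?thesis by (intro that[of S0]) simp_all
qed

text \<open>With at least two truncations, the prism at each of them is cut by another one.\<close>

lemma stk_two_steps:
 "stk S T L ==> 2 <= length L ==> (k, tr, d) \<in> set L ==>
  \<exists>k' tr' d'. (k', tr', d') \<in> set L & tr' ~= tr & (tr' \<subseteq> insert d tr \<or> tr' \<subseteq> insert k tr)"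
proof (induction arbitrary: k tr d rule: stk.induct)
 case (step S T L tr0 d0 k0)
 have new: "(k0, tr0, d0) \<in> set (L @ [(k0, tr0, d0)])" by simp
 have sub: "s \<in> set (L @ [(k0, tr0, d0)])" if "s \<in> set L" for s using that by simp
 have ne: "L ~= []" using step.prems(1) by auto
 have tr0T: "tr0 \<in> fst ` T" using step.hyps(2) by force
 show ?case
 proof (cases "(k, tr, d) \<in> set L")
  case False
  hence e: "tr = tr0" "d = d0" using step.prems(2) by auto
  obtain k' tr' d' where s: "(k', tr', d') \<in> set L" "tr' \<subseteq> insert d0 tr0" using stk_cell_step[OF step.hyps(1) ne step.hyps(2)] by blast
  have "tr' ~= tr0" using stk_step_notcell[OF step.hyps(1) s(1)] tr0T by blast
  thus ?thesis unfolding e using sub[OF s(1)] s(2) by blast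
 next
  case True
  show ?thesis
  proof (cases "2 <= length L")
   case l: True
   obtain k' tr' d' where "(k', tr', d') \<in> set L" "tr' ~= tr" "tr' \<subseteq> insert d tr \<or> tr' \<subseteq> insert k tr" using step.IH[OF l True] by blast
   thus ?thesis using sub by blast
  next
   case False
   moreover have "length L ~= 0" using ne by simp
   ultimately have "length L = Suc 0" by linarith
   then obtain x where "L = [x]" unfolding length_Suc_conv by auto
   hence Lx: "L = [(k, tr, d)]" using True by simp
   obtain S0 where "card S0 = 4" and S0: "S0 = insert d tr" and "k \<notin> S0" "S = insert k S0" "d \<notin> tr" "card tr = 3"
    and T0: "T = step_cells ((\<lambda>x. (S0 - {x}, x)) ` S0) k tr d"
    by (rule stk_single[OF step.hyps(1)[unfolded Lx]])
   have "tr0 \<subseteq> insert d tr \<or> tr0 \<subseteq> insert k tr" using step.hyps(2) unfolding T0 step_cells_def S0 by auto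
   moreover have "tr0 ~= tr" using stk_step_notcell[OF step.hyps(1) True] tr0T by blast
   ultimately show ?thesis using new by blast
  qed
 qed
qed simp

section \<open>Angles and circuits of a labelled graph on its stack\<close>

locale graph_stack =
 fixes G :: "'v pair_pre_digraph" and \<rho> :: "'v \<times> 'v => 'v \<times> 'v" and \<theta> :: "'v set => real"
  and mark :: "'s::finite => ('v \<times> 'v) set" and \<tau> :: "'v => 's set" and T L
 assumes M: "marked_labelled_graph G \<rho> \<theta> mark" and A: "andreev_conditions G \<rho> \<theta>"
  and st: "stk UNIV T L" and L: "L ~= []" and \<tau>: "\<tau> u = {s. u \<in> face_verts (mark s)}"
  and bij: "bij_betw \<tau> (pverts G) (fst ` T)"
  and ed: "s ~= t ==> e \<in> face_edges (mark s) \<inter> face_edges (mark t) \<longleftrightarrow>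
    (\<exists>u\<in>pverts G. \<exists>w\<in>pverts G. u ~= w & e = {u, w} & {s, t} \<subseteq> \<tau> u \<inter> \<tau> w)"
  and arcs: "u \<in> pverts G ==> w \<in> pverts G ==> u ~= w ==> (u, w) \<in> parcs G \<longleftrightarrow> (\<exists>s t. s ~= t & {s, t} \<subseteq> \<tau> u \<inter> \<tau> w)"
  and fv: "face_verts (mark s) \<subseteq> pverts G"
begin

text \<open>For adjacent faces this is their common edge, and for other distinct pairs it is empty.
  The geometry of the graph is thereby expressed in the indices of the stack.\<close>

definition edge :: "'s => 's => 'v set" where "edge s t = {u \<in> pverts G. {s, t} \<subseteq> \<tau> u}"

lemma edge_sym: "edge s t = edge t s" unfolding edge_def by auto

lemma edge_verts: "face_verts (mark s) \<inter> face_verts (mark t) = edge s t"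
 unfolding edge_def \<tau> using fv by auto

lemma edge_pair:
 assumes a: "adj T s t" obtains u w where "edge s t = {u, w}" "u ~= w" "u \<in> pverts G" "w \<in> pverts G"
proof -
 have ne: "s ~= t" using a unfolding adj_def by blast
 obtain x y where xy: "x ~= y" "ends T s t = {x, y}" using stk_ends[OF st a] by blast
 have "x \<in> ends T s t" "y \<in> ends T s t" using xy(2) by auto
 hence c: "{s,t,x} \<in> fst ` T" "{s,t,y} \<in> fst ` T" and xn: "x ~= s" "x ~= t" "y ~= s" "y ~= t" unfolding ends_def by auto
 have sur: "\<tau> ` pverts G = fst ` T" and inj: "inj_on \<tau> (pverts G)" using bij unfolding bij_betw_def by auto
 obtain u where u: "u \<in> pverts G" "\<tau> u = {s,t,x}" using c(1) sur by (metis imageE)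
 obtain w where w: "w \<in> pverts G" "\<tau> w = {s,t,y}" using c(2) sur by (metis imageE)
 have "x \<notin> \<tau> w" using xn xy(1) unfolding w(2) by auto
 hence uw: "u ~= w" using u(2) by auto
 have "q = u \<or> q = w" if q: "q \<in> pverts G" "{s,t} \<subseteq> \<tau> q" for q
 proof -
  have qT: "\<tau> q \<in> fst ` T" using q(1) sur by blast
  then obtain e where "(\<tau> q, e) \<in> T" by auto
  hence c3: "card (\<tau> q) = 3" using stk_cell[OF st] by blast
  obtain z where z: "z \<in> \<tau> q" "z ~= s" "z ~= t" by (rule card3_third[OF c3])
  have fin: "finite (\<tau> q)" using c3 by (intro card_ge_0_finite) simp
  have "{s,t,z} \<subseteq> \<tau> q" using q(2) z(1) by blast
  moreover have "card {s,t,z} = 3" using ne z by simp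
  ultimately have e: "{s,t,z} = \<tau> q" using card_subset_eq[OF fin] c3 by metis
  hence "z \<in> ends T s t" unfolding ends_def using qT z by simp
  hence "z = x \<or> z = y" unfolding xy(2) by simp
  hence "\<tau> q = \<tau> u \<or> \<tau> q = \<tau> w" unfolding u(2) w(2) e[symmetric] by auto
  thus ?thesis using inj_onD[OF inj _ q(1) u(1)] inj_onD[OF inj _ q(1) w(1)] by blast
 qed
 hence "edge s t = {u, w}" unfolding edge_def using u w by auto
 thus thesis using that uw u(1) w(1) by blast
qed

lemma adj_vertex: assumes "s ~= t" "u \<in> pverts G" "{s,t} \<subseteq> \<tau> u" shows "adj T s t"
proof -
 have "\<tau> u \<in> fst ` T" using bij assms(2) unfolding bij_betw_def by blast
 thus ?thesis using assms by (intro adjI) auto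
qed

lemma common_edge_iff:
 assumes "s ~= t"
 shows "e \<in> face_edges (mark s) \<inter> face_edges (mark t) \<longleftrightarrow> adj T s t & e = edge s t"
 unfolding ed[OF assms]
proof
 assume "\<exists>u\<in>pverts G. \<exists>w\<in>pverts G. u ~= w & e = {u, w} & {s, t} \<subseteq> \<tau> u \<inter> \<tau> w"
 then obtain u w where u: "u \<in> pverts G" "w \<in> pverts G" "u ~= w" "e = {u, w}" "{s, t} \<subseteq> \<tau> u \<inter> \<tau> w" by (elim bexE conjE)
 have a: "adj T s t" by (rule adj_vertex[OF assms u(1)]) (use u(5) in blast)
 obtain x y where xy: "edge s t = {x, y}" "x ~= y" using a by (rule edge_pair)
 have sub: "{u, w} \<subseteq> edge s t" unfolding edge_def using u by blast
 have "card {u, w} = 2" "card (edge s t) = 2" unfolding xy(1) using u(3) xy(2) by simp_all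
 moreover have "finite (edge s t)" unfolding xy(1) by simp
 ultimately have "{u, w} = edge s t" using card_subset_eq[OF _ sub] by metis
 thus "adj T s t & e = edge s t" using a u(4) by simp
next
 assume a: "adj T s t & e = edge s t"
 then obtain u w where u: "edge s t = {u, w}" "u ~= w" "u \<in> pverts G" "w \<in> pverts G" using edge_pair by metis
 have "u \<in> edge s t" "w \<in> edge s t" unfolding u(1) by auto
 hence "{s,t} \<subseteq> \<tau> u \<inter> \<tau> w" unfolding edge_def by blast
 thus "\<exists>u\<in>pverts G. \<exists>w\<in>pverts G. u ~= w & e = {u, w} & {s, t} \<subseteq> \<tau> u \<inter> \<tau> w" using a u by metis
qed

lemma edge_in_edges: assumes a: "adj T s t" shows "edge s t \<in> edges G"
proof -
 obtain u w where u: "edge s t = {u, w}" "u ~= w" "u \<in> pverts G" "w \<in> pverts G" using a by (rule edge_pair)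
 have "u \<in> edge s t" "w \<in> edge s t" unfolding u(1) by auto
 hence "{s,t} \<subseteq> \<tau> u \<inter> \<tau> w" unfolding edge_def by blast
 moreover have "s ~= t" using a unfolding adj_def by blast
 ultimately have "(u, w) \<in> parcs G" using arcs[OF u(3,4,2)] by blast
 thus ?thesis unfolding u(1) edges_def by blast
qed

lemma pairG: "pair_graph G" using M unfolding marked_labelled_graph_def by blast

lemma edges_edge: assumes e: "e \<in> edges G" obtains s t where "adj T s t" "e = edge s t"
proof -
 obtain u w where uw: "(u, w) \<in> parcs G" "e = {u, w}" using e unfolding edges_def by blast
 have V: "u \<in> pverts G" "w \<in> pverts G" "u ~= w" using pair_graphD(3-5)[OF pairG uw(1)] by auto
 obtain s t where s: "s ~= t" "{s, t} \<subseteq> \<tau> u \<inter> \<tau> w" using uw(1) arcs[OF V] by blast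
 have "e \<in> face_edges (mark s) \<inter> face_edges (mark t)" unfolding ed[OF s(1)] using V uw(2) s(2) by blast
 thus thesis using that common_edge_iff[OF s(1)] by blast
qed

text \<open>The sets of faces through two different vertices are different triples, so they have at
  most two elements in common.\<close>

lemma edge_inj: assumes a: "adj T s t" and b: "adj T s' t'" and e: "edge s t = edge s' t'" shows "{s,t} = {s',t'}"
proof -
 obtain u w where u: "edge s t = {u, w}" "u ~= w" "u \<in> pverts G" "w \<in> pverts G" using a by (rule edge_pair)
 have m: "u \<in> edge s t" "w \<in> edge s t" "u \<in> edge s' t'" "w \<in> edge s' t'" unfolding e[symmetric] u(1) by auto
 hence sub: "{s,t} \<subseteq> \<tau> u \<inter> \<tau> w" "{s',t'} \<subseteq> \<tau> u \<inter> \<tau> w" unfolding edge_def by blast+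
 have uT: "\<tau> u \<in> fst ` T" "\<tau> w \<in> fst ` T" using bij u(3,4) unfolding bij_betw_def by blast+
 have "card (\<tau> u) = 3" "card (\<tau> w) = 3" using uT stk_cell[OF st] by fastforce+
 moreover have "\<tau> u ~= \<tau> w" using bij u unfolding bij_betw_def by (meson inj_onD)
 moreover have f: "finite (\<tau> u)" "finite (\<tau> w)" by simp_all
 ultimately have "card (\<tau> u \<inter> \<tau> w) < 3" by (metis card_subset_eq inf.cobounded1 inf.cobounded2 order_le_less card_mono)
 moreover have "card {s,t} = 2" "card {s',t'} = 2" using a b unfolding adj_def by auto
 ultimately have "{s,t} = \<tau> u \<inter> \<tau> w" "{s',t'} = \<tau> u \<inter> \<tau> w"
  using sub f by (metis card_seteq finite_Int less_Suc_eq_le numeral_2_eq_2 numeral_3_eq_3)+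
 thus ?thesis by simp
qed

definition th where "th s t = \<theta> (edge s t)"

lemma th_range: "adj T s t ==> 0 < th s t & th s t <= pi/2"
 unfolding th_def using edge_in_edges[of s t] M unfolding marked_labelled_graph_def by blast

lemma th_sym: "th s t = th t s" unfolding th_def edge_sym[of s t] ..

lemma triple_circuit:
 assumes a: "adj T a b" "adj T b c" "adj T c a"
 shows "circuit G \<rho> 3 [mark a, mark b, mark c] [edge a b, edge b c, edge c a]"
proof -
 have ne: "a ~= b" "b ~= c" "c ~= a" using a unfolding adj_def by auto
 have mb: "inj mark" "range mark = faces G \<rho>" using M unfolding marked_labelled_graph_def bij_betw_def by auto
 have d: "distinct [mark a, mark b, mark c]" using ne mb(1) by (auto dest: injD)
 have s: "set [mark a, mark b, mark c] \<subseteq> faces G \<rho>" using mb(2) by auto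
 have e: "face_edges (mark s) \<inter> face_edges (mark t) = {edge s t}" if "adj T s t" for s t
 proof -
  have "s ~= t" using that unfolding adj_def by blast
  from common_edge_iff[OF this] that show ?thesis by blast
 qed
 have "face_edges ([mark a, mark b, mark c] ! i) \<inter> face_edges ([mark a, mark b, mark c] ! (Suc i mod 3)) = {[edge a b, edge b c, edge c a] ! i} &
  face_verts ([mark a, mark b, mark c] ! i) \<inter> face_verts ([mark a, mark b, mark c] ! (Suc i mod 3)) = [edge a b, edge b c, edge c a] ! i"
  if "i < 3" for i
 proof -
  have "i = 0 \<or> i = 1 \<or> i = 2" using that by auto
  thus ?thesis using e[OF a(1)] e[OF a(2)] e[OF a(3)] edge_verts[of a b] edge_verts[of b c] edge_verts[of c a]
   by (elim disjE) (simp_all add: numeral_2_eq_2)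
 qed
 thus ?thesis unfolding circuit_def using d s by simp
qed

text \<open>If two of the three edges shared a vertex, all three faces would pass through it and
  \<open>{a,b,c}\<close> would be a cell.\<close>

lemma prismatic_sum:
 assumes a: "adj T a b" "adj T b c" "adj T c a" and n: "{a,b,c} \<notin> fst ` T"
 shows "th a b + th b c + th c a < pi"
proof -
 have ne: "a ~= b" "b ~= c" "c ~= a" using a unfolding adj_def by auto
 have no: "\<not> {a,b,c} \<subseteq> \<tau> u" if "u \<in> pverts G" for u
 proof
  assume s: "{a,b,c} \<subseteq> \<tau> u"
  have uT: "\<tau> u \<in> fst ` T" using bij that unfolding bij_betw_def by blast
  hence "card (\<tau> u) = 3" using stk_cell[OF st] by fastforce
  moreover have "card {a,b,c} = 3" using ne by simp
  ultimately have "{a,b,c} = \<tau> u" using card_subset_eq[OF _ s] by simp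
  thus False using uT n by simp
 qed
 have dis: "edge a b \<inter> edge b c = {}" "edge b c \<inter> edge c a = {}" "edge a b \<inter> edge c a = {}"
  unfolding edge_def using no by blast+
 have "prismatic [edge a b, edge b c, edge c a]"
  unfolding prismatic_def
 proof (intro allI impI)
  fix i j assume "i < length [edge a b, edge b c, edge c a]" "j < length [edge a b, edge b c, edge c a]" "i ~= j"
  hence "(i = 0 \<or> i = 1 \<or> i = 2) & (j = 0 \<or> j = 1 \<or> j = 2) & i ~= j" by auto
  thus "[edge a b, edge b c, edge c a] ! i \<inter> [edge a b, edge b c, edge c a] ! j = {}"
   using dis by (elim conjE disjE) (simp_all add: Int_commute)
 qed
 hence "hyperbolic \<theta> [edge a b, edge b c, edge c a]"
  using A triple_circuit[OF a] unfolding andreev_conditions_def by blast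
 thus ?thesis unfolding hyperbolic_def th_def by simp
qed

lemma step_sum:
 assumes s: "(k, {a,b,c}, d) \<in> set L" "distinct [a,b,c]"
 shows "th a b + th a c + th b c < pi"
proof -
 have ad: "adj T a b" "adj T b c" "adj T c a" by (rule stk_step_adj[OF st s(1)]; use s(2) in auto)+
 show ?thesis using prismatic_sum[OF ad stk_step_notcell[OF st s(1)]] th_sym[of a c] by simp
qed

end

section \<open>Exclusion of the exceptional prism, and the moduli space\<close>

context graph_stack begin

lemma edge_eq:
 assumes "u \<in> pverts G" "w \<in> pverts G" "u ~= w" "s ~= t" "{s,t} \<subseteq> \<tau> u \<inter> \<tau> w"
 shows "edge s t = {u, w}" "{u, w} \<in> edges G"
proof -
 have "{u, w} \<in> face_edges (mark s) \<inter> face_edges (mark t)" unfolding ed[OF assms(4)]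
  by (rule bexI[OF _ assms(1)], rule bexI[OF _ assms(2)], intro conjI refl assms)
 hence e: "adj T s t" "{u, w} = edge s t" unfolding common_edge_iff[OF assms(4)] by (rule conjunct1, rule conjunct2)
 thus "edge s t = {u, w}" "{u, w} \<in> edges G" using edge_in_edges[OF e(1)] by simp_all
qed

text \<open>One truncation of a tetrahedron gives a triangular prism whose triangles are the faces
  \<open>d\<close> and \<open>k\<close>. \<open>U i x\<close> is the corner of the triangle
  \<open>i\<close> that avoids the lateral face \<open>x\<close>; the six edges of the triangles
  carry the angles of \<open>d\<close> and \<open>k\<close> with \<open>tr\<close>.\<close>

lemma single_step_prism:
 assumes Lx: "L = [(k, tr, d)]" and right: "!!i. i \<in> tr ==> th k i = pi/2 & th d i = pi/2"
 shows "exceptional_prism G \<theta>"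
proof -
 obtain S0 where "card S0 = 4" and S0: "S0 = insert d tr" and k0: "k \<notin> S0" and "UNIV = insert k S0" and dtr: "d \<notin> tr" and c3: "card tr = 3"
  and T0: "T = step_cells ((\<lambda>x. (S0 - {x}, x)) ` S0) k tr d"
  by (rule stk_single[OF st[unfolded Lx]])
 have ktr: "k \<notin> tr" "k ~= d" using k0 unfolding S0 by auto
 obtain a b c where abc: "tr = {a,b,c}" "distinct [a,b,c]" using c3[unfolded card3_iff_distinct] by blast
 have ne: "a ~= b" "b ~= a" "a ~= c" "c ~= a" "b ~= c" "c ~= b" using abc(2) by auto
 have m: "a \<in> tr" "b \<in> tr" "c \<in> tr" unfolding abc(1) by auto
 have S0d: "S0 - {x} = insert d (tr - {x})" if "x \<in> tr" for x using that dtr unfolding S0 by auto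
 have cells: "insert i (tr - {x}) \<in> fst ` T" if "x \<in> tr" "i = d \<or> i = k" for i x
 proof (cases "i = d")
  case True
  have "(S0 - {x}, x) \<in> T" unfolding T0 step_cells_def using that(1) dtr S0 by auto
  thus ?thesis unfolding True S0d[OF that(1)] by force
 next
  case False
  have "(insert k (tr - {x}), x) \<in> T" unfolding T0 step_cells_def using that(1) by blast
  thus ?thesis using that(2) False by force
 qed
 have cellE: "\<exists>x\<in>tr. \<exists>i. (i = d \<or> i = k) & \<upsilon> = insert i (tr - {x})" if \<upsilon>: "\<upsilon> \<in> fst ` T" for \<upsilon>
 proof -
  obtain e where "(\<upsilon>, e) \<in> T" using \<upsilon> by auto
  then consider "(\<upsilon>, e) ~= (tr, d)" "\<upsilon> = S0 - {e}" "e \<in> S0" | "e \<in> tr" "\<upsilon> = insert k (tr - {e})"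
   unfolding T0 step_cells_def by auto
  thus ?thesis
  proof cases
   case 1
   have "e ~= d" using 1(1,2) dtr unfolding S0 by auto
   hence "e \<in> tr" using 1(3) unfolding S0 by blast
   thus ?thesis using 1(2) S0d by blast
  next
   case 2 thus ?thesis by blast
  qed
 qed
 have sur: "\<tau> ` pverts G = fst ` T" and inj: "inj_on \<tau> (pverts G)" using bij unfolding bij_betw_def by auto
 define U where "U i x = inv_into (pverts G) \<tau> (insert i (tr - {x}))" for i x
 have U: "U i x \<in> pverts G" "\<tau> (U i x) = insert i (tr - {x})" if "x \<in> tr" "i = d \<or> i = k" for i x
  using cells[OF that] unfolding U_def sur[symmetric] by (rule inv_into_into, rule f_inv_into_f)
 have Uinj: "i = j & x = y" if h: "x \<in> tr" "i = d \<or> i = k" "y \<in> tr" "j = d \<or> j = k" and e: "U i x = U j y" for i j x y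
 proof -
  have e2: "insert i (tr - {x}) = insert j (tr - {y})" using U(2)[OF h(1,2)] U(2)[OF h(3,4)] e by simp
  have n: "i \<notin> tr" "j \<notin> tr" using h dtr ktr by auto
  have "i \<in> insert j (tr - {y})" unfolding e2[symmetric] by simp
  hence "i = j" using n by blast
  moreover have "x = y"
  proof (rule ccontr)
   assume "x ~= y"
   hence "x \<in> insert i (tr - {x})" unfolding e2 using h(1) by blast
   thus False using n(1) h(1) by blast
  qed
  ultimately show ?thesis by simp
 qed
 have dist: "distinct [U d a, U d b, U d c, U k a, U k b, U k c]"
 proof -
  have "inj_on (\<lambda>(i, x). U i x) (set [(d,a), (d,b), (d,c), (k,a), (k,b), (k,c)])"
   by (rule inj_onI) (use Uinj m in auto)
  moreover have "distinct [(d,a), (d,b), (d,c), (k,a), (k,b), (k,c)]" using ne ktr(2) by simp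
  ultimately have "distinct (map (\<lambda>(i, x). U i x) [(d,a), (d,b), (d,c), (k,a), (k,b), (k,c)])" by (simp only: distinct_map simp_thms)
  thus ?thesis by simp
 qed
 have vE: "\<exists>x\<in>tr. \<exists>i. (i = d \<or> i = k) & u = U i x" if u: "u \<in> pverts G" for u
 proof -
  have "\<tau> u \<in> fst ` T" using u sur by blast
  from cellE[OF this] obtain x i where x: "x \<in> tr" "i = d \<or> i = k" "\<tau> u = insert i (tr - {x})" by blast
  have "u = U i x" by (rule inj_onD[OF inj _ u U(1)[OF x(1,2)]]) (simp only: x(3) U(2)[OF x(1,2)])
  thus ?thesis using x by blast
 qed
 have verts: "pverts G = {U d a, U d b, U d c, U k a, U k b, U k c}"
 proof
  show "pverts G \<subseteq> {U d a, U d b, U d c, U k a, U k b, U k c}"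
  proof
   fix u assume "u \<in> pverts G"
   from vE[OF this] obtain x i where x: "x \<in> tr" "i = d \<or> i = k" "u = U i x" by blast
   thus "u \<in> {U d a, U d b, U d c, U k a, U k b, U k c}" unfolding abc(1) by auto
  qed
  show "{U d a, U d b, U d c, U k a, U k b, U k c} \<subseteq> pverts G" using U(1) m by simp
 qed
 have horiz: "{U i x, U i y} \<in> edges G & \<theta> {U i x, U i y} = pi/2" if h: "{x,y,z} \<subseteq> tr" "x ~= y" "z ~= x" "z ~= y" "i = d \<or> i = k" for x y z i
 proof -
  have xs: "x \<in> tr" "y \<in> tr" "z \<in> tr" using h(1) by auto
  have nuw: "U i x ~= U i y" using Uinj[OF xs(1) h(5) xs(2) h(5)] h(2) by blast
  have iz: "i ~= z" using h(5) xs(3) dtr ktr by blast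
  have sub: "{i, z} \<subseteq> \<tau> (U i x) \<inter> \<tau> (U i y)" unfolding U(2)[OF xs(1) h(5)] U(2)[OF xs(2) h(5)] using xs(3) h(3,4) by blast
  note e = edge_eq[OF U(1)[OF xs(1) h(5)] U(1)[OF xs(2) h(5)] nuw iz sub]
  have "th i z = pi/2" using right[OF xs(3)] h(5) by blast
  thus ?thesis using e unfolding th_def by simp
 qed
 have vert: "{U d x, U k x} \<in> edges G" if h: "{x,y,z} \<subseteq> tr" "x ~= y" "z ~= x" "z ~= y" for x y z
 proof -
  have xs: "x \<in> tr" "y \<in> tr" "z \<in> tr" using h(1) by auto
  have dk: "d = d \<or> d = k" "k = d \<or> k = k" by simp_all
  have nuw: "U d x ~= U k x" using Uinj[OF xs(1) dk(1) xs(1) dk(2)] ktr(2) by blast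
  have sub: "{y, z} \<subseteq> \<tau> (U d x) \<inter> \<tau> (U k x)" unfolding U(2)[OF xs(1) dk(1)] U(2)[OF xs(1) dk(2)] using xs h by blast
  show ?thesis by (rule edge_eq(2)[OF U(1)[OF xs(1) dk(1)] U(1)[OF xs(1) dk(2)] nuw _ sub]) (use h(4) in blast)
 qed
 let ?E = "{{U d a, U d b}, {U d b, U d c}, {U d c, U d a}, {U k a, U k b}, {U k b, U k c}, {U k c, U k a}, {U d a, U k a}, {U d b, U k b}, {U d c, U k c}}"
 have hz: "{U i a, U i b} \<in> edges G & \<theta> {U i a, U i b} = pi/2" "{U i b, U i c} \<in> edges G & \<theta> {U i b, U i c} = pi/2"
  "{U i c, U i a} \<in> edges G & \<theta> {U i c, U i a} = pi/2" if "i = d \<or> i = k" for i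
  by (rule horiz[of _ _ c] horiz[of _ _ a] horiz[of _ _ b]; use m ne that in simp)+
 have vt: "{U d a, U k a} \<in> edges G" "{U d b, U k b} \<in> edges G" "{U d c, U k c} \<in> edges G"
  by (rule vert[of a b c] vert[of b c a] vert[of c a b]; use m ne in simp)+
 have "edges G = ?E"
 proof
  show "?E \<subseteq> edges G" using hz[of d] hz[of k] vt by simp
  show "edges G \<subseteq> ?E"
  proof
   fix e assume "e \<in> edges G"
   then obtain s t where st': "adj T s t" "e = edge s t" by (rule edges_edge)
   have sne: "s ~= t" using st'(1) unfolding adj_def by blast
   obtain u w where u: "edge s t = {u, w}" "u ~= w" "u \<in> pverts G" "w \<in> pverts G" using st'(1) by (rule edge_pair)
   have "u \<in> edge s t" "w \<in> edge s t" unfolding u(1) by auto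
   hence sub: "{s,t} \<subseteq> \<tau> u \<inter> \<tau> w" unfolding edge_def by blast
   obtain x i where x: "x \<in> tr" "i = d \<or> i = k" "u = U i x" using vE[OF u(3)] by blast
   obtain y j where y: "y \<in> tr" "j = d \<or> j = k" "w = U j y" using vE[OF u(4)] by blast
   have e: "e = {U i x, U j y}" unfolding st'(2) u(1) x(3) y(3) ..
   have xyz: "x = a \<or> x = b \<or> x = c" "y = a \<or> y = b \<or> y = c" using x(1) y(1) unfolding abc(1) by auto
   consider "i = j" "x ~= y" | "i ~= j" "x = y" | "i ~= j" "x ~= y" using u(2) x(3) y(3) by blast
   thus "e \<in> ?E"
   proof cases
    case 1
    thus ?thesis using xyz x(2) unfolding e 1(1)[symmetric] by (elim disjE) (simp_all add: insert_commute)
   next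
    case 2
    hence "e = {U d x, U k x}" using x(2) y(2) unfolding e by (auto simp: insert_commute)
    thus ?thesis using xyz(1) by (elim disjE) simp_all
   next
    \<comment> \<open>Corners that differ in both indices have a single common face, so no edge
      joins them.\<close>
    case 3
    have ij: "i \<notin> tr" "j \<notin> tr" using x(2) y(2) dtr ktr by auto
    have "{s,t} \<subseteq> insert i (tr - {x}) \<inter> insert j (tr - {y})" using sub unfolding x(3) y(3) U(2)[OF x(1,2)] U(2)[OF y(1,2)] .
    hence "{s,t} \<subseteq> tr - {x,y}" using ij 3(1) by blast
    moreover have "card (tr - {x,y}) = 1" using 3(2) x(1) y(1) c3 by (subst card_Diff_subset) simp_all
    moreover have "card {s,t} = 2" using sne by simp
    ultimately show ?thesis using card_mono[of "tr - {x,y}" "{s,t}"] by simp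
   qed
  qed
 qed
 moreover have "\<forall>e\<in>{{U d a, U d b}, {U d b, U d c}, {U d c, U d a}, {U k a, U k b}, {U k b, U k c}, {U k c, U k a}}. \<theta> e = pi/2"
  using hz[of d] hz[of k] by simp
 ultimately show ?thesis unfolding exceptional_prism_def using dist verts by blast
qed

text \<open>A single truncation is handled by \<open>single_step_prism\<close>. Otherwise another
  truncated triangle consists of \<open>d\<close> or \<open>k\<close> and two faces of
  \<open>tr\<close>; two right angles and a positive third angle contradict the bound of
  \<open>step_sum\<close>.\<close>

lemma step_nonexc:
 assumes s: "(k, tr, d) \<in> set L" shows "\<exists>i\<in>tr. th k i ~= pi/2 \<or> th d i ~= pi/2"
proof (rule ccontr)
 assume "\<not> ?thesis"
 hence r: "th k i = pi/2 & th d i = pi/2" if "i \<in> tr" for i using that by blast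
 show False
 proof (cases "2 <= length L")
  case False
  moreover have "length L ~= 0" using L by simp
  ultimately have "length L = Suc 0" by linarith
  then obtain x where "L = [x]" unfolding length_Suc_conv by auto
  hence "L = [(k, tr, d)]" using s by simp
  from single_step_prism[OF this r] show False using A unfolding andreev_conditions_def by blast
 next
  case True
  obtain k' tr' d' where s': "(k', tr', d') \<in> set L" "tr' ~= tr" "tr' \<subseteq> insert d tr \<or> tr' \<subseteq> insert k tr"
   using stk_two_steps[OF st True s] by blast
  then obtain i where i: "i = d \<or> i = k" "tr' \<subseteq> insert i tr" by blast
  have c: "card tr = 3" "card tr' = 3" using stk_step_mem[OF st s] stk_step_mem[OF st s'(1)] by blast+
  have "i \<in> tr'"
  proof (rule ccontr)
   assume "i \<notin> tr'"
   hence "tr' \<subseteq> tr" using i(2) by blast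
   thus False using card_subset_eq[of tr tr'] c s'(2) by simp
  qed
  then obtain y z where yz: "tr' = {i,y,z}" "distinct [i,y,z]" by (rule card3E[OF c(2)])
  have "y \<in> tr'" "z \<in> tr'" unfolding yz(1) by auto
  hence m: "y \<in> tr" "z \<in> tr" using i(2) yz(2) by auto
  have "th i y + th i z + th y z < pi" by (rule step_sum[OF s'(1)[unfolded yz(1)] yz(2)])
  moreover have "th i y = pi/2" "th i z = pi/2" using r m i(1) by blast+
  moreover have "adj T y z" by (rule stk_step_adj[OF st s'(1)]) (use yz in simp_all)
  hence "0 < th y z" using th_range by blast
  ultimately show False by simp
 qed
qed

lemma angled: "inj f ==> angled_stack T L th f"
 by unfold_locales (use st L th_sym th_range step_sum step_nonexc in \<open>auto dest: injD\<close>)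

lemma card_Ep_eq:
 assumes f: "inj f" shows "card (angled_stack.Ep T th f) = e_plus G \<theta>"
proof -
 interpret angled_stack T L th f by (rule angled[OF f])
 have "bij_betw (\<lambda>(i, j). edge i j) Ep {e \<in> edges G. \<theta> e ~= pi/2}"
  unfolding bij_betw_def
 proof
  show "inj_on (\<lambda>(i, j). edge i j) Ep"
  proof (rule inj_onI, clarify)
   fix i j i' j' assume a: "(i, j) \<in> Ep" "(i', j') \<in> Ep" and e: "edge i j = edge i' j'"
   have h: "adj T i j" "adj T i' j'" "f i < f j" "f i' < f j'" using a unfolding Ep_def by auto
   have "{i,j} = {i',j'}" by (rule edge_inj[OF h(1,2) e])
   thus "i = i' & j = j'" using h(3,4) unfolding doubleton_eq_iff by auto
  qed
  show "(\<lambda>(i, j). edge i j) ` Ep = {e \<in> edges G. \<theta> e ~= pi/2}"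
  proof
   show "(\<lambda>(i, j). edge i j) ` Ep \<subseteq> {e \<in> edges G. \<theta> e ~= pi/2}" unfolding Ep_def th_def using edge_in_edges by auto
   show "{e \<in> edges G. \<theta> e ~= pi/2} \<subseteq> (\<lambda>(i, j). edge i j) ` Ep"
   proof
    fix e assume e: "e \<in> {e \<in> edges G. \<theta> e ~= pi/2}"
    then obtain s t where s: "adj T s t" "e = edge s t" using edges_edge by blast
    have n: "th s t ~= pi/2" "th t s ~= pi/2" using e unfolding s(2) th_def edge_sym[of t s] by auto
    have "f s ~= f t" using injf s(1) unfolding adj_def by (auto dest: injD)
    then consider "(s, t) \<in> Ep" | "(t, s) \<in> Ep" using s(1) adj_sym[OF s(1)] n unfolding Ep_def by fastforce
    thus "e \<in> (\<lambda>(i, j). edge i j) ` Ep"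
    proof cases
     case 1 thus ?thesis by (rule image_eqI[rotated]) (simp add: s(2))
    next
     case 2 thus ?thesis by (rule image_eqI[rotated]) (use edge_sym[of s t] in \<open>simp add: s(2)\<close>)
    qed
   qed
  qed
 qed
 thus ?thesis unfolding e_plus_def by (rule bij_betw_same_card)
qed

text \<open>A mirror polyhedron has vertices in the sense of \<open>VS\<close>, from which the data
  of all truncations are recovered. Conversely \<open>polar_inv_exists\<close> turns
  \<open>good\<close> data into vertices, and \<open>vertex_system\<close> turns these into a
  polyhedron.\<close>

lemma Y_space_eq:
 fixes f :: "'s => nat"
 assumes f: "inj f" shows "Y_space G \<theta> mark = angled_stack.YY T L th"
proof -
 interpret angled_stack T L th f by (rule angled[OF f])
 show ?thesis
 proof
  show "Y_space G \<theta> mark \<subseteq> YY"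
  proof
   fix y assume "y \<in> Y_space G \<theta> mark"
   then obtain \<alpha> v P face where y: "y = (\<lambda>s. (ray (\<alpha> s), ray (v s)))" and mp: "mirror_polyhedron P face \<alpha> v"
    and rg: "realizes_graph G mark P face"
    and an: "\<forall>s t e. s ~= t & e \<in> face_edges (mark s) \<inter> face_edges (mark t) --> has_dihedral_angle \<alpha> v s t (\<theta> e)"
    unfolding Y_space_def by blast
   have "\<exists>p. VS UNIV T \<alpha> p" by (rule mirror_vertices(1)[OF st mp rg bij \<tau>]) (rule arcs)
   then obtain p where p: "VS UNIV T \<alpha> p" ..
   have mv: "adjacent_in P (face s) (face t)" if "adj T s t" for s t
    by (rule mirror_vertices(2)[OF st mp rg bij \<tau> _ that]) (rule arcs)
   have "good \<alpha> v"
    unfolding good_def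
   proof (intro conjI allI impI)
    show "\<alpha> s \<bullet> v s = 2" for s using mp unfolding mirror_polyhedron_def by blast
    fix s t assume a: "adj T s t"
    have "- (\<alpha> s \<bullet> v t) \<ge> 0" "\<alpha> s \<bullet> v t = 0 \<longleftrightarrow> \<alpha> t \<bullet> v s = 0" using mp mv[OF a] unfolding mirror_polyhedron_def by blast+
    thus "\<alpha> s \<bullet> v t <= 0" "\<alpha> s \<bullet> v t = 0 \<longleftrightarrow> \<alpha> t \<bullet> v s = 0" by simp_all
    have ne: "s ~= t" using a unfolding adj_def by blast
    hence "edge s t \<in> face_edges (mark s) \<inter> face_edges (mark t)" using common_edge_iff[OF ne] a by blast
    hence "has_dihedral_angle \<alpha> v s t (\<theta> (edge s t))" using an ne by blast
    thus "(\<alpha> s \<bullet> v t) * (\<alpha> t \<bullet> v s) = 4 * (cos (th s t))\<^sup>2" unfolding has_dihedral_angle_def th_def by blast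
   next
    fix k tr d assume "(k, tr, d) \<in> set L"
    thus "nd \<alpha> (insert d tr)" "beyond \<alpha> k tr d" using VS_steps[OF st p] by blast+
   qed
   thus "y \<in> YY" unfolding YY_def y by blast
  qed
  show "YY \<subseteq> Y_space G \<theta> mark"
  proof
   fix y assume "y \<in> YY"
   then obtain \<alpha> v where y: "y = (\<lambda>s. (ray (\<alpha> s), ray (v s)))" and g: "good \<alpha> v" unfolding YY_def by blast
   \<comment> \<open>The triangles truncated at some stage are the ones that need a polar form, and
     they are hyperbolic by \<open>good_hyp\<close>.\<close>
   define H where "H tr \<longleftrightarrow> (\<exists>k d. (k, tr, d) \<in> set L)" for tr
   have "\<exists>p \<pi>. polar_inv UNIV T H \<alpha> v p \<pi>"
   proof (rule polar_inv_exists[OF st])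
    show "\<alpha> s \<bullet> v t <= 0 & (\<alpha> s \<bullet> v t = 0 \<longleftrightarrow> \<alpha> t \<bullet> v s = 0)" if "adj T s t" for s t using goodD(2,3)[OF g that] by blast
    show "\<alpha> s \<bullet> v s = 2" for s by (rule goodD(1)[OF g])
    show "hyp (cartan \<alpha> v) a b c" if h: "H {a,b,c}" "adj T a b" "adj T a c" "adj T b c" for a b c
    proof -
     obtain k d where "(k, {a,b,c}, d) \<in> set L" using h(1) unfolding H_def by blast
     thus ?thesis by (rule good_hyp[OF g]) (use h(2-4) in \<open>auto simp: adj_def\<close>)
    qed
    show "H tr & nd \<alpha> (insert d tr) & beyond \<alpha> k tr d & ((\<exists>i\<in>tr. \<alpha> k \<bullet> v i ~= 0) \<or> (\<exists>i\<in>tr. \<alpha> d \<bullet> v i ~= 0))"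
     if s: "(k, tr, d) \<in> set L" for k tr d
    proof -
     have mem: "d \<notin> tr" "k \<notin> tr" using stk_step_mem[OF st s] by blast+
     obtain i where i: "i \<in> tr" "th k i ~= pi/2 \<or> th d i ~= pi/2" using step_nonexc[OF s] by blast
     have "adj T k i" "adj T d i" by (rule stk_step_adj[OF st s]; use i(1) mem in blast)+
     hence "\<alpha> k \<bullet> v i ~= 0 \<or> \<alpha> d \<bullet> v i ~= 0" using good_zero[OF g] i(2) by blast
     thus ?thesis using i(1) s goodD(5,6)[OF g s] unfolding H_def by blast
    qed
    show "nd \<alpha> UNIV" if "L = []" using L that by simp
   qed
   then obtain p \<pi> where "polar_inv UNIV T H \<alpha> v p \<pi>" by blast
   then interpret pi: polar_inv UNIV T H \<alpha> v p \<pi> .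
   have "VS UNIV T \<alpha> p"
    unfolding VS_def using pi.p0 pi.pneg by fastforce
   then interpret vertex_system T L \<alpha> p by unfold_locales (rule st)
   have dih: "has_dihedral_angle \<alpha> v s t (th s t)" if a: "adj T s t" for s t
    unfolding has_dihedral_angle_def using th_range[OF a] goodD(4)[OF g a] by blast
   have mp: "mirror_polyhedron (hface \<alpha> {}) (\<lambda>s. hface \<alpha> {s}) \<alpha> v"
    by (rule mirror) (use goodD[OF g] dih in blast)+
   have rg: "realizes_graph G mark (hface \<alpha> {}) (\<lambda>s. hface \<alpha> {s})" by (rule realizes[OF bij \<tau>]) (rule arcs)
   have "\<forall>s t e. s ~= t & e \<in> face_edges (mark s) \<inter> face_edges (mark t) --> has_dihedral_angle \<alpha> v s t (\<theta> e)"
   proof (intro allI impI, elim conjE)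
    fix s t e assume ne: "s ~= t" and "e \<in> face_edges (mark s) \<inter> face_edges (mark t)"
    hence "adj T s t" "e = edge s t" using common_edge_iff[OF ne] by blast+
    thus "has_dihedral_angle \<alpha> v s t (\<theta> e)" using dih unfolding th_def by simp
   qed
   thus "y \<in> Y_space G \<theta> mark" unfolding Y_space_def y using mp rg by blast
  qed
 qed
qed

theorem X_space_chart:
 fixes W :: "'w::euclidean_space set"
 shows "3 <= e_plus G \<theta>" and "subspace W ==> dim W = e_plus G \<theta> - 3 ==> diffeomorphic (X_space G \<theta> mark) (sub_smooth euclidean_smooth W)"
proof -
 obtain f :: "'s => nat" where f: "inj f" using finite_imp_inj_to_nat_seg[OF finite[of "UNIV :: 's set"]] by blast
 interpret angled_stack T L th f by (rule angled[OF f])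
 show "3 <= e_plus G \<theta>" using card_Ep unfolding card_Ep_eq[OF f] .
 assume "subspace W" "dim W = e_plus G \<theta> - 3"
 thus "diffeomorphic (X_space G \<theta> mark) (sub_smooth euclidean_smooth W)"
  unfolding X_space_def Y_space_eq[OF f] card_Ep_eq[OF f, symmetric] by (rule moduli_chart)
qed

end

theorem mainTheorem3:
  fixes G :: "'v pair_pre_digraph"
    and \<rho> :: "'v \<times> 'v \<Rightarrow> 'v \<times> 'v"
    and \<theta> :: "'v set \<Rightarrow> real"
    and mark :: "'s::finite \<Rightarrow> ('v \<times> 'v) set"
  assumes "marked_labelled_graph G \<rho> \<theta> mark"
    and "combinatorial_ecimahedron G"
    and "andreev_conditions G \<rho> \<theta>"
  shows "e_plus G \<theta> \<ge> 3 \<and>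
    (\<forall>W :: 'w::euclidean_space set. subspace W \<and> dim W = e_plus G \<theta> - 3 \<longrightarrow>
       diffeomorphic (X_space G \<theta> mark) (sub_smooth euclidean_smooth W))"
proof -
 have nt: "\<not> tetrahedron_graph G" using assms(3) unfolding andreev_conditions_def by blast
 show ?thesis
 proof (rule marked_graph_stack[OF assms(1,2) nt])
  let ?\<tau> = "\<lambda>u. {s. u \<in> face_verts (mark s)}"
  fix T L
  assume h: "stk (UNIV :: 's set) T L" "L ~= []" "bij_betw ?\<tau> (pverts G) (fst ` T)"
   "!!s t e. s ~= t ==> e \<in> face_edges (mark s) \<inter> face_edges (mark t) \<longleftrightarrow>
     (\<exists>u\<in>pverts G. \<exists>w\<in>pverts G. u ~= w & e = {u, w} & {s, t} \<subseteq> ?\<tau> u \<inter> ?\<tau> w)"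
   "!!u w. u \<in> pverts G ==> w \<in> pverts G ==> u ~= w ==> (u, w) \<in> parcs G \<longleftrightarrow>
     (\<exists>s t. s ~= t & {s, t} \<subseteq> ?\<tau> u \<inter> ?\<tau> w)"
   "!!s. face_verts (mark s) \<subseteq> pverts G"
  interpret graph_stack G \<rho> \<theta> mark ?\<tau> T L
   by unfold_locales (rule assms(1,3) h(1-3) refl h(6) | (rule h(4), assumption) | (rule h(5), assumption+))+
  show ?thesis using X_space_chart by blast
 qed
qed

end
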